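(* Let $k\ge1$ be an integer, $\beta>0$, $\sigma\ge k+1$, $\Omega=(0,1)^2$, and let $b,f$ be sufficiently smooth functions on $\bar\Omega$ with $b(x,y)\ge2\beta^2$. Let $C_0,C_1>0$ be constants. Then there is a constant $C>0$, independent of $\varepsilon$ and $N$, such that the following holds for every $0<\varepsilon<1$ and every integer $N\ge4$ divisible by $4$ with $\varepsilon\le C_0N^{-1}$ and $\tau=\sigma\sqrt\varepsilon\,\ln N/\beta\le\tfrac14$. Let $u$ be the solution of $-\varepsilon\Delta u+b(x,y)u=f(x,y)$ in $\Omega$, $u=0$ on $\partial\Omega$, and put $p=\varepsilon u_x$, $q=\varepsilon u_y$, $t=(u,p,q)$. Assume that $u=S+\sum_{m=1}^4W_m+\sum_{m=1}^4Z_m$ on $\bar\Omega$ where, for all $0\le i,j\le k+2$ and $(x,y)\in\bar\Omega$, with $\partial^{i,j}=\partial^{i+j}/\partial x^i\partial y^j$, $$|\partial^{i,j}S|\le C_1,$$ $$|\partial^{i,j}W_1|\le C_1\varepsilon^{-i/2}e^{-\beta x/\sqrt\varepsilon},\quad |\partial^{i,j}W_2|\le C_1\varepsilon^{-j/2}e^{-\beta y/\sqrt\varepsilon},$$ $$|\partial^{i,j}W_3|\le C_1\varepsilon^{-i/2}e^{-\beta(1-x)/\sqrt\varepsilon},\quad |\partial^{i,j}W_4|\le C_1\varepsilon^{-j/2}e^{-\beta(1-y)/\sqrt\varepsilon},$$ $$|\partial^{i,j}Z_1|\le C_1\varepsilon^{-(i+j)/2}e^{-\beta(x+y)/\sqrt\varepsilon},\quad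 |\partial^{i,j}Z_2|\le C_1\varepsilon^{-(i+j)/2}e^{-\beta(1-x+y)/\sqrt\varepsilon},$$ $$|\partial^{i,j}Z_3|\le C_1\varepsilon^{-(i+j)/2}e^{-\beta(2-x-y)/\sqrt\varepsilon},\quad |\partial^{i,j}Z_4|\le C_1\varepsilon^{-(i+j)/2}e^{-\beta(x+1-y)/\sqrt\varepsilon}.$$ Let $T=(U,P,Q)\in R_N\times R_N\times R_N$ be the numerical solution of the LDG scheme (defined in the context) on the tensor-product Shishkin mesh with parameters $\sigma,\beta,\varepsilon,N$, and let $e=t-T=(u-U,p-P,q-Q)$. Then $$|||e|||_E\le C\left(\varepsilon^{1/4}(N^{-1}\ln N)^{k+1}+\varepsilon^{1/2}N^{-k}+N^{-(k+1)}\right),$$ $$|||e|||_B\le C\left(\varepsilon^{1/2}(N^{-1}\ln N)^{k+1}+\varepsilon^{1/4}N^{-k}+(N^{-1}\ln N)^{k+1}\right).$$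
   Context: **Mesh.** With $\tau=\sigma\sqrt\varepsilon\ln N/\beta\le1/4$, the points $0=x_0<x_1<\dots<x_N=1$ divide $[0,\tau]$ into $N/4$ equal subintervals, $[\tau,1-\tau]$ into $N/2$ equal subintervals, and $[1-\tau,1]$ into $N/4$ equal subintervals; the points $y_j$, $0\le j\le N$, are defined in the same way. Put $I_i=(x_{i-1},x_i)$, $J_j=(y_{j-1},y_j)$, $K_{ij}=I_i\times J_j$ for $i,j=1,\dots,N$. **Finite element space.** $R_N=\{v\in L^2(\Omega): v|_{K_{ij}}\in\mathbb Q_k(K_{ij}),\ 1\le i,j\le N\}$, where $\mathbb Q_k(K_{ij})$ is the space of polynomials on $K_{ij}$ of degree at most $k$ in each variable. **Traces and jumps.** For a piecewise smooth (with respect to the mesh) function $v$, $v^\pm_{i,y}=\lim_{x\to x_i^\pm}v(x,y)$ and $v^\pm_{x,j}=\lim_{y\to y_j^\pm}v(x,y)$. The jumps are $[[v]]_{i,y}=v^+_{i,y}-v^-_{i,y}$ for $1\le i\le N-1$, $[[v]]_{0,y}=v^+_{0,y}$, $[[v]]_{N,y}=-v^-_{N,y}$; and $[[v]]_{x,j}=v^+_{x,j}-v^-_{x,j}$ for $1\le j\le N-1$, $[[v]]_{x,0}=v^+_{x,0}$, $[[v]]_{x,N}=-v^-_{x,N}$. **Inner products.** $(\cdot,\cdot)_D$ is the $L^2(D)$ inner product for $D\subset\mathbb R^2$, $\langle\cdot,\cdot\rangle_I$ is the $L^2(I)$ inner product for an interval $I$, and $\|\cdot\|$ is the $L^2(\Omega)$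 norm. **LDG scheme.** Find $T=(U,P,Q)\in R_N^3$ such that for all $i,j=1,\dots,N$ and all $(v,s,r)\in R_N^3$, $$\varepsilon^{-1}(P,s)_{K_{ij}}+(U,s_x)_{K_{ij}}-\langle\hat U_{i,y},s^-_{i,y}\rangle_{J_j}+\langle\hat U_{i-1,y},s^+_{i-1,y}\rangle_{J_j}=0,$$ $$\varepsilon^{-1}(Q,r)_{K_{ij}}+(U,r_y)_{K_{ij}}-\langle\hat U_{x,j},r^-_{x,j}\rangle_{I_i}+\langle\hat U_{x,j-1},r^+_{x,j-1}\rangle_{I_i}=0,$$ $$(P,v_x)_{K_{ij}}-\langle\hat P_{i,y},v^-_{i,y}\rangle_{J_j}+\langle\hat P_{i-1,y},v^+_{i-1,y}\rangle_{J_j}+(Q,v_y)_{K_{ij}}-\langle\hat Q_{x,j},v^-_{x,j}\rangle_{I_i}+\langle\hat Q_{x,j-1},v^+_{x,j-1}\rangle_{I_i}+(bU,v)_{K_{ij}}=(f,v)_{K_{ij}}.$$ The numerical fluxes on vertical edges are $$\hat P_{0,y}=P^+_{0,y}+\lambda_{0,y}U^+_{0,y},\quad \hat P_{i,y}=P^+_{i,y}\ (1\le i\le N-1),\quad \hat P_{N,y}=P^-_{N,y}-\lambda_{N,y}U^-_{N,y},$$ $$\hat U_{0,y}=\hat U_{N,y}=0,\quad \hat U_{3N/4,y}=U^-_{3N/4,y}+\lambda_P[[P]]_{3N/4,y},\quad \hat U_{i,y}=U^-_{i,y}\ (1\le i\le N-1,\ i\ne3N/4),$$ and on horizontal edges $$\hat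 Q_{x,0}=Q^+_{x,0}+\lambda_{x,0}U^+_{x,0},\quad \hat Q_{x,j}=Q^+_{x,j}\ (1\le j\le N-1),\quad \hat Q_{x,N}=Q^-_{x,N}-\lambda_{x,N}U^-_{x,N},$$ $$\hat U_{x,0}=\hat U_{x,N}=0,\quad \hat U_{x,3N/4}=U^-_{x,3N/4}+\lambda_Q[[Q]]_{x,3N/4},\quad \hat U_{x,j}=U^-_{x,j}\ (1\le j\le N-1,\ j\ne3N/4),$$ where $\lambda_{0,y}=\lambda_{N,y}=\lambda_{x,0}=\lambda_{x,N}=\sqrt\varepsilon$ and $\lambda_P=\lambda_Q=1/\sqrt\varepsilon$. **Norms.** For a triple $t=(u,p,q)$ of functions that are piecewise smooth with respect to the mesh, $$|||t|||_E^2=\varepsilon^{-1}\|p\|^2+\varepsilon^{-1}\|q\|^2+\|b^{1/2}u\|^2+\sum_{j=1}^N\sum_{i\in\{0,N\}}\langle\lambda_{i,y},[[u]]_{i,y}^2\rangle_{J_j}+\sum_{i=1}^N\sum_{j\in\{0,N\}}\langle\lambda_{x,j},[[u]]_{x,j}^2\rangle_{I_i}+\sum_{j=1}^N\langle\lambda_P,[[p]]^2_{3N/4,y}\rangle_{J_j}+\sum_{i=1}^N\langle\lambda_Q,[[q]]^2_{x,3N/4}\rangle_{I_i},$$ $$|||t|||_B^2=\varepsilon^{-3/2}\|p\|^2+\varepsilon^{-3/2}\|q\|^2+\|b^{1/2}u\|^2+\sum_{j=1}^N\sum_{i\in\{0,N\}}\langle1,[[u]]_{i,y}^2\rangle_{J_j}+\sum_{i=1}^N\sum_{j\in\{0,N\}}\langle1,[[u]]_{x,j}^2\rangle_{I_i}+\sum_{j=1}^N\langle\lambda_P,[[p]]^2_{3N/4,y}\rangle_{J_j}+\sum_{i=1}^N\langle\lambda_Q,[[q]]^2_{x,3N/4}\rangle_{I_i}.$$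 **Constants.** $C$ may depend on $k,\sigma,\beta,b,f,C_0,C_1$ but not on $\varepsilon$ or $N$. *)

theory Defs
  imports "HOL-Analysis.Analysis"
begin

type_synonym fn2 = "real \<times> real \<Rightarrow> real"

abbreviation Omega :: "(real \<times> real) set" where
  "Omega \<equiv> {0<..<1} \<times> {0<..<1}"

abbreviation cl_Omega :: "(real \<times> real) set" where
  "cl_Omega \<equiv> {0..1} \<times> {0..1}"


subsection \<open>Partial derivatives on the closed unit square\<close>

text \<open>Derivatives are taken within the unit interval, so that they are one-sided on the boundary of
  the square; at interior points they are the ordinary partial derivatives.\<close>

definition dx :: "fn2 \<Rightarrow> fn2" where
  "dx g = (\<lambda>(x, y). vector_derivative (\<lambda>\<xi>. g (\<xi>, y)) (at x within {0..1}))"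

definition dy :: "fn2 \<Rightarrow> fn2" where
  "dy g = (\<lambda>(x, y). vector_derivative (\<lambda>\<eta>. g (x, \<eta>)) (at y within {0..1}))"

definition pd :: "nat \<Rightarrow> nat \<Rightarrow> fn2 \<Rightarrow> fn2" where
  "pd i j g = (dx ^^ i) ((dy ^^ j) g)"

text \<open>\<open>smooth_on D A g\<close>: the partial derivatives of \<open>g\<close> with orders in the (downward closed) index
  set \<open>A\<close> exist and are continuous on \<open>D\<close>, where \<open>D\<close> is the open or the closed unit square.
  The two derivative clauses say that the differentiations commute.\<close>

definition smooth_on :: "(real \<times> real) set \<Rightarrow> (nat \<times> nat) set \<Rightarrow> fn2 \<Rightarrow> bool" where
  "smooth_on D A g \<longleftrightarrow> (\<forall>(i, j)\<in>A.
     continuous_on D (pd i j g) \<and>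
     (\<forall>(x, y)\<in>D.
       ((Suc i, j) \<in> A \<longrightarrow>
          ((\<lambda>\<xi>. pd i j g (\<xi>, y)) has_real_derivative pd (Suc i) j g (x, y)) (at x within {0..1})) \<and>
       ((i, Suc j) \<in> A \<longrightarrow>
          ((\<lambda>\<eta>. pd i j g (x, \<eta>)) has_real_derivative pd i (Suc j) g (x, y)) (at y within {0..1}))))"

definition Ck_on :: "(real \<times> real) set \<Rightarrow> nat \<Rightarrow> fn2 \<Rightarrow> bool" where
  "Ck_on D m g \<longleftrightarrow> smooth_on D {(i, j). i + j \<le> m} g"


subsection \<open>The continuous problem and the solution decomposition\<close>

definition bvp_solution :: "real \<Rightarrow> fn2 \<Rightarrow> fn2 \<Rightarrow> fn2 \<Rightarrow> bool" where
  "bvp_solution \<epsilon> b f u \<longleftrightarrow>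
     continuous_on cl_Omega u \<and> Ck_on Omega 2 u \<and>
     (\<forall>z\<in>Omega. - \<epsilon> * (pd 2 0 u z + pd 0 2 u z) + b z * u z = f z) \<and>
     (\<forall>z\<in>cl_Omega - Omega. u z = 0)"

definition derivs_bounded :: "nat \<Rightarrow> fn2 \<Rightarrow> (nat \<Rightarrow> nat \<Rightarrow> real \<Rightarrow> real \<Rightarrow> real) \<Rightarrow> bool" where
  "derivs_bounded n g B \<longleftrightarrow>
     smooth_on cl_Omega ({..n} \<times> {..n}) g \<and>
     (\<forall>i\<le>n. \<forall>j\<le>n. \<forall>(x, y)\<in>cl_Omega. \<bar>pd i j g (x, y)\<bar> \<le> B i j x y)"

definition solution_decomposition ::
  "nat \<Rightarrow> real \<Rightarrow> real \<Rightarrow> real \<Rightarrow> fn2 \<Rightarrow> fn2 \<Rightarrow> (nat \<Rightarrow> fn2) \<Rightarrow> (nat \<Rightarrow> fn2) \<Rightarrow> bool" where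
  "solution_decomposition k \<beta> C\<^sub>1 \<epsilon> u S W Z \<longleftrightarrow>
     (\<forall>z\<in>cl_Omega. u z = S z + (\<Sum>m=1..4. W m z) + (\<Sum>m=1..4. Z m z)) \<and>
     derivs_bounded (k + 2) S (\<lambda>i j x y. C\<^sub>1) \<and>
     derivs_bounded (k + 2) (W 1)
       (\<lambda>i j x y. C\<^sub>1 * \<epsilon> powr (- real i / 2) * exp (- \<beta> * x / sqrt \<epsilon>)) \<and>
     derivs_bounded (k + 2) (W 2)
       (\<lambda>i j x y. C\<^sub>1 * \<epsilon> powr (- real j / 2) * exp (- \<beta> * y / sqrt \<epsilon>)) \<and>
     derivs_bounded (k + 2) (W 3)
       (\<lambda>i j x y. C\<^sub>1 * \<epsilon> powr (- real i / 2) * exp (- \<beta> * (1 - x) / sqrt \<epsilon>)) \<and>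
     derivs_bounded (k + 2) (W 4)
       (\<lambda>i j x y. C\<^sub>1 * \<epsilon> powr (- real j / 2) * exp (- \<beta> * (1 - y) / sqrt \<epsilon>)) \<and>
     derivs_bounded (k + 2) (Z 1)
       (\<lambda>i j x y. C\<^sub>1 * \<epsilon> powr (- real (i + j) / 2) * exp (- \<beta> * (x + y) / sqrt \<epsilon>)) \<and>
     derivs_bounded (k + 2) (Z 2)
       (\<lambda>i j x y. C\<^sub>1 * \<epsilon> powr (- real (i + j) / 2) * exp (- \<beta> * (1 - x + y) / sqrt \<epsilon>)) \<and>
     derivs_bounded (k + 2) (Z 3)
       (\<lambda>i j x y. C\<^sub>1 * \<epsilon> powr (- real (i + j) / 2) * exp (- \<beta> * (2 - x - y) / sqrt \<epsilon>)) \<and>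
     derivs_bounded (k + 2) (Z 4)
       (\<lambda>i j x y. C\<^sub>1 * \<epsilon> powr (- real (i + j) / 2) * exp (- \<beta> * (x + 1 - y) / sqrt \<epsilon>))"


subsection \<open>Shishkin mesh\<close>

definition transition :: "real \<Rightarrow> real \<Rightarrow> real \<Rightarrow> nat \<Rightarrow> real" where
  "transition \<sigma> \<beta> \<epsilon> N = \<sigma> * sqrt \<epsilon> * ln (real N) / \<beta>"

text \<open>The mesh points are the same in both coordinate directions; \<open>N\<close> is divisible by 4.\<close>

definition mesh :: "real \<Rightarrow> nat \<Rightarrow> nat \<Rightarrow> real" where
  "mesh \<tau> N i =
     (if i \<le> N div 4 then real i * (\<tau> / (real N / 4))
      else if i \<le> 3 * N div 4 then \<tau> + (real i - real N / 4) * ((1 - 2 * \<tau>) / (real N / 2))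
      else 1 - \<tau> + (real i - 3 * real N / 4) * (\<tau> / (real N / 4)))"

definition ival :: "(nat \<Rightarrow> real) \<Rightarrow> nat \<Rightarrow> real set" where
  "ival X i = {X (i - 1)<..<X i}"

definition cell :: "(nat \<Rightarrow> real) \<Rightarrow> nat \<Rightarrow> nat \<Rightarrow> (real \<times> real) set" where
  "cell X i j = ival X i \<times> ival X j"


subsection \<open>Inner products and the finite element space\<close>

text \<open>We integrate with respect to the completed measure: the values of the discrete functions
  on the mesh lines are arbitrary.\<close>

definition l2_inner :: "'a::euclidean_space set \<Rightarrow> ('a \<Rightarrow> real) \<Rightarrow> ('a \<Rightarrow> real) \<Rightarrow> real" where
  "l2_inner D g h = set_lebesgue_integral lebesgue D (\<lambda>z. g z * h z)"

definition l2_norm :: "'a::euclidean_space set \<Rightarrow> ('a \<Rightarrow> real) \<Rightarrow> real" where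
  "l2_norm D g = sqrt (l2_inner D g g)"

definition in_L2 :: "'a::euclidean_space set \<Rightarrow> ('a \<Rightarrow> real) \<Rightarrow> bool" where
  "in_L2 D g \<longleftrightarrow> set_borel_measurable lebesgue D g \<and> set_integrable lebesgue D (\<lambda>z. (g z)\<^sup>2)"

definition is_Qk_on :: "nat \<Rightarrow> (real \<times> real) set \<Rightarrow> fn2 \<Rightarrow> bool" where
  "is_Qk_on k K v \<longleftrightarrow>
     (\<exists>c :: nat \<Rightarrow> nat \<Rightarrow> real. \<forall>(x, y)\<in>K. v (x, y) = (\<Sum>a\<le>k. \<Sum>d\<le>k. c a d * x ^ a * y ^ d))"

definition fe_space :: "nat \<Rightarrow> nat \<Rightarrow> (nat \<Rightarrow> real) \<Rightarrow> fn2 set" where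
  "fe_space k N X = {v. in_L2 Omega v \<and> (\<forall>i\<in>{1..N}. \<forall>j\<in>{1..N}. is_Qk_on k (cell X i j) v)}"


subsection \<open>Traces and jumps\<close>

text \<open>In the names, \<open>x\<close> marks traces, jumps and fluxes across the vertical line \<open>x = X i\<close> (functions of
  \<open>y\<close>), and \<open>y\<close> those across the horizontal line \<open>y = X j\<close> (functions of \<open>x\<close>); \<open>p\<close> and \<open>m\<close> stand for
  the superscripts plus and minus.\<close>

definition trxp :: "(nat \<Rightarrow> real) \<Rightarrow> fn2 \<Rightarrow> nat \<Rightarrow> real \<Rightarrow> real" where
  "trxp X v i y = Lim (at_right (X i)) (\<lambda>x. v (x, y))"

definition trxm :: "(nat \<Rightarrow> real) \<Rightarrow> fn2 \<Rightarrow> nat \<Rightarrow> real \<Rightarrow> real" where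
  "trxm X v i y = Lim (at_left (X i)) (\<lambda>x. v (x, y))"

definition tryp :: "(nat \<Rightarrow> real) \<Rightarrow> fn2 \<Rightarrow> nat \<Rightarrow> real \<Rightarrow> real" where
  "tryp X v j x = Lim (at_right (X j)) (\<lambda>y. v (x, y))"

definition trym :: "(nat \<Rightarrow> real) \<Rightarrow> fn2 \<Rightarrow> nat \<Rightarrow> real \<Rightarrow> real" where
  "trym X v j x = Lim (at_left (X j)) (\<lambda>y. v (x, y))"

definition jumpx :: "nat \<Rightarrow> (nat \<Rightarrow> real) \<Rightarrow> fn2 \<Rightarrow> nat \<Rightarrow> real \<Rightarrow> real" where
  "jumpx N X v i y =
     (if i = 0 then trxp X v i y
      else if i = N then - trxm X v i y
      else trxp X v i y - trxm X v i y)"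

definition jumpy :: "nat \<Rightarrow> (nat \<Rightarrow> real) \<Rightarrow> fn2 \<Rightarrow> nat \<Rightarrow> real \<Rightarrow> real" where
  "jumpy N X v j x =
     (if j = 0 then tryp X v j x
      else if j = N then - trym X v j x
      else tryp X v j x - trym X v j x)"


subsection \<open>LDG scheme\<close>

text \<open>\<open>lam_bd\<close> is the common value of \<open>\<lambda>\<^sub>0\<^sub>,\<^sub>y, \<lambda>\<^sub>N\<^sub>,\<^sub>y, \<lambda>\<^sub>x\<^sub>,\<^sub>0, \<lambda>\<^sub>x\<^sub>,\<^sub>N\<close>, and \<open>lam_tr\<close> that of \<open>\<lambda>\<^sub>P, \<lambda>\<^sub>Q\<close>.\<close>

definition lam_bd :: "real \<Rightarrow> real" where
  "lam_bd \<epsilon> = sqrt \<epsilon>"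

definition lam_tr :: "real \<Rightarrow> real" where
  "lam_tr \<epsilon> = 1 / sqrt \<epsilon>"

definition fluxPx :: "real \<Rightarrow> nat \<Rightarrow> (nat \<Rightarrow> real) \<Rightarrow> fn2 \<Rightarrow> fn2 \<Rightarrow> nat \<Rightarrow> real \<Rightarrow> real" where
  "fluxPx \<epsilon> N X U P i y =
     (if i = 0 then trxp X P i y + lam_bd \<epsilon> * trxp X U i y
      else if i = N then trxm X P i y - lam_bd \<epsilon> * trxm X U i y
      else trxp X P i y)"

definition fluxUx :: "real \<Rightarrow> nat \<Rightarrow> (nat \<Rightarrow> real) \<Rightarrow> fn2 \<Rightarrow> fn2 \<Rightarrow> nat \<Rightarrow> real \<Rightarrow> real" where
  "fluxUx \<epsilon> N X U P i y =
     (if i = 0 \<or> i = N then 0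
      else if i = 3 * N div 4 then trxm X U i y + lam_tr \<epsilon> * jumpx N X P i y
      else trxm X U i y)"

definition fluxQy :: "real \<Rightarrow> nat \<Rightarrow> (nat \<Rightarrow> real) \<Rightarrow> fn2 \<Rightarrow> fn2 \<Rightarrow> nat \<Rightarrow> real \<Rightarrow> real" where
  "fluxQy \<epsilon> N X U Q j x =
     (if j = 0 then tryp X Q j x + lam_bd \<epsilon> * tryp X U j x
      else if j = N then trym X Q j x - lam_bd \<epsilon> * trym X U j x
      else tryp X Q j x)"

definition fluxUy :: "real \<Rightarrow> nat \<Rightarrow> (nat \<Rightarrow> real) \<Rightarrow> fn2 \<Rightarrow> fn2 \<Rightarrow> nat \<Rightarrow> real \<Rightarrow> real" where
  "fluxUy \<epsilon> N X U Q j x =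
     (if j = 0 \<or> j = N then 0
      else if j = 3 * N div 4 then trym X U j x + lam_tr \<epsilon> * jumpy N X Q j x
      else trym X U j x)"

definition ldg_solution ::
  "nat \<Rightarrow> nat \<Rightarrow> (nat \<Rightarrow> real) \<Rightarrow> real \<Rightarrow> fn2 \<Rightarrow> fn2 \<Rightarrow> fn2 \<Rightarrow> fn2 \<Rightarrow> fn2 \<Rightarrow> bool" where
  "ldg_solution k N X \<epsilon> b f U P Q \<longleftrightarrow>
     U \<in> fe_space k N X \<and> P \<in> fe_space k N X \<and> Q \<in> fe_space k N X \<and>
     (\<forall>i\<in>{1..N}. \<forall>j\<in>{1..N}.
       \<forall>v\<in>fe_space k N X. \<forall>s\<in>fe_space k N X. \<forall>r\<in>fe_space k N X.
       (1 / \<epsilon>) * l2_inner (cell X i j) P s + l2_inner (cell X i j) U (dx s)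
         - l2_inner (ival X j) (fluxUx \<epsilon> N X U P i) (trxm X s i)
         + l2_inner (ival X j) (fluxUx \<epsilon> N X U P (i - 1)) (trxp X s (i - 1)) = 0 \<and>
       (1 / \<epsilon>) * l2_inner (cell X i j) Q r + l2_inner (cell X i j) U (dy r)
         - l2_inner (ival X i) (fluxUy \<epsilon> N X U Q j) (trym X r j)
         + l2_inner (ival X i) (fluxUy \<epsilon> N X U Q (j - 1)) (tryp X r (j - 1)) = 0 \<and>
       l2_inner (cell X i j) P (dx v)
         - l2_inner (ival X j) (fluxPx \<epsilon> N X U P i) (trxm X v i)
         + l2_inner (ival X j) (fluxPx \<epsilon> N X U P (i - 1)) (trxp X v (i - 1))
         + l2_inner (cell X i j) Q (dy v)
         - l2_inner (ival X i) (fluxQy \<epsilon> N X U Q j) (trym X v j)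
         + l2_inner (ival X i) (fluxQy \<epsilon> N X U Q (j - 1)) (tryp X v (j - 1))
         + l2_inner (cell X i j) (\<lambda>z. b z * U z) v
         = l2_inner (cell X i j) f v)"


subsection \<open>Energy and balanced norms\<close>

text \<open>The two norms differ only in the weight \<open>\<omega>\<close> of the auxiliary variables \<open>p\<close> and \<open>q\<close> and in the weight
  \<open>\<mu>\<close> of the jumps on the boundary of the square.\<close>

definition weighted_norm ::
  "real \<Rightarrow> real \<Rightarrow> nat \<Rightarrow> (nat \<Rightarrow> real) \<Rightarrow> real \<Rightarrow> fn2 \<Rightarrow> fn2 \<Rightarrow> fn2 \<Rightarrow> fn2 \<Rightarrow> real" where
  "weighted_norm \<omega> \<mu> N X \<epsilon> b u p q = sqrt (
     \<omega> * (l2_norm Omega p)\<^sup>2 + \<omega> * (l2_norm Omega q)\<^sup>2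
     + (l2_norm Omega (\<lambda>z. sqrt (b z) * u z))\<^sup>2
     + (\<Sum>j=1..N. \<Sum>i\<in>{0, N}. l2_inner (ival X j) (\<lambda>_. \<mu>) (\<lambda>y. (jumpx N X u i y)\<^sup>2))
     + (\<Sum>i=1..N. \<Sum>j\<in>{0, N}. l2_inner (ival X i) (\<lambda>_. \<mu>) (\<lambda>x. (jumpy N X u j x)\<^sup>2))
     + (\<Sum>j=1..N. l2_inner (ival X j) (\<lambda>_. lam_tr \<epsilon>) (\<lambda>y. (jumpx N X p (3 * N div 4) y)\<^sup>2))
     + (\<Sum>i=1..N. l2_inner (ival X i) (\<lambda>_. lam_tr \<epsilon>) (\<lambda>x. (jumpy N X q (3 * N div 4) x)\<^sup>2)))"

definition energy_norm ::
  "nat \<Rightarrow> (nat \<Rightarrow> real) \<Rightarrow> real \<Rightarrow> fn2 \<Rightarrow> fn2 \<Rightarrow> fn2 \<Rightarrow> fn2 \<Rightarrow> real" where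
  "energy_norm N X \<epsilon> b = weighted_norm (1 / \<epsilon>) (lam_bd \<epsilon>) N X \<epsilon> b"

definition balanced_norm ::
  "nat \<Rightarrow> (nat \<Rightarrow> real) \<Rightarrow> real \<Rightarrow> fn2 \<Rightarrow> fn2 \<Rightarrow> fn2 \<Rightarrow> fn2 \<Rightarrow> real" where
  "balanced_norm N X \<epsilon> b = weighted_norm (\<epsilon> powr (- 3 / 2)) 1 N X \<epsilon> b"

end

theory Submission
  imports Defs "HOL-Computational_Algebra.Polynomial"
begin

text \<open>Energy argument for the difference between the discrete solution and a special interpolant. The solution is
  interpolated by tensor products of Gauss--Radau projections, chosen so that in the bilinear form the projection errors
  are annihilated by the discrete test functions up to the fluxes at the boundary and at the penalised line
  \<open>x = 1 - \<tau>\<close>. What remains is either continuous across the mesh lines and can be integrated by parts back onto the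
  test function, or is paired with a jump that the energy norm controls; this yields the factor \<open>\<epsilon>^(1/4)\<close> in front of
  \<open>(ln N / N)^(k+1)\<close> and avoids inverse inequalities on the strongly anisotropic cells. On coarse cells the interpolant
  of \<open>u\<close> is additionally corrected to make the reaction term vanish, at the price \<open>\<epsilon>^(1/2) / N^k\<close> of an inverse
  inequality on a mesh of width of order \<open>1 / N\<close>. All bounds for the discrete error are of the form \<open>C * W\<close> with
  \<open>W = \<epsilon>^(1/2) (ln N / N)^(2k+2) + \<epsilon> / N^(2k)\<close>, which is small enough to absorb the larger weights of the balanced norm.\<close>

subsection \<open>Orthonormal polynomials and Gauss--Radau projections\<close>

text \<open>In the balanced norm the squares of \<open>p\<close>, \<open>q\<close> and of the
  boundary jumps weigh \<open>\<epsilon>^(-1/2)\<close> times more than in the energy norm, so every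
  source of the discrete error must carry a factor \<open>\<epsilon>^(1/2)\<close> in the squared
  estimate. An error of size \<open>N^(-k-1)\<close> on the whole square, as produced by the
  reaction term, would be fatal; on the refined strips it is harmless, because their width is
  proportional to \<open>\<epsilon>^(1/2) * ln N\<close>. Hence the correction on coarse cells. It
  destroys the Radau property, and its traces meet jumps of the test functions. Between coarse cells
  an inverse inequality controls these jumps; at \<open>1 - \<tau>\<close> the right neighbour is a
  thin cell, and only the penalty in the flux helps; at \<open>\<tau>\<close> the flux reads the
  refined side, which is not corrected. Two dimensions reduce to one because projecting in
  \<open>y\<close> commutes with differentiating in \<open>x\<close>: at fixed \<open>y\<close> the
  error along a row is a function continuous in \<open>x\<close> plus a one-dimensional Radau error.
  Columns follow by exchanging the variables, which is possible because the interpolant of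
  \<open>u\<close> is symmetric in them.\<close>

lemma gram_projection:
  fixes \<phi> :: "'i \<Rightarrow> 'a \<Rightarrow> real" and B :: "('a \<Rightarrow> real) \<Rightarrow> ('a \<Rightarrow> real) \<Rightarrow> real"
  assumes "finite I"
    and V_diff: "\<And>f g c. f \<in> V \<Longrightarrow> g \<in> V \<Longrightarrow> (\<lambda>x. f x - c * g x) \<in> V"
    and B_diff: "\<And>f g h c. f \<in> V \<Longrightarrow> g \<in> V \<Longrightarrow> h \<in> V \<Longrightarrow> B (\<lambda>x. f x - c * g x) h = B f h - c * B g h"
    and B_sym: "\<And>f g. f \<in> V \<Longrightarrow> g \<in> V \<Longrightarrow> B f g = B g f"
    and B_pos: "\<And>f. f \<in> V \<Longrightarrow> 0 \<le> B f f"
    and \<phi>: "\<And>i. i \<in> I \<Longrightarrow> \<phi> i \<in> V" and f: "f \<in> V"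
  shows "\<exists>c. (\<lambda>x. f x - (\<Sum>j\<in>I. c j * \<phi> j x)) \<in> V \<and> (\<forall>i\<in>I. B (\<lambda>x. f x - (\<Sum>j\<in>I. c j * \<phi> j x)) (\<phi> i) = 0)"
  using \<open>finite I\<close> \<phi> f
\<comment> \<open>Gram--Schmidt for a form that is only semidefinite: the new basis function is made
  orthogonal to the old ones, giving \<open>\<psi>\<close>, and the residual \<open>r\<close> of
  \<open>f\<close> is then corrected along \<open>\<psi>\<close>. The same argument serves
  univariate polynomials and weighted bivariate ones.\<close>
proof (induction I arbitrary: f rule: finite_induct)
  case empty
  then show ?case by simp
next
  case (insert n I)
  define \<psi>0 where "\<psi>0 = \<phi> n"
  have "\<psi>0 \<in> V" using insert.prems by (simp add: \<psi>0_def)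
  from insert.IH[OF _ this] insert.prems obtain c' where
    c'V: "(\<lambda>x. \<psi>0 x - (\<Sum>j\<in>I. c' j * \<phi> j x)) \<in> V" and
    c'0: "\<And>i. i \<in> I \<Longrightarrow> B (\<lambda>x. \<psi>0 x - (\<Sum>j\<in>I. c' j * \<phi> j x)) (\<phi> i) = 0" by blast
  define \<psi> where "\<psi> = (\<lambda>x. \<psi>0 x - (\<Sum>j\<in>I. c' j * \<phi> j x))"
  from insert.IH[OF _ insert.prems(2)] insert.prems obtain c where
    cV: "(\<lambda>x. f x - (\<Sum>j\<in>I. c j * \<phi> j x)) \<in> V" and
    c0: "\<And>i. i \<in> I \<Longrightarrow> B (\<lambda>x. f x - (\<Sum>j\<in>I. c j * \<phi> j x)) (\<phi> i) = 0" by blast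
  define r where "r = (\<lambda>x. f x - (\<Sum>j\<in>I. c j * \<phi> j x))"
  have V: "\<psi> \<in> V" "r \<in> V" using c'V cV by (auto simp: \<psi>_def r_def)
  \<comment> \<open>A function orthogonal to the old basis cannot distinguish \<open>\<psi>0\<close>
    from its orthogonalised version \<open>\<psi>\<close>.\<close>
  have orth_span: "B g \<psi>0 = B g \<psi>" if g: "g \<in> V" "\<And>i. i \<in> I \<Longrightarrow> B g (\<phi> i) = 0" for g
  proof -
    have "B (\<lambda>x. \<psi>0 x - (\<Sum>j\<in>J. c' j * \<phi> j x)) g = B \<psi>0 g \<and> (\<lambda>x. \<psi>0 x - (\<Sum>j\<in>J. c' j * \<phi> j x)) \<in> V" if "J \<subseteq> I" for J
      using finite_subset[OF that insert.hyps(1)] that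
    proof (induction J rule: finite_induct)
      case empty
      then show ?case using \<open>\<psi>0 \<in> V\<close> by simp
    next
      case (insert j J)
      have jV: "\<phi> j \<in> V" using insert.prems \<open>\<And>i. i \<in> Set.insert n I \<Longrightarrow> \<phi> i \<in> V\<close> by auto
      have eq: "(\<lambda>x. \<psi>0 x - (\<Sum>j\<in>Set.insert j J. c' j * \<phi> j x)) = (\<lambda>x. (\<psi>0 x - (\<Sum>j\<in>J. c' j * \<phi> j x)) - c' j * \<phi> j x)"
        using insert.hyps by (simp add: algebra_simps)
      have "B (\<phi> j) g = 0" using g(2)[of j] B_sym[OF g(1) jV] insert.prems by auto
      then show ?case unfolding eq using insert.IH insert.prems jV g(1) by (auto simp: B_diff V_diff)
    qed
    from this[of I] have "B \<psi> g = B \<psi>0 g" by (simp add: \<psi>_def)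
    then show ?thesis using B_sym V g(1) \<open>\<psi>0 \<in> V\<close> by metis
  qed
  have r\<psi>0: "B r \<psi>0 = B r \<psi>" by (rule orth_span) (use V c0 in \<open>auto simp: r_def\<close>)
  have \<psi>\<psi>0: "B \<psi> \<psi>0 = B \<psi> \<psi>" by (rule orth_span) (use V c'0 in \<open>auto simp: \<psi>_def\<close>)
  \<comment> \<open>For \<open>B \<psi> \<psi> = 0\<close> the quotient is 0 by convention;
    \<open>key\<close> shows that this is still the right coefficient.\<close>
  define \<alpha> where "\<alpha> = B r \<psi> / B \<psi> \<psi>"
  have key: "B r \<psi> - \<alpha> * B \<psi> \<psi> = 0"
  proof (cases "B \<psi> \<psi> = 0")
    case True
    \<comment> \<open>The square of \<open>r - t * \<psi>\<close> is nonnegative for every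
      \<open>t\<close>. In this degenerate case it is affine in \<open>t\<close>, which forces its
      slope to vanish.\<close>
    have *: "0 \<le> B r r - 2 * t * B r \<psi>" for t
    proof -
      have "(\<lambda>x. r x - t * \<psi> x) \<in> V" by (rule V_diff) (use V in auto)
      from B_pos[OF this] have "0 \<le> B r (\<lambda>x. r x - t * \<psi> x) - t * B \<psi> (\<lambda>x. r x - t * \<psi> x)"
        using B_diff[OF V(2) V(1) \<open>(\<lambda>x. r x - t * \<psi> x) \<in> V\<close>] by simp
      also have "B r (\<lambda>x. r x - t * \<psi> x) = B r r - t * B r \<psi>"
        using B_diff[OF V(2) V(1) V(2)] B_sym V \<open>(\<lambda>x. r x - t * \<psi> x) \<in> V\<close> by metis
      also have "B \<psi> (\<lambda>x. r x - t * \<psi> x) = B r \<psi> - t * B \<psi> \<psi>"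
        using B_diff[OF V(2) V(1) V(1)] B_sym V \<open>(\<lambda>x. r x - t * \<psi> x) \<in> V\<close> by metis
      finally show ?thesis using True by simp
    qed
    have "B r \<psi> = 0"
    proof (rule ccontr)
      assume "B r \<psi> \<noteq> 0"
      then have "2 * ((B r r + 1) / (2 * B r \<psi>)) * B r \<psi> = B r r + 1" by (simp add: field_simps)
      with *[of "(B r r + 1) / (2 * B r \<psi>)"] show False by linarith
    qed
    then show ?thesis using True by simp
  next
    case False
    then show ?thesis by (simp add: \<alpha>_def)
  qed
  define d where "d = (\<lambda>j. if j = n then \<alpha> else c j - \<alpha> * c' j)"
  have eq: "(\<lambda>x. f x - (\<Sum>j\<in>Set.insert n I. d j * \<phi> j x)) = (\<lambda>x. r x - \<alpha> * \<psi> x)"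
  proof
    fix x
    have "(\<Sum>j\<in>I. d j * \<phi> j x) = (\<Sum>j\<in>I. c j * \<phi> j x) - \<alpha> * (\<Sum>j\<in>I. c' j * \<phi> j x)"
      using insert.hyps by (auto simp: sum_distrib_left sum_subtractf[symmetric] d_def algebra_simps intro!: sum.cong)
    then show "f x - (\<Sum>j\<in>Set.insert n I. d j * \<phi> j x) = r x - \<alpha> * \<psi> x"
      using insert.hyps by (simp add: r_def \<psi>_def \<psi>0_def d_def algebra_simps)
  qed
  have "B (\<lambda>x. r x - \<alpha> * \<psi> x) (\<phi> i) = 0" if "i \<in> Set.insert n I" for i
  proof (cases "i = n")
    case True
    have "B (\<lambda>x. r x - \<alpha> * \<psi> x) \<psi>0 = B r \<psi>0 - \<alpha> * B \<psi> \<psi>0"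
      by (rule B_diff) (use V \<open>\<psi>0 \<in> V\<close> in auto)
    then show ?thesis using key r\<psi>0 \<psi>\<psi>0 True by (simp add: \<psi>0_def)
  next
    case False
    then have "i \<in> I" using that by auto
    then have "B (\<lambda>x. r x - \<alpha> * \<psi> x) (\<phi> i) = B r (\<phi> i) - \<alpha> * B \<psi> (\<phi> i)"
      using V insert.prems by (intro B_diff) auto
    then show ?thesis using c0[OF \<open>i \<in> I\<close>] c'0[OF \<open>i \<in> I\<close>] by (simp add: r_def \<psi>_def)
  qed
  moreover have "(\<lambda>x. r x - \<alpha> * \<psi> x) \<in> V" using V by (intro V_diff)
  ultimately show ?case unfolding eq[symmetric] by blast
qed

lemma integral_mult_poly_linear:
  fixes f g h :: "real \<Rightarrow> real"
  assumes "continuous_on {a..b} f" "continuous_on {a..b} g" "continuous_on {a..b} h"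
  shows "integral {a..b} (\<lambda>x. (f x - c * g x) * h x) = integral {a..b} (\<lambda>x. f x * h x) - c * integral {a..b} (\<lambda>x. g x * h x)"
proof -
  have "integral {a..b} (\<lambda>x. (f x - c * g x) * h x) = integral {a..b} (\<lambda>x. f x * h x - c * (g x * h x))"
    by (simp add: algebra_simps)
  also have "\<dots> = integral {a..b} (\<lambda>x. f x * h x) - integral {a..b} (\<lambda>x. c * (g x * h x))"
    by (intro integral_diff integrable_continuous_interval continuous_intros assms)
  finally show ?thesis by simp
qed

lemma poly_zero_on_interval:
  fixes p :: "real poly"
  assumes "\<And>x. 0 < x \<Longrightarrow> x < 1 \<Longrightarrow> poly p x = 0"
  shows "p = 0"
proof (rule ccontr)
  assume "p \<noteq> 0"
  then have "finite {x. poly p x = 0}" by (rule poly_roots_finite)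
  moreover have "{0<..<1::real} \<subseteq> {x. poly p x = 0}" using assms by auto
  ultimately have "finite {0<..<1::real}" by (rule finite_subset[rotated])
  then show False using infinite_Ioo[of 0 "1::real"] by simp
qed

text \<open>The weight may vanish at the endpoints, because the weights \<open>t\<close> and
  \<open>1 - t\<close> are what later excludes zeros of the orthogonal polynomials there.\<close>

lemma integral_weighted_square_pos:
  fixes p :: "real poly" and w :: "real \<Rightarrow> real"
  assumes "continuous_on {0..1} w" "\<And>x. 0 \<le> x \<Longrightarrow> x \<le> 1 \<Longrightarrow> 0 \<le> w x" "\<And>x. 0 < x \<Longrightarrow> x < 1 \<Longrightarrow> 0 < w x"
    and "integral {0..1} (\<lambda>t. w t * (poly p t * poly p t)) = 0"
  shows "p = 0"
proof (rule poly_zero_on_interval)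
  have "continuous_on {0..1} (\<lambda>t. w t * (poly p t * poly p t))" by (intro continuous_intros assms)
  then have "\<forall>x\<in>{0..1}. w x * (poly p x * poly p x) = 0"
    using integral_eq_0_iff[of 0 1 "\<lambda>t. w t * (poly p t * poly p t)"] assms by auto
  then show "poly p x = 0" if "0 < x" "x < 1" for x using assms(3)[OF that] that
    by (metis atLeastAtMost_iff less_eq_real_def mult_eq_0_iff order_less_irrefl)
qed

text \<open>Up to sign these are the normalised Legendre polynomials shifted to the unit interval.
  \<open>legp\<close> fixes one choice; only degree and orthonormality are used of it.\<close>

definition orthopoly :: "(nat \<Rightarrow> real poly) \<Rightarrow> bool" where
  "orthopoly e \<longleftrightarrow> (\<forall>n. degree (e n) = n \<and> e n \<noteq> 0) \<and>
     (\<forall>m n. integral {0..1} (\<lambda>t. poly (e m) t * poly (e n) t) = (if m = n then 1 else 0))"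

lemma ex_orthopoly: "\<exists>e. orthopoly e"
proof -
  have ex: "\<exists>q :: real poly. degree q = n \<and> q \<noteq> 0 \<and> (\<forall>j<n. integral {0..1} (\<lambda>t. poly q t * t ^ j) = 0)
     \<and> integral {0..1} (\<lambda>t. poly q t * poly q t) = 1" for n :: nat
  proof -
    let ?V = "{f :: real \<Rightarrow> real. continuous_on {0..1} f}"
    let ?B = "\<lambda>f g :: real \<Rightarrow> real. integral {0..1} (\<lambda>t. f t * g t)"
    have "\<exists>c. (\<lambda>x::real. x ^ n - (\<Sum>j<n. c j * x ^ j)) \<in> ?V \<and> (\<forall>i\<in>{..<n}. ?B (\<lambda>x. x ^ n - (\<Sum>j<n. c j * x ^ j)) (\<lambda>x. x ^ i) = 0)"
    proof (rule gram_projection[where V = ?V and B = ?B])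
      show "?B (\<lambda>x. f x - c * g x) h = ?B f h - c * ?B g h" if "f \<in> ?V" "g \<in> ?V" "h \<in> ?V" for f g h c
        using that by (intro integral_mult_poly_linear) auto
      show "?B f g = ?B g f" for f g by (simp add: mult.commute)
      show "0 \<le> ?B f f" if "f \<in> ?V" for f
        using that by (intro integral_nonneg integrable_continuous_interval continuous_intros) auto
    qed (auto intro!: continuous_intros)
    then obtain c where "\<forall>i\<in>{..<n}. integral {0..1::real} (\<lambda>t. (t ^ n - (\<Sum>j<n. c j * t ^ j)) * t ^ i) = 0"
      by (elim exE conjE) (rule that)
    then have c: "integral {0..1::real} (\<lambda>t. (t ^ n - (\<Sum>j<n. c j * t ^ j)) * t ^ i) = 0" if "i < n" for i using that by simp
    define q where "q = monom 1 n - (\<Sum>j<n. monom (c j) j)"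
    have pq: "poly q t = t ^ n - (\<Sum>j<n. c j * t ^ j)" for t by (simp add: q_def poly_monom poly_sum)
    have cn: "coeff q n = 1" by (simp add: q_def coeff_sum)
    have "degree q \<le> n" unfolding q_def
      by (intro degree_diff_le degree_monom_le degree_sum_le) (auto intro: order.trans[OF degree_monom_le])
    with cn have dq: "degree q = n" "q \<noteq> 0" by (auto intro!: antisym le_degree)
    define I where "I = integral {0..1} (\<lambda>t. poly q t * poly q t)"
    have "I \<ge> 0" unfolding I_def by (intro integral_nonneg integrable_continuous_interval continuous_intros) auto
    moreover have "I \<noteq> 0" using integral_weighted_square_pos[of "\<lambda>_. 1" q] dq by (auto simp: I_def)
    ultimately have "I > 0" by simp
    define r where "r = smult (1 / sqrt I) q"
    have "integral {0..1} (\<lambda>t. poly r t * poly r t) = integral {0..1} (\<lambda>t. (1 / I) * (poly q t * poly q t))"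
      using \<open>I > 0\<close> by (intro integral_cong) (simp add: r_def field_simps)
    also have "\<dots> = 1" using \<open>I > 0\<close> unfolding integral_mult_right by (simp add: I_def)
    finally have "integral {0..1} (\<lambda>t. poly r t * poly r t) = 1" .
    moreover have "integral {0..1} (\<lambda>t. poly r t * t ^ j) = 0" if "j < n" for j
    proof -
      have "integral {0..1} (\<lambda>t. poly r t * t ^ j) = integral {0..1} (\<lambda>t. (1 / sqrt I) * (poly q t * t ^ j))"
        by (simp add: r_def algebra_simps)
      then show ?thesis unfolding integral_mult_right using c[OF that] by (simp add: pq)
    qed
    ultimately show ?thesis using dq \<open>I > 0\<close> by (intro exI[of _ r] conjI allI impI) (simp_all add: r_def)
  qed
  then obtain e where e: "\<And>n. degree (e n) = n" "\<And>n. e n \<noteq> 0" "\<And>n j. j < n \<Longrightarrow> integral {0..1} (\<lambda>t. poly (e n) t * t ^ j) = (0::real)"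
    "\<And>n. integral {0..1} (\<lambda>t. poly (e n) t * poly (e n) t) = 1" by metis
  have low: "integral {0..1} (\<lambda>t. poly (e n) t * poly (e m) t) = 0" if "m < n" for m n
  proof -
    have "integral {0..1} (\<lambda>t. poly (e n) t * poly (e m) t) = integral {0..1} (\<lambda>t. \<Sum>j\<le>m. coeff (e m) j * (poly (e n) t * t ^ j))"
      by (simp add: poly_altdef[of "e m"] e(1) sum_distrib_left algebra_simps)
    also have "\<dots> = (\<Sum>j\<le>m. integral {0..1} (\<lambda>t. coeff (e m) j * (poly (e n) t * t ^ j)))"
      by (intro integral_sum integrable_continuous_interval continuous_intros) auto
    also have "\<dots> = 0" unfolding integral_mult_right using e(3) that by (intro sum.neutral) auto
    finally show ?thesis .
  qed
  have "integral {0..1} (\<lambda>t. poly (e m) t * poly (e n) t) = (if m = n then 1 else 0)" for m n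
    using low[of m n] low[of n m] e(4)[of m] by (cases m n rule: linorder_cases) (auto simp: mult.commute)
  then show ?thesis using e unfolding orthopoly_def by blast
qed

definition legp :: "nat \<Rightarrow> real poly" where "legp = (SOME e. orthopoly e)"

lemma orthopoly_legp: "orthopoly legp"
  unfolding legp_def using ex_orthopoly by (rule someI_ex)

lemma degree_legp [simp]: "degree (legp n) = n" and legp_nonzero [simp]: "legp n \<noteq> 0"
  and orthonormal_legp: "integral {0..1} (\<lambda>t. poly (legp m) t * poly (legp n) t) = (if m = n then 1 else 0)"
  using orthopoly_legp by (auto simp: orthopoly_def)

lemma ex_expansion_legp: "degree p \<le> k \<Longrightarrow> \<exists>a. p = (\<Sum>m\<le>k. smult (a m) (legp m))"
proof (induction k arbitrary: p)
  case 0
  obtain b where b: "legp 0 = [:b:]" using degree_legp[of 0] by (metis degree_eq_zeroE)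
  obtain a where a: "p = [:a:]" using 0 by (auto elim: degree_eq_zeroE)
  have "b \<noteq> 0" using legp_nonzero[of 0] b by auto
  then show ?case using a b by (intro exI[of _ "\<lambda>_. a / b"]) simp
next
  case (Suc k)
  define c where "c = coeff p (Suc k) / coeff (legp (Suc k)) (Suc k)"
  have "coeff (legp (Suc k)) (Suc k) \<noteq> 0" using legp_nonzero[of "Suc k"] degree_legp[of "Suc k"] leading_coeff_0_iff by metis
  then have "coeff (p - smult c (legp (Suc k))) (Suc k) = 0" by (simp add: c_def)
  moreover have "degree (p - smult c (legp (Suc k))) \<le> Suc k"
    using Suc.prems degree_smult_le[of c "legp (Suc k)"] by (intro degree_diff_le) auto
  ultimately have "degree (p - smult c (legp (Suc k))) \<le> k"
    by (metis degree_le le_SucE le_degree leading_coeff_0_iff le0 degree_0)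
  from Suc.IH[OF this] obtain a where a: "p - smult c (legp (Suc k)) = (\<Sum>m\<le>k. smult (a m) (legp m))" by blast
  then have "p = (\<Sum>m\<le>k. smult (a m) (legp m)) + smult c (legp (Suc k))" by (simp add: algebra_simps)
  then show ?case by (intro exI[of _ "a(Suc k := c)"]) simp
qed

definition mom :: "nat \<Rightarrow> (real \<Rightarrow> real) \<Rightarrow> real" where
  "mom n g = integral {0..1} (\<lambda>t. poly (legp n) t * g t)"

lemma mom_sum_smult:
  "n \<le> k \<Longrightarrow> mom n (\<lambda>t. \<Sum>m\<le>k. a m * poly (legp m) t) = a n"
proof -
  assume "n \<le> k"
  have "mom n (\<lambda>t. \<Sum>m\<le>k. a m * poly (legp m) t) = integral {0..1} (\<lambda>t. \<Sum>m\<le>k. a m * (poly (legp n) t * poly (legp m) t))"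
    by (simp add: mom_def sum_distrib_left algebra_simps)
  also have "\<dots> = (\<Sum>m\<le>k. integral {0..1} (\<lambda>t. a m * (poly (legp n) t * poly (legp m) t)))"
    by (intro integral_sum integrable_continuous_interval continuous_intros) auto
  also have "\<dots> = (\<Sum>m\<le>k. if m = n then a m else 0)"
    unfolding integral_mult_right orthonormal_legp by (intro sum.cong) auto
  finally show ?thesis using \<open>n \<le> k\<close> by simp
qed

lemma expansion_legp:
  assumes "degree p \<le> k"
  shows "poly p s = (\<Sum>m\<le>k. mom m (poly p) * poly (legp m) s)"
proof -
  obtain a where a: "p = (\<Sum>m\<le>k. smult (a m) (legp m))" using ex_expansion_legp[OF assms] by blast
  then have "poly p = (\<lambda>t. \<Sum>m\<le>k. a m * poly (legp m) t)" by (auto simp: poly_sum)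
  then show ?thesis using mom_sum_smult[of _ k a] by simp
qed

lemma mom_lower_degree: "degree r < n \<Longrightarrow> mom n (poly r) = 0"
proof -
  assume "degree r < n"
  obtain a where a: "r = (\<Sum>m\<le>degree r. smult (a m) (legp m))" using ex_expansion_legp[of r "degree r"] by blast
  define b where "b m = (if m \<le> degree r then a m else 0)" for m
  have "(\<Sum>m\<le>n. b m * poly (legp m) t) = (\<Sum>m\<le>degree r. a m * poly (legp m) t)" for t
    using \<open>degree r < n\<close> by (intro sum.mono_neutral_cong_right) (auto simp: b_def)
  then have "poly r = (\<lambda>t. \<Sum>m\<le>n. b m * poly (legp m) t)" using arg_cong[OF a, of poly] by (auto simp: poly_sum)
  then show ?thesis using mom_sum_smult[of n n b] \<open>degree r < n\<close> by (simp add: b_def)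
qed

text \<open>A zero at the endpoint would factor \<open>legp k\<close> as \<open>(t - z) * r\<close>
  with \<open>r\<close> of lower degree. Orthogonality to \<open>r\<close> then makes the integral
  of \<open>(t - z) * r^2\<close> vanish, although the integrand has one sign. The division by
  \<open>poly (legp k) z\<close> in the Radau projection rests on this.\<close>

lemma legp_endpoint_nonzero:
  assumes "z = 0 \<or> z = (1::real)"
  shows "poly (legp k) z \<noteq> 0"
proof
  assume "poly (legp k) z = 0"
  then obtain r where r: "legp k = [:- z, 1:] * r" using poly_eq_0_iff_dvd by (metis dvd_def)
  then have "r \<noteq> 0" by (metis legp_nonzero mult_zero_right)
  then have "degree (legp k) = Suc (degree r)" unfolding r by (subst degree_mult_eq) auto
  then have "mom k (poly r) = 0" by (intro mom_lower_degree) simp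
  then have z: "integral {0..1} (\<lambda>t. (t - z) * (poly r t * poly r t)) = 0" unfolding mom_def r by (simp add: algebra_simps)
  show False
  proof (cases "z = 0")
    case True
    then show False using integral_weighted_square_pos[of "\<lambda>t. t" r] z \<open>r \<noteq> 0\<close> by (auto intro!: continuous_intros)
  next
    case False
    then have "z = 1" using assms by simp
    have "integral {0..1} (\<lambda>t. (1 - t) * (poly r t * poly r t)) = - integral {0..1} (\<lambda>t. (t - z) * (poly r t * poly r t))"
      unfolding integral_neg[symmetric] \<open>z = 1\<close> by (intro integral_cong) (simp add: algebra_simps)
    then show False using integral_weighted_square_pos[of "\<lambda>t. 1 - t" r] z \<open>r \<noteq> 0\<close> by (simp add: continuous_on_diff)
  qed
qed

text \<open>The Gauss--Radau projection onto polynomials of degree at most \<open>k\<close>, exact at the endpoint \<open>z\<close> and with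
  error orthogonal to lower degrees, as an explicit functional: the truncated orthonormal expansion of degree below \<open>k\<close>
  plus the multiple of the top polynomial that restores the value at \<open>z\<close>. In this kernel form boundedness, linearity
  and commutation with a second variable are immediate.\<close>

definition rker :: "nat \<Rightarrow> real \<Rightarrow> real \<Rightarrow> real \<Rightarrow> real" where
  "rker k z s t = (\<Sum>n<k. (poly (legp n) s - poly (legp k) s / poly (legp k) z * poly (legp n) z) * poly (legp n) t)"

definition rpt :: "nat \<Rightarrow> real \<Rightarrow> real \<Rightarrow> real" where
  "rpt k z s = poly (legp k) s / poly (legp k) z"

definition rprj :: "nat \<Rightarrow> real \<Rightarrow> (real \<Rightarrow> real) \<Rightarrow> real \<Rightarrow> real" where
  "rprj k z g s = integral {0..1} (\<lambda>t. rker k z s t * g t) + rpt k z s * g z"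

lemma continuous_on_rker [continuous_intros]: "continuous_on S (rker k z s)"
  unfolding rker_def by (intro continuous_intros)

text \<open>The moments below \<open>k\<close> are kept and the top coefficient is fixed by the
  value at \<open>z\<close>. The algebraic properties of the projection are read off from this form,
  the analytic ones from the kernel form.\<close>

lemma rprj_expand:
  assumes g: "continuous_on {0..1} g"
  shows "rprj k z g s = (\<Sum>n<k. mom n g * poly (legp n) s)
     + (g z - (\<Sum>n<k. mom n g * poly (legp n) z)) / poly (legp k) z * poly (legp k) s"
proof -
  have "integral {0..1} (\<lambda>t. rker k z s t * g t) = integral {0..1} (\<lambda>t. \<Sum>n<k.
      (poly (legp n) s - poly (legp k) s / poly (legp k) z * poly (legp n) z) * (poly (legp n) t * g t))"
    by (simp add: rker_def sum_distrib_right sum_distrib_left mult.assoc)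
  also have "\<dots> = (\<Sum>n<k. (poly (legp n) s - poly (legp k) s / poly (legp k) z * poly (legp n) z) * mom n g)"
    unfolding mom_def integral_mult_right[symmetric]
    by (intro integral_sum integrable_continuous_interval continuous_intros g) auto
  also have "\<dots> = (\<Sum>n<k. mom n g * poly (legp n) s) - (\<Sum>n<k. mom n g * poly (legp n) z) / poly (legp k) z * poly (legp k) s"
    by (simp add: sum_subtractf algebra_simps sum_distrib_left sum_distrib_right sum_divide_distrib)
  finally show ?thesis by (simp add: rprj_def rpt_def field_simps diff_divide_distrib)
qed

lemma rprj_endpoint:
  assumes "continuous_on {0..1} g" "z = 0 \<or> z = 1"
  shows "rprj k z g z = g z"
  using legp_endpoint_nonzero[OF assms(2), of k] by (simp add: rprj_expand[OF assms(1)])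

definition rpoly :: "nat \<Rightarrow> real \<Rightarrow> (real \<Rightarrow> real) \<Rightarrow> real poly" where
  "rpoly k z g = (\<Sum>n<k. smult (mom n g) (legp n))
     + smult ((g z - (\<Sum>n<k. mom n g * poly (legp n) z)) / poly (legp k) z) (legp k)"

lemma rprj_poly: "continuous_on {0..1} g \<Longrightarrow> rprj k z g = poly (rpoly k z g)"
  by (auto simp: rprj_expand rpoly_def poly_sum)

lemma degree_rpoly: "degree (rpoly k z g) \<le> k"
  unfolding rpoly_def
  by (intro degree_add_le degree_sum_le) (auto intro: order.trans[OF degree_smult_le])

lemma mom_diff:
  assumes "continuous_on {0..1} f" "continuous_on {0..1} g"
  shows "mom n (\<lambda>x. f x - g x) = mom n f - mom n g"
  using integral_mult_poly_linear[OF assms, of "poly (legp n)" 1] by (simp add: mom_def continuous_intros mult.commute)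

lemma rprj_reproduces:
  assumes "degree p \<le> k" "z = 0 \<or> z = 1"
  shows "rprj k z (poly p) s = poly p s"
proof -
  have c: "continuous_on {0..1} (poly p)" by (intro continuous_intros)
  have *: "poly p s = (\<Sum>n<k. mom n (poly p) * poly (legp n) s) + mom k (poly p) * poly (legp k) s" for s
    using expansion_legp[OF assms(1), of s] by (simp add: lessThan_Suc_atMost[symmetric])
  have "poly p z - (\<Sum>n<k. mom n (poly p) * poly (legp n) z) = mom k (poly p) * poly (legp k) z" using *[of z] by simp
  then show ?thesis using legp_endpoint_nonzero[OF assms(2), of k] by (simp add: rprj_expand[OF c] *[of s])
qed

lemma rprj_orthogonal:
  assumes g: "continuous_on {0..1} g" and r: "degree r < k"
  shows "integral {0..1} (\<lambda>t. (g t - rprj k z g t) * poly r t) = 0"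
proof -
  let ?d = "\<lambda>t. g t - rprj k z g t"
  have cd: "continuous_on {0..1} ?d" unfolding rprj_poly[OF g] by (intro continuous_intros g)
  have m: "mom m ?d = 0" if "m < k" for m
  proof -
    have "rprj k z g = (\<lambda>s. \<Sum>n\<le>k. (if n < k then mom n g else (g z - (\<Sum>n<k. mom n g * poly (legp n) z)) / poly (legp k) z) * poly (legp n) s)"
      by (auto simp: rprj_expand[OF g] lessThan_Suc_atMost[symmetric])
    then have "mom m (rprj k z g) = mom m g" using mom_sum_smult[of m k] that by simp
    moreover have "mom m ?d = mom m g - mom m (rprj k z g)"
      unfolding rprj_poly[OF g] by (intro mom_diff g continuous_intros)
    ultimately show ?thesis by simp
  qed
  obtain a where a: "r = (\<Sum>m\<le>degree r. smult (a m) (legp m))" using ex_expansion_legp[of r "degree r"] by blast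
  have "integral {0..1} (\<lambda>t. ?d t * poly r t) = integral {0..1} (\<lambda>t. \<Sum>m\<le>degree r. a m * (poly (legp m) t * ?d t))"
    by (subst a) (simp add: poly_sum sum_distrib_left algebra_simps sum_subtractf)
  also have "\<dots> = (\<Sum>m\<le>degree r. a m * mom m ?d)" unfolding mom_def integral_mult_right[symmetric]
    by (intro integral_sum integrable_continuous_interval continuous_intros cd) auto
  also have "\<dots> = 0" using m r by (intro sum.neutral) auto
  finally show ?thesis .
qed

lemma rprj_cong: "(\<And>t. 0 \<le> t \<Longrightarrow> t \<le> 1 \<Longrightarrow> f t = g t) \<Longrightarrow> z = 0 \<or> z = 1 \<Longrightarrow> rprj k z f s = rprj k z g s"
  unfolding rprj_def by (auto intro!: integral_cong)

lemma rprj_diff: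
  assumes "continuous_on {0..1} f" "continuous_on {0..1} g"
  shows "rprj k z (\<lambda>t. f t - g t) s = rprj k z f s - rprj k z g s"
proof -
  have "integral {0..1} (\<lambda>t. rker k z s t * (f t - g t))
    = integral {0..1} (\<lambda>t. rker k z s t * f t - rker k z s t * g t)" by (simp add: algebra_simps)
  also have "\<dots> = integral {0..1} (\<lambda>t. rker k z s t * f t) - integral {0..1} (\<lambda>t. rker k z s t * g t)"
    by (intro integral_diff integrable_continuous_interval continuous_intros assms)
  finally show ?thesis by (simp add: rprj_def algebra_simps)
qed

lemma rprj_add:
  assumes "continuous_on {0..1} f" "continuous_on {0..1} g"
  shows "rprj k z (\<lambda>t. f t + g t) s = rprj k z f s + rprj k z g s"
proof -
  have "integral {0..1} (\<lambda>t. rker k z s t * (f t + g t))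
    = integral {0..1} (\<lambda>t. rker k z s t * f t + rker k z s t * g t)" by (simp add: algebra_simps)
  also have "\<dots> = integral {0..1} (\<lambda>t. rker k z s t * f t) + integral {0..1} (\<lambda>t. rker k z s t * g t)"
    by (intro integral_add integrable_continuous_interval continuous_intros assms)
  finally show ?thesis by (simp add: rprj_def algebra_simps)
qed

lemma rprj_cmult: "rprj k z (\<lambda>t. c * f t) s = c * rprj k z f s"
proof -
  have "integral {0..1} (\<lambda>t. rker k z s t * (c * f t)) = integral {0..1} (\<lambda>t. c * (rker k z s t * f t))"
    by (simp add: algebra_simps)
  then show ?thesis unfolding integral_mult_right by (simp add: rprj_def algebra_simps)
qed

lemma poly_bounded_unit: "\<exists>B\<ge>0. \<forall>s\<in>{0..1}. \<bar>poly p s\<bar> \<le> (B::real)"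
proof -
  have "compact ((\<lambda>s. poly p s) ` {0..1})" by (intro compact_continuous_image continuous_intros) auto
  then have "bounded ((\<lambda>s. poly p s) ` {0..1})" by (rule compact_imp_bounded)
  then obtain B where "\<forall>x\<in>(\<lambda>s. poly p s) ` {0..1}. norm x \<le> B" unfolding bounded_iff by blast
  then show ?thesis by (intro exI[of _ "max B 0"]) auto
qed

text \<open>Kernel and point functional are bounded on the unit interval, so the projection is
  stable in the maximum norm. Asking for \<open>C \<ge> 1\<close> lets later estimates absorb the
  identity into the bound for the projection.\<close>

lemma ex_rprj_bound:
  "\<exists>C\<ge>1. \<forall>z\<in>{0,1}. \<forall>g M. continuous_on {0..1} g \<longrightarrow> (\<forall>t\<in>{0..1}. \<bar>g t\<bar> \<le> M) \<longrightarrow> (\<forall>s\<in>{0..1}. \<bar>rprj k z g s\<bar> \<le> C * M)"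
proof -
  have "\<forall>n. \<exists>B. B \<ge> 0 \<and> (\<forall>s\<in>{0..1}. \<bar>poly (legp n) s\<bar> \<le> B)" using poly_bounded_unit by blast
  from choice[OF this] obtain B where B: "\<And>n. B n \<ge> 0" "\<And>n s. s \<in> {0..1} \<Longrightarrow> \<bar>poly (legp n) s\<bar> \<le> B n"
    by blast
  define D where "D = max (1 / \<bar>poly (legp k) 0\<bar>) (1 / \<bar>poly (legp k) 1\<bar>)"
  define C where "C = (\<Sum>n<k. (B n + B k * D * B n) * B n) + B k * D"
  have D0: "D \<ge> 0" by (simp add: D_def max_def)
  have bound: "\<bar>rprj k z g s\<bar> \<le> C * M"
    if z: "z = 0 \<or> z = 1" and g: "continuous_on {0..1} g" "\<And>t. t \<in> {0..1} \<Longrightarrow> \<bar>g t\<bar> \<le> M" and s: "s \<in> {0..1}" for z g M s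
  proof -
    have M0: "M \<ge> 0" using g(2)[of 0] by simp
    have zz: "z \<in> {0..1}" using z by auto
    have Dz: "1 / \<bar>poly (legp k) z\<bar> \<le> D" using z by (auto simp: D_def)
    have pt: "\<bar>poly (legp k) s / poly (legp k) z\<bar> \<le> B k * D"
      using mult_mono[OF B(2)[OF s] Dz B(1)] by (simp add: abs_divide)
    have ker: "\<bar>rker k z s t\<bar> \<le> (\<Sum>n<k. (B n + B k * D * B n) * B n)" if t: "t \<in> {0..1}" for t
      unfolding rker_def
    proof (intro order.trans[OF sum_abs] sum_mono)
      fix n
      have "\<bar>poly (legp k) s / poly (legp k) z * poly (legp n) z\<bar> \<le> B k * D * B n"
        unfolding abs_mult by (intro mult_mono pt B zz) (use B D0 in auto)
      then have "\<bar>poly (legp n) s - poly (legp k) s / poly (legp k) z * poly (legp n) z\<bar> \<le> B n + B k * D * B n"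
        using B(2)[OF s, of n] by linarith
      then show "\<bar>(poly (legp n) s - poly (legp k) s / poly (legp k) z * poly (legp n) z) * poly (legp n) t\<bar> \<le> (B n + B k * D * B n) * B n"
        unfolding abs_mult by (intro mult_mono B t) (use B D0 in auto)
    qed
    have "norm (integral {0..1} (\<lambda>t. rker k z s t * g t)) \<le> integral {0..1} (\<lambda>t::real. (\<Sum>n<k. (B n + B k * D * B n) * B n) * M)"
    proof (rule integral_norm_bound_integral)
      show "norm (rker k z s t * g t) \<le> (\<Sum>n<k. (B n + B k * D * B n) * B n) * M" if "t \<in> {0..1}" for t
        unfolding real_norm_def abs_mult using ker[OF that] g(2)[OF that] M0
        by (intro mult_mono) (auto intro!: sum_nonneg mult_nonneg_nonneg add_nonneg_nonneg B D0)
    qed (auto intro!: integrable_continuous_interval continuous_intros g)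
    then have 1: "\<bar>integral {0..1} (\<lambda>t. rker k z s t * g t)\<bar> \<le> (\<Sum>n<k. (B n + B k * D * B n) * B n) * M" by simp
    have 2: "\<bar>rpt k z s * g z\<bar> \<le> B k * D * M" unfolding rpt_def abs_mult
      using mult_mono[OF pt g(2)[OF zz]] B(1)[of k] D0 by (simp add: abs_mult)
    show ?thesis unfolding rprj_def C_def using 1 2 by (simp add: algebra_simps abs_le_iff)
  qed
  have "\<bar>rprj k z g s\<bar> \<le> max C 1 * M"
    if "z \<in> {0, 1}" "continuous_on {0..1} g" "\<forall>t\<in>{0..1}. \<bar>g t\<bar> \<le> M" "s \<in> {0..1}" for z g M s
  proof -
    have "0 \<le> M" using that(3)[rule_format, of 0] by simp
    then show ?thesis using bound[of z g M s] that by (auto intro: order.trans[OF _ mult_right_mono[of C "max C 1" M]])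
  qed
  then show ?thesis by (intro exI[of _ "max C 1"]) auto
qed

text \<open>Chosen once and for all, so that the stability constant is visibly a function of
  \<open>k\<close> alone; the final constant has to be free of \<open>\<epsilon>\<close> and
  \<open>N\<close>.\<close>

definition cpi :: "nat \<Rightarrow> real" where
  "cpi k = (SOME C. C \<ge> 1 \<and> (\<forall>z\<in>{0,1}. \<forall>g M. continuous_on {0..1} g \<longrightarrow> (\<forall>t\<in>{0..1}. \<bar>g t\<bar> \<le> M) \<longrightarrow> (\<forall>s\<in>{0..1}. \<bar>rprj k z g s\<bar> \<le> C * M)))"

lemma cpi_ge: "cpi k \<ge> 1"
  and rprj_bound: "z = 0 \<or> z = 1 \<Longrightarrow> continuous_on {0..1} g \<Longrightarrow> (\<And>t. t \<in> {0..1} \<Longrightarrow> \<bar>g t\<bar> \<le> M) \<Longrightarrow> s \<in> {0..1} \<Longrightarrow> \<bar>rprj k z g s\<bar> \<le> cpi k * M"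
proof -
  have "cpi k \<ge> 1 \<and> (\<forall>z\<in>{0,1}. \<forall>g M. continuous_on {0..1} g \<longrightarrow> (\<forall>t\<in>{0..1}. \<bar>g t\<bar> \<le> M) \<longrightarrow> (\<forall>s\<in>{0..1}. \<bar>rprj k z g s\<bar> \<le> cpi k * M))"
    unfolding cpi_def by (rule someI_ex) (use ex_rprj_bound in blast)
  then show "cpi k \<ge> 1"
    and "z = 0 \<or> z = 1 \<Longrightarrow> continuous_on {0..1} g \<Longrightarrow> (\<And>t. t \<in> {0..1} \<Longrightarrow> \<bar>g t\<bar> \<le> M) \<Longrightarrow> s \<in> {0..1} \<Longrightarrow> \<bar>rprj k z g s\<bar> \<le> cpi k * M"
    by blast+
qed


section \<open>Radau projections on an arbitrary interval\<close>

definition prj :: "nat \<Rightarrow> real \<Rightarrow> real \<Rightarrow> real \<Rightarrow> (real \<Rightarrow> real) \<Rightarrow> real \<Rightarrow> real" where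
  "prj k z a b f x = rprj k z (\<lambda>t. f (a + (b - a) * t)) ((x - a) / (b - a))"

lemma affine_in_Icc: "a \<le> b \<Longrightarrow> t \<in> {0..1} \<Longrightarrow> a + (b - a) * t \<in> {a..b::real}"
  using mult_left_le[of t "b - a"] mult_nonneg_nonneg[of "b - a" t] by auto

lemma continuous_on_affine_Icc:
  fixes f :: "real \<Rightarrow> real"
  shows "a \<le> b \<Longrightarrow> continuous_on {a..b} f \<Longrightarrow> continuous_on {0..1} (\<lambda>t. f (a + (b - a) * t))"
  by (erule continuous_on_compose2) (auto intro!: continuous_intros dest: affine_in_Icc simp del: atLeastAtMost_iff)

lemma scaled_in_unit: "a < b \<Longrightarrow> x \<in> {a..b} \<Longrightarrow> (x - a) / (b - a) \<in> {0..1::real}"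
  by (auto simp: field_simps)

lemma integral_affine_unit:
  fixes f :: "real \<Rightarrow> real"
  assumes "a < b" "continuous_on {a..b} f"
  shows "integral {a..b} f = (b - a) * integral {0..1} (\<lambda>t. f (a + (b - a) * t))"
proof -
  have "(f has_integral integral {a..b} f) (cbox a b)"
    using assms by (simp add: integrable_continuous_interval integrable_integral)
  from has_integral_affinity'[OF this, of "b - a" a] assms(1)
  have "((\<lambda>x. f ((b - a) * x + a)) has_integral integral {a..b} f / (b - a)) {0..1}"
    by (simp add: divide_simps)
  then show ?thesis using assms(1) by (simp add: integral_unique add.commute)
qed

text \<open>In \<open>prj\<close> the parameter \<open>z\<close> stays in reference coordinates: 0
  marks the left and 1 the right endpoint. Exactness on the right suits the left traces in the flux
  of \<open>u\<close>, exactness on the left the right traces in the flux of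
  \<open>p\<close>.\<close>

lemma prj_endpoint:
  assumes "a < b" "continuous_on {a..b} f"
  shows "prj k 0 a b f a = f a" "prj k 1 a b f b = f b"
  using rprj_endpoint[OF continuous_on_affine_Icc[of a b f]] assms by (auto simp: prj_def)

definition affine_poly :: "real \<Rightarrow> real \<Rightarrow> real poly" where
  "affine_poly a b = [:- a / (b - a), 1 / (b - a):]"

definition ppoly :: "nat \<Rightarrow> real \<Rightarrow> real \<Rightarrow> real \<Rightarrow> (real \<Rightarrow> real) \<Rightarrow> real poly" where
  "ppoly k z a b f = pcompose (rpoly k z (\<lambda>t. f (a + (b - a) * t))) (affine_poly a b)"

lemma poly_affine_poly: "poly (affine_poly a b) x = (x - a) / (b - a)"
  by (simp add: affine_poly_def diff_divide_distrib)

lemma prj_poly: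
  assumes "a < b" "continuous_on {a..b} f"
  shows "prj k z a b f x = poly (ppoly k z a b f) x"
  using rprj_poly[OF continuous_on_affine_Icc[of a b f]] assms
  by (simp add: prj_def ppoly_def poly_pcompose poly_affine_poly)

lemma degree_ppoly: "degree (ppoly k z a b f) \<le> k"
proof -
  have "degree (ppoly k z a b f) \<le> degree (rpoly k z (\<lambda>t. f (a + (b - a) * t))) * degree (affine_poly a b)"
    unfolding ppoly_def by (rule degree_pcompose_le)
  also have "\<dots> \<le> k * 1" by (intro mult_mono degree_rpoly) (auto simp: affine_poly_def)
  finally show ?thesis by simp
qed

lemma prj_orthogonal:
  assumes ab: "a < b" and f: "continuous_on {a..b} f" and r: "degree r < k"
  shows "integral {a..b} (\<lambda>x. (f x - prj k z a b f x) * poly r x) = 0"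
proof -
  define r' where "r' = pcompose r [:a, b - a:]"
  have "degree r' \<le> degree r * degree [:a, b - a:]" unfolding r'_def by (rule degree_pcompose_le)
  also have "\<dots> \<le> degree r * 1" by (intro mult_mono) auto
  finally have d: "degree r' < k" using r by simp
  have c: "continuous_on {a..b} (\<lambda>x. (f x - prj k z a b f x) * poly r x)"
    unfolding prj_poly[OF ab f] by (intro continuous_intros f)
  have "integral {a..b} (\<lambda>x. (f x - prj k z a b f x) * poly r x)
    = (b - a) * integral {0..1} (\<lambda>t. (f (a + (b - a) * t) - rprj k z (\<lambda>t. f (a + (b - a) * t)) t) * poly r' t)"
    by (subst integral_affine_unit[OF ab c]) (use ab in \<open>simp add: prj_def r'_def poly_pcompose mult.commute\<close>)
  then show ?thesis using rprj_orthogonal[OF continuous_on_affine_Icc[OF less_imp_le[OF ab] f] d] by simp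
qed

lemma prj_cong: "a < b \<Longrightarrow> (\<And>t. a \<le> t \<Longrightarrow> t \<le> b \<Longrightarrow> f t = g t) \<Longrightarrow> z = 0 \<or> z = 1 \<Longrightarrow> prj k z a b f s = prj k z a b g s"
  unfolding prj_def using affine_in_Icc[of a b] by (intro rprj_cong) auto

lemma prj_diff:
  assumes "a < b" "continuous_on {a..b} f" "continuous_on {a..b} g"
  shows "prj k z a b (\<lambda>t. f t - g t) s = prj k z a b f s - prj k z a b g s"
  unfolding prj_def using assms by (intro rprj_diff continuous_on_affine_Icc) auto

lemma prj_add:
  assumes "a < b" "continuous_on {a..b} f" "continuous_on {a..b} g"
  shows "prj k z a b (\<lambda>t. f t + g t) s = prj k z a b f s + prj k z a b g s"
  unfolding prj_def using assms by (intro rprj_add continuous_on_affine_Icc) auto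

lemma prj_cmult: "prj k z a b (\<lambda>t. c * f t) s = c * prj k z a b f s"
  unfolding prj_def by (rule rprj_cmult)

lemma prj_zero: "prj k z a b (\<lambda>t. 0) s = 0"
  using prj_cmult[of k z a b 0 "\<lambda>_. 0"] by simp

lemma prj_bound:
  assumes "a < b" "continuous_on {a..b} f" "\<And>t. t \<in> {a..b} \<Longrightarrow> \<bar>f t\<bar> \<le> M" "z = 0 \<or> z = 1" "x \<in> {a..b}"
  shows "\<bar>prj k z a b f x\<bar> \<le> cpi k * M"
  unfolding prj_def using assms affine_in_Icc[of a b]
  by (intro rprj_bound continuous_on_affine_Icc scaled_in_unit) auto

lemma prj_reproduces:
  assumes "a < b" "degree p \<le> k" "z = 0 \<or> z = 1"
  shows "prj k z a b (poly p) x = poly p x"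
proof -
  define r' where "r' = pcompose p [:a, b - a:]"
  have "degree r' \<le> degree p * degree [:a, b - a:]" unfolding r'_def by (rule degree_pcompose_le)
  also have "\<dots> \<le> degree p * 1" by (intro mult_mono) auto
  finally have d: "degree r' \<le> k" using assms by simp
  have "prj k z a b (poly p) x = rprj k z (poly r') ((x - a) / (b - a))"
    unfolding prj_def r'_def by (rule arg_cong2[of _ _ _ _ "rprj k z"]) (auto simp: poly_pcompose mult.commute fun_eq_iff)
  also have "\<dots> = poly r' ((x - a) / (b - a))" by (rule rprj_reproduces[OF d assms(3)])
  also have "\<dots> = poly p (a + (b - a) * ((x - a) / (b - a)))" by (simp add: r'_def poly_pcompose mult.commute)
  also have "a + (b - a) * ((x - a) / (b - a)) = x" using assms(1) by simp
  finally show ?thesis .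
qed

text \<open>The Taylor polynomial at \<open>a\<close> is reproduced, so only the remainder is
  projected, and stability bounds it. The factor 2 covers the remainder and its projection, using
  \<open>cpi k \<ge> 1\<close>.\<close>

lemma prj_approx:
  assumes ab: "a < b" and z: "z = 0 \<or> z = 1"
    and f: "\<And>i x. x \<in> {a..b} \<Longrightarrow> i \<le> k \<Longrightarrow> (f i has_real_derivative f (Suc i) x) (at x within {a..b})"
    and M: "\<And>x. x \<in> {a..b} \<Longrightarrow> \<bar>f (Suc k) x\<bar> \<le> M" and x: "x \<in> {a..b}"
  shows "\<bar>f 0 x - prj k z a b (f 0) x\<bar> \<le> 2 * cpi k * (b - a) ^ Suc k * M"
proof -
  define p where "p = (\<Sum>i\<le>k. smult (f i a / fact i) (pcompose (monom 1 i) [:-a, 1:]))"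
  have p: "poly p t = (\<Sum>i\<le>k. f i a * (t - a) ^ i / fact i)" for t
    by (simp add: p_def poly_sum poly_pcompose poly_monom)
  have dp: "degree p \<le> k" unfolding p_def
  proof (intro degree_sum_le)
    fix i assume "i \<in> {..k}"
    have "degree (pcompose (monom (1::real) i) [:-a, 1:]) \<le> degree (monom (1::real) i) * 1" using degree_pcompose_le[of "monom (1::real) i" "[:-a,1:]"] by simp
    also have "\<dots> \<le> k" using \<open>i \<in> {..k}\<close> degree_monom_le[of "1::real" i] by simp
    finally show "degree (smult (f i a / fact i) (pcompose (monom 1 i) [:-a, 1:])) \<le> k" using degree_smult_le order.trans by blast
  qed simp
  have M0: "M \<ge> 0" using M[of a] ab by force
  have taylor: "\<bar>f 0 t - poly p t\<bar> \<le> (b - a) ^ Suc k * M" if t: "t \<in> {a..b}" for t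
  proof -
    have "norm (f 0 t - (\<Sum>i\<le>k. f i a * (t - a) ^ i / fact i)) \<le> M * norm (t - a) ^ Suc k / fact k"
      using field_Taylor[of "{a..b}" k f M a t] f M t ab by auto
    also have "\<dots> \<le> M * norm (t - a) ^ Suc k / 1" using M0 by (intro divide_left_mono) auto
    also have "\<dots> \<le> M * (b - a) ^ Suc k / 1" using t M0 by (intro divide_right_mono mult_left_mono power_mono) auto
    finally show ?thesis unfolding p by (simp add: mult.commute)
  qed
  have cf: "continuous_on {a..b} (f 0)" using f[of _ 0] by (intro DERIV_continuous_on) auto
  have cp: "continuous_on {a..b} (poly p)" by (intro continuous_intros)
  have "\<bar>prj k z a b (\<lambda>t. f 0 t - poly p t) x\<bar> \<le> cpi k * ((b - a) ^ Suc k * M)"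
    using taylor by (intro prj_bound ab z x continuous_intros cf) auto
  moreover have "prj k z a b (\<lambda>t. f 0 t - poly p t) x = prj k z a b (f 0) x - poly p x"
    unfolding prj_diff[OF ab cf cp] prj_reproduces[OF ab dp z] ..
  moreover have "(b - a) ^ Suc k * M \<le> cpi k * ((b - a) ^ Suc k * M)"
    using cpi_ge[of k] M0 ab mult_right_mono[of 1 "cpi k" "(b - a) ^ Suc k * M"] by simp
  ultimately show ?thesis using taylor[OF x] by (simp add: abs_le_iff)
qed

text \<open>In kernel form this is differentiation under the integral sign. It makes the error of
  the \<open>y\<close>-projection differentiable in \<open>x\<close>, with derivative the projection
  error of the \<open>x\<close>-derivative.\<close>

lemma prj_has_derivative:
  assumes U: "convex U" "x0 \<in> U" and ab: "a < b" and z: "z = 0 \<or> z = 1"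
    and F: "\<And>x y. x \<in> U \<Longrightarrow> y \<in> {a..b} \<Longrightarrow> ((\<lambda>x. F x y) has_real_derivative F' x y) (at x within U)"
    and cF: "\<And>x. x \<in> U \<Longrightarrow> continuous_on {a..b} (F x)"
    and cF': "continuous_on (U \<times> {a..b}) (\<lambda>(x, y). F' x y)"
  shows "((\<lambda>x. prj k z a b (F x) y) has_real_derivative prj k z a b (F' x0) y) (at x0 within U)"
proof -
  let ?s = "(y - a) / (b - a)" let ?l = "\<lambda>t. a + (b - a) * t"
  have l: "?l t \<in> {a..b}" if "t \<in> {0..1}" for t using affine_in_Icc[of a b t] ab that by simp
  have "((\<lambda>x. integral (cbox 0 1) (\<lambda>t. rker k z ?s t * F x (?l t))) has_field_derivative integral (cbox 0 1) (\<lambda>t. rker k z ?s t * F' x0 (?l t))) (at x0 within U)"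
  proof (rule leibniz_rule_field_derivative[OF _ _ _ U(2) U(1)])
    show "((\<lambda>x. rker k z ?s t * F x (?l t)) has_field_derivative rker k z ?s t * F' x (?l t)) (at x within U)"
      if "x \<in> U" "t \<in> cbox 0 1" for x t using F[OF that(1) l] that by (intro DERIV_cmult) auto
    show "(\<lambda>t. rker k z ?s t * F x (?l t)) integrable_on cbox 0 1" if "x \<in> U" for x
      using cF[OF that] continuous_on_affine_Icc[of a b "F x"] ab by (intro integrable_continuous continuous_intros) auto
    have "continuous_on (U \<times> cbox 0 1) (\<lambda>p. rker k z ?s (snd p) * (\<lambda>(x, y). F' x y) (fst p, ?l (snd p)))"
      using l by (intro continuous_intros continuous_on_compose2[OF continuous_on_rker] continuous_on_compose2[OF cF']) auto
    then show "continuous_on (U \<times> cbox 0 1) (\<lambda>(x, t). rker k z ?s t * F' x (?l t))" by (simp add: case_prod_beta)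
  qed
  then have 1: "((\<lambda>x. integral {0..1} (\<lambda>t. rker k z ?s t * F x (?l t))) has_real_derivative integral {0..1} (\<lambda>t. rker k z ?s t * F' x0 (?l t))) (at x0 within U)"
    by simp
  have "z \<in> {0..1}" using z by auto
  have 2: "((\<lambda>x. rpt k z ?s * F x (?l z)) has_real_derivative rpt k z ?s * F' x0 (?l z)) (at x0 within U)"
    using F[OF U(2) l[OF \<open>z \<in> {0..1}\<close>]] by (intro DERIV_cmult) auto
  show ?thesis using DERIV_add[OF 1 2] unfolding prj_def rprj_def .
qed

lemma prj_continuous_param:
  assumes ab: "a < b" and z: "z = 0 \<or> z = 1"
    and cF: "continuous_on (U \<times> {a..b}) (\<lambda>(x, y). F x y)"
  shows "continuous_on U (\<lambda>x. prj k z a b (F x) y)"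
proof -
  let ?s = "(y - a) / (b - a)" let ?l = "\<lambda>t. a + (b - a) * t"
  have l: "?l t \<in> {a..b}" if "t \<in> {0..1}" for t using affine_in_Icc[of a b t] ab that by simp
  have "continuous_on (U \<times> cbox 0 1) (\<lambda>p. rker k z ?s (snd p) * (\<lambda>(x, y). F x y) (fst p, ?l (snd p)))"
    using l by (intro continuous_intros continuous_on_compose2[OF continuous_on_rker] continuous_on_compose2[OF cF]) auto
  then have "continuous_on U (\<lambda>x. integral (cbox 0 1) (\<lambda>t. rker k z ?s t * F x (?l t)))"
    by (intro integral_continuous_on_param) (simp add: case_prod_beta)
  moreover have "continuous_on U (\<lambda>x. (\<lambda>(x, y). F x y) (x, ?l z))"
    using l[of z] z by (intro continuous_on_compose2[OF cF] continuous_intros) auto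
  ultimately show ?thesis unfolding prj_def rprj_def by (intro continuous_intros) auto
qed

lemma integral_swap_rect:
  fixes F :: "real \<Rightarrow> real \<Rightarrow> real"
  assumes "continuous_on ({a..b} \<times> {c..d}) (\<lambda>(x, y). F x y)"
  shows "integral {a..b} (\<lambda>x. integral {c..d} (F x)) = integral {c..d} (\<lambda>y. integral {a..b} (\<lambda>x. F x y))"
  using integral_swap_continuous[of a c b d F] assms by (simp add: cbox_Pair_eq)

text \<open>Expanding both projections leaves a double integral against the two kernels, to which
  Fubini applies. This symmetry lets rows and columns of the mesh share one interpolant of
  \<open>u\<close>.\<close>

lemma rprj_commute:
  assumes z: "z = 0 \<or> z = 1" "z' = 0 \<or> z' = 1" and F: "continuous_on ({0..1} \<times> {0..1}) (\<lambda>(x, y). F x y)"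
  shows "rprj k z (\<lambda>s. rprj k z' (\<lambda>t. F s t) y) x = rprj k z' (\<lambda>t. rprj k z (\<lambda>s. F s t) x) y"
proof -
  have z01: "z \<in> {0..1}" "z' \<in> {0..1}" using z by auto
  have c1: "continuous_on {0..1} (\<lambda>s. F s t)" if "t \<in> {0..1}" for t
    using that by (intro continuous_on_compose2[OF F, of _ "\<lambda>s. (s, t)", simplified] continuous_intros) auto
  have c2: "continuous_on {0..1} (\<lambda>t. F s t)" if "s \<in> {0..1}" for s
    using that by (intro continuous_on_compose2[OF F, of _ "\<lambda>t. (s, t)", simplified] continuous_intros) auto
  have ck: "continuous_on A (\<lambda>x. rker k z y (f x))" if "continuous_on A f" for A and f :: "real \<times> real \<Rightarrow> real" and z y
    by (intro continuous_on_compose2[OF continuous_on_rker that]) auto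
  have "continuous_on ({0..1} \<times> {0..1}) (\<lambda>p. rker k z x (fst p) * (rker k z' y (snd p) * (\<lambda>(x, y). F x y) p))"
    by (intro continuous_intros F ck)
  then have sw: "integral {0..1} (\<lambda>s. integral {0..1} (\<lambda>t. rker k z x s * (rker k z' y t * F s t)))
     = integral {0..1} (\<lambda>t. integral {0..1} (\<lambda>s. rker k z x s * (rker k z' y t * F s t)))"
    by (intro integral_swap_rect) (simp add: case_prod_beta)
  have "continuous_on ({0..1} \<times> {0..1}) (\<lambda>p. rker k z' y (snd p) * (\<lambda>(x, y). F x y) p)"
    by (intro continuous_intros ck F)
  then have ci1: "continuous_on {0..1} (\<lambda>s. integral {0..1} (\<lambda>t. rker k z' y t * F s t))"
    using integral_continuous_on_param[of "{0..1}" 0 1 "\<lambda>s t. rker k z' y t * F s t"]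
    by (simp add: case_prod_beta)
  have "continuous_on ({0..1} \<times> {0..1}) (\<lambda>p. rker k z x (snd p) * (\<lambda>(x, y). F x y) (snd p, fst p))"
    by (intro continuous_intros ck continuous_on_compose2[OF F]) auto
  then have ci2: "continuous_on {0..1} (\<lambda>t. integral {0..1} (\<lambda>s. rker k z x s * F s t))"
    using integral_continuous_on_param[of "{0..1}" 0 1 "\<lambda>t s. rker k z x s * F s t"]
    by (simp add: case_prod_beta)
  have L: "integral {0..1} (\<lambda>s. rker k z x s * (integral {0..1} (\<lambda>t. rker k z' y t * F s t) + rpt k z' y * F s z'))
     = integral {0..1} (\<lambda>s. integral {0..1} (\<lambda>t. rker k z x s * (rker k z' y t * F s t))) + rpt k z' y * integral {0..1} (\<lambda>s. rker k z x s * F s z')"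
  proof -
    have "integral {0..1} (\<lambda>s. rker k z x s * (integral {0..1} (\<lambda>t. rker k z' y t * F s t) + rpt k z' y * F s z'))
       = integral {0..1} (\<lambda>s. rker k z x s * integral {0..1} (\<lambda>t. rker k z' y t * F s t) + rpt k z' y * (rker k z x s * F s z'))"
      by (simp add: algebra_simps)
    also have "\<dots> = integral {0..1} (\<lambda>s. rker k z x s * integral {0..1} (\<lambda>t. rker k z' y t * F s t)) + integral {0..1} (\<lambda>s. rpt k z' y * (rker k z x s * F s z'))"
      by (intro integral_add integrable_continuous_interval continuous_intros ci1 c1 z01)
    finally show ?thesis by simp
  qed
  have R: "integral {0..1} (\<lambda>t. rker k z' y t * (integral {0..1} (\<lambda>s. rker k z x s * F s t) + rpt k z x * F z t))
     = integral {0..1} (\<lambda>t. integral {0..1} (\<lambda>s. rker k z x s * (rker k z' y t * F s t))) + rpt k z x * integral {0..1} (\<lambda>t. rker k z' y t * F z t)"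
  proof -
    have "integral {0..1} (\<lambda>t. rker k z' y t * (integral {0..1} (\<lambda>s. rker k z x s * F s t) + rpt k z x * F z t))
       = integral {0..1} (\<lambda>t. rker k z' y t * integral {0..1} (\<lambda>s. rker k z x s * F s t) + rpt k z x * (rker k z' y t * F z t))"
      by (simp add: algebra_simps)
    also have "\<dots> = integral {0..1} (\<lambda>t. rker k z' y t * integral {0..1} (\<lambda>s. rker k z x s * F s t)) + integral {0..1} (\<lambda>t. rpt k z x * (rker k z' y t * F z t))"
      by (intro integral_add integrable_continuous_interval continuous_intros ci2 c2 z01)
    also have "integral {0..1} (\<lambda>t. rker k z' y t * integral {0..1} (\<lambda>s. rker k z x s * F s t)) = integral {0..1} (\<lambda>t. integral {0..1} (\<lambda>s. rker k z x s * (rker k z' y t * F s t)))"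
      by (simp add: integral_mult_right[symmetric] algebra_simps del: integral_mult_right)
    finally show ?thesis by simp
  qed
  show ?thesis unfolding rprj_def L R sw by (simp add: algebra_simps)
qed

lemma prj_commute:
  assumes ab: "a < b" "c < d" and z: "z = 0 \<or> z = 1" "z' = 0 \<or> z' = 1" and F: "continuous_on ({a..b} \<times> {c..d}) (\<lambda>(x, y). F x y)"
  shows "prj k z a b (\<lambda>s. prj k z' c d (\<lambda>t. F s t) y) x = prj k z' c d (\<lambda>t. prj k z a b (\<lambda>s. F s t) x) y"
  unfolding prj_def
proof (rule rprj_commute[OF z])
  have "continuous_on ({0..1} \<times> {0..1}) (\<lambda>p. (\<lambda>(x, y). F x y) (a + (b - a) * fst p, c + (d - c) * snd p))"
    using affine_in_Icc[of a b] affine_in_Icc[of c d] ab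
    by (intro continuous_intros continuous_on_compose2[OF F]) auto
  then show "continuous_on ({0..1} \<times> {0..1}) (\<lambda>(x, y). F (a + (b - a) * x) (c + (d - c) * y))" by (simp add: case_prod_beta)
qed

lemma parseval_legp:
  assumes "degree p \<le> k"
  shows "integral {0..1} (\<lambda>t. (poly p t)\<^sup>2) = (\<Sum>m\<le>k. (mom m (poly p))\<^sup>2)"
proof -
  have "integral {0..1} (\<lambda>t. (poly p t)\<^sup>2) = integral {0..1} (\<lambda>t. \<Sum>m\<le>k. mom m (poly p) * (poly (legp m) t * poly p t))"
  proof (rule integral_cong)
    fix t :: real
    have "(poly p t)\<^sup>2 = (\<Sum>m\<le>k. mom m (poly p) * poly (legp m) t) * poly p t"
      by (simp add: expansion_legp[OF assms, of t, symmetric] power2_eq_square)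
    then show "(poly p t)\<^sup>2 = (\<Sum>m\<le>k. mom m (poly p) * (poly (legp m) t * poly p t))"
      by (simp add: sum_distrib_right mult.assoc)
  qed
  also have "\<dots> = (\<Sum>m\<le>k. mom m (poly p) * mom m (poly p))" unfolding mom_def integral_mult_right[symmetric]
    by (intro integral_sum integrable_continuous_interval continuous_intros) auto
  finally show ?thesis by (simp add: power2_eq_square)
qed

subsection \<open>The one-dimensional bilinear form\<close>

lemma pderiv_sum: "pderiv (\<Sum>i\<in>I. f i) = (\<Sum>i\<in>I. pderiv (f i))"
  by (induction I rule: infinite_finite_induct) (auto simp: pderiv_add)

text \<open>In the orthonormal expansion a point value of \<open>p\<close> or of its derivative is
  an inner product of coefficient vectors. Cauchy--Schwarz and Parseval then give a constant that
  depends on \<open>k\<close> only.\<close>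

lemma ex_unit_inverse:
  "\<exists>C\<ge>1. \<forall>p::real poly. degree p \<le> k \<longrightarrow> (\<forall>s\<in>{0..1}. (poly p s)\<^sup>2 \<le> C * integral {0..1} (\<lambda>t. (poly p t)\<^sup>2)
     \<and> (poly (pderiv p) s)\<^sup>2 \<le> C * integral {0..1} (\<lambda>t. (poly p t)\<^sup>2))"
proof -
  have "\<forall>n. \<exists>B. B \<ge> 0 \<and> (\<forall>s\<in>{0..1}. \<bar>poly (legp n) s\<bar> \<le> B)" using poly_bounded_unit by blast
  from choice[OF this] obtain B where B: "\<And>n. B n \<ge> 0" "\<And>n s. s \<in> {0..1} \<Longrightarrow> \<bar>poly (legp n) s\<bar> \<le> B n" by blast
  have "\<forall>n. \<exists>B. B \<ge> 0 \<and> (\<forall>s\<in>{0..1}. \<bar>poly (pderiv (legp n)) s\<bar> \<le> B)" using poly_bounded_unit by blast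
  from choice[OF this] obtain D where D: "\<And>n. D n \<ge> 0" "\<And>n s. s \<in> {0..1} \<Longrightarrow> \<bar>poly (pderiv (legp n)) s\<bar> \<le> D n" by blast
  define C where "C = 1 + (\<Sum>m\<le>k. (B m)\<^sup>2) + (\<Sum>m\<le>k. (D m)\<^sup>2)"
  have s0: "0 \<le> (\<Sum>m\<le>k. (B m)\<^sup>2)" "0 \<le> (\<Sum>m\<le>k. (D m)\<^sup>2)" by (auto intro: sum_nonneg)
  have bnd: "(\<Sum>m\<le>k. mom m (poly p) * f m)\<^sup>2 \<le> C * integral {0..1} (\<lambda>t. (poly p t)\<^sup>2)"
    if p: "degree p \<le> k" and f: "\<And>m. \<bar>f m\<bar> \<le> F m" and F: "F = B \<or> F = D" for p f F
  proof -
    have "(\<Sum>m\<le>k. mom m (poly p) * f m)\<^sup>2 \<le> (\<Sum>m\<le>k. (mom m (poly p))\<^sup>2) * (\<Sum>m\<le>k. (f m)\<^sup>2)"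
      by (rule Cauchy_Schwarz_ineq_sum)
    also have "(\<Sum>m\<le>k. (f m)\<^sup>2) \<le> (\<Sum>m\<le>k. (F m)\<^sup>2)" using f by (intro sum_mono) (simp add: abs_le_square_iff[symmetric] order.trans[OF _ abs_ge_self])
    then have "(\<Sum>m\<le>k. (mom m (poly p))\<^sup>2) * (\<Sum>m\<le>k. (f m)\<^sup>2) \<le> (\<Sum>m\<le>k. (mom m (poly p))\<^sup>2) * C"
      using F s0 by (intro mult_left_mono) (auto simp: C_def intro!: sum_nonneg)
    finally show ?thesis by (simp add: parseval_legp[OF p] mult.commute)
  qed
  have "(poly p s)\<^sup>2 \<le> C * integral {0..1} (\<lambda>t. (poly p t)\<^sup>2) \<and> (poly (pderiv p) s)\<^sup>2 \<le> C * integral {0..1} (\<lambda>t. (poly p t)\<^sup>2)"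
    if p: "degree p \<le> k" and s: "s \<in> {0..1}" for p s
  proof
    show "(poly p s)\<^sup>2 \<le> C * integral {0..1} (\<lambda>t. (poly p t)\<^sup>2)"
      using bnd[OF p B(2)[OF s]] expansion_legp[OF p, of s] by simp
    have "poly p = poly (\<Sum>m\<le>k. smult (mom m (poly p)) (legp m))"
      using expansion_legp[OF p] by (auto simp: poly_sum)
    then have "p = (\<Sum>m\<le>k. smult (mom m (poly p)) (legp m))" by (simp only: poly_eq_poly_eq_iff)
    from arg_cong[OF this, of pderiv] have "pderiv p = (\<Sum>m\<le>k. smult (mom m (poly p)) (pderiv (legp m)))"
      unfolding pderiv_sum pderiv_smult .
    then have "poly (pderiv p) s = (\<Sum>m\<le>k. mom m (poly p) * poly (pderiv (legp m)) s)" by (simp add: poly_sum)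
    then show "(poly (pderiv p) s)\<^sup>2 \<le> C * integral {0..1} (\<lambda>t. (poly p t)\<^sup>2)"
      using bnd[OF p D(2)[OF s]] by simp
  qed
  moreover have "C \<ge> 1" using s0 by (simp add: C_def)
  ultimately show ?thesis by blast
qed

definition cinv :: "nat \<Rightarrow> real" where
  "cinv k = (SOME C. C \<ge> 1 \<and> (\<forall>p::real poly. degree p \<le> k \<longrightarrow> (\<forall>s\<in>{0..1}. (poly p s)\<^sup>2 \<le> C * integral {0..1} (\<lambda>t. (poly p t)\<^sup>2)
     \<and> (poly (pderiv p) s)\<^sup>2 \<le> C * integral {0..1} (\<lambda>t. (poly p t)\<^sup>2))))"

lemma cinv_ge: "cinv k \<ge> 1"
  and unit_inverse: "degree (p::real poly) \<le> k \<Longrightarrow> s \<in> {0..1} \<Longrightarrow> (poly p s)\<^sup>2 \<le> cinv k * integral {0..1} (\<lambda>t. (poly p t)\<^sup>2)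
     \<and> (poly (pderiv p) s)\<^sup>2 \<le> cinv k * integral {0..1} (\<lambda>t. (poly p t)\<^sup>2)"
proof -
  have "cinv k \<ge> 1 \<and> (\<forall>p::real poly. degree p \<le> k \<longrightarrow> (\<forall>s\<in>{0..1}. (poly p s)\<^sup>2 \<le> cinv k * integral {0..1} (\<lambda>t. (poly p t)\<^sup>2)
     \<and> (poly (pderiv p) s)\<^sup>2 \<le> cinv k * integral {0..1} (\<lambda>t. (poly p t)\<^sup>2)))"
    unfolding cinv_def by (rule someI_ex) (use ex_unit_inverse in blast)
  then show "cinv k \<ge> 1" and "degree (p::real poly) \<le> k \<Longrightarrow> s \<in> {0..1} \<Longrightarrow> (poly p s)\<^sup>2 \<le> cinv k * integral {0..1} (\<lambda>t. (poly p t)\<^sup>2)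
     \<and> (poly (pderiv p) s)\<^sup>2 \<le> cinv k * integral {0..1} (\<lambda>t. (poly p t)\<^sup>2)" by blast+
qed

text \<open>Scaling to the unit interval produces the powers of the width. The bounds are applied on
  coarse cells only, where the width is comparable to \<open>1 / N\<close>.\<close>

lemma inverse_inequalities:
  assumes ab: "a < b" and p: "degree p \<le> k" and x: "x \<in> {a..b}"
  shows "(poly p x)\<^sup>2 \<le> cinv k / (b - a) * integral {a..b} (\<lambda>t. (poly p t)\<^sup>2)"
    and "(poly (pderiv p) x)\<^sup>2 \<le> cinv k / (b - a) ^ 3 * integral {a..b} (\<lambda>t. (poly p t)\<^sup>2)"
proof -
  define r where "r = pcompose p [:a, b - a:]"
  define s where "s = (x - a) / (b - a)"
  have "degree r \<le> degree p * degree [:a, b - a:]" unfolding r_def by (rule degree_pcompose_le)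
  also have "\<dots> \<le> degree p * 1" by (intro mult_mono) auto
  finally have d: "degree r \<le> k" using p by simp
  have s: "s \<in> {0..1}" unfolding s_def by (rule scaled_in_unit[OF ab x])
  have xs: "a + s * (b - a) = x" using ab by (simp add: s_def)
  have rs: "poly r s = poly p x" by (simp add: r_def poly_pcompose xs)
  have r's: "poly (pderiv r) s = (b - a) * poly (pderiv p) x"
    by (simp add: r_def pderiv_pcompose poly_pcompose xs pderiv_pCons)
  have "integral {a..b} (\<lambda>t. (poly p t)\<^sup>2) = (b - a) * integral {0..1} (\<lambda>t. (poly p (a + (b - a) * t))\<^sup>2)"
    by (rule integral_affine_unit[OF ab]) (intro continuous_intros)
  then have I: "integral {0..1} (\<lambda>t. (poly r t)\<^sup>2) = integral {a..b} (\<lambda>t. (poly p t)\<^sup>2) / (b - a)"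
    using ab by (simp add: r_def poly_pcompose mult.commute)
  show "(poly p x)\<^sup>2 \<le> cinv k / (b - a) * integral {a..b} (\<lambda>t. (poly p t)\<^sup>2)"
    using unit_inverse[OF d s] unfolding rs I by simp
  have "((b - a) * poly (pderiv p) x)\<^sup>2 \<le> cinv k * (integral {a..b} (\<lambda>t. (poly p t)\<^sup>2) / (b - a))"
    using unit_inverse[OF d s] unfolding r's I by simp
  then have "(poly (pderiv p) x)\<^sup>2 \<le> cinv k * (integral {a..b} (\<lambda>t. (poly p t)\<^sup>2) / (b - a)) / (b - a)\<^sup>2"
    using ab by (simp add: pos_le_divide_eq power_mult_distrib mult_ac)
  also have "\<dots> = cinv k / (b - a) ^ 3 * integral {a..b} (\<lambda>t. (poly p t)\<^sup>2)"
    by (simp add: power2_eq_square power3_eq_cube field_simps)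
  finally show "(poly (pderiv p) x)\<^sup>2 \<le> cinv k / (b - a) ^ 3 * integral {a..b} (\<lambda>t. (poly p t)\<^sup>2)" .
qed

section \<open>Young inequality and summation by nodes\<close>

lemma young: "0 < c \<Longrightarrow> \<bar>a * b\<bar> \<le> c * a\<^sup>2 + b\<^sup>2 / (4 * c)" for a b c :: real
proof -
  assume c: "0 < c"
  have "0 \<le> (2 * c * \<bar>a\<bar> - \<bar>b\<bar>)\<^sup>2 / (4 * c)" using c by simp
  also have "\<dots> = c * a\<^sup>2 + b\<^sup>2 / (4 * c) - \<bar>a * b\<bar>"
    using c by (simp add: power2_diff field_simps power2_eq_square abs_mult)
  finally show ?thesis by simp
qed

lemma young_integral:
  fixes f g :: "real \<Rightarrow> real"
  assumes c: "0 < c" and f: "continuous_on {a..b} f" and g: "continuous_on {a..b} g"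
  shows "\<bar>integral {a..b} (\<lambda>x. f x * g x)\<bar> \<le> c * integral {a..b} (\<lambda>x. (f x)\<^sup>2) + integral {a..b} (\<lambda>x. (g x)\<^sup>2) / (4 * c)"
proof -
  have "norm (integral {a..b} (\<lambda>x. f x * g x)) \<le> integral {a..b} (\<lambda>x. c * (f x)\<^sup>2 + (g x)\<^sup>2 / (4 * c))"
    using young[OF c] c
    by (intro integral_norm_bound_integral integrable_continuous_interval continuous_intros f g) auto
  also have "\<dots> = integral {a..b} (\<lambda>x. c * (f x)\<^sup>2) + integral {a..b} (\<lambda>x. (g x)\<^sup>2 / (4 * c))"
    using c by (intro integral_add integrable_continuous_interval continuous_intros f g) auto
  finally show ?thesis by simp
qed

text \<open>With \<open>a i\<close> the contribution at the right end of cell \<open>i\<close> and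
  \<open>b (i - 1)\<close> the one at its left end, a sum over cells is regrouped as a sum over
  nodes, where neighbouring traces can cancel.\<close>

lemma edge_sum:
  fixes a b :: "nat \<Rightarrow> real"
  assumes "1 \<le> N"
  shows "(\<Sum>i=1..N. a i + b (i - 1)) = b 0 + a N + (\<Sum>i\<in>{1..<N}. a i + b i)"
  using assms
proof (induction N rule: nat_induct_at_least)
  case base
  then show ?case by simp
next
  case (Suc n)
  then show ?case by (simp add: sum.atLeastLessThan_Suc algebra_simps)
qed


text \<open>In \<open>u i x\<close> and \<open>p i x\<close> the index \<open>i\<close> is the cell from which the value at \<open>x\<close> is taken, so that
  \<open>u i (X i)\<close> and \<open>u (Suc i) (X i)\<close> are the left and right traces at the node \<open>X i\<close>; \<open>m\<close> is the node of the
  penalised flux.\<close>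

definition uflux :: "nat \<Rightarrow> nat \<Rightarrow> real \<Rightarrow> (nat \<Rightarrow> real) \<Rightarrow> (nat \<Rightarrow> real \<Rightarrow> real) \<Rightarrow> (nat \<Rightarrow> real \<Rightarrow> real) \<Rightarrow> nat \<Rightarrow> real" where
  "uflux N m lt X u p i = (if i = 0 \<or> i = N then 0
     else if i = m then u i (X i) + lt * (p (Suc i) (X i) - p i (X i)) else u i (X i))"

definition pflux :: "nat \<Rightarrow> real \<Rightarrow> (nat \<Rightarrow> real) \<Rightarrow> (nat \<Rightarrow> real \<Rightarrow> real) \<Rightarrow> (nat \<Rightarrow> real \<Rightarrow> real) \<Rightarrow> nat \<Rightarrow> real" where
  "pflux N lam X u p i = (if i = 0 then p 1 (X 0) + lam * u 1 (X 0)
     else if i = N then p N (X N) - lam * u N (X N) else p (Suc i) (X i))"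

text \<open>For one row of cells at a fixed height this is the part of the scheme acting in
  \<open>x\<close>: the first equation tested with \<open>S\<close> plus the \<open>p\<close>-terms
  of the third tested with \<open>V\<close>. The terms with \<open>1 / \<epsilon>\<close> and the
  reaction term are kept outside.\<close>

definition rowB :: "nat \<Rightarrow> nat \<Rightarrow> real \<Rightarrow> real \<Rightarrow> (nat \<Rightarrow> real) \<Rightarrow> (nat \<Rightarrow> real \<Rightarrow> real) \<Rightarrow> (nat \<Rightarrow> real \<Rightarrow> real)
    \<Rightarrow> (nat \<Rightarrow> real poly) \<Rightarrow> (nat \<Rightarrow> real poly) \<Rightarrow> real" where
  "rowB N m lam lt X u p S V = (\<Sum>i=1..N.
     integral {X (i - 1)..X i} (\<lambda>x. u i x * poly (pderiv (S i)) x + p i x * poly (pderiv (V i)) x)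
     - uflux N m lt X u p i * poly (S i) (X i) + uflux N m lt X u p (i - 1) * poly (S i) (X (i - 1))
     - pflux N lam X u p i * poly (V i) (X i) + pflux N lam X u p (i - 1) * poly (V i) (X (i - 1)))"

text \<open>At interior nodes only the jumps of the test functions remain. \<open>S\<close>
  contributes nothing at the two boundary nodes because the flux of \<open>u\<close> is 0
  there.\<close>

lemma rowB_edges:
  assumes "1 \<le> N"
  shows "rowB N m lam lt X u p S V = (\<Sum>i=1..N. integral {X (i - 1)..X i} (\<lambda>x. u i x * poly (pderiv (S i)) x + p i x * poly (pderiv (V i)) x))
    + pflux N lam X u p 0 * poly (V 1) (X 0) - pflux N lam X u p N * poly (V N) (X N)
    + (\<Sum>i\<in>{1..<N}. uflux N m lt X u p i * (poly (S (Suc i)) (X i) - poly (S i) (X i))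
       + pflux N lam X u p i * (poly (V (Suc i)) (X i) - poly (V i) (X i)))"
proof -
  have "rowB N m lam lt X u p S V = (\<Sum>i=1..N. integral {X (i - 1)..X i} (\<lambda>x. u i x * poly (pderiv (S i)) x + p i x * poly (pderiv (V i)) x)
     + ((- uflux N m lt X u p i * poly (S i) (X i) - pflux N lam X u p i * poly (V i) (X i)) +
       (uflux N m lt X u p (i - 1) * poly (S (Suc (i - 1))) (X (i - 1)) + pflux N lam X u p (i - 1) * poly (V (Suc (i - 1))) (X (i - 1)))))"
    unfolding rowB_def by (intro sum.cong) auto
  also have "\<dots> = (\<Sum>i=1..N. integral {X (i - 1)..X i} (\<lambda>x. u i x * poly (pderiv (S i)) x + p i x * poly (pderiv (V i)) x))
     + (\<Sum>i=1..N. (- uflux N m lt X u p i * poly (S i) (X i) - pflux N lam X u p i * poly (V i) (X i)) +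
       (uflux N m lt X u p (i - 1) * poly (S (Suc (i - 1))) (X (i - 1)) + pflux N lam X u p (i - 1) * poly (V (Suc (i - 1))) (X (i - 1))))"
    by (rule sum.distrib)
  also have "(\<Sum>i=1..N. (- uflux N m lt X u p i * poly (S i) (X i) - pflux N lam X u p i * poly (V i) (X i)) +
       (uflux N m lt X u p (i - 1) * poly (S (Suc (i - 1))) (X (i - 1)) + pflux N lam X u p (i - 1) * poly (V (Suc (i - 1))) (X (i - 1))))
     = (uflux N m lt X u p 0 * poly (S 1) (X 0) + pflux N lam X u p 0 * poly (V 1) (X 0)) + (- uflux N m lt X u p N * poly (S N) (X N) - pflux N lam X u p N * poly (V N) (X N))
      + (\<Sum>i\<in>{1..<N}. (- uflux N m lt X u p i * poly (S i) (X i) - pflux N lam X u p i * poly (V i) (X i)) +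
       (uflux N m lt X u p i * poly (S (Suc i)) (X i) + pflux N lam X u p i * poly (V (Suc i)) (X i)))"
    using edge_sum[OF assms, of "\<lambda>i. - uflux N m lt X u p i * poly (S i) (X i) - pflux N lam X u p i * poly (V i) (X i)"
      "\<lambda>i. uflux N m lt X u p i * poly (S (Suc i)) (X i) + pflux N lam X u p i * poly (V (Suc i)) (X i)"] by simp
  finally show ?thesis by (simp add: uflux_def[of _ _ _ _ _ _ 0] uflux_def[of _ _ _ _ _ _ N] sum.distrib sum_subtractf sum_negf algebra_simps)
qed

lemma continuous_on_poly_real [continuous_intros]: "continuous_on S (poly p)" for p :: "real poly"
  by (intro continuous_intros)

lemma rowB_linear:
  assumes c: "\<And>i. i \<in> {1..N} \<Longrightarrow> continuous_on {X (i - 1)..X i} (u i)" "\<And>i. i \<in> {1..N} \<Longrightarrow> continuous_on {X (i - 1)..X i} (p i)"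
    "\<And>i. i \<in> {1..N} \<Longrightarrow> continuous_on {X (i - 1)..X i} (w i)" "\<And>i. i \<in> {1..N} \<Longrightarrow> continuous_on {X (i - 1)..X i} (q i)"
  shows "rowB N m lam lt X (\<lambda>i x. u i x + r * w i x) (\<lambda>i x. p i x + r * q i x) S V
     = rowB N m lam lt X u p S V + r * rowB N m lam lt X w q S V"
proof -
  have uf: "uflux N m lt X (\<lambda>i x. u i x + r * w i x) (\<lambda>i x. p i x + r * q i x) i = uflux N m lt X u p i + r * uflux N m lt X w q i" for i
    by (simp add: uflux_def algebra_simps)
  have pf: "pflux N lam X (\<lambda>i x. u i x + r * w i x) (\<lambda>i x. p i x + r * q i x) i = pflux N lam X u p i + r * pflux N lam X w q i" for i
    by (simp add: pflux_def algebra_simps)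
  have int: "integral {X (i - 1)..X i} (\<lambda>x. (u i x + r * w i x) * poly (pderiv (S i)) x + (p i x + r * q i x) * poly (pderiv (V i)) x)
     = integral {X (i - 1)..X i} (\<lambda>x. u i x * poly (pderiv (S i)) x + p i x * poly (pderiv (V i)) x)
      + r * integral {X (i - 1)..X i} (\<lambda>x. w i x * poly (pderiv (S i)) x + q i x * poly (pderiv (V i)) x)" if "i \<in> {1..N}" for i
  proof -
    have "integral {X (i - 1)..X i} (\<lambda>x. (u i x + r * w i x) * poly (pderiv (S i)) x + (p i x + r * q i x) * poly (pderiv (V i)) x)
      = integral {X (i - 1)..X i} (\<lambda>x. (u i x * poly (pderiv (S i)) x + p i x * poly (pderiv (V i)) x)
         + r * (w i x * poly (pderiv (S i)) x + q i x * poly (pderiv (V i)) x))" by (simp add: algebra_simps)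
    also have "\<dots> = integral {X (i - 1)..X i} (\<lambda>x. u i x * poly (pderiv (S i)) x + p i x * poly (pderiv (V i)) x)
      + integral {X (i - 1)..X i} (\<lambda>x. r * (w i x * poly (pderiv (S i)) x + q i x * poly (pderiv (V i)) x))"
      by (intro integral_add integrable_continuous_interval continuous_intros c that)
    finally show ?thesis by simp
  qed
  show ?thesis unfolding rowB_def uf pf sum_distrib_left sum.distrib[symmetric]
    by (intro sum.cong refl) (simp only: int, simp add: algebra_simps)
qed

lemma integral_by_parts_poly:
  fixes f :: "real \<Rightarrow> real"
  assumes "a \<le> b" and f: "\<And>x. x \<in> {a..b} \<Longrightarrow> (f has_real_derivative f' x) (at x within {a..b})" and f': "continuous_on {a..b} f'"
  shows "integral {a..b} (\<lambda>x. f x * poly (pderiv p) x) = f b * poly p b - f a * poly p a - integral {a..b} (\<lambda>x. f' x * poly p x)"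
proof -
  have cf: "continuous_on {a..b} f" using f by (rule DERIV_continuous_on)
  have "((\<lambda>x. f x * poly (pderiv p) x + f' x * poly p x) has_integral f b * poly p b - f a * poly p a) {a..b}"
  proof (rule fundamental_theorem_of_calculus[OF \<open>a \<le> b\<close>])
    fix x assume x: "x \<in> {a..b}"
    have "(poly p has_real_derivative poly (pderiv p) x) (at x within {a..b})"
      by (rule has_field_derivative_at_within[OF poly_DERIV])
    from DERIV_mult[OF f[OF x] this] show "((\<lambda>x. f x * poly p x) has_vector_derivative f x * poly (pderiv p) x + f' x * poly p x) (at x within {a..b})"
      by (simp add: has_real_derivative_iff_has_vector_derivative[symmetric] algebra_simps)
  qed
  then have "integral {a..b} (\<lambda>x. f x * poly (pderiv p) x + f' x * poly p x) = f b * poly p b - f a * poly p a" by (rule integral_unique)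
  moreover have "integral {a..b} (\<lambda>x. f x * poly (pderiv p) x + f' x * poly p x) = integral {a..b} (\<lambda>x. f x * poly (pderiv p) x) + integral {a..b} (\<lambda>x. f' x * poly p x)"
    by (intro integral_add integrable_continuous_interval continuous_intros cf f')
  ultimately show ?thesis by simp
qed

text \<open>The trial pair is the test pair, with \<open>V\<close> in the place of \<open>u\<close>
  and \<open>S\<close> in the place of \<open>p\<close>. The volume terms are the derivative of a
  product, and with alternating fluxes (left value for \<open>u\<close>, right value for
  \<open>p\<close>) the products at interior nodes cancel. The stabilisation terms are all that is
  left.\<close>

lemma rowB_coercive:
  assumes m: "1 \<le> m" "m < N" and X: "\<And>i. i \<in> {1..N} \<Longrightarrow> X (i - 1) < X i"
  shows "rowB N m lam lt X (\<lambda>i. poly (V i)) (\<lambda>i. poly (S i)) S V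
    = lam * ((poly (V 1) (X 0))\<^sup>2 + (poly (V N) (X N))\<^sup>2) + lt * (poly (S (Suc m)) (X m) - poly (S m) (X m))\<^sup>2"
proof -
  let ?u = "\<lambda>i. poly (V i)" let ?p = "\<lambda>i. poly (S i)"
  have N: "1 \<le> N" using m by simp
  have int: "integral {X (i - 1)..X i} (\<lambda>x. poly (V i) x * poly (pderiv (S i)) x + poly (S i) x * poly (pderiv (V i)) x)
      = poly (V i) (X i) * poly (S i) (X i) + (- (poly (V (Suc (i - 1))) (X (i - 1)) * poly (S (Suc (i - 1))) (X (i - 1))))" if "i \<in> {1..N}" for i
  proof (rule integral_unique)
    have "((\<lambda>x. poly (V i) x * poly (pderiv (S i)) x + poly (S i) x * poly (pderiv (V i)) x) has_integral
       poly (V i) (X i) * poly (S i) (X i) - poly (V i) (X (i - 1)) * poly (S i) (X (i - 1))) {X (i - 1)..X i}"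
    proof (rule fundamental_theorem_of_calculus)
      show "X (i - 1) \<le> X i" using X[OF that] by simp
      fix x
      show "((\<lambda>x. poly (V i) x * poly (S i) x) has_vector_derivative poly (V i) x * poly (pderiv (S i)) x + poly (S i) x * poly (pderiv (V i)) x) (at x within {X (i - 1)..X i})"
        unfolding has_real_derivative_iff_has_vector_derivative[symmetric]
        using DERIV_mult[OF has_field_derivative_at_within[OF poly_DERIV] has_field_derivative_at_within[OF poly_DERIV], of "V i" "S i" x "{X (i - 1)..X i}"]
        by (simp add: algebra_simps)
    qed
    then show "((\<lambda>x. poly (V i) x * poly (pderiv (S i)) x + poly (S i) x * poly (pderiv (V i)) x) has_integral
       poly (V i) (X i) * poly (S i) (X i) + (- (poly (V (Suc (i - 1))) (X (i - 1)) * poly (S (Suc (i - 1))) (X (i - 1))))) {X (i - 1)..X i}"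
      using that by simp
  qed
  have "(\<Sum>i=1..N. integral {X (i - 1)..X i} (\<lambda>x. poly (V i) x * poly (pderiv (S i)) x + poly (S i) x * poly (pderiv (V i)) x))
     = (\<Sum>i=1..N. poly (V i) (X i) * poly (S i) (X i) + (- (poly (V (Suc (i - 1))) (X (i - 1)) * poly (S (Suc (i - 1))) (X (i - 1)))))"
    using int by (intro sum.cong) auto
  also have "\<dots> = - (poly (V 1) (X 0) * poly (S 1) (X 0)) + poly (V N) (X N) * poly (S N) (X N)
     + (\<Sum>i\<in>{1..<N}. poly (V i) (X i) * poly (S i) (X i) + (- (poly (V (Suc i)) (X i) * poly (S (Suc i)) (X i))))"
    using edge_sum[OF N, of "\<lambda>i. poly (V i) (X i) * poly (S i) (X i)" "\<lambda>i. - (poly (V (Suc i)) (X i) * poly (S (Suc i)) (X i))"] by simp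
  finally have I: "(\<Sum>i=1..N. integral {X (i - 1)..X i} (\<lambda>x. poly (V i) x * poly (pderiv (S i)) x + poly (S i) x * poly (pderiv (V i)) x))
     = - (poly (V 1) (X 0) * poly (S 1) (X 0)) + poly (V N) (X N) * poly (S N) (X N)
     + (\<Sum>i\<in>{1..<N}. poly (V i) (X i) * poly (S i) (X i) + (- (poly (V (Suc i)) (X i) * poly (S (Suc i)) (X i))))" .
  have "(\<Sum>i\<in>{1..<N}. poly (V i) (X i) * poly (S i) (X i) + (- (poly (V (Suc i)) (X i) * poly (S (Suc i)) (X i))))
     + (\<Sum>i\<in>{1..<N}. uflux N m lt X ?u ?p i * (poly (S (Suc i)) (X i) - poly (S i) (X i))
       + pflux N lam X ?u ?p i * (poly (V (Suc i)) (X i) - poly (V i) (X i)))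
     = (\<Sum>i\<in>{1..<N}. if i = m then lt * (poly (S (Suc m)) (X m) - poly (S m) (X m))\<^sup>2 else 0)"
    unfolding sum.distrib[symmetric]
    by (intro sum.cong) (auto simp: uflux_def pflux_def algebra_simps power2_eq_square)
  also have "\<dots> = lt * (poly (S (Suc m)) (X m) - poly (S m) (X m))\<^sup>2" using m by simp
  finally show ?thesis unfolding rowB_edges[OF N] I using N
    by (simp add: pflux_def algebra_simps power2_eq_square)
qed

text \<open>For functions continuous across the nodes all fluxes equal the common trace, and the
  zero boundary values of \<open>g\<close> match its zero flux. Cellwise integration by parts
  therefore has no edge terms. The derivative moves off the test functions, so that no inverse
  inequality on thin cells arises.\<close>

lemma rowB_smooth:
  assumes m: "1 \<le> m" "m < N" and X: "\<And>i. i \<in> {1..N} \<Longrightarrow> X (i - 1) < X i"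
    and g: "\<And>i x. i \<in> {1..N} \<Longrightarrow> x \<in> {X (i - 1)..X i} \<Longrightarrow> (g i has_real_derivative g' i x) (at x within {X (i - 1)..X i})"
    and g': "\<And>i. i \<in> {1..N} \<Longrightarrow> continuous_on {X (i - 1)..X i} (g' i)"
    and h: "\<And>i x. i \<in> {1..N} \<Longrightarrow> x \<in> {X (i - 1)..X i} \<Longrightarrow> (h i has_real_derivative h' i x) (at x within {X (i - 1)..X i})"
    and h': "\<And>i. i \<in> {1..N} \<Longrightarrow> continuous_on {X (i - 1)..X i} (h' i)"
    and gX: "\<And>i. i \<in> {1..<N} \<Longrightarrow> g i (X i) = g (Suc i) (X i)" "g 1 (X 0) = 0" "g N (X N) = 0"
    and hX: "\<And>i. i \<in> {1..<N} \<Longrightarrow> h i (X i) = h (Suc i) (X i)"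
  shows "rowB N m lam lt X g h S V = - (\<Sum>i=1..N. integral {X (i - 1)..X i} (\<lambda>x. g' i x * poly (S i) x)) - (\<Sum>i=1..N. integral {X (i - 1)..X i} (\<lambda>x. h' i x * poly (V i) x))"
proof -
  have N: "1 \<le> N" using m by simp
  have cg: "continuous_on {X (i - 1)..X i} (g i)" "continuous_on {X (i - 1)..X i} (h i)" if "i \<in> {1..N}" for i
    by (rule DERIV_continuous_on, rule g[OF that], assumption) (rule DERIV_continuous_on, rule h[OF that])
  have int: "integral {X (i - 1)..X i} (\<lambda>x. g i x * poly (pderiv (S i)) x + h i x * poly (pderiv (V i)) x)
     = - integral {X (i - 1)..X i} (\<lambda>x. g' i x * poly (S i) x) - integral {X (i - 1)..X i} (\<lambda>x. h' i x * poly (V i) x)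
     + ((g i (X i) * poly (S i) (X i) + h i (X i) * poly (V i) (X i))
     + (- (g (Suc (i - 1)) (X (i - 1)) * poly (S (Suc (i - 1))) (X (i - 1)) + h (Suc (i - 1)) (X (i - 1)) * poly (V (Suc (i - 1))) (X (i - 1)))))" if i: "i \<in> {1..N}" for i
  proof -
    have "integral {X (i - 1)..X i} (\<lambda>x. g i x * poly (pderiv (S i)) x + h i x * poly (pderiv (V i)) x)
       = integral {X (i - 1)..X i} (\<lambda>x. g i x * poly (pderiv (S i)) x) + integral {X (i - 1)..X i} (\<lambda>x. h i x * poly (pderiv (V i)) x)"
      by (intro integral_add integrable_continuous_interval continuous_intros cg i)
    then show ?thesis
      using integral_by_parts_poly[OF less_imp_le[OF X[OF i]] g[OF i] g'[OF i], of "S i"]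
        integral_by_parts_poly[OF less_imp_le[OF X[OF i]] h[OF i] h'[OF i], of "V i"] i by simp
  qed
  have "(\<Sum>i=1..N. integral {X (i - 1)..X i} (\<lambda>x. g i x * poly (pderiv (S i)) x + h i x * poly (pderiv (V i)) x))
    = - (\<Sum>i=1..N. integral {X (i - 1)..X i} (\<lambda>x. g' i x * poly (S i) x)) - (\<Sum>i=1..N. integral {X (i - 1)..X i} (\<lambda>x. h' i x * poly (V i) x))
     + (\<Sum>i=1..N. (g i (X i) * poly (S i) (X i) + h i (X i) * poly (V i) (X i))
     + (- (g (Suc (i - 1)) (X (i - 1)) * poly (S (Suc (i - 1))) (X (i - 1)) + h (Suc (i - 1)) (X (i - 1)) * poly (V (Suc (i - 1))) (X (i - 1)))))"
    unfolding sum_negf[symmetric] sum_subtractf[symmetric] sum.distrib[symmetric] using int by (intro sum.cong) auto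
  also have "(\<Sum>i=1..N. (g i (X i) * poly (S i) (X i) + h i (X i) * poly (V i) (X i))
     + (- (g (Suc (i - 1)) (X (i - 1)) * poly (S (Suc (i - 1))) (X (i - 1)) + h (Suc (i - 1)) (X (i - 1)) * poly (V (Suc (i - 1))) (X (i - 1)))))
    = - (g 1 (X 0) * poly (S 1) (X 0) + h 1 (X 0) * poly (V 1) (X 0)) + (g N (X N) * poly (S N) (X N) + h N (X N) * poly (V N) (X N))
     + (\<Sum>i\<in>{1..<N}. (g i (X i) * poly (S i) (X i) + h i (X i) * poly (V i) (X i))
     + (- (g (Suc i) (X i) * poly (S (Suc i)) (X i) + h (Suc i) (X i) * poly (V (Suc i)) (X i))))"
    using edge_sum[OF N, of "\<lambda>i. g i (X i) * poly (S i) (X i) + h i (X i) * poly (V i) (X i)"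
      "\<lambda>i. - (g (Suc i) (X i) * poly (S (Suc i)) (X i) + h (Suc i) (X i) * poly (V (Suc i)) (X i))"] by simp
  finally have I: "(\<Sum>i=1..N. integral {X (i - 1)..X i} (\<lambda>x. g i x * poly (pderiv (S i)) x + h i x * poly (pderiv (V i)) x))
    = - (\<Sum>i=1..N. integral {X (i - 1)..X i} (\<lambda>x. g' i x * poly (S i) x)) - (\<Sum>i=1..N. integral {X (i - 1)..X i} (\<lambda>x. h' i x * poly (V i) x))
     + (- (g 1 (X 0) * poly (S 1) (X 0) + h 1 (X 0) * poly (V 1) (X 0)) + (g N (X N) * poly (S N) (X N) + h N (X N) * poly (V N) (X N))
     + (\<Sum>i\<in>{1..<N}. (g i (X i) * poly (S i) (X i) + h i (X i) * poly (V i) (X i))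
     + (- (g (Suc i) (X i) * poly (S (Suc i)) (X i) + h (Suc i) (X i) * poly (V (Suc i)) (X i)))))" .
  have "(\<Sum>i\<in>{1..<N}. (g i (X i) * poly (S i) (X i) + h i (X i) * poly (V i) (X i))
     + (- (g (Suc i) (X i) * poly (S (Suc i)) (X i) + h (Suc i) (X i) * poly (V (Suc i)) (X i))))
     + (\<Sum>i\<in>{1..<N}. uflux N m lt X g h i * (poly (S (Suc i)) (X i) - poly (S i) (X i))
       + pflux N lam X g h i * (poly (V (Suc i)) (X i) - poly (V i) (X i))) = 0"
    unfolding sum.distrib[symmetric] using gX(1) hX
    by (intro sum.neutral) (auto simp: uflux_def pflux_def algebra_simps)
  then show ?thesis unfolding rowB_edges[OF N] I using N gX(2,3)
    by (simp add: pflux_def algebra_simps)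
qed

text \<open>For Radau errors only the traces at the two boundary nodes and at the penalised node survive.\<close>

lemma rowB_radau:
  assumes m: "1 \<le> m" "m < N"
    and c: "\<And>i. i \<in> {1..N} \<Longrightarrow> continuous_on {X (i - 1)..X i} (a i)" "\<And>i. i \<in> {1..N} \<Longrightarrow> continuous_on {X (i - 1)..X i} (b i)"
    and aX: "\<And>i. i \<in> {1..N} \<Longrightarrow> a i (X i) = 0" and bX: "\<And>i. i \<in> {1..N} \<Longrightarrow> b i (X (i - 1)) = 0"
    and orth: "\<And>i. i \<in> {1..N} \<Longrightarrow> integral {X (i - 1)..X i} (\<lambda>x. a i x * poly (pderiv (S i)) x) = 0"
      "\<And>i. i \<in> {1..N} \<Longrightarrow> integral {X (i - 1)..X i} (\<lambda>x. b i x * poly (pderiv (V i)) x) = 0"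
  shows "rowB N m lam lt X a b S V = lam * a 1 (X 0) * poly (V 1) (X 0) - b N (X N) * poly (V N) (X N)
     - lt * b m (X m) * (poly (S (Suc m)) (X m) - poly (S m) (X m))"
proof -
  have N: "1 \<le> N" using m by simp
  have "integral {X (i - 1)..X i} (\<lambda>x. a i x * poly (pderiv (S i)) x + b i x * poly (pderiv (V i)) x) = 0" if i: "i \<in> {1..N}" for i
  proof -
    have "integral {X (i - 1)..X i} (\<lambda>x. a i x * poly (pderiv (S i)) x + b i x * poly (pderiv (V i)) x)
       = integral {X (i - 1)..X i} (\<lambda>x. a i x * poly (pderiv (S i)) x) + integral {X (i - 1)..X i} (\<lambda>x. b i x * poly (pderiv (V i)) x)"
      by (intro integral_add integrable_continuous_interval continuous_intros c i)
    then show ?thesis using orth[OF i] by simp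
  qed
  then have I: "(\<Sum>i=1..N. integral {X (i - 1)..X i} (\<lambda>x. a i x * poly (pderiv (S i)) x + b i x * poly (pderiv (V i)) x)) = 0" by simp
  have b0: "b (Suc i) (X i) = 0" if "i < N" for i using bX[of "Suc i"] that by simp
  have "(\<Sum>i\<in>{1..<N}. uflux N m lt X a b i * (poly (S (Suc i)) (X i) - poly (S i) (X i))
       + pflux N lam X a b i * (poly (V (Suc i)) (X i) - poly (V i) (X i)))
     = (\<Sum>i\<in>{1..<N}. if i = m then - lt * b m (X m) * (poly (S (Suc m)) (X m) - poly (S m) (X m)) else 0)"
    using aX b0 by (intro sum.cong) (auto simp: uflux_def pflux_def)
  also have "\<dots> = - lt * b m (X m) * (poly (S (Suc m)) (X m) - poly (S m) (X m))" using m by simp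
  finally show ?thesis unfolding rowB_edges[OF N] I using N aX[of N] b0[of 0]
    by (simp add: pflux_def)
qed

text \<open>The flux takes the left value, so the correction of cell \<open>i\<close> is seen at its
  right node only. Node \<open>m\<close> therefore occurs, while at node \<open>lo\<close> the flux
  reads a refined cell and vanishes.\<close>

lemma rowB_correction:
  assumes m: "1 \<le> lo" "lo \<le> m" "m < N" and d0: "\<And>i x. i \<notin> {lo<..m} \<Longrightarrow> d i x = 0"
  shows "rowB N m lam lt X d (\<lambda>_ _. 0) S V = (\<Sum>i\<in>{lo<..m}. integral {X (i - 1)..X i} (\<lambda>x. d i x * poly (pderiv (S i)) x)
     + d i (X i) * (poly (S (Suc i)) (X i) - poly (S i) (X i)))"
proof -
  have N: "1 \<le> N" using m by simp
  have "(\<Sum>i=1..N. integral {X (i - 1)..X i} (\<lambda>x. d i x * poly (pderiv (S i)) x)) = (\<Sum>i\<in>{lo<..m}. integral {X (i - 1)..X i} (\<lambda>x. d i x * poly (pderiv (S i)) x))"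
    using m d0 by (intro sum.mono_neutral_right) auto
  moreover have "(\<Sum>i\<in>{1..<N}. uflux N m lt X d (\<lambda>_ _. 0) i * (poly (S (Suc i)) (X i) - poly (S i) (X i))
       + pflux N lam X d (\<lambda>_ _. 0) i * (poly (V (Suc i)) (X i) - poly (V i) (X i)))
     = (\<Sum>i\<in>{lo<..m}. d i (X i) * (poly (S (Suc i)) (X i) - poly (S i) (X i)))"
    using m d0 by (intro sum.mono_neutral_cong_right) (auto simp: uflux_def pflux_def)
  ultimately show ?thesis unfolding rowB_edges[OF N] using N m d0
    by (simp add: pflux_def sum.distrib)
qed

lemma sum_shift_le:
  fixes f :: "nat \<Rightarrow> real"
  assumes "\<And>i. 0 \<le> f i" "1 \<le> lo" "m < N"
  shows "(\<Sum>i\<in>{lo<..<m}. f i + f (Suc i)) \<le> 2 * (\<Sum>i=1..N. f i)"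
proof -
  have "(\<Sum>i\<in>{lo<..<m}. f (Suc i)) = (\<Sum>i\<in>Suc ` {lo<..<m}. f i)" by (simp add: sum.reindex)
  also have "\<dots> \<le> (\<Sum>i=1..N. f i)" using assms by (intro sum_mono2) auto
  moreover have "(\<Sum>i\<in>{lo<..<m}. f i) \<le> (\<Sum>i=1..N. f i)" using assms by (intro sum_mono2) auto
  ultimately show ?thesis by (simp add: sum.distrib)
qed

text \<open>This estimate explains the penalised flux. At nodes between two coarse cells the jump of
  \<open>S\<close> is bounded by the values of \<open>S\<close> on both sides through inverse
  inequalities with width \<open>H\<close>. At node \<open>m\<close> the right neighbour is refined,
  and an inverse inequality there would cost a negative power of its width; instead the penalty term
  of the energy takes the jump.\<close>

lemma correction_estimate:
  assumes m: "1 \<le> lo" "lo < m" "m < N" and X: "\<And>i. i \<in> {1..N} \<Longrightarrow> X (i - 1) < X i"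
    and H: "\<And>i. i \<in> {lo<..m} \<Longrightarrow> X i - X (i - 1) = H" "0 < H"
    and deg: "\<And>i. degree (S i) \<le> k" "\<And>i. degree (D i) \<le> k" and eps: "0 < \<epsilon>" and lt: "0 < lt"
  shows "\<bar>\<Sum>i\<in>{lo<..m}. integral {X (i - 1)..X i} (\<lambda>x. poly (D i) x * poly (pderiv (S i)) x)
     + poly (D i) (X i) * (poly (S (Suc i)) (X i) - poly (S i) (X i))\<bar>
    \<le> 1 / (4 * \<epsilon>) * (\<Sum>i=1..N. integral {X (i - 1)..X i} (\<lambda>x. (poly (S i) x)\<^sup>2))
     + lt / 8 * (poly (S (Suc m)) (X m) - poly (S m) (X m))\<^sup>2
     + 10 * (cinv k)\<^sup>2 * \<epsilon> / H\<^sup>2 * (\<Sum>i\<in>{lo<..m}. integral {X (i - 1)..X i} (\<lambda>x. (poly (D i) x)\<^sup>2))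
     + 2 * cinv k / (lt * H) * integral {X (m - 1)..X m} (\<lambda>x. (poly (D m) x)\<^sup>2)"
proof -
  define c where "c = cinv k"
  have c: "c \<ge> 1" using cinv_ge by (simp add: c_def)
  define s2 where "s2 i = (if i \<in> {1..N} then integral {X (i - 1)..X i} (\<lambda>x. (poly (S i) x)\<^sup>2) else 0)" for i
  define d2 where "d2 i = (if i \<in> {1..N} then integral {X (i - 1)..X i} (\<lambda>x. (poly (D i) x)\<^sup>2) else 0)" for i
  define J where "J i = poly (S (Suc i)) (X i) - poly (S i) (X i)" for i
  have s2_0: "0 \<le> s2 i" and d2_0: "0 \<le> d2 i" for i
    by (auto simp: s2_def d2_def intro!: integral_nonneg integrable_continuous_interval continuous_intros)
  \<comment> \<open>The Young weight \<open>2 * c * \<epsilon> / H^2\<close> is chosen so that the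
    inverse inequality for the derivative of \<open>S\<close> leaves exactly
    \<open>1 / (8 * \<epsilon>)\<close>.\<close>
  have vol: "\<bar>integral {X (i - 1)..X i} (\<lambda>x. poly (D i) x * poly (pderiv (S i)) x)\<bar> \<le> 1 / (8 * \<epsilon>) * s2 i + 2 * c * \<epsilon> / H\<^sup>2 * d2 i"
    if i: "i \<in> {lo<..m}" for i
  proof -
    have iN: "i \<in> {1..N}" using i m by auto
    have le: "X (i - 1) < X i" using X[OF iN] .
    have "integral {X (i - 1)..X i} (\<lambda>x. (poly (pderiv (S i)) x)\<^sup>2) \<le> integral {X (i - 1)..X i} (\<lambda>x::real. c / H ^ 3 * s2 i)"
      using inverse_inequalities(2)[OF le deg(1)[of i]] H(1)[OF i] iN
      by (intro integral_le integrable_continuous_interval continuous_intros) (auto simp: c_def s2_def)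
    also have "\<dots> = c / H\<^sup>2 * s2 i" using H(1)[OF i] H(2) le
      by (simp add: power2_eq_square power3_eq_cube)
    finally have S': "integral {X (i - 1)..X i} (\<lambda>x. (poly (pderiv (S i)) x)\<^sup>2) \<le> c / H\<^sup>2 * s2 i" .
    have "\<bar>integral {X (i - 1)..X i} (\<lambda>x. poly (D i) x * poly (pderiv (S i)) x)\<bar> \<le> (2 * c * \<epsilon> / H\<^sup>2) * d2 i + integral {X (i - 1)..X i} (\<lambda>x. (poly (pderiv (S i)) x)\<^sup>2) / (4 * (2 * c * \<epsilon> / H\<^sup>2))"
      using young_integral[of "2 * c * \<epsilon> / H\<^sup>2" "X (i - 1)" "X i" "poly (D i)" "poly (pderiv (S i))"] c eps H iN by (simp add: continuous_intros d2_def)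
    also have "\<dots> \<le> (2 * c * \<epsilon> / H\<^sup>2) * d2 i + (c / H\<^sup>2 * s2 i) / (4 * (2 * c * \<epsilon> / H\<^sup>2))"
      using S' c eps H by (intro add_left_mono divide_right_mono) auto
    also have "(c / H\<^sup>2 * s2 i) / (4 * (2 * c * \<epsilon> / H\<^sup>2)) = 1 / (8 * \<epsilon>) * s2 i" using c eps H by (simp add: field_simps)
    finally show ?thesis by simp
  qed
  have sq: "(poly (S i) x)\<^sup>2 \<le> c / H * s2 i" if "i \<in> {lo<..m}" "x \<in> {X (i - 1)..X i}" for i x
    using inverse_inequalities(1)[OF X deg(1), of i x] H(1)[OF that(1)] that m by (auto simp: c_def s2_def)
  have dq: "(poly (D i) x)\<^sup>2 \<le> c / H * d2 i" if "i \<in> {lo<..m}" "x \<in> {X (i - 1)..X i}" for i x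
    using inverse_inequalities(1)[OF X deg(2), of i x] H(1)[OF that(1)] that m by (auto simp: c_def d2_def)
  \<comment> \<open>Each cell is adjacent to at most two such nodes, so the factor
    \<open>1 / (16 * \<epsilon>)\<close> adds up to another
    \<open>1 / (8 * \<epsilon>)\<close>.\<close>
  have edge: "\<bar>poly (D i) (X i) * J i\<bar> \<le> 1 / (16 * \<epsilon>) * (s2 i + s2 (Suc i)) + 8 * c\<^sup>2 * \<epsilon> / H\<^sup>2 * d2 i" if i: "i \<in> {lo<..<m}" for i
  proof -
    have iN: "i \<in> {1..N}" "Suc i \<in> {1..N}" using i m by auto
    have "(J i)\<^sup>2 \<le> 2 * (poly (S (Suc i)) (X i))\<^sup>2 + 2 * (poly (S i) (X i))\<^sup>2"
      unfolding J_def using sum_squares_bound[of "poly (S (Suc i)) (X i)" "- poly (S i) (X i)"] by (simp add: power2_diff)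
    also have "\<dots> \<le> 2 * (c / H * s2 (Suc i)) + 2 * (c / H * s2 i)"
      using sq[of "Suc i" "X i"] sq[of i "X i"] X[OF iN(1)] X[OF iN(2)] i by simp
    finally have J: "(J i)\<^sup>2 \<le> 2 * c / H * (s2 i + s2 (Suc i))" by (simp add: algebra_simps add_divide_distrib)
    have "\<bar>poly (D i) (X i) * J i\<bar> \<le> (8 * c * \<epsilon> / H) * (poly (D i) (X i))\<^sup>2 + (J i)\<^sup>2 / (4 * (8 * c * \<epsilon> / H))"
      using c eps H by (intro young) auto
    also have "\<dots> \<le> (8 * c * \<epsilon> / H) * (c / H * d2 i) + (2 * c / H * (s2 i + s2 (Suc i))) / (4 * (8 * c * \<epsilon> / H))"
      using c eps H J dq[of i "X i"] X[OF iN(1)] i by (intro add_mono mult_left_mono divide_right_mono) auto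
    also have "(2 * c / H * (s2 i + s2 (Suc i))) / (4 * (8 * c * \<epsilon> / H)) = 1 / (16 * \<epsilon>) * (s2 i + s2 (Suc i))"
      using c eps H by (simp add: field_simps)
    finally show ?thesis by (simp add: power2_eq_square algebra_simps)
  qed
  have last: "\<bar>poly (D m) (X m) * J m\<bar> \<le> lt / 8 * (J m)\<^sup>2 + 2 * c / (lt * H) * d2 m"
  proof -
    have "\<bar>poly (D m) (X m) * J m\<bar> \<le> (2 / lt) * (poly (D m) (X m))\<^sup>2 + (J m)\<^sup>2 / (4 * (2 / lt))"
      using lt by (intro young) auto
    also have "\<dots> \<le> (2 / lt) * (c / H * d2 m) + (J m)\<^sup>2 / (4 * (2 / lt))"
      using dq[of m "X m"] X[of m] m lt by (intro add_right_mono mult_left_mono) auto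
    finally show ?thesis using lt by (simp add: algebra_simps)
  qed
  have split: "{lo<..m} = insert m {lo<..<m}" using m by auto
  have "\<bar>\<Sum>i\<in>{lo<..m}. integral {X (i - 1)..X i} (\<lambda>x. poly (D i) x * poly (pderiv (S i)) x) + poly (D i) (X i) * J i\<bar>
    \<le> (\<Sum>i\<in>{lo<..m}. \<bar>integral {X (i - 1)..X i} (\<lambda>x. poly (D i) x * poly (pderiv (S i)) x)\<bar> + \<bar>poly (D i) (X i) * J i\<bar>)"
    by (intro order.trans[OF sum_abs] sum_mono) simp
  also have "\<dots> = (\<Sum>i\<in>{lo<..m}. \<bar>integral {X (i - 1)..X i} (\<lambda>x. poly (D i) x * poly (pderiv (S i)) x)\<bar>) + (\<Sum>i\<in>{lo<..<m}. \<bar>poly (D i) (X i) * J i\<bar>) + \<bar>poly (D m) (X m) * J m\<bar>"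
    unfolding sum.distrib by (simp add: split)
  also have "\<dots> \<le> (\<Sum>i\<in>{lo<..m}. 1 / (8 * \<epsilon>) * s2 i + 2 * c * \<epsilon> / H\<^sup>2 * d2 i) + (\<Sum>i\<in>{lo<..<m}. 1 / (16 * \<epsilon>) * (s2 i + s2 (Suc i)) + 8 * c\<^sup>2 * \<epsilon> / H\<^sup>2 * d2 i)
     + (lt / 8 * (J m)\<^sup>2 + 2 * c / (lt * H) * d2 m)"
    using vol edge last by (intro add_mono sum_mono) auto
  also have "\<dots> = 1 / (8 * \<epsilon>) * (\<Sum>i\<in>{lo<..m}. s2 i) + 2 * c * \<epsilon> / H\<^sup>2 * (\<Sum>i\<in>{lo<..m}. d2 i)
     + 1 / (16 * \<epsilon>) * (\<Sum>i\<in>{lo<..<m}. s2 i + s2 (Suc i)) + 8 * c\<^sup>2 * \<epsilon> / H\<^sup>2 * (\<Sum>i\<in>{lo<..<m}. d2 i)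
     + (lt / 8 * (J m)\<^sup>2 + 2 * c / (lt * H) * d2 m)"
    by (simp only: sum.distrib sum_distrib_left distrib_left)
  also have "\<dots> \<le> 1 / (8 * \<epsilon>) * (\<Sum>i=1..N. s2 i) + 2 * c\<^sup>2 * \<epsilon> / H\<^sup>2 * (\<Sum>i\<in>{lo<..m}. d2 i)
     + 1 / (16 * \<epsilon>) * (2 * (\<Sum>i=1..N. s2 i)) + 8 * c\<^sup>2 * \<epsilon> / H\<^sup>2 * (\<Sum>i\<in>{lo<..m}. d2 i)
     + (lt / 8 * (J m)\<^sup>2 + 2 * c / (lt * H) * d2 m)"
  proof (intro add_mono mult_left_mono sum_shift_le order.refl mult_right_mono divide_right_mono)
    show "c \<le> c\<^sup>2" using c by (simp add: power2_eq_square)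
    show "(\<Sum>i\<in>{lo<..m}. s2 i) \<le> (\<Sum>i=1..N. s2 i)" using m s2_0 by (intro sum_mono2) auto
    show "(\<Sum>i\<in>{lo<..<m}. d2 i) \<le> (\<Sum>i\<in>{lo<..m}. d2 i)" using d2_0 by (intro sum_mono2) auto
  qed (use m eps H c lt s2_0 d2_0 in \<open>auto intro: sum_nonneg\<close>)
  also have "\<dots> = 1 / (4 * \<epsilon>) * (\<Sum>i=1..N. s2 i) + lt / 8 * (J m)\<^sup>2 + 10 * c\<^sup>2 * \<epsilon> / H\<^sup>2 * (\<Sum>i\<in>{lo<..m}. d2 i) + 2 * c / (lt * H) * d2 m"
    by (simp add: algebra_simps add_divide_distrib[symmetric])
  also have "(\<Sum>i=1..N. s2 i) = (\<Sum>i=1..N. integral {X (i - 1)..X i} (\<lambda>x. (poly (S i) x)\<^sup>2))" by (simp add: s2_def)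
  also have "(\<Sum>i\<in>{lo<..m}. d2 i) = (\<Sum>i\<in>{lo<..m}. integral {X (i - 1)..X i} (\<lambda>x. (poly (D i) x)\<^sup>2))"
    using m by (intro sum.cong) (auto simp: d2_def)
  also have "d2 m = integral {X (m - 1)..X m} (\<lambda>x. (poly (D m) x)\<^sup>2)" using m by (simp add: d2_def)
  finally show ?thesis by (simp add: J_def c_def)
qed

text \<open>Each term is split by Young so that half of the energy in \<open>rowB_coercive\<close>
  pays for all of them. The squares of \<open>S\<close> use \<open>1/8 + 1/8\<close> from
  \<open>T1\<close> and \<open>T2\<close> and \<open>1/4\<close> from the correction; the jump at
  \<open>m\<close> uses \<open>1/8 + 1/8\<close>; each boundary trace of \<open>V\<close> uses
  \<open>1/4\<close>.\<close>

lemma row_estimate: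
  assumes m: "1 \<le> lo" "lo < m" "m < N" and X: "\<And>i. i \<in> {1..N} \<Longrightarrow> X (i - 1) < X i"
    and H: "\<And>i. i \<in> {lo<..m} \<Longrightarrow> X i - X (i - 1) = H" "0 < H"
    and deg: "\<And>i. degree (S i) \<le> k" "\<And>i. degree (V i) \<le> k" "\<And>i. degree (D i) \<le> k"
    and pos: "0 < \<epsilon>" "0 < lt" "0 < lam" "0 < \<beta>"
    and D0: "\<And>i. i \<notin> {lo<..m} \<Longrightarrow> D i = 0"
    and g: "\<And>i x. i \<in> {1..N} \<Longrightarrow> x \<in> {X (i - 1)..X i} \<Longrightarrow> (g i has_real_derivative g' i x) (at x within {X (i - 1)..X i})"
    and g': "\<And>i. i \<in> {1..N} \<Longrightarrow> continuous_on {X (i - 1)..X i} (g' i)"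
    and h: "\<And>i x. i \<in> {1..N} \<Longrightarrow> x \<in> {X (i - 1)..X i} \<Longrightarrow> (h i has_real_derivative h' i x) (at x within {X (i - 1)..X i})"
    and h': "\<And>i. i \<in> {1..N} \<Longrightarrow> continuous_on {X (i - 1)..X i} (h' i)"
    and gX: "\<And>i. i \<in> {1..<N} \<Longrightarrow> g i (X i) = g (Suc i) (X i)" "g 1 (X 0) = 0" "g N (X N) = 0"
    and hX: "\<And>i. i \<in> {1..<N} \<Longrightarrow> h i (X i) = h (Suc i) (X i)"
    and c: "\<And>i. i \<in> {1..N} \<Longrightarrow> continuous_on {X (i - 1)..X i} (a i)" "\<And>i. i \<in> {1..N} \<Longrightarrow> continuous_on {X (i - 1)..X i} (b i)"
    and aX: "\<And>i. i \<in> {1..N} \<Longrightarrow> a i (X i) = 0" and bX: "\<And>i. i \<in> {1..N} \<Longrightarrow> b i (X (i - 1)) = 0"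
    and orth: "\<And>i. i \<in> {1..N} \<Longrightarrow> integral {X (i - 1)..X i} (\<lambda>x. a i x * poly (pderiv (S i)) x) = 0"
      "\<And>i. i \<in> {1..N} \<Longrightarrow> integral {X (i - 1)..X i} (\<lambda>x. b i x * poly (pderiv (V i)) x) = 0"
  shows "\<bar>(\<Sum>i=1..N. 1 / \<epsilon> * integral {X (i - 1)..X i} (\<lambda>x. (h i x + b i x) * poly (S i) x))
      + rowB N m lam lt X (\<lambda>i x. g i x + a i x - poly (D i) x) (\<lambda>i x. h i x + b i x) S V\<bar>
    \<le> 1 / 2 * (1 / \<epsilon> * (\<Sum>i=1..N. integral {X (i - 1)..X i} (\<lambda>x. (poly (S i) x)\<^sup>2))
        + lam * ((poly (V 1) (X 0))\<^sup>2 + (poly (V N) (X N))\<^sup>2) + lt * (poly (S (Suc m)) (X m) - poly (S m) (X m))\<^sup>2)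
      + \<beta>\<^sup>2 / 2 * (\<Sum>i=1..N. integral {X (i - 1)..X i} (\<lambda>x. (poly (V i) x)\<^sup>2))
      + 2 / \<epsilon> * (\<Sum>i=1..N. integral {X (i - 1)..X i} (\<lambda>x. (h i x + b i x)\<^sup>2))
      + 2 * \<epsilon> * (\<Sum>i=1..N. integral {X (i - 1)..X i} (\<lambda>x. (g' i x)\<^sup>2))
      + 1 / (2 * \<beta>\<^sup>2) * (\<Sum>i=1..N. integral {X (i - 1)..X i} (\<lambda>x. (h' i x)\<^sup>2))
      + 2 * lt * (b m (X m))\<^sup>2 + lam * (a 1 (X 0))\<^sup>2 + (b N (X N))\<^sup>2 / lam
      + 10 * (cinv k)\<^sup>2 * \<epsilon> / H\<^sup>2 * (\<Sum>i\<in>{lo<..m}. integral {X (i - 1)..X i} (\<lambda>x. (poly (D i) x)\<^sup>2))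
      + 2 * cinv k / (lt * H) * integral {X (m - 1)..X m} (\<lambda>x. (poly (D m) x)\<^sup>2)"
proof -
  let ?I = "\<lambda>i f. integral {X (i - 1)..X i} f"
  let ?J = "poly (S (Suc m)) (X m) - poly (S m) (X m)"
  have cg: "continuous_on {X (i - 1)..X i} (g i)" "continuous_on {X (i - 1)..X i} (h i)" if "i \<in> {1..N}" for i
    by (rule DERIV_continuous_on, rule g[OF that], assumption) (rule DERIV_continuous_on, rule h[OF that])
  have m': "1 \<le> m" using m by simp
  define C where "C = rowB N m lam lt X (\<lambda>i. poly (D i)) (\<lambda>_ _. 0) S V"
  have "rowB N m lam lt X (\<lambda>i x. g i x + a i x - poly (D i) x) (\<lambda>i x. h i x + b i x) S V
    = rowB N m lam lt X (\<lambda>i x. (g i x + 1 * a i x) + (-1) * poly (D i) x) (\<lambda>i x. (h i x + 1 * b i x) + (-1) * 0) S V" by simp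
  also have "\<dots> = rowB N m lam lt X (\<lambda>i x. g i x + 1 * a i x) (\<lambda>i x. h i x + 1 * b i x) S V + (-1) * C"
    unfolding C_def by (rule rowB_linear) (intro continuous_intros cg c; assumption)+
  also have "rowB N m lam lt X (\<lambda>i x. g i x + 1 * a i x) (\<lambda>i x. h i x + 1 * b i x) S V = rowB N m lam lt X g h S V + 1 * rowB N m lam lt X a b S V"
    by (rule rowB_linear) (intro cg c; assumption)+
  also have "rowB N m lam lt X g h S V = - (\<Sum>i=1..N. ?I i (\<lambda>x. g' i x * poly (S i) x)) - (\<Sum>i=1..N. ?I i (\<lambda>x. h' i x * poly (V i) x))"
    by (rule rowB_smooth[OF m' m(3) X g g' h h' gX hX])
  also have "rowB N m lam lt X a b S V = lam * a 1 (X 0) * poly (V 1) (X 0) - b N (X N) * poly (V N) (X N) - lt * b m (X m) * ?J"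
    by (rule rowB_radau[OF m' m(3)]) (fact c aX bX orth)+
  finally have R: "rowB N m lam lt X (\<lambda>i x. g i x + a i x - poly (D i) x) (\<lambda>i x. h i x + b i x) S V
     = - (\<Sum>i=1..N. ?I i (\<lambda>x. g' i x * poly (S i) x)) - (\<Sum>i=1..N. ?I i (\<lambda>x. h' i x * poly (V i) x))
       + (lam * a 1 (X 0) * poly (V 1) (X 0) - b N (X N) * poly (V N) (X N) - lt * b m (X m) * ?J) - C" by simp
  have C: "\<bar>C\<bar> \<le> 1 / (4 * \<epsilon>) * (\<Sum>i=1..N. ?I i (\<lambda>x. (poly (S i) x)\<^sup>2)) + lt / 8 * ?J\<^sup>2
     + 10 * (cinv k)\<^sup>2 * \<epsilon> / H\<^sup>2 * (\<Sum>i\<in>{lo<..m}. ?I i (\<lambda>x. (poly (D i) x)\<^sup>2)) + 2 * cinv k / (lt * H) * ?I m (\<lambda>x. (poly (D m) x)\<^sup>2)"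
  proof -
    have "C = (\<Sum>i\<in>{lo<..m}. ?I i (\<lambda>x. poly (D i) x * poly (pderiv (S i)) x) + poly (D i) (X i) * (poly (S (Suc i)) (X i) - poly (S i) (X i)))"
      unfolding C_def using m D0 by (intro rowB_correction) auto
    then show ?thesis using correction_estimate[where lo = lo and m = m and N = N and X = X and H = H and S = S and D = D and k = k and \<epsilon> = \<epsilon> and lt = lt, OF m X H deg(1) deg(3) pos(1) pos(2)] by simp
  qed
  have T1: "\<bar>\<Sum>i=1..N. 1 / \<epsilon> * ?I i (\<lambda>x. (h i x + b i x) * poly (S i) x)\<bar> \<le> 2 / \<epsilon> * (\<Sum>i=1..N. ?I i (\<lambda>x. (h i x + b i x)\<^sup>2)) + 1 / (8 * \<epsilon>) * (\<Sum>i=1..N. ?I i (\<lambda>x. (poly (S i) x)\<^sup>2))"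
    unfolding sum_distrib_left sum.distrib[symmetric]
  proof (intro order.trans[OF sum_abs] sum_mono)
    fix i assume i: "i \<in> {1..N}"
    have "\<bar>?I i (\<lambda>x. (h i x + b i x) * poly (S i) x)\<bar> \<le> 2 * ?I i (\<lambda>x. (h i x + b i x)\<^sup>2) + ?I i (\<lambda>x. (poly (S i) x)\<^sup>2) / (4 * 2)"
      by (intro young_integral continuous_intros cg c i) auto
    then have "1 / \<epsilon> * \<bar>?I i (\<lambda>x. (h i x + b i x) * poly (S i) x)\<bar> \<le> 1 / \<epsilon> * (2 * ?I i (\<lambda>x. (h i x + b i x)\<^sup>2) + ?I i (\<lambda>x. (poly (S i) x)\<^sup>2) / (4 * 2))"
      using pos by (intro mult_left_mono) auto
    then show "\<bar>1 / \<epsilon> * ?I i (\<lambda>x. (h i x + b i x) * poly (S i) x)\<bar> \<le> 2 / \<epsilon> * ?I i (\<lambda>x. (h i x + b i x)\<^sup>2) + 1 / (8 * \<epsilon>) * ?I i (\<lambda>x. (poly (S i) x)\<^sup>2)"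
      using pos by (simp add: abs_mult algebra_simps)
  qed
  have T2: "\<bar>\<Sum>i=1..N. ?I i (\<lambda>x. g' i x * poly (S i) x)\<bar> \<le> 2 * \<epsilon> * (\<Sum>i=1..N. ?I i (\<lambda>x. (g' i x)\<^sup>2)) + 1 / (8 * \<epsilon>) * (\<Sum>i=1..N. ?I i (\<lambda>x. (poly (S i) x)\<^sup>2))"
    unfolding sum_distrib_left sum.distrib[symmetric]
  proof (intro order.trans[OF sum_abs] sum_mono)
    fix i assume i: "i \<in> {1..N}"
    show "\<bar>?I i (\<lambda>x. g' i x * poly (S i) x)\<bar> \<le> 2 * \<epsilon> * ?I i (\<lambda>x. (g' i x)\<^sup>2) + 1 / (8 * \<epsilon>) * ?I i (\<lambda>x. (poly (S i) x)\<^sup>2)"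
      using young_integral[of "2 * \<epsilon>" "X (i - 1)" "X i" "g' i" "poly (S i)"] pos g'[OF i] by (simp add: continuous_intros)
  qed
  \<comment> \<open>The weight leaves \<open>\<beta>^2 / 2\<close> in front of \<open>V\<close>.
    Rows and columns together then use at most half of the reaction term, because \<open>b\<close>
    is at least \<open>2 * \<beta>^2\<close>.\<close>
  have T3: "\<bar>\<Sum>i=1..N. ?I i (\<lambda>x. h' i x * poly (V i) x)\<bar> \<le> 1 / (2 * \<beta>\<^sup>2) * (\<Sum>i=1..N. ?I i (\<lambda>x. (h' i x)\<^sup>2)) + \<beta>\<^sup>2 / 2 * (\<Sum>i=1..N. ?I i (\<lambda>x. (poly (V i) x)\<^sup>2))"
    unfolding sum_distrib_left sum.distrib[symmetric]
  proof (intro order.trans[OF sum_abs] sum_mono)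
    fix i assume i: "i \<in> {1..N}"
    show "\<bar>?I i (\<lambda>x. h' i x * poly (V i) x)\<bar> \<le> 1 / (2 * \<beta>\<^sup>2) * ?I i (\<lambda>x. (h' i x)\<^sup>2) + \<beta>\<^sup>2 / 2 * ?I i (\<lambda>x. (poly (V i) x)\<^sup>2)"
      using young_integral[of "1 / (2 * \<beta>\<^sup>2)" "X (i - 1)" "X i" "h' i" "poly (V i)"] pos h'[OF i] by (simp add: continuous_intros field_simps)
  qed
  have T4: "\<bar>lt * b m (X m) * ?J\<bar> \<le> 2 * lt * (b m (X m))\<^sup>2 + lt / 8 * ?J\<^sup>2"
  proof -
    have "lt * \<bar>b m (X m) * ?J\<bar> \<le> lt * (2 * (b m (X m))\<^sup>2 + ?J\<^sup>2 / (4 * 2))" using young[of 2] pos by (intro mult_left_mono) auto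
    then show ?thesis using pos by (simp add: abs_mult mult.assoc mult.left_commute distrib_left)
  qed
  have T5: "\<bar>lam * a 1 (X 0) * poly (V 1) (X 0)\<bar> \<le> lam * (a 1 (X 0))\<^sup>2 + lam / 4 * (poly (V 1) (X 0))\<^sup>2"
  proof -
    have "lam * \<bar>a 1 (X 0) * poly (V 1) (X 0)\<bar> \<le> lam * (1 * (a 1 (X 0))\<^sup>2 + (poly (V 1) (X 0))\<^sup>2 / (4 * 1))" using young[of 1] pos by (intro mult_left_mono) auto
    then show ?thesis using pos by (simp add: abs_mult algebra_simps)
  qed
  have T6: "\<bar>b N (X N) * poly (V N) (X N)\<bar> \<le> (b N (X N))\<^sup>2 / lam + lam / 4 * (poly (V N) (X N))\<^sup>2"
    using young[of "1 / lam" "b N (X N)" "poly (V N) (X N)"] pos by (simp add: field_simps)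
  have "0 \<le> (poly (V 1) (X 0))\<^sup>2 * lam" "0 \<le> (poly (V N) (X N))\<^sup>2 * lam" "0 \<le> ?J\<^sup>2 * lt" using pos by auto
  then show ?thesis unfolding R using C T1 T2 T3 T4 T5 T6
    by (simp add: algebra_simps abs_le_iff)
qed

subsection \<open>Mesh, layer functions and weights\<close>

locale shishkin =
  fixes k :: nat and \<beta> \<sigma> \<epsilon> C1 :: real and N :: nat
  assumes k: "1 \<le> k" and beta: "0 < \<beta>" and sigma: "real k + 1 \<le> \<sigma>" and eps: "0 < \<epsilon>" "\<epsilon> < 1"
    and N: "4 \<le> N" "4 dvd N" and trans: "transition \<sigma> \<beta> \<epsilon> N \<le> 1 / 4" and C1: "0 < C1"
begin

definition "\<tau> = transition \<sigma> \<beta> \<epsilon> N"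
definition "X = mesh \<tau> N"
definition "lo = N div 4"
definition "m = 3 * N div 4"
definition "se = sqrt \<epsilon>"
definition "L = ln (real N) / real N"
definition "NN = (1 / real N) ^ (k + 1)"
text \<open>The index refers to cells: cell \<open>i\<close> lies between the nodes
  \<open>i - 1\<close> and \<open>i\<close>, so \<open>lo\<close> is the last refined cell on the
  left and \<open>m\<close> the last coarse one.\<close>

definition "refined i \<longleftrightarrow> i \<le> lo \<or> m < i" for i :: nat
text \<open>One function for both ends of the interval, so that opposite layers are handled
  together.\<close>

definition "E x = exp (- \<beta> * x / se) + exp (- \<beta> * (1 - x) / se)" for x :: real
definition "H = 2 * (1 - 2 * \<tau>) / real N"

lemma N_eq: "N = 4 * lo" "m = 3 * lo" "1 \<le> lo" "real N = 4 * real lo"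
  using N by (auto simp: lo_def m_def)

lemma index_order: "1 \<le> lo" "lo < m" "m < N" "1 \<le> m" "lo < N" "1 \<le> N"
  using N_eq by auto

lemma se: "0 < se" "se < 1" "se\<^sup>2 = \<epsilon>" "se * se = \<epsilon>" "\<epsilon> \<le> se"
proof -
  show "0 < se" "se < 1" "se\<^sup>2 = \<epsilon>" "se * se = \<epsilon>" using eps by (auto simp: se_def)
  then show "\<epsilon> \<le> se" using mult_left_le[of se se] by simp
qed

lemma lnN: "1 \<le> ln (real N)" "ln (real N) \<le> real N"
proof -
  have "exp 1 \<le> real N" using exp_le N(1) by simp
  then show "1 \<le> ln (real N)" using N by (simp add: ln_ge_iff)
  show "ln (real N) \<le> real N" using ln_le_minus_one[of "real N"] N by simp
qed

lemma tau: "\<tau> = \<sigma> * se * ln (real N) / \<beta>" "0 < \<tau>" "\<tau> \<le> 1 / 4"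
proof -
  show *: "\<tau> = \<sigma> * se * ln (real N) / \<beta>" by (simp add: \<tau>_def transition_def se_def)
  have "0 < \<sigma>" using sigma by simp
  then show "0 < \<tau>" unfolding * using se(1) lnN(1) beta by (intro divide_pos_pos mult_pos_pos) auto
  show "\<tau> \<le> 1 / 4" using trans by (simp add: \<tau>_def)
qed

lemma L: "0 < L" "L \<le> 1" "1 / real N \<le> L"
  using lnN N by (auto simp: L_def field_simps)

lemma NN: "0 < NN" "NN \<le> L ^ (k + 1)" "NN \<le> 1"
proof -
  show "0 < NN" using N by (simp add: NN_def)
  show "NN \<le> L ^ (k + 1)" unfolding NN_def using L(3) by (intro power_mono) auto
  also have "\<dots> \<le> 1" using L by (intro power_le_one) auto
  finally show "NN \<le> 1" .
qed

text \<open>The total width of the refined strips contributes one factor \<open>ln N\<close>; since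
  \<open>ln N \<ge> 1\<close>, the many logarithms in \<open>L ^ (2 * (k + 1))\<close> absorb
  it.\<close>

lemma lnN_NN: "ln (real N) * NN\<^sup>2 \<le> L ^ (2 * (k + 1))"
proof -
  have N2: "NN\<^sup>2 = (1 / real N) ^ (2 * (k + 1))" unfolding NN_def by (metis mult.commute power_mult)
  have "ln (real N) ^ 1 \<le> ln (real N) ^ (2 * (k + 1))" using lnN by (intro power_increasing) auto
  then have "ln (real N) * NN\<^sup>2 \<le> ln (real N) ^ (2 * (k + 1)) * NN\<^sup>2" by (intro mult_right_mono) auto
  also have "\<dots> = L ^ (2 * (k + 1))"
    unfolding N2 by (simp only: L_def power_mult_distrib[symmetric] times_divide_eq_right mult_1_right)
  finally show ?thesis .
qed

lemma X_fine_left: "i \<le> lo \<Longrightarrow> X i = real i * (\<tau> / real lo)"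
  using N_eq(4) by (simp add: X_def mesh_def lo_def[symmetric])

lemma H_alt: "H = (1 - 2 * \<tau>) / (2 * real lo)"
  using N_eq by (simp add: H_def field_simps)

lemma X_coarse: "lo \<le> i \<Longrightarrow> i \<le> m \<Longrightarrow> X i = \<tau> + (real i - real lo) * H"
proof (cases "i = lo")
  case True
  then show ?thesis using X_fine_left[of lo] N_eq(3) by simp
next
  case False
  assume "lo \<le> i" "i \<le> m"
  then show ?thesis using False N_eq by (simp add: X_def mesh_def lo_def[symmetric] m_def[symmetric] H_alt)
qed

lemma X_fine_right: "m \<le> i \<Longrightarrow> X i = 1 - \<tau> + (real i - real m) * (\<tau> / real lo)"
proof (cases "i = m")
  case True
  have "(real m - real lo) * H = 1 - 2 * \<tau>" using N_eq by (simp add: H_alt field_simps)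
  then show ?thesis using X_coarse[of m] index_order True by simp
next
  case False
  assume "m \<le> i"
  then show ?thesis using False N_eq by (simp add: X_def mesh_def lo_def[symmetric] m_def[symmetric])
qed

lemma X_special: "X 0 = 0" "X lo = \<tau>" "X m = 1 - \<tau>" "X N = 1"
proof -
  show "X 0 = 0" by (simp add: X_fine_left)
  show "X lo = \<tau>" using X_coarse[of lo] index_order by simp
  show "X m = 1 - \<tau>" by (simp add: X_fine_right)
  show "X N = 1" using X_fine_right[of N] index_order N_eq by (simp add: field_simps)
qed

lemma width_fine: "i \<in> {1..N} \<Longrightarrow> refined i \<Longrightarrow> X i - X (i - 1) = \<tau> / real lo"
proof -
  assume i: "i \<in> {1..N}" and f: "refined i"
  show ?thesis
  proof (cases "i \<le> lo")
    case True
    then show ?thesis using X_fine_left[of i] X_fine_left[of "i - 1"] i by (simp add: algebra_simps of_nat_diff diff_divide_distrib)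
  next
    case False
    then have "m \<le> i - 1" "m \<le> i" using f by (auto simp: refined_def)
    then show ?thesis using X_fine_right[of i] X_fine_right[of "i - 1"] i by (simp add: algebra_simps of_nat_diff diff_divide_distrib)
  qed
qed

lemma width_coarse: "i \<in> {lo<..m} \<Longrightarrow> X i - X (i - 1) = H"
  using X_coarse[of i] X_coarse[of "i - 1"] by (cases i) (auto simp: algebra_simps)

lemma H: "0 < H" "1 / real N \<le> H" "H \<le> 2 / real N"
proof -
  have "2 * (1 - 2 * \<tau>) \<le> 2" "1 \<le> 2 * (1 - 2 * \<tau>)" "0 < 2 * (1 - 2 * \<tau>)" using tau(2,3) by auto
  then show "0 < H" "1 / real N \<le> H" "H \<le> 2 / real N" unfolding H_def using N
    by (auto intro!: divide_right_mono divide_pos_pos)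
qed

lemma coarse_iff: "i \<in> {lo<..m} \<longleftrightarrow> \<not> refined i" by (auto simp: refined_def)

lemma X_less: "i \<in> {1..N} \<Longrightarrow> X (i - 1) < X i"
proof (cases "refined i")
  case True
  assume "i \<in> {1..N}"
  moreover have "0 < \<tau> / real lo" using tau(2) N_eq(3) by simp
  ultimately show ?thesis using width_fine[of i] True by linarith
next
  case False
  then show ?thesis using width_coarse[of i] H(1) coarse_iff[of i] by linarith
qed

lemma X_mono: "i \<le> j \<Longrightarrow> j \<le> N \<Longrightarrow> X i \<le> X j"
proof (induction j rule: nat_induct)
  case (Suc j)
  then show ?case using X_less[of "Suc j"] by (cases "i = Suc j") auto
qed simp

lemma X_range: "i \<le> N \<Longrightarrow> X i \<in> {0..1}"
  using X_mono[of 0 i] X_mono[of i N] X_special by simp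

lemma cell_subset: "i \<in> {1..N} \<Longrightarrow> x \<in> {X (i - 1)..X i} \<Longrightarrow> x \<in> {0..1}"
proof -
  assume i: "i \<in> {1..N}" and x: "x \<in> {X (i - 1)..X i}"
  have "i - 1 \<le> N" "i \<le> N" using i by auto
  then show ?thesis using X_range[of i] X_range[of "i - 1"] x by auto
qed

lemma coarse_cell: "i \<in> {lo<..m} \<Longrightarrow> x \<in> {X (i - 1)..X i} \<Longrightarrow> \<tau> \<le> x \<and> x \<le> 1 - \<tau>"
  using X_mono[of lo "i - 1"] X_mono[of i m] X_special index_order by force

lemma width_le: "i \<in> {1..N} \<Longrightarrow> X i - X (i - 1) \<le> 2 / real N"
proof (cases "refined i")
  case True
  assume "i \<in> {1..N}"
  have "\<tau> / real lo \<le> (1 / 4) / real lo" using tau(3) by (intro divide_right_mono) auto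
  also have "\<dots> \<le> 2 / real N" using N_eq by (simp add: field_simps)
  finally show ?thesis using width_fine[OF \<open>i \<in> {1..N}\<close> True] by simp
next
  case False
  then show ?thesis using width_coarse[of i] H coarse_iff by auto
qed

lemma fine_width: "\<tau> / real lo = 4 * \<sigma> / \<beta> * L * se"
  using N_eq by (simp add: tau(1) L_def)

section \<open>Layer functions on the mesh\<close>

lemma E_pos: "0 < E x" by (simp add: E_def add_pos_pos)

lemma E_le_2: "x \<in> {0..1} \<Longrightarrow> E x \<le> 2"
proof -
  assume "x \<in> {0..1}"
  then have "exp (- \<beta> * x / se) \<le> 1" "exp (- \<beta> * (1 - x) / se) \<le> 1"
    using beta se by (auto simp: divide_le_0_iff mult_le_0_iff)
  then show ?thesis unfolding E_def by linarith
qed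

text \<open>This is the reason for the choice of the transition point: with
  \<open>\<sigma> \<ge> k + 1\<close> a layer has decayed to the order of the interpolation error
  when it reaches the coarse cells.\<close>

lemma exp_tau: "exp (- \<beta> * \<tau> / se) \<le> NN"
proof -
  have "exp (- \<beta> * \<tau> / se) = exp (- \<sigma> * ln (real N))" using beta se by (simp add: tau(1))
  also have "\<dots> \<le> exp (- real (k + 1) * ln (real N))" using mult_right_mono[OF sigma, of "ln (real N)"] lnN by (simp only: exp_le_cancel_iff) (simp add: algebra_simps)
  also have "\<dots> = inverse (exp (ln (real N)) ^ (k + 1))" by (simp only: mult_minus_left exp_minus exp_of_nat_mult)
  also have "\<dots> = NN" using N by (simp add: NN_def power_one_over inverse_eq_divide)
  finally show ?thesis .
qed

lemma E_coarse: "\<tau> \<le> x \<Longrightarrow> x \<le> 1 - \<tau> \<Longrightarrow> E x \<le> 2 * NN"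
proof -
  assume x: "\<tau> \<le> x" "x \<le> 1 - \<tau>"
  have "exp (- \<beta> * x / se) \<le> exp (- \<beta> * \<tau> / se)" "exp (- \<beta> * (1 - x) / se) \<le> exp (- \<beta> * \<tau> / se)"
    using x beta se by (auto simp: divide_right_mono)
  then show ?thesis using exp_tau unfolding E_def by linarith
qed

text \<open>A refined cell is at most \<open>4 * \<sigma> / \<beta>\<close> times \<open>se\<close>
  wide, since \<open>L \<le> 1\<close>, so the exponentials change by a bounded factor across it. A
  projection error can thus be bounded by \<open>E\<close> at the very point considered and stays
  square integrable with the small factor \<open>se\<close>.\<close>

lemma E_cell_compare:
  assumes i: "i \<in> {1..N}" "refined i" and x: "x \<in> {X (i - 1)..X i}" "x' \<in> {X (i - 1)..X i}"
  shows "E x' \<le> exp (4 * \<sigma>) * E x"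
proof -
  have "\<bar>x - x'\<bar> \<le> 4 * \<sigma> / \<beta> * L * se" using x width_fine[OF i] fine_width by auto
  also have "\<dots> \<le> 4 * \<sigma> / \<beta> * 1 * se" using L sigma beta se by (intro mult_right_mono mult_left_mono) auto
  finally have d: "\<bar>x - x'\<bar> \<le> 4 * \<sigma> / \<beta> * se" by simp
  have "\<bar>\<beta> * (x - x') / se\<bar> = \<beta> * \<bar>x - x'\<bar> / se" using beta se by (simp add: abs_mult)
  also have "\<dots> \<le> \<beta> * (4 * \<sigma> / \<beta> * se) / se" using d beta se by (intro divide_right_mono mult_left_mono) auto
  also have "\<dots> = 4 * \<sigma>" using beta se by simp
  finally have d: "\<beta> * (x - x') / se \<le> 4 * \<sigma>" "- (\<beta> * (x - x') / se) \<le> 4 * \<sigma>" unfolding abs_le_iff by auto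
  have "- \<beta> * x' / se = \<beta> * (x - x') / se + (- \<beta> * x / se)" by (simp add: algebra_simps diff_divide_distrib)
  then have "exp (- \<beta> * x' / se) = exp (\<beta> * (x - x') / se) * exp (- \<beta> * x / se)" by (simp only: exp_add)
  also have "\<dots> \<le> exp (4 * \<sigma>) * exp (- \<beta> * x / se)" using d by (intro mult_right_mono) auto
  finally have 1: "exp (- \<beta> * x' / se) \<le> exp (4 * \<sigma>) * exp (- \<beta> * x / se)" .
  have "- \<beta> * (1 - x') / se = - (\<beta> * (x - x') / se) + (- \<beta> * (1 - x) / se)" by (simp add: algebra_simps diff_divide_distrib add_divide_distrib)
  then have "exp (- \<beta> * (1 - x') / se) = exp (- (\<beta> * (x - x') / se)) * exp (- \<beta> * (1 - x) / se)" by (simp only: exp_add)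
  also have "\<dots> \<le> exp (4 * \<sigma>) * exp (- \<beta> * (1 - x) / se)" using d by (intro mult_right_mono) auto
  finally show ?thesis using 1 by (simp add: E_def algebra_simps)
qed

lemma continuous_on_E [continuous_intros]: "continuous_on S E"
  unfolding E_def using se by (intro continuous_intros) auto

text \<open>An antiderivative of twice the sum of the squared exponentials, which dominates the
  square of \<open>E\<close>; summing over cells then telescopes.\<close>

definition "Fint x = se / \<beta> * (exp (- 2 * \<beta> * (1 - x) / se) - exp (- 2 * \<beta> * x / se))" for x

lemma E_square_integral:
  assumes "i \<in> {1..N}"
  shows "integral {X (i - 1)..X i} (\<lambda>x. (E x)\<^sup>2) \<le> Fint (X i) - Fint (X (i - 1))"
proof -
  let ?f = "\<lambda>x. 2 * exp (- 2 * \<beta> * (1 - x) / se) + 2 * exp (- 2 * \<beta> * x / se)"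
  have I: "(?f has_integral Fint (X i) - Fint (X (i - 1))) {X (i - 1)..X i}"
  proof (rule fundamental_theorem_of_calculus)
    show "X (i - 1) \<le> X i" using X_less[OF assms] by simp
    show "(Fint has_vector_derivative ?f x) (at x within {X (i - 1)..X i})" for x
      unfolding Fint_def has_real_derivative_iff_has_vector_derivative[symmetric] using se(1) beta
      by (auto intro!: derivative_eq_intros simp: field_simps)
  qed
  have "(E x)\<^sup>2 \<le> ?f x" for x
  proof -
    have "(E x)\<^sup>2 \<le> 2 * (exp (- \<beta> * x / se))\<^sup>2 + 2 * (exp (- \<beta> * (1 - x) / se))\<^sup>2"
      unfolding E_def using sum_squares_bound[of "exp (- \<beta> * x / se)" "exp (- \<beta> * (1 - x) / se)"] by (simp add: power2_sum)
    also have "\<dots> = ?f x" by (simp add: exp_double[symmetric] mult.assoc)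
    finally show ?thesis .
  qed
  then have "integral {X (i - 1)..X i} (\<lambda>x. (E x)\<^sup>2) \<le> integral {X (i - 1)..X i} ?f"
    by (intro integral_le has_integral_integrable[OF I] integrable_continuous_interval continuous_intros) auto
  then show ?thesis using I by (simp add: integral_unique)
qed

lemma telescope: "a \<le> b \<Longrightarrow> (\<Sum>i\<in>{a<..b}. f i - f (i - 1)) = f b - (f a :: real)" for a b :: nat
proof (induction b rule: dec_induct)
  case (step n)
  have "{a<..Suc n} = insert (Suc n) {a<..n}" using step.hyps by auto
  then show ?case using step.IH by simp
qed simp

lemma telescope_cells: "(\<Sum>i=1..N. f i - f (i - 1)) = f N - (f 0 :: real)"
  using telescope[of 0 N f] by (simp add: atLeastSucAtMost_greaterThanAtMost[symmetric])

lemma sum_E_square: "(\<Sum>i=1..N. integral {X (i - 1)..X i} (\<lambda>x. (E x)\<^sup>2)) \<le> 2 * se / \<beta>"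
proof -
  have "(\<Sum>i=1..N. integral {X (i - 1)..X i} (\<lambda>x. (E x)\<^sup>2)) \<le> (\<Sum>i=1..N. Fint (X i) - Fint (X (i - 1)))"
    using E_square_integral by (intro sum_mono) auto
  also have "\<dots> = Fint 1 - Fint 0" using telescope_cells[of "\<lambda>i. Fint (X i)"] X_special by simp
  also have "\<dots> \<le> se / \<beta> * 2" unfolding Fint_def right_diff_distrib[symmetric] using se beta by (intro mult_left_mono) auto
  finally show ?thesis by (simp add: mult.commute)
qed

text \<open>Integrating the exponentials from \<open>\<tau>\<close> on keeps the factor
  \<open>se\<close> next to \<open>NN\<^sup>2\<close>; the pointwise bound \<open>E_coarse\<close>
  alone would lose it.\<close>

lemma sum_E_square_coarse: "(\<Sum>i\<in>{lo<..m}. integral {X (i - 1)..X i} (\<lambda>x. (E x)\<^sup>2)) \<le> 2 * se / \<beta> * NN\<^sup>2"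
proof -
  have "(\<Sum>i\<in>{lo<..m}. integral {X (i - 1)..X i} (\<lambda>x. (E x)\<^sup>2)) \<le> (\<Sum>i\<in>{lo<..m}. Fint (X i) - Fint (X (i - 1)))"
    using E_square_integral index_order by (intro sum_mono) auto
  also have "\<dots> = Fint (1 - \<tau>) - Fint \<tau>" using telescope[of lo m "\<lambda>i. Fint (X i)"] X_special index_order by simp
  also have "\<dots> = se / \<beta> * (2 * exp (- 2 * \<beta> * \<tau> / se) - 2 * exp (- 2 * \<beta> * (1 - \<tau>) / se))"
    by (simp add: Fint_def algebra_simps)
  also have "\<dots> \<le> se / \<beta> * (2 * NN\<^sup>2)"
  proof (intro mult_left_mono)
    have "exp (- 2 * \<beta> * \<tau> / se) = (exp (- \<beta> * \<tau> / se))\<^sup>2" by (simp add: exp_double[symmetric])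
    also have "\<dots> \<le> NN\<^sup>2" using exp_tau by (intro power_mono) auto
    finally show "2 * exp (- 2 * \<beta> * \<tau> / se) - 2 * exp (- 2 * \<beta> * (1 - \<tau>) / se) \<le> 2 * NN\<^sup>2"
      by (simp add: add_increasing2 diff_le_eq)
  qed (use se beta in auto)
  finally show ?thesis by (simp add: mult_ac)
qed

lemma sum_fine_width: "(\<Sum>i=1..N. if refined i then X i - X (i - 1) else 0) = 2 * \<tau>"
proof -
  have "(\<Sum>i=1..N. X i - X (i - 1)) = (\<Sum>i=1..N. if refined i then X i - X (i - 1) else 0) + (\<Sum>i=1..N. if refined i then 0 else X i - X (i - 1))"
    unfolding sum.distrib[symmetric] by (intro sum.cong) auto
  also have "(\<Sum>i=1..N. if refined i then 0 else X i - X (i - 1)) = (\<Sum>i\<in>{lo<..m}. X i - X (i - 1))"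
    using index_order by (intro sum.mono_neutral_cong_right) (auto simp: refined_def)
  also have "\<dots> = 1 - 2 * \<tau>" using telescope[of lo m X] index_order X_special by simp
  finally show ?thesis using telescope_cells[of X] X_special by simp
qed

text \<open>\<open>kap\<close> measures the pointwise error of the projections of \<open>u\<close>; \<open>Psi\<close> below, whose square sums to
  \<open>O(se * L2)\<close>, measures the errors of the scaled derivatives.\<close>

definition "kap i x = (if refined i then L ^ (k + 1) * E x else 0) + NN" for i x

lemma kap: "0 < kap i x" "NN \<le> kap i x" "x \<in> {0..1} \<Longrightarrow> kap i x \<le> 3 * L ^ (k + 1)"
proof -
  have p: "0 < L ^ (k + 1) * E x" using L E_pos by simp
  then show "0 < kap i x" "NN \<le> kap i x" using NN(1) less_imp_le[OF p] by (auto simp: kap_def add_pos_pos)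
  assume x: "x \<in> {0..1}"
  have "L ^ (k + 1) * E x \<le> L ^ (k + 1) * 2" using E_le_2[OF x] L by (intro mult_left_mono) auto
  then have "L ^ (k + 1) * E x + NN \<le> 3 * L ^ (k + 1)" "NN \<le> 3 * L ^ (k + 1)" using NN(2) p NN(1) by linarith+
  then show "kap i x \<le> 3 * L ^ (k + 1)" unfolding kap_def by simp
qed

text \<open>In the first summand \<open>E x\<close> stems from the layers and \<open>se\<close> from
  the smooth part. The second accounts for the ramps on refined cells and, on coarse cells, for the
  layer part that the interpolant of the derivative omits.\<close>

definition "Psi i x = L ^ (k + 1) * (E x + se) + (if refined i then NN else E x)" for i x

lemma Psi_ge: "0 < Psi i x" "L ^ (k + 1) * E x \<le> Psi i x" "L ^ (k + 1) * se \<le> Psi i x" "L ^ (k + 1) * (E x + se) \<le> Psi i x"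
  "refined i \<Longrightarrow> NN \<le> Psi i x" "\<not> refined i \<Longrightarrow> E x \<le> Psi i x" "refined i \<Longrightarrow> L ^ (k + 1) * E x + NN \<le> Psi i x"
proof -
  have p: "0 < L ^ (k + 1)" "0 < L ^ (k + 1) * E x" "0 < L ^ (k + 1) * se" using L E_pos se by auto
  then show "0 < Psi i x" "L ^ (k + 1) * E x \<le> Psi i x" "L ^ (k + 1) * se \<le> Psi i x" "L ^ (k + 1) * (E x + se) \<le> Psi i x"
     "refined i \<Longrightarrow> NN \<le> Psi i x" "\<not> refined i \<Longrightarrow> E x \<le> Psi i x" "refined i \<Longrightarrow> L ^ (k + 1) * E x + NN \<le> Psi i x"
    using NN(1) E_pos[of x] by (auto simp: Psi_def distrib_left intro!: add_pos_pos)
qed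

text \<open>The 3 comes from squaring a sum of three terms, \<open>4 / \<beta>\<close> from two
  integrals of the squared layer function, 1 from \<open>\<epsilon> \<le> se\<close>, and
  \<open>2 * \<sigma> / \<beta>\<close> from the width \<open>2 * \<tau>\<close> of the refined
  part.\<close>

definition "cPsi = 3 * (4 / \<beta> + 1 + 2 * \<sigma> / \<beta>)"
definition "L2 = L ^ (2 * (k + 1))"

lemma L2: "0 < L2" "L2 \<le> 1" "(L ^ (k + 1))\<^sup>2 = L2" "NN\<^sup>2 \<le> L2"
proof -
  show "0 < L2" using L by (simp add: L2_def)
  show "L2 \<le> 1" using L unfolding L2_def by (intro power_le_one) auto
  show *: "(L ^ (k + 1))\<^sup>2 = L2" unfolding L2_def by (metis mult.commute power_mult)
  show "NN\<^sup>2 \<le> L2" unfolding *[symmetric] using NN by (intro power_mono) auto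
qed

lemma continuous_on_Psi [continuous_intros]: "continuous_on S (Psi i)"
  unfolding Psi_def by (cases "refined i") (auto intro!: continuous_intros)

text \<open>Every term supplies the factor \<open>se\<close> in its own way: layers by integration,
  the smooth part by \<open>\<epsilon> \<le> se\<close>, the term \<open>NN\<close> because it lives
  on refined cells of total width \<open>2 * \<tau>\<close>.\<close>

lemma sum_Psi_square: "(\<Sum>i=1..N. integral {X (i - 1)..X i} (\<lambda>x. (Psi i x)\<^sup>2)) \<le> cPsi * se * L2"
proof -
  let ?Q = "\<lambda>i. integral {X (i - 1)..X i} (\<lambda>x. (E x)\<^sup>2)"
  let ?h = "\<lambda>i. X i - X (i - 1)"
  have sq3: "(a + b + c)\<^sup>2 \<le> 3 * (a\<^sup>2 + b\<^sup>2 + c\<^sup>2)" for a b c :: real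
    using sum_squares_bound[of a b] sum_squares_bound[of a c] sum_squares_bound[of b c] by (simp add: power2_sum algebra_simps power2_eq_square)
  have le: "integral {X (i - 1)..X i} (\<lambda>x. (Psi i x)\<^sup>2) \<le> 3 * (L2 * ?Q i + L2 * \<epsilon> * ?h i + (if refined i then NN\<^sup>2 * ?h i else ?Q i))"
    if i: "i \<in> {1..N}" for i
  proof -
    have "(Psi i x)\<^sup>2 \<le> 3 * (L2 * (E x)\<^sup>2 + L2 * \<epsilon> + (if refined i then NN\<^sup>2 else (E x)\<^sup>2))" for x
      using sq3[of "L ^ (k + 1) * E x" "L ^ (k + 1) * se" "if refined i then NN else E x"]
      unfolding power_mult_distrib L2(3) se(3) by (simp add: Psi_def distrib_left if_distrib[of "\<lambda>x. x\<^sup>2"] if_distribR cong: if_cong)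
    then have "integral {X (i - 1)..X i} (\<lambda>x. (Psi i x)\<^sup>2) \<le> integral {X (i - 1)..X i} (\<lambda>x. 3 * (L2 * (E x)\<^sup>2 + L2 * \<epsilon> + (if refined i then NN\<^sup>2 else (E x)\<^sup>2)))"
      by (intro integral_le integrable_continuous_interval) (cases "refined i"; auto intro!: continuous_intros)+
    also have "\<dots> = 3 * (L2 * ?Q i + L2 * \<epsilon> * ?h i + (if refined i then NN\<^sup>2 * ?h i else ?Q i))"
    proof (rule integral_unique)
      have Q: "((\<lambda>x. (E x)\<^sup>2) has_integral ?Q i) {X (i - 1)..X i}"
        by (intro integrable_integral integrable_continuous_interval continuous_intros)
      have c: "((\<lambda>x. c) has_integral c * ?h i) {X (i - 1)..X i}" for c :: real
        using has_integral_const_real[of c "X (i - 1)" "X i"] X_less[OF i] by (simp add: mult.commute)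
      have f: "((\<lambda>x. if refined i then NN\<^sup>2 else (E x)\<^sup>2) has_integral (if refined i then NN\<^sup>2 * ?h i else ?Q i)) {X (i - 1)..X i}"
        using Q c[of "NN\<^sup>2"] by auto
      show "((\<lambda>x. 3 * (L2 * (E x)\<^sup>2 + L2 * \<epsilon> + (if refined i then NN\<^sup>2 else (E x)\<^sup>2))) has_integral
        3 * (L2 * ?Q i + L2 * \<epsilon> * ?h i + (if refined i then NN\<^sup>2 * ?h i else ?Q i))) {X (i - 1)..X i}"
        by (intro has_integral_mult_right has_integral_add Q c f)
    qed
    finally show ?thesis .
  qed
  have "(\<Sum>i=1..N. integral {X (i - 1)..X i} (\<lambda>x. (Psi i x)\<^sup>2)) \<le> (\<Sum>i=1..N. 3 * (L2 * ?Q i + L2 * \<epsilon> * ?h i + (if refined i then NN\<^sup>2 * ?h i else ?Q i)))"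
    using le by (intro sum_mono) auto
  also have "\<dots> = 3 * (L2 * (\<Sum>i=1..N. ?Q i) + L2 * \<epsilon> * (\<Sum>i=1..N. ?h i) + (\<Sum>i=1..N. if refined i then NN\<^sup>2 * ?h i else ?Q i))"
    by (simp only: sum.distrib sum_distrib_left distrib_left)
  also have "(\<Sum>i=1..N. ?h i) = 1" using telescope_cells[of X] X_special by simp
  also have "(\<Sum>i=1..N. if refined i then NN\<^sup>2 * ?h i else ?Q i) = (\<Sum>i=1..N. NN\<^sup>2 * (if refined i then ?h i else 0)) + (\<Sum>i=1..N. if refined i then 0 else ?Q i)"
    unfolding sum.distrib[symmetric] by (intro sum.cong) auto
  also have "(\<Sum>i=1..N. NN\<^sup>2 * (if refined i then ?h i else 0)) = NN\<^sup>2 * (2 * \<tau>)"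
    unfolding sum_distrib_left[symmetric] sum_fine_width ..
  also have "(\<Sum>i=1..N. if refined i then 0 else ?Q i) = (\<Sum>i\<in>{lo<..m}. ?Q i)"
    using index_order by (intro sum.mono_neutral_cong_right) (auto simp: refined_def)
  also have "3 * (L2 * (\<Sum>i=1..N. ?Q i) + L2 * \<epsilon> * 1 + (NN\<^sup>2 * (2 * \<tau>) + (\<Sum>i\<in>{lo<..m}. ?Q i)))
     \<le> 3 * (L2 * (2 * se / \<beta>) + L2 * se * 1 + (2 * \<sigma> / \<beta> * se * L2 + 2 * se / \<beta> * L2))"
  proof (intro mult_left_mono add_mono sum_E_square)
    have "NN\<^sup>2 * (2 * \<tau>) = 2 * \<sigma> / \<beta> * se * (ln (real N) * NN\<^sup>2)" by (simp add: tau(1) mult_ac)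
    also have "\<dots> \<le> 2 * \<sigma> / \<beta> * se * L2" using lnN_NN sigma beta se by (intro mult_left_mono) (auto simp: L2_def)
    finally show "NN\<^sup>2 * (2 * \<tau>) \<le> 2 * \<sigma> / \<beta> * se * L2" .
    have "2 * se / \<beta> * NN\<^sup>2 \<le> 2 * se / \<beta> * L2" using L2 se beta by (intro mult_left_mono) auto
    then show "(\<Sum>i\<in>{lo<..m}. ?Q i) \<le> 2 * se / \<beta> * L2" using sum_E_square_coarse by linarith
  qed (use L2 se in auto)
  also have "\<dots> = cPsi * se * L2" using beta by (simp add: cPsi_def field_simps)
  finally show ?thesis .
qed

text \<open>A common constant for three situations: \<open>2 ^ (k + 1)\<close> comes from cell
  widths up to \<open>2 / N\<close>, the power of \<open>4 * \<sigma> / \<beta>\<close> from the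
  refined width, and \<open>exp (4 * \<sigma>)\<close> from comparing \<open>E\<close> within a
  refined cell. It also dominates the crude stability bound on coarse cells.\<close>

definition "cA = 4 * cpi k * (2 ^ (k + 1) + (4 * \<sigma> / \<beta>) ^ (k + 1) * exp (4 * \<sigma>))"

lemma cA: "1 \<le> cA" "2 * cpi k * 2 ^ (k + 1) \<le> cA" "2 * cpi k * ((4 * \<sigma> / \<beta>) ^ (k + 1) * exp (4 * \<sigma>)) \<le> cA" "(1 + cpi k) * 2 \<le> cA"
proof -
  have c: "1 \<le> cpi k" by (rule cpi_ge)
  define a b where "a = (2::real) ^ (k + 1)" and "b = (4 * \<sigma> / \<beta>) ^ (k + 1) * exp (4 * \<sigma>)"
  have a: "1 \<le> a" unfolding a_def by (rule one_le_power) simp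
  have b: "0 \<le> b" unfolding b_def using sigma beta by simp
  have e: "cA = 4 * (cpi k * a) + 4 * (cpi k * b)" by (simp add: cA_def a_def b_def algebra_simps)
  have p: "0 \<le> cpi k * b" "cpi k \<le> cpi k * a" using a b c by auto
  then show "1 \<le> cA" "2 * cpi k * 2 ^ (k + 1) \<le> cA" "2 * cpi k * ((4 * \<sigma> / \<beta>) ^ (k + 1) * exp (4 * \<sigma>)) \<le> cA" "(1 + cpi k) * 2 \<le> cA"
    unfolding a_def[symmetric] b_def[symmetric] e mult.assoc distrib_right using p c by linarith+
qed

section \<open>Pointwise projection errors of smooth functions and of layers\<close>

lemma approx_smooth:
  assumes i: "i \<in> {1..N}" and z: "z = 0 \<or> z = 1"
    and f: "\<And>j x. x \<in> {X (i - 1)..X i} \<Longrightarrow> j \<le> k \<Longrightarrow> (f j has_real_derivative f (Suc j) x) (at x within {X (i - 1)..X i})"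
    and a: "\<And>x. x \<in> {X (i - 1)..X i} \<Longrightarrow> \<bar>f (Suc k) x\<bar> \<le> a" and x: "x \<in> {X (i - 1)..X i}"
  shows "\<bar>f 0 x - prj k z (X (i - 1)) (X i) (f 0) x\<bar> \<le> cA * a * NN"
proof -
  have a0: "0 \<le> a" using a[OF x] by simp
  have "\<bar>f 0 x - prj k z (X (i - 1)) (X i) (f 0) x\<bar> \<le> 2 * cpi k * (X i - X (i - 1)) ^ Suc k * a"
    by (rule prj_approx[where f = f, OF X_less[OF i] z f a x])
  also have "\<dots> \<le> 2 * cpi k * (2 / real N) ^ Suc k * a"
    using width_le[OF i] X_less[OF i] a0 cpi_ge[of k] by (intro mult_right_mono mult_left_mono power_mono) auto
  also have "(2 / real N) ^ Suc k = 2 ^ (k + 1) * NN" by (simp add: NN_def power_divide)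
  also have "2 * cpi k * (2 ^ (k + 1) * NN) * a = (2 * cpi k * 2 ^ (k + 1)) * (a * NN)" by simp
  also have "\<dots> \<le> cA * (a * NN)" using cA a0 NN by (intro mult_right_mono) auto
  finally show ?thesis by (simp add: mult.assoc)
qed

text \<open>Two regimes. On refined cells the powers of \<open>se\<close> in the width cancel those
  in the derivative bound and \<open>L ^ (k + 1)\<close> remains. On coarse cells nothing is
  approximated: the function and its projection are both of size \<open>NN\<close>.\<close>

lemma approx_layer:
  assumes i: "i \<in> {1..N}" and z: "z = 0 \<or> z = 1"
    and f: "\<And>j x. x \<in> {X (i - 1)..X i} \<Longrightarrow> j \<le> k \<Longrightarrow> (f j has_real_derivative f (Suc j) x) (at x within {X (i - 1)..X i})"
    and a: "\<And>x. x \<in> {X (i - 1)..X i} \<Longrightarrow> \<bar>f 0 x\<bar> \<le> a * E x" "\<And>x. x \<in> {X (i - 1)..X i} \<Longrightarrow> \<bar>f (Suc k) x\<bar> \<le> a / se ^ (k + 1) * E x"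
    and x: "x \<in> {X (i - 1)..X i}"
  shows "\<bar>f 0 x - prj k z (X (i - 1)) (X i) (f 0) x\<bar> \<le> cA * a * kap i x"
proof -
  have "0 \<le> a * E x" using a(1)[OF x] by simp
  then have a0: "0 \<le> a" using E_pos[of x] by (simp add: zero_le_mult_iff)
  show ?thesis
  proof (cases "refined i")
    case True
    have "\<bar>f (Suc k) x'\<bar> \<le> a / se ^ (k + 1) * (exp (4 * \<sigma>) * E x)" if x': "x' \<in> {X (i - 1)..X i}" for x'
      using a(2)[OF x'] E_cell_compare[OF i True x x'] a0 se by (meson divide_nonneg_nonneg less_imp_le mult_left_mono order_trans zero_le_power)
    then have "\<bar>f 0 x - prj k z (X (i - 1)) (X i) (f 0) x\<bar> \<le> 2 * cpi k * (X i - X (i - 1)) ^ Suc k * (a / se ^ (k + 1) * (exp (4 * \<sigma>) * E x))"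
      by (intro prj_approx[where f = f, OF X_less[OF i] z f _ x]) auto
    also have "\<dots> = 2 * cpi k * ((4 * \<sigma> / \<beta>) ^ (k + 1) * L ^ (k + 1) * se ^ (k + 1)) * (a / se ^ (k + 1) * (exp (4 * \<sigma>) * E x))"
      unfolding width_fine[OF i True] fine_width by (simp only: power_mult_distrib Suc_eq_plus1)
    also have "\<dots> = 2 * cpi k * ((4 * \<sigma> / \<beta>) ^ (k + 1) * exp (4 * \<sigma>)) * (a * (L ^ (k + 1) * E x))" using se by simp
    also have "\<dots> \<le> cA * (a * (L ^ (k + 1) * E x))" using cA a0 L E_pos[of x] by (intro mult_right_mono) auto
    also have "\<dots> \<le> cA * (a * kap i x)" using cA a0 True NN by (intro mult_left_mono) (auto simp: kap_def)
    finally show ?thesis by (simp add: mult.assoc)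
  next
    case False
    then have ic: "i \<in> {lo<..m}" using coarse_iff[of i] by blast
    have b: "\<bar>f 0 x'\<bar> \<le> a * (2 * NN)" if x': "x' \<in> {X (i - 1)..X i}" for x'
      using a(1)[OF x'] E_coarse[of x'] coarse_cell[OF ic x'] a0 by (meson mult_left_mono order_trans)
    have "continuous_on {X (i - 1)..X i} (f 0)" by (rule DERIV_continuous_on, rule f) auto
    then have "\<bar>prj k z (X (i - 1)) (X i) (f 0) x\<bar> \<le> cpi k * (a * (2 * NN))"
      by (intro prj_bound[OF X_less[OF i] _ b z x])
    then have "\<bar>f 0 x - prj k z (X (i - 1)) (X i) (f 0) x\<bar> \<le> (1 + cpi k) * 2 * (a * NN)" using b[OF x] by (simp add: algebra_simps)
    also have "\<dots> \<le> cA * (a * NN)" using cA a0 NN by (intro mult_right_mono) auto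
    finally show ?thesis using False by (simp add: kap_def mult.assoc)
  qed
qed

end

subsection \<open>Projections of the decomposed solution\<close>

text \<open>A function bundled with its mixed partial derivatives: \<open>F i j\<close> stands for
  the derivative of order \<open>i\<close> in \<open>x\<close> and \<open>j\<close> in
  \<open>y\<close>. Sums and the exchange of variables then act on all derivatives at once, without
  iterating \<open>dx\<close> and \<open>dy\<close>.\<close>

type_synonym family = "nat \<Rightarrow> nat \<Rightarrow> real \<Rightarrow> real \<Rightarrow> real"

definition smooth_family :: "nat \<Rightarrow> family \<Rightarrow> bool" where
  "smooth_family n F \<longleftrightarrow> (\<forall>i\<le>n. \<forall>j\<le>n. continuous_on ({0..1} \<times> {0..1}) (\<lambda>(x, y). F i j x y) \<and>
     (\<forall>x\<in>{0..1}. \<forall>y\<in>{0..1}.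
       (i < n \<longrightarrow> ((\<lambda>x. F i j x y) has_real_derivative F (Suc i) j x y) (at x within {0..1})) \<and>
       (j < n \<longrightarrow> ((\<lambda>y. F i j x y) has_real_derivative F i (Suc j) x y) (at y within {0..1}))))"

lemma smooth_familyD:
  assumes "smooth_family n F" "i \<le> n" "j \<le> n"
  shows "continuous_on ({0..1} \<times> {0..1}) (\<lambda>(x, y). F i j x y)"
    and "i < n \<Longrightarrow> x \<in> {0..1} \<Longrightarrow> y \<in> {0..1} \<Longrightarrow> ((\<lambda>x. F i j x y) has_real_derivative F (Suc i) j x y) (at x within {0..1})"
    and "j < n \<Longrightarrow> x \<in> {0..1} \<Longrightarrow> y \<in> {0..1} \<Longrightarrow> ((\<lambda>y. F i j x y) has_real_derivative F i (Suc j) x y) (at y within {0..1})"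
  using assms unfolding smooth_family_def by blast+

lemma smooth_family_section:
  assumes "smooth_family n F" "i \<le> n" "j \<le> n"
  shows "x \<in> {0..1} \<Longrightarrow> continuous_on {0..1} (F i j x)" "y \<in> {0..1} \<Longrightarrow> continuous_on {0..1} (\<lambda>x. F i j x y)"
proof -
  show "continuous_on {0..1} (F i j x)" if "x \<in> {0..1}"
    using that by (intro continuous_on_compose2[OF smooth_familyD(1)[OF assms], of _ "\<lambda>t. (x, t)", simplified] continuous_intros) auto
  show "continuous_on {0..1} (\<lambda>x. F i j x y)" if "y \<in> {0..1}"
    using that by (intro continuous_on_compose2[OF smooth_familyD(1)[OF assms], of _ "\<lambda>s. (s, y)", simplified] continuous_intros) auto
qed

definition fam_add :: "family \<Rightarrow> family \<Rightarrow> family" where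
  "fam_add F G = (\<lambda>i j x y. F i j x y + G i j x y)"

lemma smooth_family_add:
  assumes F: "smooth_family n F" and G: "smooth_family n G"
  shows "smooth_family n (fam_add F G)"
proof -
  have "continuous_on ({0..1} \<times> {0..1}) (\<lambda>p. (\<lambda>(x, y). F i j x y) p + (\<lambda>(x, y). G i j x y) p)" if "i \<le> n" "j \<le> n" for i j
    using that by (intro continuous_on_add smooth_familyD(1)[OF F] smooth_familyD(1)[OF G])
  then show ?thesis unfolding smooth_family_def fam_add_def
    by (auto simp: case_prod_beta intro!: DERIV_add smooth_familyD(2,3)[OF F] smooth_familyD(2,3)[OF G])
qed

definition fam_swap :: "family \<Rightarrow> family" where
  "fam_swap F = (\<lambda>i j x y. F j i y x)"

lemma smooth_family_swap:
  assumes F: "smooth_family n F"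
  shows "smooth_family n (fam_swap F)"
proof -
  have "continuous_on ({0..1} \<times> {0..1}) (\<lambda>p. (\<lambda>(x, y). F j i x y) (snd p, fst p))" if "i \<le> n" "j \<le> n" for i j
    by (rule continuous_on_compose2[OF smooth_familyD(1)[OF F that(2,1)]]) (auto intro!: continuous_intros)
  then show ?thesis unfolding smooth_family_def fam_swap_def
    by (auto simp: case_prod_beta intro!: smooth_familyD(2,3)[OF F])
qed

context shishkin
begin

text \<open>\<open>w\<close> and \<open>v\<close> collect the layers at the vertical and the horizontal sides, \<open>z\<close> the four corner layers.\<close>

definition decomp :: "family \<Rightarrow> family \<Rightarrow> family \<Rightarrow> family \<Rightarrow> bool" where
  "decomp s w v z \<longleftrightarrow> smooth_family (k + 2) s \<and> smooth_family (k + 2) w \<and> smooth_family (k + 2) v \<and> smooth_family (k + 2) z \<and>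
     (\<forall>i\<le>k + 2. \<forall>j\<le>k + 2. \<forall>x\<in>{0..1}. \<forall>y\<in>{0..1}.
        \<bar>s i j x y\<bar> \<le> C1 \<and> \<bar>w i j x y\<bar> \<le> C1 / se ^ i * E x \<and> \<bar>v i j x y\<bar> \<le> C1 / se ^ j * E y
        \<and> \<bar>z i j x y\<bar> \<le> C1 / se ^ (i + j) * E x * E y)"

lemma decomp_swap: "decomp s w v z \<Longrightarrow> decomp (fam_swap s) (fam_swap v) (fam_swap w) (fam_swap z)"
proof -
  assume d: "decomp s w v z"
  have "\<bar>fam_swap s i j x y\<bar> \<le> C1 \<and> \<bar>fam_swap v i j x y\<bar> \<le> C1 / se ^ i * E x \<and> \<bar>fam_swap w i j x y\<bar> \<le> C1 / se ^ j * E y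
     \<and> \<bar>fam_swap z i j x y\<bar> \<le> C1 / se ^ (i + j) * E x * E y" if "i \<le> k + 2" "j \<le> k + 2" "x \<in> {0..1}" "y \<in> {0..1}" for i j x y
  proof -
    have "C1 / se ^ (j + i) * E y * E x = C1 / se ^ (i + j) * E x * E y" by (simp add: add.commute mult_ac)
    moreover have "\<bar>s j i y x\<bar> \<le> C1 \<and> \<bar>w j i y x\<bar> \<le> C1 / se ^ j * E y \<and> \<bar>v j i y x\<bar> \<le> C1 / se ^ i * E x \<and> \<bar>z j i y x\<bar> \<le> C1 / se ^ (j + i) * E y * E x"
      using d that unfolding decomp_def by blast
    ultimately show ?thesis by (simp only: fam_swap_def)
  qed
  then show ?thesis using d unfolding decomp_def by (intro conjI smooth_family_swap) blast+
qed

definition total :: "family \<Rightarrow> family \<Rightarrow> family \<Rightarrow> family \<Rightarrow> family" where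
  "total s w v z = fam_add (fam_add s v) (fam_add w z)"

lemma total_swap: "fam_swap (total s w v z) = total (fam_swap s) (fam_swap v) (fam_swap w) (fam_swap z)"
  by (simp add: total_def fam_swap_def fam_add_def fun_eq_iff)

text \<open>The \<open>y\<close>-projection is always exact at the upper end of the cell.
  \<open>PX\<close> keeps its endpoint as a parameter: 1 for \<open>u\<close> and 0 for the
  derivative entering \<open>p\<close>, matching the traces taken by the fluxes.\<close>

definition PY :: "nat \<Rightarrow> (real \<Rightarrow> real \<Rightarrow> real) \<Rightarrow> real \<Rightarrow> real \<Rightarrow> real" where
  "PY j F x y = prj k 1 (X (j - 1)) (X j) (F x) y"

definition PX :: "real \<Rightarrow> nat \<Rightarrow> (real \<Rightarrow> real) \<Rightarrow> real \<Rightarrow> real" where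
  "PX z i f x = prj k z (X (i - 1)) (X i) f x"

lemma cell_subset': "i \<in> {1..N} \<Longrightarrow> {X (i - 1)..X i} \<subseteq> {0..1}"
  using cell_subset by blast

lemma PY_deriv:
  assumes F: "smooth_family n F" and i: "i < n" "j0 \<le> n" and j: "j \<in> {1..N}" and x: "x \<in> {0..1}"
  shows "((\<lambda>x. PY j (F i j0) x y) has_real_derivative PY j (F (Suc i) j0) x y) (at x within {0..1})"
  unfolding PY_def
proof (rule prj_has_derivative)
  show "((\<lambda>x. F i j0 x y) has_real_derivative F (Suc i) j0 x y) (at x within {0..1})" if "x \<in> {0..1}" "y \<in> {X (j - 1)..X j}" for x y
    using smooth_familyD(2)[OF F, of i j0 x y] i that cell_subset[OF j] by auto
  show "continuous_on {X (j - 1)..X j} (F i j0 x)" if "x \<in> {0..1}" for x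
    using continuous_on_subset[OF smooth_family_section(1)[OF F _ _ that] cell_subset'[OF j]] i by simp
  show "continuous_on ({0..1} \<times> {X (j - 1)..X j}) (\<lambda>(x, y). F (Suc i) j0 x y)"
    using i cell_subset'[OF j] by (intro continuous_on_subset[OF smooth_familyD(1)[OF F]]) auto
qed (use X_less[OF j] x in auto)

lemma PY_continuous:
  assumes F: "smooth_family n F" and i: "i \<le> n" "j0 \<le> n" and j: "j \<in> {1..N}"
  shows "continuous_on {0..1} (\<lambda>x. PY j (F i j0) x y)"
  unfolding PY_def using cell_subset'[OF j] i
  by (intro prj_continuous_param X_less[OF j] continuous_on_subset[OF smooth_familyD(1)[OF F]]) auto

lemma PY_bound:
  assumes F: "smooth_family n F" and i: "i \<le> n" "j0 \<le> n" and j: "j \<in> {1..N}" and x: "x \<in> {0..1}" and y: "y \<in> {X (j - 1)..X j}"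
    and a: "\<And>t. t \<in> {0..1} \<Longrightarrow> \<bar>F i j0 x t\<bar> \<le> a"
  shows "\<bar>PY j (F i j0) x y\<bar> \<le> cpi k * a"
  unfolding PY_def using a cell_subset'[OF j] y
  by (intro prj_bound X_less[OF j] continuous_on_subset[OF smooth_family_section(1)[OF F i x]]) auto

lemma PY_add:
  assumes F: "smooth_family n F" "smooth_family n G" and i: "i \<le> n" "j0 \<le> n" and j: "j \<in> {1..N}" and x: "x \<in> {0..1}"
  shows "PY j (fam_add F G i j0) x y = PY j (F i j0) x y + PY j (G i j0) x y"
  unfolding PY_def fam_add_def
  by (intro prj_add X_less[OF j] continuous_on_subset[OF smooth_family_section(1)[OF F(1) i x] cell_subset'[OF j]]
      continuous_on_subset[OF smooth_family_section(1)[OF F(2) i x] cell_subset'[OF j]])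

lemma Y_smooth:
  assumes F: "smooth_family (k + 2) F" and i: "i \<le> k + 2" and j: "j \<in> {1..N}" and x: "x \<in> {0..1}" and y: "y \<in> {X (j - 1)..X j}"
    and a: "\<And>t. t \<in> {0..1} \<Longrightarrow> \<bar>F i (Suc k) x t\<bar> \<le> a"
  shows "\<bar>F i 0 x y - PY j (F i 0) x y\<bar> \<le> cA * a * NN"
  unfolding PY_def
proof (rule approx_smooth[where f = "\<lambda>l. F i l x", OF j _ _ a y])
  show "((\<lambda>t. F i l x t) has_real_derivative F i (Suc l) x t) (at t within {X (j - 1)..X j})" if "t \<in> {X (j - 1)..X j}" "l \<le> k" for l t
    using smooth_familyD(3)[OF F, of i l x t] i x that cell_subset[OF j]
    by (intro has_field_derivative_subset[OF _ cell_subset'[OF j]]) auto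
qed (use cell_subset[OF j] in auto)

lemma Y_layer:
  assumes F: "smooth_family (k + 2) F" and i: "i \<le> k + 2" and j: "j \<in> {1..N}" and x: "x \<in> {0..1}" and y: "y \<in> {X (j - 1)..X j}"
    and a: "\<And>t. t \<in> {0..1} \<Longrightarrow> \<bar>F i 0 x t\<bar> \<le> a * E t" "\<And>t. t \<in> {0..1} \<Longrightarrow> \<bar>F i (Suc k) x t\<bar> \<le> a / se ^ (k + 1) * E t"
  shows "\<bar>F i 0 x y - PY j (F i 0) x y\<bar> \<le> cA * a * kap j y"
  unfolding PY_def
proof (rule approx_layer[where f = "\<lambda>l. F i l x", OF j _ _ a y])
  show "((\<lambda>t. F i l x t) has_real_derivative F i (Suc l) x t) (at t within {X (j - 1)..X j})" if "t \<in> {X (j - 1)..X j}" "l \<le> k" for l t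
    using smooth_familyD(3)[OF F, of i l x t] i x that cell_subset[OF j]
    by (intro has_field_derivative_subset[OF _ cell_subset'[OF j]]) auto
qed (use cell_subset[OF j] in auto)

text \<open>Here \<open>r\<close> selects \<open>u\<close> or its first \<open>x\<close>-derivative.
  The approximation order \<open>k + 1\<close> for the latter needs \<open>k + 2\<close>
  derivatives, the order up to which the decomposition is controlled.\<close>

lemma X_smooth:
  assumes F: "smooth_family (k + 2) F" and r: "r \<le> 1" and j: "j \<in> {1..N}" and i: "i \<in> {1..N}" and y: "y \<in> {X (j - 1)..X j}"
    and x: "x \<in> {X (i - 1)..X i}" and z: "z = 0 \<or> z = 1"
    and a: "\<And>x t. x \<in> {0..1} \<Longrightarrow> t \<in> {0..1} \<Longrightarrow> \<bar>F (Suc k + r) 0 x t\<bar> \<le> a"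
  shows "\<bar>PY j (F r 0) x y - PX z i (\<lambda>x. PY j (F r 0) x y) x\<bar> \<le> cA * (cpi k * a) * NN"
proof -
  have "\<bar>(\<lambda>l x. PY j (F (l + r) 0) x y) 0 x - prj k z (X (i - 1)) (X i) ((\<lambda>l x. PY j (F (l + r) 0) x y) 0) x\<bar> \<le> cA * (cpi k * a) * NN"
  proof (rule approx_smooth[where f = "\<lambda>l x. PY j (F (l + r) 0) x y", OF i z _ _ x])
    show "((\<lambda>x. PY j (F (l + r) 0) x y) has_real_derivative PY j (F (Suc l + r) 0) x y) (at x within {X (i - 1)..X i})" if "x \<in> {X (i - 1)..X i}" "l \<le> k" for l x
      using PY_deriv[OF F, of "l + r" 0 j x y] j r that cell_subset[OF i]
      by (intro has_field_derivative_subset[OF _ cell_subset'[OF i]]) auto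
    show "\<bar>PY j (F (Suc k + r) 0) x y\<bar> \<le> cpi k * a" if "x \<in> {X (i - 1)..X i}" for x
      using r a cell_subset[OF i that] by (intro PY_bound[OF F _ _ j _ y]) auto
  qed
  then show ?thesis by (simp add: PX_def)
qed

lemma X_layer:
  assumes F: "smooth_family (k + 2) F" and r: "r \<le> 1" and j: "j \<in> {1..N}" and i: "i \<in> {1..N}" and y: "y \<in> {X (j - 1)..X j}"
    and x: "x \<in> {X (i - 1)..X i}" and z: "z = 0 \<or> z = 1"
    and a: "\<And>x t. x \<in> {0..1} \<Longrightarrow> t \<in> {0..1} \<Longrightarrow> \<bar>F r 0 x t\<bar> \<le> a * E x"
      "\<And>x t. x \<in> {0..1} \<Longrightarrow> t \<in> {0..1} \<Longrightarrow> \<bar>F (Suc k + r) 0 x t\<bar> \<le> a / se ^ (k + 1) * E x"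
  shows "\<bar>PY j (F r 0) x y - PX z i (\<lambda>x. PY j (F r 0) x y) x\<bar> \<le> cA * (cpi k * a) * kap i x"
proof -
  have "\<bar>(\<lambda>l x. PY j (F (l + r) 0) x y) 0 x - prj k z (X (i - 1)) (X i) ((\<lambda>l x. PY j (F (l + r) 0) x y) 0) x\<bar> \<le> cA * (cpi k * a) * kap i x"
  proof (rule approx_layer[where f = "\<lambda>l x. PY j (F (l + r) 0) x y", OF i z _ _ _ x])
    show "((\<lambda>x. PY j (F (l + r) 0) x y) has_real_derivative PY j (F (Suc l + r) 0) x y) (at x within {X (i - 1)..X i})" if "x \<in> {X (i - 1)..X i}" "l \<le> k" for l x
      using PY_deriv[OF F, of "l + r" 0 j x y] j r that cell_subset[OF i]
      by (intro has_field_derivative_subset[OF _ cell_subset'[OF i]]) auto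
    show "\<bar>PY j (F (0 + r) 0) x y\<bar> \<le> cpi k * a * E x" if "x \<in> {X (i - 1)..X i}" for x
      using PY_bound[OF F, of r 0 j x y "a * E x"] r a(1) cell_subset[OF i that] j y by (auto simp: mult.assoc)
    show "\<bar>PY j (F (Suc k + r) 0) x y\<bar> \<le> cpi k * a / se ^ (k + 1) * E x" if "x \<in> {X (i - 1)..X i}" for x
      using PY_bound[OF F, of "Suc k + r" 0 j x y "a / se ^ (k + 1) * E x"] r a(2) cell_subset[OF i that] j y by auto
  qed
  then show ?thesis by (simp add: PX_def)
qed

lemma PX_PY_add:
  assumes F: "smooth_family n F" "smooth_family n G" and r: "r \<le> n" and j: "j \<in> {1..N}" and i: "i \<in> {1..N}" and z: "z = 0 \<or> z = 1"
  shows "PX z i (\<lambda>x. PY j (fam_add F G r 0) x y) x = PX z i (\<lambda>x. PY j (F r 0) x y) x + PX z i (\<lambda>x. PY j (G r 0) x y) x"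
proof -
  have "PX z i (\<lambda>x. PY j (fam_add F G r 0) x y) x = PX z i (\<lambda>x. PY j (F r 0) x y + PY j (G r 0) x y) x"
    unfolding PX_def using cell_subset[OF i] r
    by (intro prj_cong[OF X_less[OF i] _ z] PY_add[OF F] j) auto
  also have "\<dots> = PX z i (\<lambda>x. PY j (F r 0) x y) x + PX z i (\<lambda>x. PY j (G r 0) x y) x"
    unfolding PX_def using r
    by (intro prj_add X_less[OF i] continuous_on_subset[OF PY_continuous[OF F(1)] cell_subset'[OF i]]
        continuous_on_subset[OF PY_continuous[OF F(2)] cell_subset'[OF i]] j) auto
  finally show ?thesis .
qed

text \<open>\<open>K\<close> is a generous common constant: the numerical factors that accumulate in
  the interpolation estimates reach at most 18, and \<open>1 + \<beta>\<close> comes from the slope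
  of the ramps.\<close>

definition "K0 = cA * cpi k * C1"
definition "K = 30 * K0 * (1 + \<beta>)"

lemma K0: "0 < K0" "cA * C1 \<le> K0" "cpi k * C1 \<le> K0" "C1 \<le> K0" "30 * K0 \<le> K" "0 < K" "30 * K0 * \<beta> \<le> K"
proof -
  have c: "1 \<le> cA" "1 \<le> cpi k" using cA(1) cpi_ge by auto
  then have 1: "1 * C1 \<le> cA * C1" using C1 by (intro mult_right_mono) auto
  have 2: "cA * C1 * 1 \<le> cA * C1 * cpi k" using c C1 by (intro mult_left_mono) auto
  have 3: "cpi k * C1 * 1 \<le> cpi k * C1 * cA" using c C1 by (intro mult_left_mono) auto
  show a: "cA * C1 \<le> K0" using 2 by (simp add: K0_def mult_ac)
  show "cpi k * C1 \<le> K0" using 3 by (simp add: K0_def mult_ac)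
  show b: "C1 \<le> K0" using 1 a by simp
  then show *: "0 < K0" using C1 by linarith
  have "0 < K0 * \<beta>" using * beta by simp
  then show "30 * K0 \<le> K" "0 < K" "30 * K0 * \<beta> \<le> K" using * by (auto simp: K_def distrib_left mult.assoc)
qed

end

locale layered = shishkin +
  fixes s w v z :: family
  assumes dec: "decomp s w v z"
begin

abbreviation "u \<equiv> total s w v z"

lemma sm: "smooth_family (k + 2) s" "smooth_family (k + 2) w" "smooth_family (k + 2) v" "smooth_family (k + 2) z"
  "smooth_family (k + 2) (fam_add s v)" "smooth_family (k + 2) (fam_add w z)" "smooth_family (k + 2) u"
  using dec by (auto simp: decomp_def total_def intro!: smooth_family_add)

lemma bnd:
  assumes "i \<le> k + 2" "j \<le> k + 2" "x \<in> {0..1}" "y \<in> {0..1}"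
  shows "\<bar>s i j x y\<bar> \<le> C1" "\<bar>w i j x y\<bar> \<le> C1 / se ^ i * E x" "\<bar>v i j x y\<bar> \<le> C1 / se ^ j * E y" "\<bar>z i j x y\<bar> \<le> C1 / se ^ (i + j) * E x * E y"
  using dec assms unfolding decomp_def by blast+

section \<open>Errors of the projections in each variable\<close>

lemma y_error:
  assumes i: "i \<le> 2" and j: "j \<in> {1..N}" and x: "x \<in> {0..1}" and y: "y \<in> {X (j - 1)..X j}"
  shows "\<bar>u i 0 x y - PY j (u i 0) x y\<bar> \<le> 2 * K0 * kap j y * (1 + E x / se ^ i)"
proof -
  have ik: "i \<le> k + 2" using i by simp
  have y01: "y \<in> {0..1}" using cell_subset[OF j y] .
  have q: "0 \<le> C1 / se ^ i * E x" using C1 se E_pos[of x] by simp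
  have 1: "\<bar>s i 0 x y - PY j (s i 0) x y\<bar> \<le> cA * C1 * NN" using ik x bnd by (intro Y_smooth sm j y) auto
  have 2: "\<bar>w i 0 x y - PY j (w i 0) x y\<bar> \<le> cA * (C1 / se ^ i * E x) * NN" using ik x bnd by (intro Y_smooth sm j y) auto
  have 3: "\<bar>v i 0 x y - PY j (v i 0) x y\<bar> \<le> cA * C1 * kap j y"
    using ik x bnd(3)[of i 0 x] bnd(3)[of i "Suc k" x] by (intro Y_layer sm j y) auto
  have 4: "\<bar>z i 0 x y - PY j (z i 0) x y\<bar> \<le> cA * (C1 / se ^ i * E x) * kap j y"
  proof (intro Y_layer sm j y ik x)
    fix t :: real assume t: "t \<in> {0..1}"
    show "\<bar>z i 0 x t\<bar> \<le> C1 / se ^ i * E x * E t" using bnd(4)[of i 0 x t] ik x t by simp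
    show "\<bar>z i (Suc k) x t\<bar> \<le> C1 / se ^ i * E x / se ^ (k + 1) * E t" using bnd(4)[of i "Suc k" x t] ik x t
      by (simp add: power_add divide_simps mult_ac)
  qed
  have "PY j (u i 0) x y = (PY j (s i 0) x y + PY j (v i 0) x y) + (PY j (w i 0) x y + PY j (z i 0) x y)"
    unfolding total_def using PY_add[OF sm(5,6) ik _ j x] PY_add[OF sm(1,3) ik _ j x] PY_add[OF sm(2,4) ik _ j x] by simp
  moreover have "u i 0 x y = (s i 0 x y + v i 0 x y) + (w i 0 x y + z i 0 x y)" by (simp add: total_def fam_add_def)
  ultimately have "\<bar>u i 0 x y - PY j (u i 0) x y\<bar> \<le> cA * C1 * NN + cA * (C1 / se ^ i * E x) * NN + cA * C1 * kap j y + cA * (C1 / se ^ i * E x) * kap j y"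
    using 1 2 3 4 by linarith
  also have "\<dots> \<le> cA * C1 * kap j y + cA * (C1 / se ^ i * E x) * kap j y + cA * C1 * kap j y + cA * (C1 / se ^ i * E x) * kap j y"
    using cA(1) C1 mult_nonneg_nonneg[OF _ q, of cA] kap(2)[of j y] by (intro add_mono mult_left_mono order.refl) auto
  also have "\<dots> = (cA * C1) * (2 * kap j y * (1 + E x / se ^ i))" by (simp add: algebra_simps)
  also have "\<dots> \<le> K0 * (2 * kap j y * (1 + E x / se ^ i))"
    using K0 kap(1)[of j y] E_pos[of x] se by (intro mult_right_mono) auto
  finally show ?thesis by (simp add: mult_ac)
qed

text \<open>In \<open>x\<close> both \<open>s\<close> and \<open>v\<close> are smooth: the layers in
  \<open>v\<close> run along horizontal sides and enter only through \<open>E t \<le> 2\<close>.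
  Hence neither a layer term nor a negative power of \<open>se\<close> appears, even for the
  derivative.\<close>

lemma x_error_sv:
  assumes r: "r \<le> 1" and j: "j \<in> {1..N}" and i: "i \<in> {1..N}" and y: "y \<in> {X (j - 1)..X j}" and x: "x \<in> {X (i - 1)..X i}" and zz: "zz = 0 \<or> zz = 1"
  shows "\<bar>PY j (fam_add s v r 0) x y - PX zz i (\<lambda>x. PY j (fam_add s v r 0) x y) x\<bar> \<le> 3 * K0 * NN"
proof -
  have r2: "r \<le> k + 2" "Suc k + r \<le> k + 2" using r by auto
  have 1: "\<bar>PY j (s r 0) x y - PX zz i (\<lambda>x. PY j (s r 0) x y) x\<bar> \<le> cA * (cpi k * C1) * NN"
    using r2 bnd by (intro X_smooth sm r j i y x zz) auto
  have 2: "\<bar>PY j (v r 0) x y - PX zz i (\<lambda>x. PY j (v r 0) x y) x\<bar> \<le> cA * (cpi k * (2 * C1)) * NN"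
  proof (intro X_smooth sm r j i y x zz)
    fix x t :: real assume *: "x \<in> {0..1}" "t \<in> {0..1}"
    have "\<bar>v (Suc k + r) 0 x t\<bar> \<le> C1 * E t" using bnd(3)[of "Suc k + r" 0 x t] r2 * by simp
    also have "\<dots> \<le> C1 * 2" using E_le_2[OF *(2)] C1 by (intro mult_left_mono) auto
    finally show "\<bar>v (Suc k + r) 0 x t\<bar> \<le> 2 * C1" by simp
  qed
  have "PY j (fam_add s v r 0) x y = PY j (s r 0) x y + PY j (v r 0) x y"
    using PY_add[OF sm(1,3) r2(1) _ j cell_subset[OF i x]] by simp
  moreover have "PX zz i (\<lambda>x. PY j (fam_add s v r 0) x y) x = PX zz i (\<lambda>x. PY j (s r 0) x y) x + PX zz i (\<lambda>x. PY j (v r 0) x y) x"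
    by (rule PX_PY_add[OF sm(1,3) r2(1) j i zz])
  ultimately have "\<bar>PY j (fam_add s v r 0) x y - PX zz i (\<lambda>x. PY j (fam_add s v r 0) x y) x\<bar> \<le> cA * (cpi k * C1) * NN + cA * (cpi k * (2 * C1)) * NN"
    using 1 2 by linarith
  then show ?thesis by (simp add: K0_def algebra_simps)
qed

lemma x_error_wz:
  assumes r: "r \<le> 1" and j: "j \<in> {1..N}" and i: "i \<in> {1..N}" and y: "y \<in> {X (j - 1)..X j}" and x: "x \<in> {X (i - 1)..X i}" and zz: "zz = 0 \<or> zz = 1"
  shows "\<bar>PY j (fam_add w z r 0) x y - PX zz i (\<lambda>x. PY j (fam_add w z r 0) x y) x\<bar> \<le> 3 * K0 / se ^ r * kap i x"
proof -
  have r2: "r \<le> k + 2" "Suc k + r \<le> k + 2" using r by auto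
  have 1: "\<bar>PY j (w r 0) x y - PX zz i (\<lambda>x. PY j (w r 0) x y) x\<bar> \<le> cA * (cpi k * (C1 / se ^ r)) * kap i x"
    using r2 bnd(2)[of r 0] bnd(2)[of "Suc k + r" 0] by (intro X_layer sm r j i y x zz) (auto simp: power_add mult_ac)
  have E2: "a * E t \<le> 2 * a" if "t \<in> {0..1}" "0 \<le> a" for a t using E_le_2[OF that(1)] that(2) mult_left_mono[of "E t" 2 a] by simp
  have 2: "\<bar>PY j (z r 0) x y - PX zz i (\<lambda>x. PY j (z r 0) x y) x\<bar> \<le> cA * (cpi k * (2 * (C1 / se ^ r))) * kap i x"
  proof (intro X_layer sm r j i y x zz)
    fix x t :: real assume *: "x \<in> {0..1}" "t \<in> {0..1}"
    have "\<bar>z r 0 x t\<bar> \<le> C1 / se ^ r * E x * E t" using bnd(4)[of r 0 x t] r2 * by simp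
    also have "\<dots> \<le> 2 * (C1 / se ^ r * E x)" by (rule E2[OF *(2)]) (use C1 se E_pos[of x] in simp)
    finally show "\<bar>z r 0 x t\<bar> \<le> 2 * (C1 / se ^ r) * E x" by simp
    have "\<bar>z (Suc k + r) 0 x t\<bar> \<le> C1 / se ^ (Suc k + r) * E x * E t" using bnd(4)[of "Suc k + r" 0 x t] r2 * by simp
    also have "\<dots> \<le> 2 * (C1 / se ^ (Suc k + r) * E x)" by (rule E2[OF *(2)]) (use C1 se E_pos[of x] in simp)
    finally show "\<bar>z (Suc k + r) 0 x t\<bar> \<le> 2 * (C1 / se ^ r) / se ^ (k + 1) * E x" by (simp add: power_add mult_ac)
  qed
  have "PY j (fam_add w z r 0) x y = PY j (w r 0) x y + PY j (z r 0) x y"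
    using PY_add[OF sm(2,4) r2(1) _ j cell_subset[OF i x]] by simp
  moreover have "PX zz i (\<lambda>x. PY j (fam_add w z r 0) x y) x = PX zz i (\<lambda>x. PY j (w r 0) x y) x + PX zz i (\<lambda>x. PY j (z r 0) x y) x"
    by (rule PX_PY_add[OF sm(2,4) r2(1) j i zz])
  ultimately have "\<bar>PY j (fam_add w z r 0) x y - PX zz i (\<lambda>x. PY j (fam_add w z r 0) x y) x\<bar>
      \<le> \<bar>PY j (w r 0) x y - PX zz i (\<lambda>x. PY j (w r 0) x y) x\<bar> + \<bar>PY j (z r 0) x y - PX zz i (\<lambda>x. PY j (z r 0) x y) x\<bar>"
    by linarith
  also have "\<dots> \<le> cA * (cpi k * (C1 / se ^ r)) * kap i x + cA * (cpi k * (2 * (C1 / se ^ r))) * kap i x"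
    by (rule add_mono[OF 1 2])
  finally have "\<bar>PY j (fam_add w z r 0) x y - PX zz i (\<lambda>x. PY j (fam_add w z r 0) x y) x\<bar> \<le> cA * (cpi k * (C1 / se ^ r)) * kap i x + cA * (cpi k * (2 * (C1 / se ^ r))) * kap i x" .
  then show ?thesis by (simp add: K0_def algebra_simps)
qed

lemma x_error_u:
  assumes r: "r \<le> 1" and j: "j \<in> {1..N}" and i: "i \<in> {1..N}" and y: "y \<in> {X (j - 1)..X j}" and x: "x \<in> {X (i - 1)..X i}" and zz: "zz = 0 \<or> zz = 1"
  shows "\<bar>PY j (u r 0) x y - PX zz i (\<lambda>x. PY j (u r 0) x y) x\<bar> \<le> 6 * K0 / se ^ r * kap i x"
proof -
  have r2: "r \<le> k + 2" using r by auto
  have "PY j (u r 0) x y = PY j (fam_add s v r 0) x y + PY j (fam_add w z r 0) x y"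
    unfolding total_def using PY_add[OF sm(5,6) r2(1) _ j cell_subset[OF i x]] by simp
  moreover have "PX zz i (\<lambda>x. PY j (u r 0) x y) x = PX zz i (\<lambda>x. PY j (fam_add s v r 0) x y) x + PX zz i (\<lambda>x. PY j (fam_add w z r 0) x y) x"
    unfolding total_def by (rule PX_PY_add[OF sm(5,6) r2(1) j i zz])
  ultimately have "\<bar>PY j (u r 0) x y - PX zz i (\<lambda>x. PY j (u r 0) x y) x\<bar> \<le> 3 * K0 * NN + 3 * K0 / se ^ r * kap i x"
    using x_error_sv[OF assms] x_error_wz[OF assms] by linarith
  also have "3 * K0 * NN \<le> 3 * K0 / se ^ r * kap i x"
  proof (intro mult_mono kap)
    have "se ^ r \<le> 1" using se by (intro power_le_one) auto
    then show "3 * K0 \<le> 3 * K0 / se ^ r" using K0 se by (simp add: pos_le_divide_eq mult_left_le)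
  qed (use K0 NN se in auto)
  finally show ?thesis by simp
qed

lemma u_error:
  assumes j: "j \<in> {1..N}" and i: "i \<in> {1..N}" and y: "y \<in> {X (j - 1)..X j}" and x: "x \<in> {X (i - 1)..X i}"
  shows "\<bar>u 0 0 x y - PX 1 i (\<lambda>x. PY j (u 0 0) x y) x\<bar> \<le> 6 * K0 * (kap i x + kap j y)"
proof -
  have x01: "x \<in> {0..1}" by (rule cell_subset[OF i x])
  have "\<bar>u 0 0 x y - PY j (u 0 0) x y\<bar> \<le> 2 * K0 * kap j y * (1 + E x)" using y_error[of 0 j x y] j x01 y by simp
  also have "\<dots> \<le> 2 * K0 * kap j y * 3" using K0 kap(1)[of j y] E_le_2[OF x01] by (intro mult_left_mono) auto
  finally show ?thesis using x_error_u[of 0 j i y x 1] j i y x by (simp add: algebra_simps)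
qed

end

lemma rowB_cong:
  assumes m: "1 \<le> m" "m < N" and X: "\<And>i. i \<in> {1..N} \<Longrightarrow> X (i - 1) < X i"
    and u: "\<And>i x. i \<in> {1..N} \<Longrightarrow> x \<in> {X (i - 1)..X i} \<Longrightarrow> u i x = u' i x"
    and p: "\<And>i x. i \<in> {1..N} \<Longrightarrow> x \<in> {X (i - 1)..X i} \<Longrightarrow> p i x = p' i x"
  shows "rowB N m lam lt X u p S V = rowB N m lam lt X u' p' S V"
proof -
  have r: "u i (X i) = u' i (X i)" "p i (X i) = p' i (X i)" if "i \<in> {1..N}" for i
    using u[OF that, of "X i"] p[OF that, of "X i"] X[OF that] by auto
  have l: "u (Suc i) (X i) = u' (Suc i) (X i)" "p (Suc i) (X i) = p' (Suc i) (X i)" if "i < N" for i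
    using u[of "Suc i" "X i"] p[of "Suc i" "X i"] X[of "Suc i"] that by auto
  have uf: "uflux N m lt X u p i = uflux N m lt X u' p' i" if "i \<le> N" for i
    using that r[of i] l[of i] m by (auto simp: uflux_def)
  have pf: "pflux N lam X u p i = pflux N lam X u' p' i" if "i \<le> N" for i
    using that r[of i] l[of i] m by (auto simp: pflux_def)
  have I: "integral {X (i - 1)..X i} (\<lambda>x. u i x * poly (pderiv (S i)) x + p i x * poly (pderiv (V i)) x)
     = integral {X (i - 1)..X i} (\<lambda>x. u' i x * poly (pderiv (S i)) x + p' i x * poly (pderiv (V i)) x)" if "i \<in> {1..N}" for i
    using u[OF that] p[OF that] by (intro integral_cong) auto
  have "i \<le> N" "i - 1 \<le> N" if "i \<in> {1..N}" for i using that by auto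
  then show ?thesis unfolding rowB_def using uf pf I by (intro sum.cong) auto
qed

context layered
begin

text \<open>\<open>Gu\<close> interpolates \<open>u\<close> and \<open>Gp\<close> interpolates \<open>\<epsilon> * u 1 0\<close>. A plain projection of the layer part \<open>Xf 1 0\<close> would
  be bad in the coarse region, where it is negligible anyway; there it is dropped. To avoid the jump which this
  creates at \<open>\<tau>\<close> and \<open>1 - \<tau>\<close>, a linear ramp is subtracted in the refined cells. The error of \<open>Gp\<close> is then the
  sum of a continuous function \<open>gp\<close> and a Radau error \<open>bp\<close> (lemma \<open>gp_plus_bp\<close>).\<close>

definition Gu :: "nat \<Rightarrow> nat \<Rightarrow> real \<Rightarrow> real \<Rightarrow> real" where
  "Gu i j x y = PX 1 i (\<lambda>x. PY j (u 0 0) x y) x"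

definition Fp :: "nat \<Rightarrow> family" where
  "Fp i = (if refined i then u else fam_add s v)"

definition zt :: "nat \<Rightarrow> nat \<Rightarrow> real \<Rightarrow> real \<Rightarrow> real" where
  "zt i j y x = PY j (Fp i 1 0) x y"

definition Xf :: family where "Xf = fam_add w z"

text \<open>On coarse cells this is the omitted layer part itself, on refined cells the ramp. Joined
  in this way they form a function continuous in \<open>x\<close>, which makes \<open>gp\<close>
  admissible in \<open>rowB_smooth\<close>.\<close>

definition rho :: "nat \<Rightarrow> nat \<Rightarrow> real \<Rightarrow> real \<Rightarrow> real" where
  "rho i j x y = (if i \<le> lo then PY j (Xf 1 0) \<tau> y * (x / \<tau>)
     else if i \<le> m then PY j (Xf 1 0) x y else PY j (Xf 1 0) (1 - \<tau>) y * ((1 - x) / \<tau>))"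

definition rho' :: "nat \<Rightarrow> nat \<Rightarrow> real \<Rightarrow> real \<Rightarrow> real" where
  "rho' i j x y = (if i \<le> lo then PY j (Xf 1 0) \<tau> y / \<tau>
     else if i \<le> m then PY j (Xf 2 0) x y else - PY j (Xf 1 0) (1 - \<tau>) y / \<tau>)"

definition ramp :: "nat \<Rightarrow> nat \<Rightarrow> real \<Rightarrow> real \<Rightarrow> real" where
  "ramp i j x y = (if refined i then rho i j x y else 0)"

definition Gp :: "nat \<Rightarrow> nat \<Rightarrow> real \<Rightarrow> real \<Rightarrow> real" where
  "Gp i j x y = \<epsilon> * (PX 0 i (zt i j y) x - ramp i j x y)"

definition gp :: "nat \<Rightarrow> nat \<Rightarrow> real \<Rightarrow> real \<Rightarrow> real" where
  "gp i j y x = \<epsilon> * (u 1 0 x y - PY j (u 1 0) x y + rho i j x y)"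

definition gp' :: "nat \<Rightarrow> nat \<Rightarrow> real \<Rightarrow> real \<Rightarrow> real" where
  "gp' i j y x = \<epsilon> * (u 2 0 x y - PY j (u 2 0) x y + rho' i j x y)"

definition bp :: "nat \<Rightarrow> nat \<Rightarrow> real \<Rightarrow> real \<Rightarrow> real" where
  "bp i j y x = \<epsilon> * (zt i j y x - PX 0 i (zt i j y) x)"

definition au :: "nat \<Rightarrow> nat \<Rightarrow> real \<Rightarrow> real \<Rightarrow> real" where
  "au i j y x = PY j (u 0 0) x y - Gu i j x y"

lemma smXf: "smooth_family (k + 2) Xf" and smFp: "smooth_family (k + 2) (Fp i)"
  using sm by (auto simp: Xf_def Fp_def)

lemma gp_plus_bp:
  assumes "j \<in> {1..N}" "x \<in> {0..1}"
  shows "gp i j y x + bp i j y x = \<epsilon> * u 1 0 x y - Gp i j x y"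
proof -
  have "PY j (u 1 0) x y = PY j (fam_add s v 1 0) x y + PY j (Xf 1 0) x y"
    unfolding total_def Xf_def by (rule PY_add[OF sm(5,6)]) (use assms in auto)
  then show ?thesis
    by (auto simp: gp_def bp_def Gp_def zt_def Fp_def ramp_def rho_def refined_def algebra_simps)
qed

lemma Xf_bound:
  assumes "i \<le> 2" "x \<in> {0..1}" "j \<in> {1..N}" "y \<in> {X (j - 1)..X j}"
  shows "\<bar>PY j (Xf i 0) x y\<bar> \<le> 3 * K0 / se ^ i * E x"
proof -
  have ik: "i \<le> k + 2" using assms by simp
  have "\<bar>PY j (Xf i 0) x y\<bar> \<le> cpi k * (3 * (C1 / se ^ i * E x))"
  proof (rule PY_bound[OF smXf ik _ assms(3,2,4)])
    fix t :: real assume t: "t \<in> {0..1}"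
    have q: "0 \<le> C1 / se ^ i * E x" using C1 se E_pos[of x] by simp
    have "\<bar>z i 0 x t\<bar> \<le> C1 / se ^ i * E x * E t" using bnd(4)[of i 0 x t] ik assms(2) t by simp
    also have "\<dots> \<le> C1 / se ^ i * E x * 2" using E_le_2[OF t] q by (intro mult_left_mono) auto
    finally have "\<bar>z i 0 x t\<bar> \<le> C1 / se ^ i * E x * 2" .
    moreover have "\<bar>w i 0 x t\<bar> \<le> C1 / se ^ i * E x" using bnd(2)[of i 0 x t] ik assms(2) t by simp
    ultimately show "\<bar>Xf i 0 x t\<bar> \<le> 3 * (C1 / se ^ i * E x)" unfolding Xf_def fam_add_def by linarith
  qed simp
  also have "\<dots> = (cpi k * C1) * (3 / se ^ i * E x)" by simp
  also have "\<dots> \<le> K0 * (3 / se ^ i * E x)" using K0(3) se E_pos[of x] by (intro mult_right_mono) auto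
  finally show ?thesis by (simp add: mult_ac)
qed

lemma tau01: "\<tau> \<in> {0..1}" "1 - \<tau> \<in> {0..1}" "E \<tau> \<le> 2 * NN" "E (1 - \<tau>) \<le> 2 * NN"
  using tau(2,3) E_coarse[of \<tau>] E_coarse[of "1 - \<tau>"] by auto

lemma Xf_tau_bound:
  assumes "j \<in> {1..N}" "y \<in> {X (j - 1)..X j}" "x = \<tau> \<or> x = 1 - \<tau>"
  shows "\<bar>PY j (Xf 1 0) x y\<bar> \<le> 6 * K0 / se * NN"
proof -
  have "\<bar>PY j (Xf 1 0) x y\<bar> \<le> 3 * K0 / se ^ 1 * E x" using assms tau01 by (intro Xf_bound) auto
  also have "\<dots> \<le> 3 * K0 / se ^ 1 * (2 * NN)" using assms(3) tau01 K0 se by (intro mult_left_mono) auto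
  finally show ?thesis by simp
qed

lemma refined_ramp_range:
  assumes "i \<in> {1..N}" "x \<in> {X (i - 1)..X i}"
  shows "i \<le> lo \<Longrightarrow> 0 \<le> x / \<tau> \<and> x / \<tau> \<le> 1" "m < i \<Longrightarrow> 0 \<le> (1 - x) / \<tau> \<and> (1 - x) / \<tau> \<le> 1"
proof -
  have x: "x \<in> {0..1}" by (rule cell_subset[OF assms])
  show "0 \<le> x / \<tau> \<and> x / \<tau> \<le> 1" if "i \<le> lo"
    using X_mono[of i lo] that index_order X_special assms(2) tau(2) x by auto
  show "0 \<le> (1 - x) / \<tau> \<and> (1 - x) / \<tau> \<le> 1" if "m < i"
  proof -
    have "1 - \<tau> \<le> X (i - 1)" using X_mono[of m "i - 1"] that assms(1) X_special by auto
    then show ?thesis using assms(2) tau(2) x by auto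
  qed
qed

lemma rho_bound:
  assumes i: "i \<in> {1..N}" "x \<in> {X (i - 1)..X i}" and j: "j \<in> {1..N}" "y \<in> {X (j - 1)..X j}"
  shows "\<bar>\<epsilon> * rho i j x y\<bar> \<le> 6 * K0 * se * Psi i x"
proof -
  have x: "x \<in> {0..1}" by (rule cell_subset[OF i])
  have r: "\<bar>rho i j x y\<bar> \<le> 6 * K0 / se * Psi i x"
  proof (cases "refined i")
    case True
    have p: "\<bar>a * c\<bar> \<le> 6 * K0 / se * Psi i x" if "\<bar>a\<bar> \<le> 6 * K0 / se * NN" "0 \<le> c \<and> c \<le> 1" for a c
    proof -
      have "\<bar>a * c\<bar> \<le> \<bar>a\<bar> * 1" unfolding abs_mult using that by (intro mult_left_mono) auto
      also have "\<dots> \<le> 6 * K0 / se * NN" using that by simp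
      also have "\<dots> \<le> 6 * K0 / se * Psi i x" using Psi_ge(5)[OF True] K0 se by (intro mult_left_mono) auto
      finally show ?thesis .
    qed
    show ?thesis
    proof (cases "i \<le> lo")
      case True
      then have e: "rho i j x y = PY j (Xf 1 0) \<tau> y * (x / \<tau>)" by (simp only: rho_def if_True)
      show ?thesis unfolding e by (intro p Xf_tau_bound[OF j] refined_ramp_range(1)[OF i True]) simp
    next
      case False
      then have "m < i" "\<not> i \<le> m" using True by (auto simp: refined_def)
      then have e: "rho i j x y = PY j (Xf 1 0) (1 - \<tau>) y * ((1 - x) / \<tau>)" using False by (simp only: rho_def if_False)
      show ?thesis unfolding e by (intro p Xf_tau_bound[OF j] refined_ramp_range(2)[OF i \<open>m < i\<close>]) simp
    qed
  next
    case False
    then have "rho i j x y = PY j (Xf 1 0) x y" by (auto simp: rho_def refined_def)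
    also have "\<bar>\<dots>\<bar> \<le> 3 * K0 / se ^ 1 * E x" using x j by (intro Xf_bound) auto
    also have "\<dots> \<le> 6 * K0 / se * Psi i x" using Psi_ge(6)[OF False] E_pos[of x] K0 se
      by (intro mult_mono) (auto simp: divide_right_mono)
    finally show ?thesis .
  qed
  have "\<bar>\<epsilon> * rho i j x y\<bar> = \<epsilon> * \<bar>rho i j x y\<bar>" using eps by (simp add: abs_mult)
  also have "\<dots> \<le> (se * se) * (6 * K0 / se * Psi i x)" unfolding se(4) using r eps by (intro mult_left_mono) auto
  finally show ?thesis using se(1) by (simp add: mult_ac)
qed

text \<open>The ramps have slope of order \<open>NN / (se * \<tau>)\<close>. Since
  \<open>\<sigma> * ln N \<ge> 1\<close>, the transition point is at least
  \<open>se / \<beta>\<close>, so multiplying by \<open>\<epsilon>\<close> leaves only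
  \<open>\<beta> * NN\<close>. On coarse cells the second derivative of a layer costs exactly the
  factor \<open>\<epsilon>\<close>.\<close>

lemma rho'_bound:
  assumes i: "i \<in> {1..N}" "x \<in> {X (i - 1)..X i}" and j: "j \<in> {1..N}" "y \<in> {X (j - 1)..X j}"
  shows "\<bar>\<epsilon> * rho' i j x y\<bar> \<le> 6 * K0 * (1 + \<beta>) * Psi i x"
proof -
  have x: "x \<in> {0..1}" by (rule cell_subset[OF i])
  have P: "0 < Psi i x" by (rule Psi_ge)
  have "1 * 1 \<le> \<sigma> * ln (real N)" using sigma lnN by (intro mult_mono) auto
  then have "se / \<beta> * 1 \<le> se / \<beta> * (\<sigma> * ln (real N))" using se beta by (intro mult_left_mono) auto
  then have t: "se / \<beta> \<le> \<tau>" by (simp add: tau(1) mult_ac)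
  have p: "\<epsilon> * \<bar>a / \<tau>\<bar> \<le> 6 * K0 * (1 + \<beta>) * Psi i x" if a: "\<bar>a\<bar> \<le> 6 * K0 / se * NN" and f: "refined i" for a
  proof -
    have "\<bar>a / \<tau>\<bar> = \<bar>a\<bar> / \<tau>" using tau(2) by simp
    also have "\<dots> \<le> (6 * K0 / se * NN) / (se / \<beta>)" using a t tau(2) K0 NN se beta by (intro frac_le) auto
    also have "\<dots> = 6 * K0 * \<beta> * NN / (se * se)" using se(1) beta by simp
    also have "se * se = \<epsilon>" by (rule se)
    finally have "\<epsilon> * \<bar>a / \<tau>\<bar> \<le> 6 * K0 * \<beta> * NN" using eps by (simp add: field_simps)
    also have "\<dots> \<le> 6 * K0 * (1 + \<beta>) * Psi i x" using Psi_ge(5)[OF f] K0 beta NN by (intro mult_mono) auto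
    finally show ?thesis .
  qed
  have "\<epsilon> * \<bar>rho' i j x y\<bar> \<le> 6 * K0 * (1 + \<beta>) * Psi i x"
  proof (cases "refined i")
    case True
    then show ?thesis using p[OF Xf_tau_bound[OF j]] by (auto simp: rho'_def refined_def)
  next
    case False
    then have "rho' i j x y = PY j (Xf 2 0) x y" by (auto simp: rho'_def refined_def)
    also have "\<epsilon> * \<bar>\<dots>\<bar> \<le> \<epsilon> * (3 * K0 / se ^ 2 * E x)" using x j eps by (intro mult_left_mono Xf_bound) auto
    also have "\<dots> = 3 * K0 * E x" using eps by (simp add: se(3))
    also have "\<dots> \<le> 6 * K0 * (1 + \<beta>) * Psi i x"
    proof (rule mult_mono[OF _ Psi_ge(6)[OF False]])
      show "3 * K0 \<le> 6 * K0 * (1 + \<beta>)" using K0(1) mult_pos_pos[OF K0(1) beta] by (simp add: algebra_simps)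
    qed (use E_pos[of x] K0(1) beta in auto)
    finally show ?thesis .
  qed
  then show ?thesis using eps by (simp add: abs_mult)
qed

text \<open>On coarse cells the projected function contains no layer in \<open>x\<close>, so the
  derivative brings no factor \<open>1 / se\<close> and one more power of \<open>se\<close> is
  gained than on refined cells.\<close>

lemma zt_error:
  assumes j: "j \<in> {1..N}" "y \<in> {X (j - 1)..X j}" and i: "i \<in> {1..N}" "x \<in> {X (i - 1)..X i}"
  shows "\<bar>bp i j y x\<bar> \<le> 6 * K0 * se * (if refined i then kap i x else se * NN)"
proof (cases "refined i")
  case True
  have "\<bar>zt i j y x - PX 0 i (zt i j y) x\<bar> \<le> 6 * K0 / se ^ 1 * kap i x"
    using x_error_u[of 1 j i y x 0] j i True by (simp add: zt_def[abs_def] Fp_def)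
  then have "\<epsilon> * \<bar>zt i j y x - PX 0 i (zt i j y) x\<bar> \<le> (se * se) * (6 * K0 / se ^ 1 * kap i x)"
    unfolding se(4) using eps by (intro mult_left_mono) auto
  then show ?thesis using eps se(1) True by (simp add: bp_def abs_mult mult_ac)
next
  case False
  have "\<bar>zt i j y x - PX 0 i (zt i j y) x\<bar> \<le> 3 * K0 * NN"
    using x_error_sv[of 1 j i y x 0] j i False by (simp add: zt_def[abs_def] Fp_def)
  then have "\<epsilon> * \<bar>zt i j y x - PX 0 i (zt i j y) x\<bar> \<le> (se * se) * (3 * K0 * NN)"
    unfolding se(4) using eps by (intro mult_left_mono) auto
  also have "\<dots> \<le> (se * se) * (6 * K0 * NN)" using K0(1) NN(1) se(1) by (intro mult_left_mono mult_right_mono) auto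
  finally show ?thesis using eps se(1) False by (simp add: bp_def abs_mult mult_ac)
qed

lemma bp_bounds:
  assumes j: "j \<in> {1..N}" "y \<in> {X (j - 1)..X j}" and i: "i \<in> {1..N}" "x \<in> {X (i - 1)..X i}"
  shows "\<bar>bp i j y x\<bar> \<le> 6 * K0 * se * Psi i x" "\<bar>bp i j y x\<bar> \<le> K * se * L ^ (k + 1)"
proof -
  have x: "x \<in> {0..1}" by (rule cell_subset[OF i])
  have seNN: "se * NN \<le> L ^ (k + 1) * se" using NN se by (simp add: mult.commute)
  have "(if refined i then kap i x else se * NN) \<le> Psi i x"
    using Psi_ge(7)[of i x] Psi_ge(3)[of i x] seNN by (auto simp: kap_def)
  then have "6 * K0 * se * (if refined i then kap i x else se * NN) \<le> 6 * K0 * se * Psi i x" using K0 se by (intro mult_left_mono) auto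
  then show "\<bar>bp i j y x\<bar> \<le> 6 * K0 * se * Psi i x" using zt_error[OF assms] by linarith
  have "se * NN \<le> 1 * NN" using se NN by (intro mult_right_mono) auto
  then have "(if refined i then kap i x else se * NN) \<le> 3 * L ^ (k + 1)"
    using kap(3)[OF x, of i] kap(2)[of i x] by auto
  then have "6 * K0 * se * (if refined i then kap i x else se * NN) \<le> 6 * K0 * se * (3 * L ^ (k + 1))" using K0 se by (intro mult_left_mono) auto
  also have "\<dots> = (18 * K0) * (se * L ^ (k + 1))" by simp
  also have "\<dots> \<le> K * (se * L ^ (k + 1))" using K0 se L by (intro mult_right_mono) auto
  finally show "\<bar>bp i j y x\<bar> \<le> K * se * L ^ (k + 1)" using zt_error[OF assms] by (simp add: mult_ac)
qed

text \<open>Each \<open>x\<close>-derivative of a layer costs \<open>1 / se\<close>, which the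
  factor \<open>se ^ l\<close> compensates; for the smooth part the same factor is a gain, bounded
  here by a single \<open>se\<close>.\<close>

lemma y_error_Psi:
  assumes i: "i \<in> {1..N}" "x \<in> {X (i - 1)..X i}" and j: "j \<in> {1..N}" "y \<in> {X (j - 1)..X j}" and l: "l \<in> {1, 2}"
  shows "se ^ l * \<bar>u l 0 x y - PY j (u l 0) x y\<bar> \<le> 6 * K0 * Psi i x"
proof -
  have x: "x \<in> {0..1}" and y: "y \<in> {0..1}" using cell_subset i j by blast+
  have "\<bar>u l 0 x y - PY j (u l 0) x y\<bar> \<le> 2 * K0 * kap j y * (1 + E x / se ^ l)"
    using l by (intro y_error j x) auto
  also have "\<dots> \<le> 2 * K0 * (3 * L ^ (k + 1)) * (1 + E x / se ^ l)"
    using kap(3)[OF y, of j] K0 E_pos[of x] se by (intro mult_right_mono mult_left_mono add_nonneg_nonneg) auto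
  finally have "se ^ l * \<bar>u l 0 x y - PY j (u l 0) x y\<bar> \<le> se ^ l * (2 * K0 * (3 * L ^ (k + 1)) * (1 + E x / se ^ l))"
    using se by (intro mult_left_mono) auto
  also have "\<dots> = 6 * K0 * (L ^ (k + 1) * (se ^ l + E x))" using se(1) by (simp add: field_simps)
  also have "\<dots> \<le> 6 * K0 * (L ^ (k + 1) * (se + E x))"
    using l se K0 L by (intro mult_left_mono add_right_mono) auto
  also have "\<dots> \<le> 6 * K0 * Psi i x" using Psi_ge(4)[of x i] K0 by (intro mult_left_mono) (auto simp: add.commute)
  finally show ?thesis .
qed

lemma eta_p_bound:
  assumes i: "i \<in> {1..N}" "x \<in> {X (i - 1)..X i}" and j: "j \<in> {1..N}" "y \<in> {X (j - 1)..X j}"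
  shows "\<bar>gp i j y x + bp i j y x\<bar> \<le> K * se * Psi i x"
proof -
  have "\<epsilon> * \<bar>u 1 0 x y - PY j (u 1 0) x y\<bar> = se * (se ^ 1 * \<bar>u 1 0 x y - PY j (u 1 0) x y\<bar>)" by (simp only: se(4) power_one_right mult.assoc[symmetric])
  also have "\<dots> \<le> se * (6 * K0 * Psi i x)" using se by (intro mult_left_mono y_error_Psi i j) auto
  finally have 1: "\<bar>\<epsilon> * (u 1 0 x y - PY j (u 1 0) x y)\<bar> \<le> 6 * K0 * se * Psi i x" using eps by (simp add: abs_mult mult_ac)
  have "\<bar>gp i j y x + bp i j y x\<bar> \<le> 18 * K0 * se * Psi i x"
    using 1 rho_bound[OF i j] bp_bounds(1)[OF j i] by (simp add: gp_def distrib_left)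
  also have "\<dots> = (18 * K0) * (se * Psi i x)" by simp
  also have "\<dots> \<le> K * (se * Psi i x)" using K0 se Psi_ge(1)[of i x] by (intro mult_right_mono) auto
  finally show ?thesis by (simp add: mult_ac)
qed

lemma gp'_bound:
  assumes i: "i \<in> {1..N}" "x \<in> {X (i - 1)..X i}" and j: "j \<in> {1..N}" "y \<in> {X (j - 1)..X j}"
  shows "\<bar>gp' i j y x\<bar> \<le> K * Psi i x"
proof -
  have 1: "\<bar>\<epsilon> * (u 2 0 x y - PY j (u 2 0) x y)\<bar> \<le> 6 * K0 * Psi i x" using y_error_Psi[OF i j, of 2] eps by (simp add: abs_mult se(3))
  have "\<bar>gp' i j y x\<bar> \<le> 6 * K0 * Psi i x + 6 * K0 * (1 + \<beta>) * Psi i x"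
    using 1 rho'_bound[OF i j] by (simp add: gp'_def distrib_left)
  also have "\<dots> = (12 * K0 + 6 * (K0 * \<beta>)) * Psi i x" by (simp add: algebra_simps)
  also have "\<dots> \<le> K * Psi i x"
  proof (intro mult_right_mono)
    have "0 < K0 * \<beta>" using K0 beta by simp
    then show "12 * K0 + 6 * (K0 * \<beta>) \<le> K" using K0(1) by (simp add: K_def algebra_simps)
  qed (use Psi_ge(1)[of i x] in auto)
  finally show ?thesis .
qed

lemma g'_bound:
  assumes i: "i \<in> {1..N}" "x \<in> {X (i - 1)..X i}" and j: "j \<in> {1..N}" "y \<in> {X (j - 1)..X j}"
  shows "se * \<bar>u 1 0 x y - PY j (u 1 0) x y\<bar> \<le> K * Psi i x"
proof -
  have "se * \<bar>u 1 0 x y - PY j (u 1 0) x y\<bar> \<le> 6 * K0 * Psi i x" using y_error_Psi[OF i j, of 1] by simp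
  also have "\<dots> \<le> K * Psi i x" using K0 Psi_ge(1)[of i x] by (intro mult_right_mono) auto
  finally show ?thesis .
qed

lemma au_bound:
  assumes j: "j \<in> {1..N}" "y \<in> {X (j - 1)..X j}" and i: "i \<in> {1..N}" "x \<in> {X (i - 1)..X i}"
  shows "\<bar>au i j y x\<bar> \<le> K * L ^ (k + 1)"
proof -
  have "\<bar>au i j y x\<bar> \<le> 6 * K0 * kap i x" using x_error_u[of 0 j i y x 1] j i by (simp add: au_def Gu_def)
  also have "\<dots> \<le> 6 * K0 * (3 * L ^ (k + 1))" using K0 kap(3)[OF cell_subset[OF i]] by (intro mult_left_mono) auto
  also have "\<dots> = (18 * K0) * L ^ (k + 1)" by simp
  also have "\<dots> \<le> K * L ^ (k + 1)" using K0 L by (intro mult_right_mono) auto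
  finally show ?thesis .
qed

lemma eta_u_bound:
  assumes j: "j \<in> {1..N}" "y \<in> {X (j - 1)..X j}" and i: "i \<in> {1..N}" "x \<in> {X (i - 1)..X i}"
  shows "\<bar>u 0 0 x y - Gu i j x y\<bar> \<le> K * (kap i x + kap j y)"
proof -
  have "\<bar>u 0 0 x y - Gu i j x y\<bar> \<le> 6 * K0 * (kap i x + kap j y)" using u_error[of j i y x] j i by (simp add: Gu_def)
  also have "\<dots> \<le> K * (kap i x + kap j y)" using K0 kap(1)[of i x] kap(1)[of j y] by (intro mult_right_mono) auto
  finally show ?thesis .
qed

lemma zt_continuous: "j \<in> {1..N} \<Longrightarrow> continuous_on {0..1} (zt i j y)"
  unfolding zt_def using PY_continuous[OF smFp] by auto

lemma au_continuous:
  assumes i: "i \<in> {1..N}" and j: "j \<in> {1..N}"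
  shows "continuous_on {X (i - 1)..X i} (au i j y)" "continuous_on {X (i - 1)..X i} (bp i j y)"
proof -
  have c: "continuous_on {X (i - 1)..X i} (\<lambda>x. PY j (u 0 0) x y)"
    using PY_continuous[OF sm(7) _ _ j] by (intro continuous_on_subset[OF _ cell_subset'[OF i]]) auto
  have c': "continuous_on {X (i - 1)..X i} (zt i j y)"
    using zt_continuous[OF j] by (intro continuous_on_subset[OF _ cell_subset'[OF i]])
  show "continuous_on {X (i - 1)..X i} (au i j y)"
    unfolding au_def[abs_def] Gu_def PX_def prj_poly[OF X_less[OF i] c] by (intro continuous_intros c)
  show "continuous_on {X (i - 1)..X i} (bp i j y)"
    unfolding bp_def[abs_def] PX_def prj_poly[OF X_less[OF i] c'] by (intro continuous_intros c')
qed

lemma degree_pderiv_less: "degree p \<le> k \<Longrightarrow> degree (pderiv p :: real poly) < k"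
  using k by (simp add: degree_pderiv)

lemma au_orth:
  assumes i: "i \<in> {1..N}" and j: "j \<in> {1..N}" and d: "degree p \<le> k"
  shows "integral {X (i - 1)..X i} (\<lambda>x. au i j y x * poly (pderiv p) x) = 0"
    "integral {X (i - 1)..X i} (\<lambda>x. bp i j y x * poly (pderiv p) x) = 0"
proof -
  have c: "continuous_on {X (i - 1)..X i} (\<lambda>x. PY j (u 0 0) x y)"
    using PY_continuous[OF sm(7) _ _ j] by (intro continuous_on_subset[OF _ cell_subset'[OF i]]) auto
  have c': "continuous_on {X (i - 1)..X i} (zt i j y)"
    using zt_continuous[OF j] by (intro continuous_on_subset[OF _ cell_subset'[OF i]])
  show "integral {X (i - 1)..X i} (\<lambda>x. au i j y x * poly (pderiv p) x) = 0"
    using prj_orthogonal[OF X_less[OF i] c degree_pderiv_less[OF d], of 1] by (simp add: au_def Gu_def PX_def)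
  have "integral {X (i - 1)..X i} (\<lambda>x. bp i j y x * poly (pderiv p) x) = integral {X (i - 1)..X i} (\<lambda>x. \<epsilon> * ((zt i j y x - PX 0 i (zt i j y) x) * poly (pderiv p) x))"
    by (simp add: bp_def mult.assoc)
  then show "integral {X (i - 1)..X i} (\<lambda>x. bp i j y x * poly (pderiv p) x) = 0"
    using prj_orthogonal[OF X_less[OF i] c' degree_pderiv_less[OF d], of 0] by (simp add: PX_def)
qed

lemma au_zero:
  assumes i: "i \<in> {1..N}" and j: "j \<in> {1..N}"
  shows "au i j y (X i) = 0" "bp i j y (X (i - 1)) = 0"
proof -
  have c: "continuous_on {X (i - 1)..X i} (\<lambda>x. PY j (u 0 0) x y)"
    using PY_continuous[OF sm(7) _ _ j] by (intro continuous_on_subset[OF _ cell_subset'[OF i]]) auto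
  have c': "continuous_on {X (i - 1)..X i} (zt i j y)"
    using zt_continuous[OF j] by (intro continuous_on_subset[OF _ cell_subset'[OF i]])
  show "au i j y (X i) = 0" using prj_endpoint(2)[OF X_less[OF i] c] by (simp add: au_def Gu_def PX_def)
  show "bp i j y (X (i - 1)) = 0" using prj_endpoint(1)[OF X_less[OF i] c'] by (simp add: bp_def PX_def)
qed

lemma integral_square_Psi:
  assumes f: "\<And>i. i \<in> {1..N} \<Longrightarrow> continuous_on {X (i - 1)..X i} (f i)"
    and b: "\<And>i x. i \<in> {1..N} \<Longrightarrow> x \<in> {X (i - 1)..X i} \<Longrightarrow> \<bar>f i x\<bar> \<le> c * Psi i x"
  shows "(\<Sum>i=1..N. integral {X (i - 1)..X i} (\<lambda>x. (f i x)\<^sup>2)) \<le> c\<^sup>2 * (cPsi * se * L2)"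
proof -
  have "integral {X (i - 1)..X i} (\<lambda>x. (f i x)\<^sup>2) \<le> c\<^sup>2 * integral {X (i - 1)..X i} (\<lambda>x. (Psi i x)\<^sup>2)" if i: "i \<in> {1..N}" for i
  proof -
    have "(f i x)\<^sup>2 \<le> c\<^sup>2 * (Psi i x)\<^sup>2" if "x \<in> {X (i - 1)..X i}" for x
      using power_mono[OF b[OF i that], of 2] by (simp add: power_mult_distrib)
    then have "integral {X (i - 1)..X i} (\<lambda>x. (f i x)\<^sup>2) \<le> integral {X (i - 1)..X i} (\<lambda>x. c\<^sup>2 * (Psi i x)\<^sup>2)"
      by (intro integral_le integrable_continuous_interval continuous_intros f i) auto
    then show ?thesis by simp
  qed
  then have "(\<Sum>i=1..N. integral {X (i - 1)..X i} (\<lambda>x. (f i x)\<^sup>2)) \<le> (\<Sum>i=1..N. c\<^sup>2 * integral {X (i - 1)..X i} (\<lambda>x. (Psi i x)\<^sup>2))"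
    by (intro sum_mono) auto
  also have "\<dots> \<le> c\<^sup>2 * (cPsi * se * L2)" unfolding sum_distrib_left[symmetric] using sum_Psi_square by (intro mult_left_mono) auto
  finally show ?thesis .
qed

lemma gp_derivative:
  assumes i: "i \<in> {1..N}" and x: "x \<in> {X (i - 1)..X i}" and j: "j \<in> {1..N}" and y: "y \<in> {X (j - 1)..X j}"
  shows "(gp i j y has_real_derivative gp' i j y x) (at x within {X (i - 1)..X i})"
    and "((\<lambda>x. u 0 0 x y - PY j (u 0 0) x y) has_real_derivative (u 1 0 x y - PY j (u 1 0) x y)) (at x within {X (i - 1)..X i})"
proof -
  have x01: "x \<in> {0..1}" and y01: "y \<in> {0..1}" using cell_subset i x j y by blast+
  have u: "((\<lambda>x. u l 0 x y) has_real_derivative u (Suc l) 0 x y) (at x within {X (i - 1)..X i})"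
    "((\<lambda>x. PY j (u l 0) x y) has_real_derivative PY j (u (Suc l) 0) x y) (at x within {X (i - 1)..X i})" if "l \<le> 1" for l
    using smooth_familyD(2)[OF sm(7), of l 0 x y, THEN has_field_derivative_subset[OF _ cell_subset'[OF i]]]
      PY_deriv[OF sm(7), of l 0 j x y, THEN has_field_derivative_subset[OF _ cell_subset'[OF i]]] that x01 y01 j
    by auto
  have r: "((\<lambda>x. rho i j x y) has_real_derivative rho' i j x y) (at x within {X (i - 1)..X i})"
  proof -
    have X2: "((\<lambda>x. PY j (Xf 1 0) x y) has_real_derivative PY j (Xf 2 0) x y) (at x within {X (i - 1)..X i})"
      using PY_deriv[OF smXf, of 1 0 j x y, THEN has_field_derivative_subset[OF _ cell_subset'[OF i]]] x01 j by (auto simp: numeral_2_eq_2)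
    show ?thesis unfolding rho_def rho'_def using X2 tau(2)
      by (cases "i \<le> lo"; cases "i \<le> m") (auto intro!: derivative_eq_intros simp: field_simps)
  qed
  show "(gp i j y has_real_derivative gp' i j y x) (at x within {X (i - 1)..X i})"
    unfolding gp_def[abs_def] gp'_def using u[of 1] r by (intro DERIV_cmult DERIV_add DERIV_diff) (auto simp: numeral_2_eq_2)
  show "((\<lambda>x. u 0 0 x y - PY j (u 0 0) x y) has_real_derivative (u 1 0 x y - PY j (u 1 0) x y)) (at x within {X (i - 1)..X i})"
    using u[of 0] by (intro DERIV_diff) auto
qed

lemma gp'_continuous:
  assumes i: "i \<in> {1..N}" and j: "j \<in> {1..N}" and y: "y \<in> {0..1}"
  shows "continuous_on {X (i - 1)..X i} (gp' i j y)" "l \<le> 2 \<Longrightarrow> continuous_on {X (i - 1)..X i} (\<lambda>x. u l 0 x y - PY j (u l 0) x y)"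
proof -
  have u: "continuous_on {X (i - 1)..X i} (\<lambda>x. u l 0 x y)" "continuous_on {X (i - 1)..X i} (\<lambda>x. PY j (u l 0) x y)"
     "continuous_on {X (i - 1)..X i} (\<lambda>x. PY j (Xf l 0) x y)" if "l \<le> 2" for l
    using smooth_family_section(2)[OF sm(7) _ _ y, of l 0, THEN continuous_on_subset[OF _ cell_subset'[OF i]]]
      PY_continuous[OF sm(7), of l 0 j y, THEN continuous_on_subset[OF _ cell_subset'[OF i]]]
      PY_continuous[OF smXf, of l 0 j y, THEN continuous_on_subset[OF _ cell_subset'[OF i]]] that j
    by auto
  then show "l \<le> 2 \<Longrightarrow> continuous_on {X (i - 1)..X i} (\<lambda>x. u l 0 x y - PY j (u l 0) x y)" by (intro continuous_intros)
  have "continuous_on {X (i - 1)..X i} (\<lambda>x. rho' i j x y)"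
    unfolding rho'_def using u(3)[of 2] tau(2) by (cases "i \<le> lo"; cases "i \<le> m") (auto intro!: continuous_intros)
  then show "continuous_on {X (i - 1)..X i} (gp' i j y)"
    unfolding gp'_def[abs_def] using u(1,2)[of 2] by (intro continuous_intros) auto
qed

text \<open>Only the nodes \<open>lo\<close> and \<open>m\<close> need an argument: there the ramps
  take the value of the layer part, since the normalised distance to the boundary equals 1.\<close>

lemma gp_interface:
  assumes "i \<in> {1..<N}"
  shows "gp i j y (X i) = gp (Suc i) j y (X i)"
proof -
  have "rho i j (X i) y = rho (Suc i) j (X i) y"
  proof -
    consider "i < lo" | "i = lo" | "lo < i" "i < m" | "i = m" | "m < i" by linarith
    then show ?thesis
    proof cases
      case 2
      then show ?thesis using X_special tau(2) index_order by (simp add: rho_def)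
    next
      case 4
      then show ?thesis using X_special tau(2) index_order by (simp add: rho_def)
    qed (use index_order in \<open>simp_all add: rho_def\<close>)
  qed
  then show ?thesis by (simp add: gp_def)
qed

text \<open>The 4 before \<open>cPsi\<close> is 2 for the error of \<open>p\<close> and 2 for the
  derivative of \<open>g\<close>; the \<open>\<beta>\<close>-term comes from the derivative of
  \<open>h\<close>; the final 4 is 2 for the penalised node and 1 for each boundary trace.\<close>

definition "KR = K\<^sup>2 * ((4 + 1 / (2 * \<beta>\<^sup>2)) * cPsi + 4)"

text \<open>\<open>row_estimate\<close> applied to the splitting: \<open>g\<close> is the error of
  the \<open>y\<close>-projection of \<open>u\<close>, \<open>a\<close> the Radau error of what was
  projected, and \<open>h\<close>, \<open>b\<close> are \<open>gp\<close>, \<open>bp\<close>. The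
  arbitrary polynomials \<open>D\<close> leave room for the correction, whose size is not yet known
  here.\<close>

lemma row_bound:
  assumes bc: "\<And>t. t \<in> {0..1} \<Longrightarrow> u 0 0 0 t = 0" "\<And>t. t \<in> {0..1} \<Longrightarrow> u 0 0 1 t = 0"
    and j: "j \<in> {1..N}" and y: "y \<in> {X (j - 1)..X j}"
    and deg: "\<And>i. degree (S i) \<le> k" "\<And>i. degree (V i) \<le> k" "\<And>i. degree (D i) \<le> k"
    and D0: "\<And>i. i \<notin> {lo<..m} \<Longrightarrow> D i = 0"
  shows "\<bar>(\<Sum>i=1..N. 1 / \<epsilon> * integral {X (i - 1)..X i} (\<lambda>x. (\<epsilon> * u 1 0 x y - Gp i j x y) * poly (S i) x))
      + rowB N m se (1 / se) X (\<lambda>i x. u 0 0 x y - Gu i j x y - poly (D i) x) (\<lambda>i x. \<epsilon> * u 1 0 x y - Gp i j x y) S V\<bar>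
    \<le> 1 / 2 * (1 / \<epsilon> * (\<Sum>i=1..N. integral {X (i - 1)..X i} (\<lambda>x. (poly (S i) x)\<^sup>2))
        + se * ((poly (V 1) (X 0))\<^sup>2 + (poly (V N) (X N))\<^sup>2) + 1 / se * (poly (S (Suc m)) (X m) - poly (S m) (X m))\<^sup>2)
      + \<beta>\<^sup>2 / 2 * (\<Sum>i=1..N. integral {X (i - 1)..X i} (\<lambda>x. (poly (V i) x)\<^sup>2))
      + KR * se * L2
      + 10 * (cinv k)\<^sup>2 * \<epsilon> * (real N)\<^sup>2 * (\<Sum>i\<in>{lo<..m}. integral {X (i - 1)..X i} (\<lambda>x. (poly (D i) x)\<^sup>2))
      + 2 * cinv k * se * real N * integral {X (m - 1)..X m} (\<lambda>x. (poly (D m) x)\<^sup>2)"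
proof -
  define g where "g = (\<lambda>(i::nat) x. u 0 0 x y - PY j (u 0 0) x y)"
  define g' where "g' = (\<lambda>(i::nat) x. u 1 0 x y - PY j (u 1 0) x y)"
  define h where "h = (\<lambda>i. gp i j y)"
  define h' where "h' = (\<lambda>i. gp' i j y)"
  define a where "a = (\<lambda>i. au i j y)"
  define b where "b = (\<lambda>i. bp i j y)"
  have y01: "y \<in> {0..1}" by (rule cell_subset[OF j y])
  \<comment> \<open>The projection in \<open>y\<close> of zero boundary data is zero, so
    \<open>g\<close> inherits the boundary values of \<open>u\<close>.\<close>
  have P0: "PY j (u 0 0) x y = 0" if "\<And>t. t \<in> {0..1} \<Longrightarrow> u 0 0 x t = 0" for x
  proof -
    have "PY j (u 0 0) x y = prj k 1 (X (j - 1)) (X j) (\<lambda>t. 0) y"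
      unfolding PY_def using that cell_subset[OF j] by (intro prj_cong X_less[OF j]) auto
    then show ?thesis by (simp add: prj_zero)
  qed
  have eq_h: "\<epsilon> * u 1 0 x y - Gp i j x y = h i x + b i x" if "i \<in> {1..N}" "x \<in> {X (i - 1)..X i}" for i x
    using gp_plus_bp[OF j cell_subset[OF that]] by (simp add: h_def b_def)
  have eq1: "(\<Sum>i=1..N. 1 / \<epsilon> * integral {X (i - 1)..X i} (\<lambda>x. (\<epsilon> * u 1 0 x y - Gp i j x y) * poly (S i) x))
     = (\<Sum>i=1..N. 1 / \<epsilon> * integral {X (i - 1)..X i} (\<lambda>x. (h i x + b i x) * poly (S i) x))"
    using eq_h by (intro sum.cong refl arg_cong2[of _ _ _ _ "(*)"] integral_cong) auto
  have eq2: "rowB N m se (1 / se) X (\<lambda>i x. u 0 0 x y - Gu i j x y - poly (D i) x) (\<lambda>i x. \<epsilon> * u 1 0 x y - Gp i j x y) S V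
     = rowB N m se (1 / se) X (\<lambda>i x. g i x + a i x - poly (D i) x) (\<lambda>i x. h i x + b i x) S V"
    using eq_h by (intro rowB_cong index_order X_less) (auto simp: g_def a_def au_def)
  have cg': "continuous_on {X (i - 1)..X i} (g' i)" if "i \<in> {1..N}" for i
    unfolding g'_def using gp'_continuous(2)[OF that j y01, of 1] by simp
  have ch': "continuous_on {X (i - 1)..X i} (h' i)" if "i \<in> {1..N}" for i
    unfolding h'_def by (rule gp'_continuous(1)[OF that j y01])
  have ch: "continuous_on {X (i - 1)..X i} (h i)" if "i \<in> {1..N}" for i
    unfolding h_def by (rule DERIV_continuous_on, rule gp_derivative(1)[OF that _ j y])
  have cab: "continuous_on {X (i - 1)..X i} (a i)" "continuous_on {X (i - 1)..X i} (b i)" if "i \<in> {1..N}" for i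
    unfolding a_def b_def by (rule au_continuous[OF that j])+
  have est: "\<bar>(\<Sum>i=1..N. 1 / \<epsilon> * integral {X (i - 1)..X i} (\<lambda>x. (h i x + b i x) * poly (S i) x))
      + rowB N m se (1 / se) X (\<lambda>i x. g i x + a i x - poly (D i) x) (\<lambda>i x. h i x + b i x) S V\<bar>
    \<le> 1 / 2 * (1 / \<epsilon> * (\<Sum>i=1..N. integral {X (i - 1)..X i} (\<lambda>x. (poly (S i) x)\<^sup>2))
        + se * ((poly (V 1) (X 0))\<^sup>2 + (poly (V N) (X N))\<^sup>2) + 1 / se * (poly (S (Suc m)) (X m) - poly (S m) (X m))\<^sup>2)
      + \<beta>\<^sup>2 / 2 * (\<Sum>i=1..N. integral {X (i - 1)..X i} (\<lambda>x. (poly (V i) x)\<^sup>2))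
      + 2 / \<epsilon> * (\<Sum>i=1..N. integral {X (i - 1)..X i} (\<lambda>x. (h i x + b i x)\<^sup>2))
      + 2 * \<epsilon> * (\<Sum>i=1..N. integral {X (i - 1)..X i} (\<lambda>x. (g' i x)\<^sup>2))
      + 1 / (2 * \<beta>\<^sup>2) * (\<Sum>i=1..N. integral {X (i - 1)..X i} (\<lambda>x. (h' i x)\<^sup>2))
      + 2 * (1 / se) * (b m (X m))\<^sup>2 + se * (a 1 (X 0))\<^sup>2 + (b N (X N))\<^sup>2 / se
      + 10 * (cinv k)\<^sup>2 * \<epsilon> / H\<^sup>2 * (\<Sum>i\<in>{lo<..m}. integral {X (i - 1)..X i} (\<lambda>x. (poly (D i) x)\<^sup>2))
      + 2 * cinv k / ((1 / se) * H) * integral {X (m - 1)..X m} (\<lambda>x. (poly (D m) x)\<^sup>2)"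
  proof (rule row_estimate[where g = g and g' = g' and h = h and h' = h' and a = a and b = b])
    show "(g i has_real_derivative g' i x) (at x within {X (i - 1)..X i})" if "i \<in> {1..N}" "x \<in> {X (i - 1)..X i}" for i x
      unfolding g_def g'_def by (rule gp_derivative(2)[OF that j y])
    show "(h i has_real_derivative h' i x) (at x within {X (i - 1)..X i})" if "i \<in> {1..N}" "x \<in> {X (i - 1)..X i}" for i x
      unfolding h_def h'_def by (rule gp_derivative(1)[OF that j y])
    show "g 1 (X 0) = 0" "g N (X N) = 0" using P0 bc y01 X_special by (simp_all add: g_def)
    show "h i (X i) = h (Suc i) (X i)" if "i \<in> {1..<N}" for i unfolding h_def by (rule gp_interface[OF that])
    show "a i (X i) = 0" "b i (X (i - 1)) = 0" if "i \<in> {1..N}" for i unfolding a_def b_def by (rule au_zero[OF that j])+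
    show "integral {X (i - 1)..X i} (\<lambda>x. a i x * poly (pderiv (S i)) x) = 0"
      "integral {X (i - 1)..X i} (\<lambda>x. b i x * poly (pderiv (V i)) x) = 0" if "i \<in> {1..N}" for i
      unfolding a_def b_def by (rule au_orth[OF that j] deg)+
  qed (use index_order X_less width_coarse H deg eps se beta D0 cg' ch' cab in \<open>simp_all add: g_def\<close>)
  have "(\<Sum>i=1..N. integral {X (i - 1)..X i} (\<lambda>x. (h i x + b i x)\<^sup>2)) \<le> (K * se)\<^sup>2 * (cPsi * se * L2)"
    using eta_p_bound[OF _ _ j y] by (intro integral_square_Psi continuous_intros ch cab) (auto simp: h_def b_def)
  then have "2 / \<epsilon> * (\<Sum>i=1..N. integral {X (i - 1)..X i} (\<lambda>x. (h i x + b i x)\<^sup>2)) \<le> 2 / \<epsilon> * ((K * se)\<^sup>2 * (cPsi * se * L2))"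
    using eps by (intro mult_left_mono) auto
  also have "\<dots> = 2 * (K\<^sup>2 * cPsi * (se * L2))" using eps by (simp add: power_mult_distrib se(3))
  finally have r1: "2 / \<epsilon> * (\<Sum>i=1..N. integral {X (i - 1)..X i} (\<lambda>x. (h i x + b i x)\<^sup>2)) \<le> 2 * (K\<^sup>2 * cPsi * (se * L2))" .
  have "(\<Sum>i=1..N. integral {X (i - 1)..X i} (\<lambda>x. (g' i x)\<^sup>2)) \<le> (K / se)\<^sup>2 * (cPsi * se * L2)"
    using g'_bound[OF _ _ j y] se(1) by (intro integral_square_Psi cg') (auto simp: g'_def field_simps)
  then have "2 * \<epsilon> * (\<Sum>i=1..N. integral {X (i - 1)..X i} (\<lambda>x. (g' i x)\<^sup>2)) \<le> 2 * \<epsilon> * ((K / se)\<^sup>2 * (cPsi * se * L2))"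
    using eps by (intro mult_left_mono) auto
  also have "\<dots> = 2 * (K\<^sup>2 * cPsi * (se * L2))" using eps by (simp add: power_divide se(3))
  finally have r2: "2 * \<epsilon> * (\<Sum>i=1..N. integral {X (i - 1)..X i} (\<lambda>x. (g' i x)\<^sup>2)) \<le> 2 * (K\<^sup>2 * cPsi * (se * L2))" .
  have "(\<Sum>i=1..N. integral {X (i - 1)..X i} (\<lambda>x. (h' i x)\<^sup>2)) \<le> K\<^sup>2 * (cPsi * se * L2)"
    using gp'_bound[OF _ _ j y] by (intro integral_square_Psi ch') (auto simp: h'_def)
  then have r3: "1 / (2 * \<beta>\<^sup>2) * (\<Sum>i=1..N. integral {X (i - 1)..X i} (\<lambda>x. (h' i x)\<^sup>2)) \<le> 1 / (2 * \<beta>\<^sup>2) * (K\<^sup>2 * cPsi * (se * L2))"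
    using beta by (intro mult_left_mono) (auto simp: mult_ac)
  have sq: "c\<^sup>2 \<le> K\<^sup>2 * L2" if "\<bar>c\<bar> \<le> K * L ^ (k + 1)" for c
    using power_mono[OF that, of 2] by (simp only: power_mult_distrib L2(3) power2_abs)
  have sqb: "c\<^sup>2 \<le> se * (se * (K\<^sup>2 * L2))" if "\<bar>c\<bar> \<le> K * se * L ^ (k + 1)" for c
  proof -
    have "c\<^sup>2 \<le> (K * se * L ^ (k + 1))\<^sup>2" using power_mono[OF that, of 2] by simp
    also have "\<dots> = K\<^sup>2 * se\<^sup>2 * L2" by (simp only: power_mult_distrib L2(3))
    finally show ?thesis by (simp add: power2_eq_square mult_ac)
  qed
  have "(b m (X m))\<^sup>2 \<le> se * (se * (K\<^sup>2 * L2))"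
    unfolding b_def using X_less[of m] index_order by (intro sqb bp_bounds(2)[OF j y]) auto
  then have "2 * (1 / se) * (b m (X m))\<^sup>2 \<le> 2 * (1 / se) * (se * (se * (K\<^sup>2 * L2)))" using se by (intro mult_left_mono) auto
  then have r4: "2 * (1 / se) * (b m (X m))\<^sup>2 \<le> 2 * (K\<^sup>2 * (se * L2))" using se(1) by (simp add: mult_ac)
  have "(a 1 (X 0))\<^sup>2 \<le> K\<^sup>2 * L2"
    unfolding a_def using X_less[of 1] index_order by (intro sq au_bound[OF j y]) auto
  then have r5: "se * (a 1 (X 0))\<^sup>2 \<le> K\<^sup>2 * (se * L2)" using se(1) mult_left_mono[of _ _ se] by (fastforce simp: mult_ac)
  have "(b N (X N))\<^sup>2 \<le> se * (se * (K\<^sup>2 * L2))"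
    unfolding b_def using X_less[of N] index_order by (intro sqb bp_bounds(2)[OF j y]) auto
  then have "(b N (X N))\<^sup>2 / se \<le> se * (se * (K\<^sup>2 * L2)) / se" using se by (intro divide_right_mono) auto
  then have r6: "(b N (X N))\<^sup>2 / se \<le> K\<^sup>2 * (se * L2)" using se(1) by (simp add: mult_ac)
  have Hinv: "1 / H \<le> real N" using H N by (simp add: field_simps)
  have "10 * (cinv k)\<^sup>2 * \<epsilon> / H\<^sup>2 = 10 * (cinv k)\<^sup>2 * \<epsilon> * (1 / H)\<^sup>2" by (simp add: power_divide)
  also have "\<dots> \<le> 10 * (cinv k)\<^sup>2 * \<epsilon> * (real N)\<^sup>2" using Hinv H eps by (intro mult_left_mono power_mono) auto
  finally have r7: "10 * (cinv k)\<^sup>2 * \<epsilon> / H\<^sup>2 * (\<Sum>i\<in>{lo<..m}. integral {X (i - 1)..X i} (\<lambda>x. (poly (D i) x)\<^sup>2))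
     \<le> 10 * (cinv k)\<^sup>2 * \<epsilon> * (real N)\<^sup>2 * (\<Sum>i\<in>{lo<..m}. integral {X (i - 1)..X i} (\<lambda>x. (poly (D i) x)\<^sup>2))"
    by (intro mult_right_mono sum_nonneg integral_nonneg integrable_continuous_interval continuous_intros) auto
  have "2 * cinv k / ((1 / se) * H) = 2 * cinv k * se * (1 / H)" by simp
  also have "\<dots> \<le> 2 * cinv k * se * real N" using Hinv cinv_ge[of k] se by (intro mult_left_mono) auto
  finally have r8: "2 * cinv k / ((1 / se) * H) * integral {X (m - 1)..X m} (\<lambda>x. (poly (D m) x)\<^sup>2)
     \<le> 2 * cinv k * se * real N * integral {X (m - 1)..X m} (\<lambda>x. (poly (D m) x)\<^sup>2)"
    by (intro mult_right_mono integral_nonneg integrable_continuous_interval continuous_intros) auto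
  have KR: "KR * se * L2 = 2 * (K\<^sup>2 * cPsi * (se * L2)) + 2 * (K\<^sup>2 * cPsi * (se * L2)) + 1 / (2 * \<beta>\<^sup>2) * (K\<^sup>2 * cPsi * (se * L2)) + 4 * (K\<^sup>2 * (se * L2))"
    unfolding KR_def by (simp add: algebra_simps)
  show ?thesis unfolding eq1 eq2 KR using est r1 r2 r3 r4 r5 r6 r7 r8 by linarith
qed

end

subsection \<open>Cells, bivariate polynomials and the two-dimensional form\<close>

text \<open>Iterated with the \<open>y\<close>-integral outside, so that row estimates at fixed
  \<open>y\<close> can be integrated directly; \<open>contR\<close> provides the regularity for
  exchanging the order.\<close>

definition I2 :: "real \<Rightarrow> real \<Rightarrow> real \<Rightarrow> real \<Rightarrow> (real \<Rightarrow> real \<Rightarrow> real) \<Rightarrow> real" where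
  "I2 a b c d F = integral {c..d} (\<lambda>y. integral {a..b} (\<lambda>x. F x y))"

definition contR :: "real \<Rightarrow> real \<Rightarrow> real \<Rightarrow> real \<Rightarrow> (real \<Rightarrow> real \<Rightarrow> real) \<Rightarrow> bool" where
  "contR a b c d F \<longleftrightarrow> continuous_on ({a..b} \<times> {c..d}) (\<lambda>p. F (fst p) (snd p))"

named_theorems contR

lemma contR_intros [contR]:
  "contR a b c d F \<Longrightarrow> contR a b c d G \<Longrightarrow> contR a b c d (\<lambda>x y. F x y + G x y)"
  "contR a b c d F \<Longrightarrow> contR a b c d G \<Longrightarrow> contR a b c d (\<lambda>x y. F x y - G x y)"
  "contR a b c d F \<Longrightarrow> contR a b c d G \<Longrightarrow> contR a b c d (\<lambda>x y. F x y * G x y)"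
  "contR a b c d F \<Longrightarrow> contR a b c d (\<lambda>x y. (F x y) ^ n)"
  "contR a b c d (\<lambda>x y. r)"
  unfolding contR_def by (auto intro!: continuous_intros)

lemma contR_x:
  assumes "contR a b c d F" "y \<in> {c..d}"
  shows "continuous_on {a..b} (\<lambda>x. F x y)"
  using continuous_on_compose2[OF assms(1)[unfolded contR_def], of "{a..b}" "\<lambda>x. (x, y)"] assms(2)
  by (force intro!: continuous_intros)

lemma contR_y:
  assumes "contR a b c d F" "x \<in> {a..b}"
  shows "continuous_on {c..d} (F x)"
  using continuous_on_compose2[OF assms(1)[unfolded contR_def], of "{c..d}" "\<lambda>y. (x, y)"] assms(2)
  by (force intro!: continuous_intros)

lemma contR_swap:
  assumes "contR a b c d F"
  shows "contR c d a b (\<lambda>y x. F x y)"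
  using continuous_on_compose2[OF assms[unfolded contR_def], of "{c..d} \<times> {a..b}" "\<lambda>p. (snd p, fst p)"]
  unfolding contR_def by (force intro!: continuous_intros)

lemma contR_inner:
  assumes "contR a b c d F"
  shows "continuous_on {c..d} (\<lambda>y. integral {a..b} (\<lambda>x. F x y))"
  using integral_continuous_on_param[of "{c..d}" a b "\<lambda>y x. F x y"] contR_swap[OF assms]
  by (simp add: contR_def case_prod_beta)

lemma I2_add: "contR a b c d F \<Longrightarrow> contR a b c d G \<Longrightarrow> I2 a b c d (\<lambda>x y. F x y + G x y) = I2 a b c d F + I2 a b c d G"
proof -
  assume F: "contR a b c d F" and G: "contR a b c d G"
  have "I2 a b c d (\<lambda>x y. F x y + G x y) = integral {c..d} (\<lambda>y. integral {a..b} (\<lambda>x. F x y) + integral {a..b} (\<lambda>x. G x y))"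
    unfolding I2_def by (intro integral_cong integral_add integrable_continuous_interval contR_x[OF F] contR_x[OF G])
  also have "\<dots> = I2 a b c d F + I2 a b c d G"
    unfolding I2_def by (intro integral_add integrable_continuous_interval contR_inner F G)
  finally show ?thesis .
qed

lemma I2_cmult: "I2 a b c d (\<lambda>x y. r * F x y) = r * I2 a b c d F"
  unfolding I2_def by simp

lemma I2_diff: "contR a b c d F \<Longrightarrow> contR a b c d G \<Longrightarrow> I2 a b c d (\<lambda>x y. F x y - G x y) = I2 a b c d F - I2 a b c d G"
  using I2_add[of a b c d F "\<lambda>x y. (-1) * G x y"] I2_cmult[of a b c d "-1" G] contR_intros(3)[OF contR_intros(5), of a b c d G "-1"] by simp

lemma I2_mono:
  assumes F: "contR a b c d F" and G: "contR a b c d G" and le: "\<And>x y. x \<in> {a..b} \<Longrightarrow> y \<in> {c..d} \<Longrightarrow> F x y \<le> G x y"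
  shows "I2 a b c d F \<le> I2 a b c d G"
  unfolding I2_def
  by (intro integral_le integrable_continuous_interval contR_inner F G contR_x[OF F] contR_x[OF G] le)

lemma I2_cong: "(\<And>x y. x \<in> {a..b} \<Longrightarrow> y \<in> {c..d} \<Longrightarrow> F x y = G x y) \<Longrightarrow> I2 a b c d F = I2 a b c d G"
  unfolding I2_def by (intro integral_cong) auto

lemma I2_nonneg:
  assumes "contR a b c d F" and "\<And>x y. x \<in> {a..b} \<Longrightarrow> y \<in> {c..d} \<Longrightarrow> 0 \<le> F x y"
  shows "0 \<le> I2 a b c d F"
  using I2_mono[OF contR_intros(5) assms(1), of 0] assms(2) by (simp add: I2_def)

lemma I2_swap: "contR a b c d F \<Longrightarrow> I2 c d a b (\<lambda>y x. F x y) = I2 a b c d F"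
  unfolding I2_def by (rule integral_swap_rect) (simp add: contR_def case_prod_beta)

lemma I2_const: "a \<le> b \<Longrightarrow> c \<le> d \<Longrightarrow> I2 a b c d (\<lambda>x y. r) = (b - a) * (d - c) * r"
  by (simp add: I2_def)

section \<open>Bivariate polynomials\<close>

definition ev :: "nat \<Rightarrow> (nat \<Rightarrow> nat \<Rightarrow> real) \<Rightarrow> real \<Rightarrow> real \<Rightarrow> real" where
  "ev k c x y = (\<Sum>a\<le>k. \<Sum>d\<le>k. c a d * x ^ a * y ^ d)"

definition transp :: "(nat \<Rightarrow> nat \<Rightarrow> real) \<Rightarrow> nat \<Rightarrow> nat \<Rightarrow> real" where
  "transp c = (\<lambda>a d. c d a)"

text \<open>The section of the bivariate polynomial with coefficients \<open>c\<close> at height \<open>y\<close>.\<close>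

definition sec :: "nat \<Rightarrow> (nat \<Rightarrow> nat \<Rightarrow> real) \<Rightarrow> real \<Rightarrow> real poly" where
  "sec k c y = (\<Sum>a\<le>k. monom (\<Sum>d\<le>k. c a d * y ^ d) a)"

lemma poly_sec: "poly (sec k c y) x = ev k c x y"
  by (simp add: sec_def ev_def poly_sum poly_monom sum_distrib_left sum_distrib_right mult_ac)

lemma degree_sec: "degree (sec k c y) \<le> k"
  unfolding sec_def by (intro degree_sum_le) (auto intro: order.trans[OF degree_monom_le])

lemma pderiv_sec: "poly (pderiv (sec k c y)) x = (\<Sum>a\<le>k. \<Sum>d\<le>k. c a d * (of_nat a * x ^ (a - 1)) * y ^ d)"
  by (simp add: sec_def pderiv_sum pderiv_monom poly_sum poly_monom sum_distrib_left sum_distrib_right mult_ac)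

lemma ev_transp: "ev k (transp c) y x = ev k c x y"
  unfolding ev_def transp_def by (subst sum.swap) (simp add: mult_ac)

lemma ev_linear: "ev k (\<lambda>a d. r * c a d + c' a d) x y = r * ev k c x y + ev k c' x y"
  by (simp add: ev_def sum.distrib sum_distrib_left algebra_simps)

lemma ev_zero: "ev k (\<lambda>_ _. 0) x y = 0"
  by (simp add: ev_def)

lemma sec_zero: "sec k (\<lambda>_ _. 0) y = 0"
  by (simp add: sec_def)

lemma ev_diff: "ev k (\<lambda>a d. c a d - c' a d) x y = ev k c x y - ev k c' x y"
  using ev_linear[of k "-1" c' c x y] by simp

lemma ev_add: "ev k (\<lambda>a d. c a d + c' a d) x y = ev k c x y + ev k c' x y"
  using ev_linear[of k "1" c c' x y] by simp

lemma contR_ev [contR]: "contR a b c d (\<lambda>x y. ev k q x y)"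
  unfolding contR_def ev_def by (intro continuous_intros)

lemma contR_pderiv_sec [contR]: "contR a b c d (\<lambda>x y. poly (pderiv (sec k q y)) x)" "contR a b c d (\<lambda>x y. poly (pderiv (sec k q x)) y)"
  unfolding contR_def pderiv_sec by (intro continuous_intros)+

lemma poly_bounded_degree: "degree p \<le> k \<Longrightarrow> poly p x = (\<Sum>i\<le>k. coeff p i * x ^ i)" for p :: "real poly"
  unfolding poly_altdef by (intro sum.mono_neutral_left) (auto simp: coeff_eq_0)

lemma ev_of_products:
  assumes "\<And>n. n \<in> A \<Longrightarrow> degree (P n) \<le> k" "\<And>n. n \<in> A \<Longrightarrow> degree (Q n) \<le> k"
  shows "\<exists>c. \<forall>x y. (\<Sum>n\<in>A. poly (P n) x * poly (Q n) y) = ev k c x y"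
proof (intro exI allI)
  fix x y :: real
  have "(\<Sum>n\<in>A. poly (P n) x * poly (Q n) y) = (\<Sum>n\<in>A. \<Sum>a\<le>k. \<Sum>d\<le>k. coeff (P n) a * coeff (Q n) d * x ^ a * y ^ d)"
    by (intro sum.cong refl) (simp add: poly_bounded_degree[OF assms(1)] poly_bounded_degree[OF assms(2)] sum_product mult_ac)
  also have "\<dots> = (\<Sum>a\<le>k. \<Sum>d\<le>k. \<Sum>n\<in>A. coeff (P n) a * coeff (Q n) d * x ^ a * y ^ d)"
    by (subst sum.swap, rule sum.cong[OF refl], rule sum.swap)
  also have "\<dots> = ev k (\<lambda>a d. \<Sum>n\<in>A. coeff (P n) a * coeff (Q n) d) x y"
    by (simp add: ev_def sum_distrib_right)
  finally show "(\<Sum>n\<in>A. poly (P n) x * poly (Q n) y) = ev k (\<lambda>a d. \<Sum>n\<in>A. coeff (P n) a * coeff (Q n) d) x y" .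
qed

text \<open>\<open>gram_projection\<close> for the monomials and the inner product with weight
  \<open>w\<close>. It is used with the reaction coefficient as weight, so that the reaction term
  itself is annihilated and not an unweighted surrogate.\<close>

lemma weighted_projection:
  assumes ab: "a \<le> b" "c \<le> d" and bb: "contR a b c d w" "\<And>x y. x \<in> {a..b} \<Longrightarrow> y \<in> {c..d} \<Longrightarrow> 0 \<le> w x y" and f: "contR a b c d f"
  shows "\<exists>q. \<forall>q'. I2 a b c d (\<lambda>x y. w x y * (f x y - ev k q x y) * ev k q' x y) = 0"
proof -
  let ?V = "{F :: real \<times> real \<Rightarrow> real. contR a b c d (\<lambda>x y. F (x, y))}"
  let ?B = "\<lambda>F G :: real \<times> real \<Rightarrow> real. I2 a b c d (\<lambda>x y. w x y * F (x, y) * G (x, y))"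
  let ?\<phi> = "\<lambda>(i, j) (x, y). x ^ i * y ^ j :: real"
  have \<phi>: "?\<phi> i \<in> ?V" for i unfolding contR_def case_prod_beta by (auto intro!: continuous_intros)
  have "\<exists>q. (\<lambda>p. (\<lambda>(x, y). f x y) p - (\<Sum>j\<in>{..k} \<times> {..k}. q j * ?\<phi> j p)) \<in> ?V \<and>
    (\<forall>i\<in>{..k} \<times> {..k}. ?B (\<lambda>p. (\<lambda>(x, y). f x y) p - (\<Sum>j\<in>{..k} \<times> {..k}. q j * ?\<phi> j p)) (?\<phi> i) = 0)"
  proof (rule gram_projection[where V = ?V and B = ?B])
    show "(\<lambda>x. F x - r * G x) \<in> ?V" if "F \<in> ?V" "G \<in> ?V" for F G r
      using that by (auto intro!: contR)
    show "?B (\<lambda>x. F x - r * G x) h = ?B F h - r * ?B G h" if "F \<in> ?V" "G \<in> ?V" "h \<in> ?V" for F G h r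
    proof -
      have "?B (\<lambda>x. F x - r * G x) h = I2 a b c d (\<lambda>x y. w x y * F (x, y) * h (x, y) - r * (w x y * G (x, y) * h (x, y)))"
        by (simp add: algebra_simps)
      also have "\<dots> = ?B F h - I2 a b c d (\<lambda>x y. r * (w x y * G (x, y) * h (x, y)))"
        using that by (intro I2_diff contR bb) auto
      finally show ?thesis by (simp add: I2_cmult)
    qed
    show "?B F G = ?B G F" for F G by (simp add: mult_ac)
    show "0 \<le> ?B F F" if "F \<in> ?V" for F
      using that bb(2) by (intro I2_nonneg contR bb) (auto simp: mult.assoc)
    show "(\<lambda>(x, y). f x y) \<in> ?V" using f by simp
  qed (use \<phi> in auto)
  then obtain q where q: "\<forall>i\<in>{..k} \<times> {..k}. ?B (\<lambda>p. (\<lambda>(x, y). f x y) p - (\<Sum>j\<in>{..k} \<times> {..k}. q j * ?\<phi> j p)) (?\<phi> i) = 0"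
    by (elim exE conjE) (rule that)
  define q0 where "q0 a d = q (a, d)" for a d
  have ev0: "(\<Sum>j\<in>{..k} \<times> {..k}. q j * ?\<phi> j (x, y)) = ev k q0 x y" for x y
    by (simp add: ev_def q0_def sum.cartesian_product case_prod_beta mult_ac)
  define r where "r x y = w x y * (f x y - ev k q0 x y)" for x y
  have cr: "contR a b c d r" unfolding r_def by (intro contR bb f)
  have base: "I2 a b c d (\<lambda>x y. r x y * (x ^ i * y ^ j)) = 0" if "i \<le> k" "j \<le> k" for i j
    using q[rule_format, of "(i, j)"] that ev0 by (simp add: r_def)
  have all: "I2 a b c d (\<lambda>x y. r x y * (\<Sum>j\<in>J. q' j * ?\<phi> j (x, y))) = 0" if "J \<subseteq> {..k} \<times> {..k}" for J q'
    using finite_subset[OF that] that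
  proof (induction J rule: infinite_finite_induct)
    case (insert j J)
    have c1: "contR a b c d (\<lambda>x y. (\<Sum>j\<in>J. q' j * ?\<phi> j (x, y)))"
      unfolding contR_def case_prod_beta by (intro continuous_intros)
    have c2: "contR a b c d (\<lambda>x y. ?\<phi> j (x, y))" unfolding contR_def case_prod_beta by (intro continuous_intros)
    have "I2 a b c d (\<lambda>x y. r x y * (\<Sum>j\<in>Set.insert j J. q' j * ?\<phi> j (x, y)))
      = I2 a b c d (\<lambda>x y. q' j * (r x y * ?\<phi> j (x, y)) + r x y * (\<Sum>j\<in>J. q' j * ?\<phi> j (x, y)))"
      using insert.hyps by (simp add: algebra_simps)
    also have "\<dots> = I2 a b c d (\<lambda>x y. q' j * (r x y * ?\<phi> j (x, y))) + I2 a b c d (\<lambda>x y. r x y * (\<Sum>j\<in>J. q' j * ?\<phi> j (x, y)))"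
      by (intro I2_add contR cr c1 c2)
    also have "\<dots> = 0" using insert.IH insert.prems base[of "fst j" "snd j"] by (auto simp: I2_cmult case_prod_beta)
    finally show ?case .
  qed (simp_all add: I2_def)
  have "I2 a b c d (\<lambda>x y. r x y * ev k q' x y) = 0" for q'
    using all[OF order.refl, of "\<lambda>j. q' (fst j) (snd j)"] by (simp add: ev_def sum.cartesian_product case_prod_beta mult_ac)
  then show ?thesis unfolding r_def by (intro exI[of _ q0]) auto
qed

lemma prj_sum:
  assumes "a < b" "finite A" "\<And>n. n \<in> A \<Longrightarrow> continuous_on {a..b} (f n)"
  shows "prj k z a b (\<lambda>x. \<Sum>n\<in>A. r n * f n x) s = (\<Sum>n\<in>A. r n * prj k z a b (f n) s)"
  using assms(2,3)
proof (induction A rule: finite_induct)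
  case (insert n A)
  have "prj k z a b (\<lambda>x. \<Sum>n\<in>Set.insert n A. r n * f n x) s = prj k z a b (\<lambda>x. r n * f n x + (\<Sum>n\<in>A. r n * f n x)) s"
    using insert.hyps by simp
  also have "\<dots> = prj k z a b (\<lambda>x. r n * f n x) s + prj k z a b (\<lambda>x. \<Sum>n\<in>A. r n * f n x) s"
    by (intro prj_add[OF assms(1)] continuous_intros insert.prems) auto
  finally show ?case using insert by (simp add: prj_cmult)
qed (simp add: prj_zero)

text \<open>The inner projection is a combination of Legendre polynomials in \<open>y\<close> whose
  coefficients \<open>\<nu> n\<close> are continuous functions of the other variable. The outer
  projection acts on these coefficients one by one, which leaves finitely many products of
  univariate polynomials.\<close>

lemma prj_prj_poly:
  assumes ab: "a < b" "c < d" and z: "z = 0 \<or> z = 1" and z': "z' = 0 \<or> z' = 1" and F: "contR a b c d F"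
  shows "\<exists>q. \<forall>x y. prj k z a b (\<lambda>s. prj k z' c d (F s) y) x = ev k q x y"
proof -
  let ?l = "\<lambda>t. c + (d - c) * t"
  have l: "?l t \<in> {c..d}" if "t \<in> {0..1}" for t using affine_in_Icc[of c d t] ab that by simp
  define \<mu> where "\<mu> n s = mom n (\<lambda>t. F s (?l t))" for n s
  have c\<mu>: "continuous_on {a..b} (\<mu> n)" for n
  proof -
    have "continuous_on ({a..b} \<times> cbox 0 1) (\<lambda>p. F (fst p) (?l (snd p)))"
      using continuous_on_compose2[OF F[unfolded contR_def], of "{a..b} \<times> cbox 0 1" "\<lambda>p. (fst p, ?l (snd p))"] l
      by (force intro!: continuous_intros)
    then have "continuous_on ({a..b} \<times> cbox 0 1) (\<lambda>p. poly (legp n) (snd p) * F (fst p) (?l (snd p)))"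
      by (intro continuous_intros)
    then show ?thesis unfolding \<mu>_def[abs_def] mom_def
      using integral_continuous_on_param[of "{a..b}" 0 1 "\<lambda>s t. poly (legp n) t * F s (?l t)"] by (simp add: case_prod_beta)
  qed
  define \<nu> where "\<nu> n s = (if n < k then \<mu> n s else (F s (?l z') - (\<Sum>n<k. \<mu> n s * poly (legp n) z')) / poly (legp k) z')" for n s
  have c\<nu>: "continuous_on {a..b} (\<nu> n)" for n
    unfolding \<nu>_def using c\<mu> contR_y[OF F] contR_x[OF F l[of z']] z' legp_endpoint_nonzero[OF z', of k]
    by (cases "n < k") (auto intro!: continuous_intros)
  have cF: "continuous_on {0..1} (\<lambda>t. F s (?l t))" if "s \<in> {a..b}" for s
    using continuous_on_affine_Icc[OF less_imp_le[OF ab(2)] contR_y[OF F that]] .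
  have "prj k z a b (\<lambda>s. prj k z' c d (F s) y) x = (\<Sum>n\<le>k. poly (ppoly k z a b (\<nu> n)) x * poly (pcompose (legp n) (affine_poly c d)) y)" for x y
  proof -
    have "prj k z' c d (F s) y = (\<Sum>n\<le>k. poly (legp n) ((y - c) / (d - c)) * \<nu> n s)" if "s \<in> {a..b}" for s
      unfolding prj_def rprj_expand[OF cF[OF that]] by (simp add: lessThan_Suc_atMost[symmetric] \<nu>_def \<mu>_def mult.commute)
    then have "prj k z a b (\<lambda>s. prj k z' c d (F s) y) x = prj k z a b (\<lambda>s. \<Sum>n\<le>k. poly (legp n) ((y - c) / (d - c)) * \<nu> n s) x"
      using z by (intro prj_cong ab) auto
    also have "\<dots> = (\<Sum>n\<le>k. poly (legp n) ((y - c) / (d - c)) * prj k z a b (\<nu> n) x)"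
      by (intro prj_sum ab c\<nu>) auto
    finally show ?thesis unfolding prj_poly[OF ab(1) c\<nu>] by (simp add: poly_pcompose poly_affine_poly mult.commute)
  qed
  moreover have "\<exists>q. \<forall>x y. (\<Sum>n\<le>k. poly (ppoly k z a b (\<nu> n)) x * poly (pcompose (legp n) (affine_poly c d)) y) = ev k q x y"
  proof (rule ev_of_products)
    fix n assume "n \<in> {..k}"
    show "degree (ppoly k z a b (\<nu> n)) \<le> k" by (rule degree_ppoly)
    have "degree (pcompose (legp n) (affine_poly c d)) \<le> degree (legp n) * degree (affine_poly c d)" by (rule degree_pcompose_le)
    also have "\<dots> \<le> n * 1" by (intro mult_mono) (auto simp: affine_poly_def)
    finally show "degree (pcompose (legp n) (affine_poly c d)) \<le> k" using \<open>n \<in> {..k}\<close> by simp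
  qed
  ultimately show ?thesis by simp
qed

text \<open>The share of one cell in \<open>rowB\<close>, integrated over the height of the row. It
  takes the whole piecewise functions as arguments because the fluxes read neighbouring
  cells.\<close>

definition cellX :: "nat \<Rightarrow> nat \<Rightarrow> nat \<Rightarrow> real \<Rightarrow> real \<Rightarrow> (nat \<Rightarrow> real) \<Rightarrow> (nat \<Rightarrow> nat \<Rightarrow> real \<Rightarrow> real \<Rightarrow> real)
    \<Rightarrow> (nat \<Rightarrow> nat \<Rightarrow> real \<Rightarrow> real \<Rightarrow> real) \<Rightarrow> (nat \<Rightarrow> nat \<Rightarrow> real) \<Rightarrow> (nat \<Rightarrow> nat \<Rightarrow> real) \<Rightarrow> nat \<Rightarrow> nat \<Rightarrow> real" where
  "cellX k N m lam lt X eu ep s v i j =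
     I2 (X (i - 1)) (X i) (X (j - 1)) (X j) (\<lambda>x y. eu i j x y * poly (pderiv (sec k s y)) x + ep i j x y * poly (pderiv (sec k v y)) x)
     - integral {X (j - 1)..X j} (\<lambda>y. uflux N m lt X (\<lambda>i x. eu i j x y) (\<lambda>i x. ep i j x y) i * ev k s (X i) y)
     + integral {X (j - 1)..X j} (\<lambda>y. uflux N m lt X (\<lambda>i x. eu i j x y) (\<lambda>i x. ep i j x y) (i - 1) * ev k s (X (i - 1)) y)
     - integral {X (j - 1)..X j} (\<lambda>y. pflux N lam X (\<lambda>i x. eu i j x y) (\<lambda>i x. ep i j x y) i * ev k v (X i) y)
     + integral {X (j - 1)..X j} (\<lambda>y. pflux N lam X (\<lambda>i x. eu i j x y) (\<lambda>i x. ep i j x y) (i - 1) * ev k v (X (i - 1)) y)"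

lemma flux_continuous:
  assumes m: "1 \<le> m" "m < N" and X: "\<And>i. i \<in> {1..N} \<Longrightarrow> X (i - 1) < X i"
    and eu: "\<And>i. i \<in> {1..N} \<Longrightarrow> contR (X (i - 1)) (X i) c d (eu i)"
    and ep: "\<And>i. i \<in> {1..N} \<Longrightarrow> contR (X (i - 1)) (X i) c d (ep i)"
    and i: "i \<le> N"
  shows "continuous_on {c..d} (\<lambda>y. uflux N m lt X (\<lambda>i x. eu i x y) (\<lambda>i x. ep i x y) i)"
    and "continuous_on {c..d} (\<lambda>y. pflux N lam X (\<lambda>i x. eu i x y) (\<lambda>i x. ep i x y) i)"
proof -
  have r: "continuous_on {c..d} (\<lambda>y. eu i (X i) y)" "continuous_on {c..d} (\<lambda>y. ep i (X i) y)" if "i \<in> {1..N}" for i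
    using contR_y[OF eu[OF that], of "X i"] contR_y[OF ep[OF that], of "X i"] X[OF that] by auto
  have l: "continuous_on {c..d} (\<lambda>y. eu (Suc i) (X i) y)" "continuous_on {c..d} (\<lambda>y. ep (Suc i) (X i) y)" if "i < N" for i
    using contR_y[OF eu, of "Suc i" "X i"] contR_y[OF ep, of "Suc i" "X i"] X[of "Suc i"] that by auto
  show "continuous_on {c..d} (\<lambda>y. uflux N m lt X (\<lambda>i x. eu i x y) (\<lambda>i x. ep i x y) i)"
    unfolding uflux_def using i m r[of i] l[of i] by (cases "i = 0 \<or> i = N"; cases "i = m") (auto intro!: continuous_intros)
  show "continuous_on {c..d} (\<lambda>y. pflux N lam X (\<lambda>i x. eu i x y) (\<lambda>i x. ep i x y) i)"
    unfolding pflux_def using i m r[of i] l[of i] r[of N] l[of 0] by (cases "i = 0"; cases "i = N") (auto intro!: continuous_intros)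
qed

lemma ev_continuous_y: "continuous_on S (\<lambda>y. ev k c x y)"
  unfolding ev_def by (intro continuous_intros)

lemma rowB_integral:
  assumes m: "1 \<le> m" "m < N" and X: "\<And>i. i \<in> {1..N} \<Longrightarrow> X (i - 1) < X i"
    and eu: "\<And>i. i \<in> {1..N} \<Longrightarrow> contR (X (i - 1)) (X i) (X (j - 1)) (X j) (eu i j)"
    and ep: "\<And>i. i \<in> {1..N} \<Longrightarrow> contR (X (i - 1)) (X i) (X (j - 1)) (X j) (ep i j)"
  shows "((\<lambda>y. rowB N m lam lt X (\<lambda>i x. eu i j x y) (\<lambda>i x. ep i j x y) (\<lambda>i. sec k (s i) y) (\<lambda>i. sec k (v i) y))
    has_integral (\<Sum>i=1..N. cellX k N m lam lt X eu ep (s i) (v i) i j)) {X (j - 1)..X j}"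
  unfolding rowB_def cellX_def poly_sec I2_def
proof (intro has_integral_sum)
  fix i assume i: "i \<in> {1..N}"
  then have i': "i \<le> N" "i - 1 \<le> N" by auto
  note F = flux_continuous[where X = X and eu = "\<lambda>i. eu i j" and ep = "\<lambda>i. ep i j" and c = "X (j - 1)" and d = "X j", OF m X eu ep]
  have c: "contR (X (i - 1)) (X i) (X (j - 1)) (X j) (\<lambda>x y. eu i j x y * poly (pderiv (sec k (s i) y)) x + ep i j x y * poly (pderiv (sec k (v i) y)) x)"
    by (intro contR eu ep i)
  show "((\<lambda>y. integral {X (i - 1)..X i} (\<lambda>x. eu i j x y * poly (pderiv (sec k (s i) y)) x + ep i j x y * poly (pderiv (sec k (v i) y)) x) -
      uflux N m lt X (\<lambda>i x. eu i j x y) (\<lambda>i x. ep i j x y) i * ev k (s i) (X i) y +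
      uflux N m lt X (\<lambda>i x. eu i j x y) (\<lambda>i x. ep i j x y) (i - 1) * ev k (s i) (X (i - 1)) y -
      pflux N lam X (\<lambda>i x. eu i j x y) (\<lambda>i x. ep i j x y) i * ev k (v i) (X i) y +
      pflux N lam X (\<lambda>i x. eu i j x y) (\<lambda>i x. ep i j x y) (i - 1) * ev k (v i) (X (i - 1)) y) has_integral
     integral {X (j - 1)..X j} (\<lambda>y. integral {X (i - 1)..X i} (\<lambda>x. eu i j x y * poly (pderiv (sec k (s i) y)) x + ep i j x y * poly (pderiv (sec k (v i) y)) x)) -
     integral {X (j - 1)..X j} (\<lambda>y. uflux N m lt X (\<lambda>i x. eu i j x y) (\<lambda>i x. ep i j x y) i * ev k (s i) (X i) y) +
     integral {X (j - 1)..X j} (\<lambda>y. uflux N m lt X (\<lambda>i x. eu i j x y) (\<lambda>i x. ep i j x y) (i - 1) * ev k (s i) (X (i - 1)) y) -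
     integral {X (j - 1)..X j} (\<lambda>y. pflux N lam X (\<lambda>i x. eu i j x y) (\<lambda>i x. ep i j x y) i * ev k (v i) (X i) y) +
     integral {X (j - 1)..X j} (\<lambda>y. pflux N lam X (\<lambda>i x. eu i j x y) (\<lambda>i x. ep i j x y) (i - 1) * ev k (v i) (X (i - 1)) y)) {X (j - 1)..X j}"
    by (intro has_integral_add has_integral_diff integrable_integral integrable_continuous_interval contR_inner[OF c]
        continuous_on_mult F i' ev_continuous_y; assumption?)
qed simp

context layered
begin

abbreviation "I2c i j F \<equiv> I2 (X (i - 1)) (X i) (X (j - 1)) (X j) F"
abbreviation "contC i j F \<equiv> contR (X (i - 1)) (X i) (X (j - 1)) (X j) F"

lemma family_contC:
  assumes "smooth_family n F" "a \<le> n" "b \<le> n" "i \<in> {1..N}" "j \<in> {1..N}"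
  shows "contC i j (F a b)"
proof -
  have "{X (i - 1)..X i} \<times> {X (j - 1)..X j} \<subseteq> {0..1} \<times> {0..1}"
    using cell_subset'[OF assms(4)] cell_subset'[OF assms(5)] by blast
  then show ?thesis using continuous_on_subset[OF smooth_familyD(1)[OF assms(1-3)]] by (simp add: contR_def case_prod_beta)
qed

lemma Gu_ev: "i \<in> {1..N} \<Longrightarrow> j \<in> {1..N} \<Longrightarrow> \<exists>q. \<forall>x y. Gu i j x y = ev k q x y"
  unfolding Gu_def PX_def PY_def by (intro prj_prj_poly X_less family_contC[OF sm(7)]) auto

lemma Gp_ev:
  assumes i: "i \<in> {1..N}" and j: "j \<in> {1..N}"
  shows "\<exists>q. \<forall>x y. Gp i j x y = ev k q x y"
proof -
  have "\<exists>q. \<forall>x y. PX 0 i (zt i j y) x = ev k q x y"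
    unfolding zt_def[abs_def] PX_def PY_def by (intro prj_prj_poly X_less family_contC[OF smFp] i j) auto
  then obtain q where q: "\<And>x y. PX 0 i (zt i j y) x = ev k q x y" by blast
  have lin: "\<exists>q. \<forall>x y. poly p x * PY j (Xf 1 0) t y = ev k q x y" if "t \<in> {0..1}" "degree p \<le> k" for t p
  proof -
    have c: "continuous_on {X (j - 1)..X j} (Xf 1 0 t)"
      by (intro continuous_on_subset[OF smooth_family_section(1)[OF smXf _ _ that(1)] cell_subset'[OF j]]) auto
    show ?thesis unfolding PY_def prj_poly[OF X_less[OF j] c]
      using ev_of_products[of "{0::nat}" "\<lambda>_. p" k "\<lambda>_. ppoly k 1 (X (j - 1)) (X j) (Xf 1 0 t)"] that(2) degree_ppoly
      by simp
  qed
  have "\<exists>q. \<forall>x y. ramp i j x y = ev k q x y"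
  proof (cases "refined i")
    case False
    then show ?thesis using ev_zero by (intro exI[of _ "\<lambda>_ _. 0"]) (simp add: ramp_def)
  next
    case True
    have d: "degree [:0, 1 / \<tau>:] \<le> k" "degree [:1 / \<tau>, - (1 / \<tau>):] \<le> k" using k by (auto intro: order.trans[OF degree_pCons_le])
    show ?thesis
    proof (cases "i \<le> lo")
      case True
      then show ?thesis using lin[OF tau01(1) d(1)] \<open>refined i\<close> by (simp add: ramp_def rho_def mult.commute)
    next
      case False
      then have "\<not> i \<le> m" using \<open>refined i\<close> by (auto simp: refined_def)
      then show ?thesis using lin[OF tau01(2) d(2)] \<open>refined i\<close> False by (simp add: ramp_def rho_def algebra_simps diff_divide_distrib)
    qed
  qed
  then obtain q' where q': "\<And>x y. ramp i j x y = ev k q' x y" by blast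
  have "Gp i j x y = ev k (\<lambda>a d. \<epsilon> * (q a d - q' a d) + 0) x y" for x y
    using ev_linear[of k \<epsilon> "\<lambda>a d. q a d - q' a d" "\<lambda>_ _. 0" x y] by (simp add: Gp_def q q' ev_diff ev_zero)
  then show ?thesis by blast
qed

lemma contC_Gu: "i \<in> {1..N} \<Longrightarrow> j \<in> {1..N} \<Longrightarrow> contC i j (Gu i j)" "i \<in> {1..N} \<Longrightarrow> j \<in> {1..N} \<Longrightarrow> contC i j (Gp i j)"
proof -
  assume ij: "i \<in> {1..N}" "j \<in> {1..N}"
  from Gu_ev[OF ij] obtain q where "Gu i j = ev k q" by (auto simp: fun_eq_iff)
  then show "contC i j (Gu i j)" by (simp add: contR)
  from Gp_ev[OF ij] obtain q where "Gp i j = ev k q" by (auto simp: fun_eq_iff)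
  then show "contC i j (Gp i j)" by (simp add: contR)
qed

text \<open>Splitting the error into its interpolation part and a discrete part and testing with the
  latter, \<open>rowB_coercive\<close> yields the full energy of the discrete part while
  \<open>row_bound\<close> uses up half of it. The result is integrated over the row.\<close>

lemma row_integrated:
  assumes bc: "\<And>t. t \<in> {0..1} \<Longrightarrow> u 0 0 0 t = 0" "\<And>t. t \<in> {0..1} \<Longrightarrow> u 0 0 1 t = 0"
    and j: "j \<in> {1..N}"
    and eu: "\<And>i x y. i \<in> {1..N} \<Longrightarrow> eu i j x y = u 0 0 x y - Gu i j x y - ev k (Dc i) x y + ev k (xu i) x y"
    and ep: "\<And>i x y. i \<in> {1..N} \<Longrightarrow> ep i j x y = \<epsilon> * u 1 0 x y - Gp i j x y + ev k (xp i) x y"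
    and D0: "\<And>i. i \<notin> {lo<..m} \<Longrightarrow> Dc i = (\<lambda>_ _. 0)"
  shows "1 / 2 * (1 / \<epsilon> * (\<Sum>i=1..N. I2c i j (\<lambda>x y. (ev k (xp i) x y)\<^sup>2))
      + integral {X (j - 1)..X j} (\<lambda>y. se * ((ev k (xu 1) (X 0) y)\<^sup>2 + (ev k (xu N) (X N) y)\<^sup>2)
          + 1 / se * (ev k (xp (Suc m)) (X m) y - ev k (xp m) (X m) y)\<^sup>2))
     \<le> (\<Sum>i=1..N. 1 / \<epsilon> * I2c i j (\<lambda>x y. ep i j x y * ev k (xp i) x y) + cellX k N m se (1 / se) X eu ep (xp i) (xu i) i j)
      + \<beta>\<^sup>2 / 2 * (\<Sum>i=1..N. I2c i j (\<lambda>x y. (ev k (xu i) x y)\<^sup>2)) + KR * se * L2 * (X j - X (j - 1))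
      + 10 * (cinv k)\<^sup>2 * \<epsilon> * (real N)\<^sup>2 * (\<Sum>i\<in>{lo<..m}. I2c i j (\<lambda>x y. (ev k (Dc i) x y)\<^sup>2))
      + 2 * cinv k * se * real N * I2c m j (\<lambda>x y. (ev k (Dc m) x y)\<^sup>2)"
proof -
  define J where "J = {X (j - 1)..X j}"
  define S where "S y i = sec k (xp i) y" for y i
  define V where "V y i = sec k (xu i) y" for y i
  define D where "D y i = sec k (Dc i) y" for y i
  define nu where "nu i x y = u 0 0 x y - Gu i j x y - ev k (Dc i) x y" for i x y
  define np where "np i x y = \<epsilon> * u 1 0 x y - Gp i j x y" for i x y
  let ?I = "\<lambda>i f. integral {X (i - 1)..X i} f"
  have cu: "contC i j (u a 0)" if "i \<in> {1..N}" "a \<le> 2" for i a using family_contC[OF sm(7), of a 0 i j] that j by simp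
  have ceu: "contC i j (\<lambda>x y. eu i j x y)" if "i \<in> {1..N}" for i
    unfolding eu[OF that] by (intro contR cu contC_Gu that j) auto
  have cep: "contC i j (\<lambda>x y. ep i j x y)" if "i \<in> {1..N}" for i
    unfolding ep[OF that] by (intro contR cu contC_Gu that j) auto
  have cnu: "contC i j (nu i)" "contC i j (np i)" if "i \<in> {1..N}" for i
    unfolding nu_def np_def by (intro contR cu contC_Gu that j; simp)+
  have ceuN: "\<And>i. i \<in> {1..N} \<Longrightarrow> contC i j (eu i j)" "\<And>i. i \<in> {1..N} \<Longrightarrow> contC i j (ep i j)" using ceu cep by auto
  define ER where "ER y = 1 / \<epsilon> * (\<Sum>i=1..N. ?I i (\<lambda>x. (ev k (xp i) x y)\<^sup>2))
      + (se * ((ev k (xu 1) (X 0) y)\<^sup>2 + (ev k (xu N) (X N) y)\<^sup>2) + 1 / se * (ev k (xp (Suc m)) (X m) y - ev k (xp m) (X m) y)\<^sup>2)" for y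
  define T where "T y = (\<Sum>i=1..N. 1 / \<epsilon> * ?I i (\<lambda>x. ep i j x y * ev k (xp i) x y))
     + rowB N m se (1 / se) X (\<lambda>i x. eu i j x y) (\<lambda>i x. ep i j x y) (S y) (V y)" for y
  define RR where "RR y = \<beta>\<^sup>2 / 2 * (\<Sum>i=1..N. ?I i (\<lambda>x. (ev k (xu i) x y)\<^sup>2)) + KR * se * L2
      + 10 * (cinv k)\<^sup>2 * \<epsilon> * (real N)\<^sup>2 * (\<Sum>i\<in>{lo<..m}. ?I i (\<lambda>x. (ev k (Dc i) x y)\<^sup>2))
      + 2 * cinv k * se * real N * ?I m (\<lambda>x. (ev k (Dc m) x y)\<^sup>2)" for y
  have pt: "1 / 2 * ER y \<le> T y + RR y" if y: "y \<in> J" for y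
  proof -
    have y': "y \<in> {X (j - 1)..X j}" using y by (simp add: J_def)
    have cx: "continuous_on {X (i - 1)..X i} (\<lambda>x. nu i x y)" "continuous_on {X (i - 1)..X i} (\<lambda>x. np i x y)" if "i \<in> {1..N}" for i
      using contR_x[OF cnu(1)[OF that] y'] contR_x[OF cnu(2)[OF that] y'] by auto
    have e1: "T y = (\<Sum>i=1..N. 1 / \<epsilon> * ?I i (\<lambda>x. np i x y * poly (S y i) x)) + (\<Sum>i=1..N. 1 / \<epsilon> * ?I i (\<lambda>x. (poly (S y i) x)\<^sup>2))
       + (rowB N m se (1 / se) X (\<lambda>i x. nu i x y) (\<lambda>i x. np i x y) (S y) (V y) + 1 * rowB N m se (1 / se) X (\<lambda>i. poly (V y i)) (\<lambda>i. poly (S y i)) (S y) (V y))"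
    proof -
      have "1 / \<epsilon> * ?I i (\<lambda>x. ep i j x y * ev k (xp i) x y) = 1 / \<epsilon> * ?I i (\<lambda>x. np i x y * poly (S y i) x) + 1 / \<epsilon> * ?I i (\<lambda>x. (poly (S y i) x)\<^sup>2)" if i: "i \<in> {1..N}" for i
      proof -
        have "?I i (\<lambda>x. ep i j x y * ev k (xp i) x y) = ?I i (\<lambda>x. np i x y * poly (S y i) x + (poly (S y i) x)\<^sup>2)"
          by (intro integral_cong) (simp add: ep[OF i] np_def S_def poly_sec algebra_simps power2_eq_square)
        also have "\<dots> = ?I i (\<lambda>x. np i x y * poly (S y i) x) + ?I i (\<lambda>x. (poly (S y i) x)\<^sup>2)"
          by (intro integral_add integrable_continuous_interval continuous_intros cx i)
        finally show ?thesis by (simp add: distrib_left add_divide_distrib)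
      qed
      moreover have "rowB N m se (1 / se) X (\<lambda>i x. eu i j x y) (\<lambda>i x. ep i j x y) (S y) (V y)
         = rowB N m se (1 / se) X (\<lambda>i x. nu i x y + 1 * poly (V y i) x) (\<lambda>i x. np i x y + 1 * poly (S y i) x) (S y) (V y)"
        by (intro rowB_cong index_order X_less) (simp_all add: eu ep nu_def np_def V_def S_def poly_sec)
      moreover have "\<dots> = rowB N m se (1 / se) X (\<lambda>i x. nu i x y) (\<lambda>i x. np i x y) (S y) (V y) + 1 * rowB N m se (1 / se) X (\<lambda>i. poly (V y i)) (\<lambda>i. poly (S y i)) (S y) (V y)"
        by (intro rowB_linear cx continuous_intros)
      ultimately show ?thesis unfolding T_def by (simp add: sum.distrib)
    qed
    have e2: "rowB N m se (1 / se) X (\<lambda>i. poly (V y i)) (\<lambda>i. poly (S y i)) (S y) (V y)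
       = se * ((poly (V y 1) (X 0))\<^sup>2 + (poly (V y N) (X N))\<^sup>2) + 1 / se * (poly (S y (Suc m)) (X m) - poly (S y m) (X m))\<^sup>2"
      by (intro rowB_coercive index_order X_less)
    have e3: "\<bar>(\<Sum>i=1..N. 1 / \<epsilon> * ?I i (\<lambda>x. np i x y * poly (S y i) x)) + rowB N m se (1 / se) X (\<lambda>i x. nu i x y) (\<lambda>i x. np i x y) (S y) (V y)\<bar> \<le> 1 / 2 * ER y + RR y"
    proof -
      have "D y i = 0" if "i \<notin> {lo<..m}" for i using D0[OF that] by (simp add: D_def sec_zero)
      from row_bound[OF bc j y', of "S y" "V y" "D y", OF _ _ _ _ _ this]
      show ?thesis by (simp add: S_def V_def D_def degree_sec poly_sec np_def nu_def ER_def RR_def add.assoc)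
    qed
    have e4: "ER y = (\<Sum>i=1..N. 1 / \<epsilon> * ?I i (\<lambda>x. (poly (S y i) x)\<^sup>2)) + rowB N m se (1 / se) X (\<lambda>i. poly (V y i)) (\<lambda>i. poly (S y i)) (S y) (V y)"
      unfolding e2 by (simp add: ER_def S_def V_def poly_sec sum_distrib_left)
    show ?thesis using e1 e3 e4 by linarith
  qed
  have sq: "contC i j (\<lambda>x y. (ev k c x y)\<^sup>2)" for i c by (intro contR)
  have int_ER: "(ER has_integral 1 / \<epsilon> * (\<Sum>i=1..N. I2c i j (\<lambda>x y. (ev k (xp i) x y)\<^sup>2))
      + integral J (\<lambda>y. se * ((ev k (xu 1) (X 0) y)\<^sup>2 + (ev k (xu N) (X N) y)\<^sup>2) + 1 / se * (ev k (xp (Suc m)) (X m) y - ev k (xp m) (X m) y)\<^sup>2)) J"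
    unfolding ER_def[abs_def] I2_def J_def
    by (intro has_integral_add has_integral_mult_right has_integral_sum integrable_integral integrable_continuous_interval contR_inner[OF sq]
        continuous_intros ev_continuous_y) simp
  have int_RR: "(RR has_integral \<beta>\<^sup>2 / 2 * (\<Sum>i=1..N. I2c i j (\<lambda>x y. (ev k (xu i) x y)\<^sup>2)) + KR * se * L2 * (X j - X (j - 1))
      + 10 * (cinv k)\<^sup>2 * \<epsilon> * (real N)\<^sup>2 * (\<Sum>i\<in>{lo<..m}. I2c i j (\<lambda>x y. (ev k (Dc i) x y)\<^sup>2))
      + 2 * cinv k * se * real N * I2c m j (\<lambda>x y. (ev k (Dc m) x y)\<^sup>2)) J"
  proof -
    have "((\<lambda>y. KR * se * L2) has_integral KR * se * L2 * (X j - X (j - 1))) J"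
      using has_integral_const_real[of "KR * se * L2" "X (j - 1)" "X j"] X_less[OF j] by (simp add: J_def mult.commute)
    then show ?thesis unfolding RR_def[abs_def] I2_def J_def
      by (intro has_integral_add has_integral_mult_right has_integral_sum integrable_integral integrable_continuous_interval contR_inner[OF sq]) auto
  qed
  have int_T: "(T has_integral (\<Sum>i=1..N. 1 / \<epsilon> * I2c i j (\<lambda>x y. ep i j x y * ev k (xp i) x y)) + (\<Sum>i=1..N. cellX k N m se (1 / se) X eu ep (xp i) (xu i) i j)) J"
    unfolding T_def[abs_def] J_def S_def V_def
  proof (intro has_integral_add rowB_integral index_order X_less has_integral_sum has_integral_mult_right)
    show "((\<lambda>y. ?I i (\<lambda>x. ep i j x y * ev k (xp i) x y)) has_integral I2c i j (\<lambda>x y. ep i j x y * ev k (xp i) x y)) {X (j - 1)..X j}"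
      if "i \<in> {1..N}" for i
      unfolding I2_def by (intro integrable_integral integrable_continuous_interval contR_inner contR cep that)
  qed (use ceuN in auto)
  have "1 / 2 * (1 / \<epsilon> * (\<Sum>i=1..N. I2c i j (\<lambda>x y. (ev k (xp i) x y)\<^sup>2))
      + integral J (\<lambda>y. se * ((ev k (xu 1) (X 0) y)\<^sup>2 + (ev k (xu N) (X N) y)\<^sup>2) + 1 / se * (ev k (xp (Suc m)) (X m) y - ev k (xp m) (X m) y)\<^sup>2))
    \<le> ((\<Sum>i=1..N. 1 / \<epsilon> * I2c i j (\<lambda>x y. ep i j x y * ev k (xp i) x y)) + (\<Sum>i=1..N. cellX k N m se (1 / se) X eu ep (xp i) (xu i) i j))
     + (\<beta>\<^sup>2 / 2 * (\<Sum>i=1..N. I2c i j (\<lambda>x y. (ev k (xu i) x y)\<^sup>2)) + KR * se * L2 * (X j - X (j - 1))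
      + 10 * (cinv k)\<^sup>2 * \<epsilon> * (real N)\<^sup>2 * (\<Sum>i\<in>{lo<..m}. I2c i j (\<lambda>x y. (ev k (Dc i) x y)\<^sup>2))
      + 2 * cinv k * se * real N * I2c m j (\<lambda>x y. (ev k (Dc m) x y)\<^sup>2))"
    by (rule has_integral_le[OF has_integral_mult_right[OF int_ER] has_integral_add[OF int_T int_RR]]) (rule pt)
  then show ?thesis by (simp add: J_def sum.distrib)
qed

text \<open>The interpolation errors in exactly the quantities measured by the norms. At the right
  boundary the Radau projection of \<open>u\<close> is exact, so only the left boundary trace
  contributes.\<close>

lemma eta_row:
  assumes bc: "\<And>t. t \<in> {0..1} \<Longrightarrow> u 0 0 0 t = 0" "\<And>t. t \<in> {0..1} \<Longrightarrow> u 0 0 1 t = 0"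
    and j: "j \<in> {1..N}" and y: "y \<in> {X (j - 1)..X j}"
  shows "(\<Sum>i=1..N. integral {X (i - 1)..X i} (\<lambda>x. (\<epsilon> * u 1 0 x y - Gp i j x y)\<^sup>2)) \<le> K\<^sup>2 * \<epsilon> * (cPsi * se * L2)"
    and "(u 0 0 (X 0) y - Gu 1 j (X 0) y)\<^sup>2 \<le> K\<^sup>2 * L2"
    and "u 0 0 (X N) y - Gu N j (X N) y = 0"
    and "((\<epsilon> * u 1 0 (X m) y - Gp (Suc m) j (X m) y) - (\<epsilon> * u 1 0 (X m) y - Gp m j (X m) y))\<^sup>2 \<le> K\<^sup>2 * \<epsilon> * L2"
proof -
  have y01: "y \<in> {0..1}" by (rule cell_subset[OF j y])
  have P0: "PY j (u 0 0) x y = 0" if "\<And>t. t \<in> {0..1} \<Longrightarrow> u 0 0 x t = 0" for x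
  proof -
    have "PY j (u 0 0) x y = prj k 1 (X (j - 1)) (X j) (\<lambda>t. 0) y"
      unfolding PY_def using that cell_subset[OF j] by (intro prj_cong X_less[OF j]) auto
    then show ?thesis by (simp add: prj_zero)
  qed
  have eq_h: "\<epsilon> * u 1 0 x y - Gp i j x y = gp i j y x + bp i j y x" if "i \<in> {1..N}" "x \<in> {X (i - 1)..X i}" for i x
    using gp_plus_bp[OF j cell_subset[OF that]] by simp
  have "(\<Sum>i=1..N. integral {X (i - 1)..X i} (\<lambda>x. (\<epsilon> * u 1 0 x y - Gp i j x y)\<^sup>2)) \<le> (K * se)\<^sup>2 * (cPsi * se * L2)"
  proof (intro integral_square_Psi)
    fix i assume i: "i \<in> {1..N}"
    have "continuous_on {X (i - 1)..X i} (\<lambda>x. gp i j y x + bp i j y x)"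
      by (intro continuous_intros au_continuous i j, rule DERIV_continuous_on, rule gp_derivative(1)[OF i _ j y])
    then show "continuous_on {X (i - 1)..X i} (\<lambda>x. \<epsilon> * u 1 0 x y - Gp i j x y)" by (rule continuous_on_eq) (use eq_h[OF i] in auto)
    show "\<bar>\<epsilon> * u 1 0 x y - Gp i j x y\<bar> \<le> K * se * Psi i x" if "x \<in> {X (i - 1)..X i}" for x
      using eta_p_bound[OF i that j y] eq_h[OF i that] by simp
  qed
  then show "(\<Sum>i=1..N. integral {X (i - 1)..X i} (\<lambda>x. (\<epsilon> * u 1 0 x y - Gp i j x y)\<^sup>2)) \<le> K\<^sup>2 * \<epsilon> * (cPsi * se * L2)"
    by (simp add: power_mult_distrib se(3))
  have "\<bar>u 0 0 (X 0) y - Gu 1 j (X 0) y\<bar> = \<bar>au 1 j y (X 0)\<bar>" using bc(1)[OF y01] P0[of 0] bc X_special by (simp add: au_def)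
  also have "\<dots> \<le> K * L ^ (k + 1)" using X_less[of 1] index_order by (intro au_bound[OF j y]) auto
  finally have "(u 0 0 (X 0) y - Gu 1 j (X 0) y)\<^sup>2 \<le> (K * L ^ (k + 1))\<^sup>2" by (rule power2_le_iff_abs_le[THEN iffD2, rotated]) (use K0 L in auto)
  then show "(u 0 0 (X 0) y - Gu 1 j (X 0) y)\<^sup>2 \<le> K\<^sup>2 * L2" by (simp only: power_mult_distrib L2(3))
  show "u 0 0 (X N) y - Gu N j (X N) y = 0"
    using au_zero(1)[of N j y] bc(2)[OF y01] P0[of 1] bc X_special index_order j by (simp add: au_def)
  have mN: "m \<in> {1..N}" "Suc m \<in> {1..N}" using index_order by auto
  have "\<epsilon> * u 1 0 (X m) y - Gp (Suc m) j (X m) y = gp m j y (X m) + 0"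
    using eq_h[OF mN(2), of "X m"] X_less[OF mN(2)] au_zero(2)[OF mN(2) j] gp_interface[of m j y] mN by simp
  moreover have "\<epsilon> * u 1 0 (X m) y - Gp m j (X m) y = gp m j y (X m) + bp m j y (X m)"
    using eq_h[OF mN(1), of "X m"] X_less[OF mN(1)] by simp
  \<comment> \<open>\<open>gp\<close> is continuous at \<open>1 - \<tau>\<close> and
    \<open>bp\<close> vanishes at left ends of cells, so the jump consists of the Radau error from
    the left alone.\<close>
  ultimately have jump: "(\<epsilon> * u 1 0 (X m) y - Gp (Suc m) j (X m) y) - (\<epsilon> * u 1 0 (X m) y - Gp m j (X m) y) = - bp m j y (X m)" by simp
  have "\<bar>bp m j y (X m)\<bar> \<le> K * se * L ^ (k + 1)" using X_less[OF mN(1)] by (intro bp_bounds(2)[OF j y mN(1)]) auto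
  then have "(bp m j y (X m))\<^sup>2 \<le> (K * se * L ^ (k + 1))\<^sup>2" by (rule power2_le_iff_abs_le[THEN iffD2, rotated]) (use K0 L se in auto)
  then show "((\<epsilon> * u 1 0 (X m) y - Gp (Suc m) j (X m) y) - (\<epsilon> * u 1 0 (X m) y - Gp m j (X m) y))\<^sup>2 \<le> K\<^sup>2 * \<epsilon> * L2"
    unfolding jump by (simp only: power_mult_distrib L2(3) power2_minus se(3))
qed

end

subsection \<open>The error of the discrete solution\<close>

definition swapf :: "(nat \<Rightarrow> nat \<Rightarrow> real \<Rightarrow> real \<Rightarrow> real) \<Rightarrow> nat \<Rightarrow> nat \<Rightarrow> real \<Rightarrow> real \<Rightarrow> real" where
  "swapf F = (\<lambda>i j x y. F j i y x)"

context layered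
begin

definition eru :: "(nat \<Rightarrow> nat \<Rightarrow> nat \<Rightarrow> nat \<Rightarrow> real) \<Rightarrow> nat \<Rightarrow> nat \<Rightarrow> real \<Rightarrow> real \<Rightarrow> real" where
  "eru Uc i j x y = u 0 0 x y - ev k (Uc i j) x y"

definition erp :: "(nat \<Rightarrow> nat \<Rightarrow> nat \<Rightarrow> nat \<Rightarrow> real) \<Rightarrow> nat \<Rightarrow> nat \<Rightarrow> real \<Rightarrow> real \<Rightarrow> real" where
  "erp Pc i j x y = \<epsilon> * u 1 0 x y - ev k (Pc i j) x y"

definition erq :: "(nat \<Rightarrow> nat \<Rightarrow> nat \<Rightarrow> nat \<Rightarrow> real) \<Rightarrow> nat \<Rightarrow> nat \<Rightarrow> real \<Rightarrow> real \<Rightarrow> real" where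
  "erq Qc i j x y = \<epsilon> * u 0 1 x y - ev k (Qc i j) x y"

section \<open>Interpolation errors in integral form\<close>

definition "wid i = X i - X (i - 1)"
definition "Esq i = integral {X (i - 1)..X i} (\<lambda>x. (E x)\<^sup>2)"

lemma wid: "i \<in> {1..N} \<Longrightarrow> 0 < wid i" "(\<Sum>i=1..N. wid i) = 1" "i \<in> {1..N} \<Longrightarrow> wid i \<le> 2 / real N"
  "(\<Sum>i=1..N. if refined i then wid i else 0) = 2 * \<tau>"
  subgoal using X_less by (simp add: wid_def)
  subgoal using telescope_cells[of X] X_special by (simp add: wid_def)
  subgoal using width_le by (simp add: wid_def)
  subgoal unfolding wid_def by (rule sum_fine_width)
  done

lemma Esq: "0 \<le> Esq i" "(\<Sum>i=1..N. Esq i) \<le> 2 * se / \<beta>"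
  unfolding Esq_def using sum_E_square by (auto intro!: integral_nonneg integrable_continuous_interval continuous_intros)

lemma I2c_const: "i \<in> {1..N} \<Longrightarrow> j \<in> {1..N} \<Longrightarrow> I2c i j (\<lambda>x y. r) = wid i * wid j * r"
  using X_less[of i] X_less[of j] by (simp add: I2_const wid_def)

lemma I2c_x: "i \<in> {1..N} \<Longrightarrow> j \<in> {1..N} \<Longrightarrow> I2c i j (\<lambda>x y. (E x)\<^sup>2) = Esq i * wid j"
  using X_less[of j] by (simp add: I2_def Esq_def wid_def mult.commute)

lemma I2c_y: "i \<in> {1..N} \<Longrightarrow> j \<in> {1..N} \<Longrightarrow> I2c i j (\<lambda>x y. (E y)\<^sup>2) = wid i * Esq j"
  using X_less[of i] by (simp add: I2_def Esq_def wid_def)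

lemma contR_E [contR]: "contR a b c d (\<lambda>x y. E x)" "contR a b c d (\<lambda>x y. E y)"
  unfolding contR_def by (intro continuous_on_compose2[OF continuous_on_E[of UNIV]] continuous_intros; simp)+

lemma cont_eta: "i \<in> {1..N} \<Longrightarrow> j \<in> {1..N} \<Longrightarrow> contC i j (\<lambda>x y. u 0 0 x y - Gu i j x y)"
  using contC_Gu(1)[of i j] family_contC[OF sm(7), of 0 0 i j] by (intro contR) auto

text \<open>The second bound is kept apart because on coarse cells both \<open>kap\<close> terms
  reduce to \<open>NN\<close> without a layer contribution; it determines the size of the correction
  \<open>Dc\<close>.\<close>

lemma eta_u_square:
  assumes i: "i \<in> {1..N}" and j: "j \<in> {1..N}"
  shows "I2c i j (\<lambda>x y. (u 0 0 x y - Gu i j x y)\<^sup>2) \<le> 3 * K\<^sup>2 * (L2 * (Esq i * wid j) + L2 * (wid i * Esq j) + 4 * NN\<^sup>2 * (wid i * wid j))"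
    and "\<not> refined i \<Longrightarrow> \<not> refined j \<Longrightarrow> I2c i j (\<lambda>x y. (u 0 0 x y - Gu i j x y)\<^sup>2) \<le> 4 * K\<^sup>2 * NN\<^sup>2 * (wid i * wid j)"
proof -
  have sq3: "(a + b + c)\<^sup>2 \<le> 3 * (a\<^sup>2 + b\<^sup>2 + c\<^sup>2)" for a b c :: real
    using sum_squares_bound[of a b] sum_squares_bound[of a c] sum_squares_bound[of b c] by (simp add: power2_sum algebra_simps power2_eq_square)
  have pt: "(u 0 0 x y - Gu i j x y)\<^sup>2 \<le> (K * (kap i x + kap j y))\<^sup>2" if "x \<in> {X (i - 1)..X i}" "y \<in> {X (j - 1)..X j}" for x y
    using power_mono[OF eta_u_bound[OF j that(2) i that(1)], of 2] by simp
  have "(kap i x + kap j y)\<^sup>2 \<le> 3 * (L2 * (E x)\<^sup>2 + L2 * (E y)\<^sup>2 + 4 * NN\<^sup>2)" for x y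
  proof -
    have "kap i x + kap j y \<le> L ^ (k + 1) * E x + L ^ (k + 1) * E y + 2 * NN"
      using L E_pos[of x] E_pos[of y] by (auto simp: kap_def)
    then have "(kap i x + kap j y)\<^sup>2 \<le> (L ^ (k + 1) * E x + L ^ (k + 1) * E y + 2 * NN)\<^sup>2"
      using kap(1)[of i x] kap(1)[of j y] by (intro power_mono) auto
    also have "\<dots> \<le> 3 * ((L ^ (k + 1) * E x)\<^sup>2 + (L ^ (k + 1) * E y)\<^sup>2 + (2 * NN)\<^sup>2)" by (rule sq3)
    also have "\<dots> = 3 * (L2 * (E x)\<^sup>2 + L2 * (E y)\<^sup>2 + 4 * NN\<^sup>2)" unfolding power_mult_distrib L2(3) by simp
    finally show ?thesis .
  qed
  then have kk: "K\<^sup>2 * (kap i x + kap j y)\<^sup>2 \<le> K\<^sup>2 * (3 * (L2 * (E x)\<^sup>2 + L2 * (E y)\<^sup>2 + 4 * NN\<^sup>2))" for x y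
    by (intro mult_left_mono) auto
  then have pt1: "(u 0 0 x y - Gu i j x y)\<^sup>2 \<le> (3 * K\<^sup>2) * (L2 * (E x)\<^sup>2 + L2 * (E y)\<^sup>2 + 4 * NN\<^sup>2)" if "x \<in> {X (i - 1)..X i}" "y \<in> {X (j - 1)..X j}" for x y
  proof -
    have e: "3 * K\<^sup>2 * t = K\<^sup>2 * (3 * t)" for t by simp
    show ?thesis unfolding e using order.trans[OF pt[OF that]] kk[of x y] by (simp only: power_mult_distrib)
  qed
  have "I2c i j (\<lambda>x y. (u 0 0 x y - Gu i j x y)\<^sup>2) \<le> I2c i j (\<lambda>x y. (3 * K\<^sup>2) * (L2 * (E x)\<^sup>2 + L2 * (E y)\<^sup>2 + 4 * NN\<^sup>2))"
    by (intro I2_mono contR cont_eta i j pt1)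
  also have "\<dots> = 3 * K\<^sup>2 * (I2c i j (\<lambda>x y. L2 * (E x)\<^sup>2) + I2c i j (\<lambda>x y. L2 * (E y)\<^sup>2) + I2c i j (\<lambda>x y. 4 * NN\<^sup>2))"
    by (simp only: I2_cmult I2_add contR_intros contR_E)
  finally show "I2c i j (\<lambda>x y. (u 0 0 x y - Gu i j x y)\<^sup>2) \<le> 3 * K\<^sup>2 * (L2 * (Esq i * wid j) + L2 * (wid i * Esq j) + 4 * NN\<^sup>2 * (wid i * wid j))"
    by (simp only: I2_cmult I2c_x[OF i j] I2c_y[OF i j] I2c_const[OF i j] mult_ac)
  show "I2c i j (\<lambda>x y. (u 0 0 x y - Gu i j x y)\<^sup>2) \<le> 4 * K\<^sup>2 * NN\<^sup>2 * (wid i * wid j)" if r: "\<not> refined i" "\<not> refined j"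
  proof -
    have "I2c i j (\<lambda>x y. (u 0 0 x y - Gu i j x y)\<^sup>2) \<le> I2c i j (\<lambda>x y. 4 * K\<^sup>2 * NN\<^sup>2)"
      using pt r by (intro I2_mono contR cont_eta i j) (auto simp: kap_def power_mult_distrib algebra_simps)
    then show ?thesis by (simp only: I2c_const[OF i j] mult_ac)
  qed
qed

lemma sum_sum_prod: "(\<Sum>j=1..N. \<Sum>i=1..N. f i * g j) = (\<Sum>i=1..N. f i) * (\<Sum>j=1..N. g j :: real)"
  by (simp add: sum_product sum.swap[of "\<lambda>i j. f i * g j"])

text \<open>The 3 comes from squaring three terms, \<open>4 / \<beta>\<close> from the layers in
  both directions, and \<open>16 * \<sigma> / \<beta>\<close> from the refined strips: the factor 4
  of \<open>NN\<^sup>2\<close> times the width \<open>2 * \<tau>\<close>, once for each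
  direction.\<close>

definition "cM = 3 * (4 / \<beta> + 16 * \<sigma> / \<beta>)"

text \<open>A cell refined in at least one direction lies in a strip of total width
  \<open>2 * \<tau>\<close>, which supplies the factor \<open>se\<close> that
  \<open>NN\<^sup>2\<close> lacks. On these cells the reaction term needs no correction.\<close>

lemma sum_eta_refined:
  "(\<Sum>j=1..N. \<Sum>i=1..N. if refined i \<or> refined j then I2c i j (\<lambda>x y. (u 0 0 x y - Gu i j x y)\<^sup>2) else 0) \<le> K\<^sup>2 * cM * (se * L2)"
proof -
  have "(\<Sum>j=1..N. \<Sum>i=1..N. if refined i \<or> refined j then I2c i j (\<lambda>x y. (u 0 0 x y - Gu i j x y)\<^sup>2) else 0)
    \<le> (\<Sum>j=1..N. \<Sum>i=1..N. 3 * K\<^sup>2 * (L2 * (Esq i * wid j) + L2 * (wid i * Esq j)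
        + 4 * NN\<^sup>2 * ((if refined i then wid i else 0) * wid j) + 4 * NN\<^sup>2 * (wid i * (if refined j then wid j else 0))))"
  proof (intro sum_mono)
    fix i j assume ij: "j \<in> {1..N}" "i \<in> {1..N}"
    have p: "0 \<le> Esq i * wid j" "0 \<le> wid i * Esq j" "0 \<le> wid i * wid j" using Esq(1)[of i] Esq(1)[of j] wid(1)[OF ij(1)] wid(1)[OF ij(2)] by auto
    have n: "0 \<le> NN\<^sup>2 * (wid i * wid j)" using p by simp
    show "(if refined i \<or> refined j then I2c i j (\<lambda>x y. (u 0 0 x y - Gu i j x y)\<^sup>2) else 0)
      \<le> 3 * K\<^sup>2 * (L2 * (Esq i * wid j) + L2 * (wid i * Esq j)
        + 4 * NN\<^sup>2 * ((if refined i then wid i else 0) * wid j) + 4 * NN\<^sup>2 * (wid i * (if refined j then wid j else 0)))"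
    proof (cases "refined i \<or> refined j")
      case True
      then have "4 * NN\<^sup>2 * (wid i * wid j) \<le> 4 * NN\<^sup>2 * ((if refined i then wid i else 0) * wid j) + 4 * NN\<^sup>2 * (wid i * (if refined j then wid j else 0))"
        using n by (auto simp: mult_ac)
      then have "L2 * (Esq i * wid j) + L2 * (wid i * Esq j) + 4 * NN\<^sup>2 * (wid i * wid j) \<le> L2 * (Esq i * wid j) + L2 * (wid i * Esq j)
        + 4 * NN\<^sup>2 * ((if refined i then wid i else 0) * wid j) + 4 * NN\<^sup>2 * (wid i * (if refined j then wid j else 0))" by linarith
      then have "3 * K\<^sup>2 * (L2 * (Esq i * wid j) + L2 * (wid i * Esq j) + 4 * NN\<^sup>2 * (wid i * wid j)) \<le> 3 * K\<^sup>2 * (L2 * (Esq i * wid j) + L2 * (wid i * Esq j)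
        + 4 * NN\<^sup>2 * ((if refined i then wid i else 0) * wid j) + 4 * NN\<^sup>2 * (wid i * (if refined j then wid j else 0)))" by (intro mult_left_mono) auto
      then show ?thesis using True eta_u_square(1)[OF ij(2,1)] by simp
    next
      case False
      then show ?thesis using p L2(1) by simp
    qed
  qed
  also have "\<dots> = 3 * K\<^sup>2 * (L2 * ((\<Sum>i=1..N. Esq i) * (\<Sum>j=1..N. wid j)) + L2 * ((\<Sum>i=1..N. wid i) * (\<Sum>j=1..N. Esq j))
        + 4 * NN\<^sup>2 * ((\<Sum>i=1..N. if refined i then wid i else 0) * (\<Sum>j=1..N. wid j)) + 4 * NN\<^sup>2 * ((\<Sum>i=1..N. wid i) * (\<Sum>j=1..N. if refined j then wid j else 0)))"
    unfolding sum_sum_prod[symmetric] by (simp only: sum.distrib sum_distrib_left distrib_left)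
  also have "\<dots> = 3 * K\<^sup>2 * (2 * L2 * (\<Sum>i=1..N. Esq i) + 16 * (\<tau> * NN\<^sup>2))" unfolding wid(2,4) by (simp add: algebra_simps)
  also have "\<dots> \<le> 3 * K\<^sup>2 * (2 * L2 * (2 * se / \<beta>) + 16 * (\<sigma> / \<beta> * se * L2))"
  proof (intro mult_left_mono add_mono Esq)
    have "\<tau> * NN\<^sup>2 = \<sigma> / \<beta> * se * (ln (real N) * NN\<^sup>2)" by (simp add: tau(1) mult_ac)
    also have "\<dots> \<le> \<sigma> / \<beta> * se * L2" using lnN_NN sigma beta se by (intro mult_left_mono) (auto simp: L2_def)
    finally show "\<tau> * NN\<^sup>2 \<le> \<sigma> / \<beta> * se * L2" .
  qed (use L2 in auto)
  also have "\<dots> = K\<^sup>2 * cM * (se * L2)" unfolding cM_def by (simp add: algebra_simps)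
  finally show ?thesis .
qed

text \<open>Without the restriction to strips a bare \<open>NN\<^sup>2\<close> remains. It enters
  only the final \<open>L2\<close> error of \<open>u\<close>, whose weight is the same in both
  norms, and never the discrete error.\<close>

lemma sum_eta_all:
  "(\<Sum>j=1..N. \<Sum>i=1..N. I2c i j (\<lambda>x y. (u 0 0 x y - Gu i j x y)\<^sup>2)) \<le> 12 * K\<^sup>2 / \<beta> * (se * L2) + 12 * K\<^sup>2 * NN\<^sup>2"
proof -
  have "(\<Sum>j=1..N. \<Sum>i=1..N. I2c i j (\<lambda>x y. (u 0 0 x y - Gu i j x y)\<^sup>2))
    \<le> (\<Sum>j=1..N. \<Sum>i=1..N. 3 * K\<^sup>2 * (L2 * (Esq i * wid j) + L2 * (wid i * Esq j) + 4 * NN\<^sup>2 * (wid i * wid j)))"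
    by (intro sum_mono eta_u_square)
  also have "\<dots> = 3 * K\<^sup>2 * (L2 * ((\<Sum>i=1..N. Esq i) * (\<Sum>j=1..N. wid j)) + L2 * ((\<Sum>i=1..N. wid i) * (\<Sum>j=1..N. Esq j)) + 4 * NN\<^sup>2 * ((\<Sum>i=1..N. wid i) * (\<Sum>j=1..N. wid j)))"
    unfolding sum_sum_prod[symmetric] by (simp only: sum.distrib sum_distrib_left distrib_left)
  also have "\<dots> = 3 * K\<^sup>2 * (2 * L2 * (\<Sum>i=1..N. Esq i) + 4 * NN\<^sup>2)" unfolding wid(2) by (simp add: algebra_simps)
  also have "\<dots> \<le> 3 * K\<^sup>2 * (2 * L2 * (2 * se / \<beta>) + 4 * NN\<^sup>2)"
    using L2 by (intro mult_left_mono add_mono Esq) auto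
  also have "\<dots> = 12 * K\<^sup>2 / \<beta> * (se * L2) + 12 * K\<^sup>2 * NN\<^sup>2" by (simp add: algebra_simps)
  finally show ?thesis .
qed

lemma eta_p_integrated:
  assumes bc: "\<And>t. t \<in> {0..1} \<Longrightarrow> u 0 0 0 t = 0" "\<And>t. t \<in> {0..1} \<Longrightarrow> u 0 0 1 t = 0"
  shows "(\<Sum>j=1..N. \<Sum>i=1..N. I2c i j (\<lambda>x y. (\<epsilon> * u 1 0 x y - Gp i j x y)\<^sup>2)) \<le> K\<^sup>2 * \<epsilon> * (cPsi * se * L2)"
proof -
  have "(\<Sum>i=1..N. I2c i j (\<lambda>x y. (\<epsilon> * u 1 0 x y - Gp i j x y)\<^sup>2)) \<le> K\<^sup>2 * \<epsilon> * (cPsi * se * L2) * wid j" if j: "j \<in> {1..N}" for j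
  proof (rule has_integral_le)
    show "((\<lambda>y. \<Sum>i=1..N. integral {X (i - 1)..X i} (\<lambda>x. (\<epsilon> * u 1 0 x y - Gp i j x y)\<^sup>2)) has_integral
      (\<Sum>i=1..N. I2c i j (\<lambda>x y. (\<epsilon> * u 1 0 x y - Gp i j x y)\<^sup>2))) {X (j - 1)..X j}"
      unfolding I2_def
      by (intro has_integral_sum integrable_integral integrable_continuous_interval contR_inner contR contC_Gu family_contC[OF sm(7)] j) auto
    show "((\<lambda>y. K\<^sup>2 * \<epsilon> * (cPsi * se * L2)) has_integral K\<^sup>2 * \<epsilon> * (cPsi * se * L2) * wid j) {X (j - 1)..X j}"
      using has_integral_const_real[of "K\<^sup>2 * \<epsilon> * (cPsi * se * L2)" "X (j - 1)" "X j"] X_less[OF j] by (simp add: wid_def mult.commute)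
  qed (rule eta_row(1)[OF bc j])
  then have "(\<Sum>j=1..N. \<Sum>i=1..N. I2c i j (\<lambda>x y. (\<epsilon> * u 1 0 x y - Gp i j x y)\<^sup>2)) \<le> (\<Sum>j=1..N. K\<^sup>2 * \<epsilon> * (cPsi * se * L2) * wid j)"
    by (intro sum_mono) auto
  also have "\<dots> = K\<^sup>2 * \<epsilon> * (cPsi * se * L2)" unfolding sum_distrib_left[symmetric] wid(2) by simp
  finally show ?thesis .
qed

definition "Bdx eu = (\<Sum>j=1..N. integral {X (j - 1)..X j} (\<lambda>y. (eu 1 j (X 0) y)\<^sup>2 + (eu N j (X N) y)\<^sup>2))" for eu :: "nat \<Rightarrow> nat \<Rightarrow> real \<Rightarrow> real \<Rightarrow> real"
definition "Jx ep = (\<Sum>j=1..N. integral {X (j - 1)..X j} (\<lambda>y. (ep (Suc m) j (X m) y - ep m j (X m) y)\<^sup>2))" for ep :: "nat \<Rightarrow> nat \<Rightarrow> real \<Rightarrow> real \<Rightarrow> real"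

lemma boundary_split:
  assumes bc: "\<And>t. t \<in> {0..1} \<Longrightarrow> u 0 0 0 t = 0" "\<And>t. t \<in> {0..1} \<Longrightarrow> u 0 0 1 t = 0"
    and eu: "\<And>i j x y. i \<in> {1, N} \<Longrightarrow> j \<in> {1..N} \<Longrightarrow> eu i j x y = u 0 0 x y - Gu i j x y + ev k (xu i j) x y"
    and ep: "\<And>i j x y. i \<in> {m, Suc m} \<Longrightarrow> j \<in> {1..N} \<Longrightarrow> ep i j x y = \<epsilon> * u 1 0 x y - Gp i j x y + ev k (xp i j) x y"
  shows "Bdx eu \<le> 2 * K\<^sup>2 * L2 + 2 * Bdx (\<lambda>i j. ev k (xu i j))" "Jx ep \<le> 2 * K\<^sup>2 * \<epsilon> * L2 + 2 * Jx (\<lambda>i j. ev k (xp i j))"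
proof -
  have s2: "(a + b)\<^sup>2 \<le> 2 * a\<^sup>2 + 2 * b\<^sup>2" for a b :: real
    using sum_squares_bound[of a b] by (simp add: power2_sum)
  have cu: "continuous_on {X (j - 1)..X j} (\<lambda>y. u a 0 (X i) y)" if "i \<le> N" "a \<le> 1" "j \<in> {1..N}" for a i j
    using continuous_on_subset[OF smooth_family_section(1)[OF sm(7), of a 0 "X i"] cell_subset'[OF that(3)]] X_range[of i] that by simp
  have cG: "continuous_on {X (j - 1)..X j} (\<lambda>y. Gu i j x y)" "continuous_on {X (j - 1)..X j} (\<lambda>y. Gp i j x y)" if ij: "i \<in> {1..N}" "j \<in> {1..N}" for i j x
  proof -
    obtain q where "\<forall>x y. Gu i j x y = ev k q x y" using Gu_ev[OF ij] by blast
    then show "continuous_on {X (j - 1)..X j} (\<lambda>y. Gu i j x y)" by (simp add: ev_continuous_y)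
    obtain q where "\<forall>x y. Gp i j x y = ev k q x y" using Gp_ev[OF ij] by blast
    then show "continuous_on {X (j - 1)..X j} (\<lambda>y. Gp i j x y)" by (simp add: ev_continuous_y)
  qed
  have N1: "1 \<in> {1..N}" "N \<in> {1..N}" "m \<in> {1..N}" "Suc m \<in> {1..N}" "m \<le> N" using index_order by auto
  have cst: "integral {X (j - 1)..X j} (\<lambda>y. c + 2 * f y) = c * wid j + 2 * integral {X (j - 1)..X j} f" if "j \<in> {1..N}" "continuous_on {X (j - 1)..X j} f" for j c f
  proof -
    have "integral {X (j - 1)..X j} (\<lambda>y. c + 2 * f y) = integral {X (j - 1)..X j} (\<lambda>y. c) + integral {X (j - 1)..X j} (\<lambda>y. 2 * f y)"
      by (intro integral_add integrable_continuous_interval continuous_intros that)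
    then show ?thesis using X_less[OF that(1)] by (simp add: wid_def mult.commute)
  qed
  have "integral {X (j - 1)..X j} (\<lambda>y. (eu 1 j (X 0) y)\<^sup>2 + (eu N j (X N) y)\<^sup>2)
     \<le> 2 * K\<^sup>2 * L2 * wid j + 2 * integral {X (j - 1)..X j} (\<lambda>y. (ev k (xu 1 j) (X 0) y)\<^sup>2 + (ev k (xu N j) (X N) y)\<^sup>2)" if j: "j \<in> {1..N}" for j
  proof -
    have e: "eu 1 j (X 0) y = (u 0 0 (X 0) y - Gu 1 j (X 0) y) + ev k (xu 1 j) (X 0) y"
       "eu N j (X N) y = (u 0 0 (X N) y - Gu N j (X N) y) + ev k (xu N j) (X N) y" for y using eu j by auto
    have "integral {X (j - 1)..X j} (\<lambda>y. (eu 1 j (X 0) y)\<^sup>2 + (eu N j (X N) y)\<^sup>2)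
      \<le> integral {X (j - 1)..X j} (\<lambda>y. 2 * K\<^sup>2 * L2 + 2 * ((ev k (xu 1 j) (X 0) y)\<^sup>2 + (ev k (xu N j) (X N) y)\<^sup>2))"
    proof (intro integral_le integrable_continuous_interval)
      show "continuous_on {X (j - 1)..X j} (\<lambda>y. (eu 1 j (X 0) y)\<^sup>2 + (eu N j (X N) y)\<^sup>2)"
        unfolding e using j N1 by (intro continuous_intros cu cG ev_continuous_y) auto
      show "continuous_on {X (j - 1)..X j} (\<lambda>y. 2 * K\<^sup>2 * L2 + 2 * ((ev k (xu 1 j) (X 0) y)\<^sup>2 + (ev k (xu N j) (X N) y)\<^sup>2))"
        by (intro continuous_intros ev_continuous_y)
      show "(eu 1 j (X 0) y)\<^sup>2 + (eu N j (X N) y)\<^sup>2 \<le> 2 * K\<^sup>2 * L2 + 2 * ((ev k (xu 1 j) (X 0) y)\<^sup>2 + (ev k (xu N j) (X N) y)\<^sup>2)" if "y \<in> {X (j - 1)..X j}" for y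
      proof -
        have eN: "eu N j (X N) y = ev k (xu N j) (X N) y" using e(2)[of y] eta_row(3)[OF bc j that] by simp
        have e0: "(u 0 0 (X 0) y - Gu 1 j (X 0) y)\<^sup>2 \<le> K\<^sup>2 * L2" by (rule eta_row(2)[OF bc j that])
        have lin: "p + r \<le> 2 * M + 2 * (q + r)" if "p \<le> 2 * c + 2 * q" "c \<le> M" "0 \<le> r" for p q r c M :: real
          using that by simp
        show ?thesis unfolding e(1) eN mult.assoc[of 2 "K\<^sup>2" L2] by (rule lin[OF s2 e0 zero_le_power2])
      qed
    qed
    then show ?thesis by (subst (asm) cst[OF j]) (auto intro!: continuous_intros ev_continuous_y)
  qed
  then have "Bdx eu \<le> (\<Sum>j=1..N. 2 * K\<^sup>2 * L2 * wid j + 2 * integral {X (j - 1)..X j} (\<lambda>y. (ev k (xu 1 j) (X 0) y)\<^sup>2 + (ev k (xu N j) (X N) y)\<^sup>2))"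
    unfolding Bdx_def by (intro sum_mono) auto
  then show "Bdx eu \<le> 2 * K\<^sup>2 * L2 + 2 * Bdx (\<lambda>i j. ev k (xu i j))"
    unfolding sum.distrib sum_distrib_left[symmetric] wid(2) Bdx_def by simp
  have "integral {X (j - 1)..X j} (\<lambda>y. (ep (Suc m) j (X m) y - ep m j (X m) y)\<^sup>2)
     \<le> 2 * K\<^sup>2 * \<epsilon> * L2 * wid j + 2 * integral {X (j - 1)..X j} (\<lambda>y. (ev k (xp (Suc m) j) (X m) y - ev k (xp m j) (X m) y)\<^sup>2)" if j: "j \<in> {1..N}" for j
  proof -
    have e: "ep (Suc m) j (X m) y - ep m j (X m) y = ((\<epsilon> * u 1 0 (X m) y - Gp (Suc m) j (X m) y) - (\<epsilon> * u 1 0 (X m) y - Gp m j (X m) y))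
       + (ev k (xp (Suc m) j) (X m) y - ev k (xp m j) (X m) y)" for y using ep[of "Suc m" j "X m" y] ep[of m j "X m" y] j by simp
    have "integral {X (j - 1)..X j} (\<lambda>y. (ep (Suc m) j (X m) y - ep m j (X m) y)\<^sup>2)
      \<le> integral {X (j - 1)..X j} (\<lambda>y. 2 * K\<^sup>2 * \<epsilon> * L2 + 2 * (ev k (xp (Suc m) j) (X m) y - ev k (xp m j) (X m) y)\<^sup>2)"
    proof (intro integral_le integrable_continuous_interval)
      show "continuous_on {X (j - 1)..X j} (\<lambda>y. (ep (Suc m) j (X m) y - ep m j (X m) y)\<^sup>2)"
        unfolding e using j N1 by (intro continuous_intros cu cG ev_continuous_y) auto
      show "continuous_on {X (j - 1)..X j} (\<lambda>y. 2 * K\<^sup>2 * \<epsilon> * L2 + 2 * (ev k (xp (Suc m) j) (X m) y - ev k (xp m j) (X m) y)\<^sup>2)"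
        by (intro continuous_intros ev_continuous_y)
      show "(ep (Suc m) j (X m) y - ep m j (X m) y)\<^sup>2 \<le> 2 * K\<^sup>2 * \<epsilon> * L2 + 2 * (ev k (xp (Suc m) j) (X m) y - ev k (xp m j) (X m) y)\<^sup>2" if "y \<in> {X (j - 1)..X j}" for y
        unfolding e by (rule order.trans[OF s2]) (use eta_row(4)[OF bc j that] in simp)
    qed
    then show ?thesis by (subst (asm) cst[OF j]) (auto intro!: continuous_intros ev_continuous_y)
  qed
  then have "Jx ep \<le> (\<Sum>j=1..N. 2 * K\<^sup>2 * \<epsilon> * L2 * wid j + 2 * integral {X (j - 1)..X j} (\<lambda>y. (ev k (xp (Suc m) j) (X m) y - ev k (xp m j) (X m) y)\<^sup>2))"
    unfolding Jx_def by (intro sum_mono) auto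
  then show "Jx ep \<le> 2 * K\<^sup>2 * \<epsilon> * L2 + 2 * Jx (\<lambda>i j. ev k (xp i j))"
    unfolding sum.distrib sum_distrib_left[symmetric] wid(2) Jx_def by simp
qed

text \<open>The two projections commute. Rows and columns are tested with the same discrete
  function, so they must use the same interpolant of \<open>u\<close>; for the two derivatives
  separate interpolants are possible.\<close>

lemma Gu_swapped:
  assumes "i \<in> {1..N}" "j \<in> {1..N}"
  shows "PX 1 j (\<lambda>t. PY i (fam_swap u 0 0) t x) y = Gu i j x y"
  unfolding Gu_def PX_def PY_def fam_swap_def
  by (rule prj_commute[symmetric]) (use family_contC[OF sm(7), of 0 0 i j] X_less assms in \<open>auto simp: contR_def case_prod_beta\<close>)

end

text \<open>The columns of the scheme are the rows of the problem with the two variables exchanged; \<open>scheme\<close> is the Galerkin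
  orthogonality, with \<open>cellX\<close> applied to the exchanged functions for the fluxes in the \<open>y\<close>-direction.\<close>

locale ldg_error = layered +
  fixes bb :: "real \<Rightarrow> real \<Rightarrow> real" and Bm :: real and Uc Pc Qc :: "nat \<Rightarrow> nat \<Rightarrow> nat \<Rightarrow> nat \<Rightarrow> real"
  assumes bc: "\<And>t. t \<in> {0..1} \<Longrightarrow> u 0 0 0 t = 0" "\<And>t. t \<in> {0..1} \<Longrightarrow> u 0 0 1 t = 0"
      "\<And>t. t \<in> {0..1} \<Longrightarrow> u 0 0 t 0 = 0" "\<And>t. t \<in> {0..1} \<Longrightarrow> u 0 0 t 1 = 0"
    and bb: "contR 0 1 0 1 bb" "\<And>x y. x \<in> {0..1} \<Longrightarrow> y \<in> {0..1} \<Longrightarrow> 2 * \<beta>\<^sup>2 \<le> bb x y" "\<And>x y. x \<in> {0..1} \<Longrightarrow> y \<in> {0..1} \<Longrightarrow> bb x y \<le> Bm"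
    and scheme: "\<And>i j s' r' v'. i \<in> {1..N} \<Longrightarrow> j \<in> {1..N} \<Longrightarrow>
      1 / \<epsilon> * I2c i j (\<lambda>x y. erp Pc i j x y * ev k s' x y) + 1 / \<epsilon> * I2c i j (\<lambda>x y. erq Qc i j x y * ev k r' x y)
      + I2c i j (\<lambda>x y. bb x y * eru Uc i j x y * ev k v' x y)
      + cellX k N m se (1 / se) X (eru Uc) (erp Pc) s' v' i j
      + cellX k N m se (1 / se) X (swapf (eru Uc)) (swapf (erq Qc)) (transp r') (transp v') j i = 0"
begin

interpretation sw: layered k \<beta> \<sigma> \<epsilon> C1 N "fam_swap s" "fam_swap v" "fam_swap w" "fam_swap z"
  by unfold_locales (rule decomp_swap[OF dec])

lemma sw_u: "total (fam_swap s) (fam_swap v) (fam_swap w) (fam_swap z) = fam_swap u"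
  by (rule total_swap[symmetric])

lemma sw_Gu: "i \<in> {1..N} \<Longrightarrow> j \<in> {1..N} \<Longrightarrow> sw.Gu j i y x = Gu i j x y"
  unfolding sw.Gu_def sw_u by (rule Gu_swapped)

lemma sw_bc: "t \<in> {0..1} \<Longrightarrow> total (fam_swap s) (fam_swap v) (fam_swap w) (fam_swap z) 0 0 0 t = 0"
  "t \<in> {0..1} \<Longrightarrow> total (fam_swap s) (fam_swap v) (fam_swap w) (fam_swap z) 0 0 1 t = 0"
  unfolding sw_u using bc(3,4) by (simp_all add: fam_swap_def)

lemma Bm: "0 < Bm" "2 * \<beta>\<^sup>2 \<le> Bm"
proof -
  show "2 * \<beta>\<^sup>2 \<le> Bm" using bb(2)[of 0 0] bb(3)[of 0 0] by simp
  moreover have "0 < 2 * \<beta>\<^sup>2" using beta by simp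
  ultimately show "0 < Bm" by linarith
qed

lemma bb_cell: "i \<in> {1..N} \<Longrightarrow> j \<in> {1..N} \<Longrightarrow> contC i j bb"
proof -
  assume ij: "i \<in> {1..N}" "j \<in> {1..N}"
  have "{X (i - 1)..X i} \<times> {X (j - 1)..X j} \<subseteq> {0..1} \<times> {0..1}"
    using cell_subset'[OF ij(1)] cell_subset'[OF ij(2)] by blast
  then show ?thesis using continuous_on_subset[OF bb(1)[unfolded contR_def]] by (simp add: contR_def)
qed

lemma I2c_transp: "I2c j i (\<lambda>x y. (ev k (transp c) x y)\<^sup>2) = I2c i j (\<lambda>x y. (ev k c x y)\<^sup>2)"
  unfolding ev_transp by (rule I2_swap) (intro contR)

definition Gc :: "nat \<Rightarrow> nat \<Rightarrow> nat \<Rightarrow> nat \<Rightarrow> real" where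
  "Gc i j = (SOME q. \<forall>x y. Gu i j x y = ev k q x y)"

lemma Gc: "i \<in> {1..N} \<Longrightarrow> j \<in> {1..N} \<Longrightarrow> Gu i j x y = ev k (Gc i j) x y"
  using someI_ex[OF Gu_ev] unfolding Gc_def by blast

definition Ppc :: "nat \<Rightarrow> nat \<Rightarrow> nat \<Rightarrow> nat \<Rightarrow> real" where
  "Ppc i j = (SOME q. \<forall>x y. Gp i j x y = ev k q x y)"

lemma Ppc: "i \<in> {1..N} \<Longrightarrow> j \<in> {1..N} \<Longrightarrow> Gp i j x y = ev k (Ppc i j) x y"
  using someI_ex[OF Gp_ev] unfolding Ppc_def by blast

definition Qpc :: "nat \<Rightarrow> nat \<Rightarrow> nat \<Rightarrow> nat \<Rightarrow> real" where
  "Qpc i j = transp (SOME q. \<forall>x y. sw.Gp j i x y = ev k q x y)"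

lemma Qpc: "i \<in> {1..N} \<Longrightarrow> j \<in> {1..N} \<Longrightarrow> sw.Gp j i y x = ev k (Qpc i j) x y"
  using someI_ex[OF sw.Gp_ev[of j i]] unfolding Qpc_def ev_transp by blast

text \<open>On coarse cells the interpolant of \<open>u\<close> is corrected by \<open>Dc\<close> so that its error becomes orthogonal to polynomials
  with respect to \<open>bb\<close>; otherwise the reaction term would only give the order of \<open>NN\<close> without a factor \<open>se\<close>.\<close>

definition Dc :: "nat \<Rightarrow> nat \<Rightarrow> nat \<Rightarrow> nat \<Rightarrow> real" where
  "Dc i j = (if refined i \<or> refined j then (\<lambda>_ _. 0)
     else (SOME q. \<forall>q'. I2c i j (\<lambda>x y. bb x y * (u 0 0 x y - Gu i j x y - ev k q x y) * ev k q' x y) = 0))"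

lemma Dc:
  assumes "i \<in> {1..N}" "j \<in> {1..N}" "\<not> refined i" "\<not> refined j"
  shows "I2c i j (\<lambda>x y. bb x y * (u 0 0 x y - Gu i j x y - ev k (Dc i j) x y) * ev k q' x y) = 0"
proof -
  have "2 * \<beta>\<^sup>2 \<ge> 0" by simp
  then have "0 \<le> bb x y" if "x \<in> {X (i - 1)..X i}" "y \<in> {X (j - 1)..X j}" for x y
    using bb(2)[OF cell_subset[OF assms(1) that(1)] cell_subset[OF assms(2) that(2)]] by linarith
  then have "\<exists>q. \<forall>q'. I2c i j (\<lambda>x y. bb x y * (u 0 0 x y - Gu i j x y - ev k q x y) * ev k q' x y) = 0"
    using X_less assms(1,2) by (intro weighted_projection bb_cell cont_eta) (auto intro: less_imp_le)
  from someI_ex[OF this] assms(3,4) show ?thesis unfolding Dc_def by simp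
qed

text \<open>Coefficients of the corrected interpolant minus the numerical solution: the discrete
  part of the error, which also serves as the test function.\<close>

definition "xu i j = (\<lambda>a d. (Gc i j a d + Dc i j a d) - Uc i j a d)"
definition "xp i j = (\<lambda>a d. Ppc i j a d - Pc i j a d)"
definition "xq i j = (\<lambda>a d. Qpc i j a d - Qc i j a d)"

lemma splits:
  assumes "i \<in> {1..N}" "j \<in> {1..N}"
  shows "eru Uc i j x y = u 0 0 x y - Gu i j x y - ev k (Dc i j) x y + ev k (xu i j) x y"
    and "erp Pc i j x y = \<epsilon> * u 1 0 x y - Gp i j x y + ev k (xp i j) x y"
    and "erq Qc i j x y = \<epsilon> * u 0 1 x y - sw.Gp j i y x + ev k (xq i j) x y"
  using Gc[OF assms] Ppc[OF assms] Qpc[OF assms]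
  by (simp_all add: eru_def erp_def erq_def xu_def xp_def xq_def ev_diff ev_add)

text \<open>The coarse interpolation error \<open>4 * K^2\<close> times the ratio of the bounds
  \<open>Bm\<close> and \<open>2 * \<beta>^2\<close> for the weight.\<close>

definition "cdel = 2 * Bm * K\<^sup>2 / \<beta>\<^sup>2"

text \<open>The correction is the weighted projection of the interpolation error, hence no larger
  than that error in the weighted norm. The bounds on \<open>bb\<close> transfer this to the
  unweighted norm.\<close>

lemma Dc_small:
  assumes i: "i \<in> {1..N}" and j: "j \<in> {1..N}"
  shows "I2c i j (\<lambda>x y. (ev k (Dc i j) x y)\<^sup>2) \<le> cdel * NN\<^sup>2 * (wid i * wid j)"
proof (cases "refined i \<or> refined j")
  case True
  have "0 \<le> cdel * NN\<^sup>2 * (wid i * wid j)" unfolding cdel_def using Bm(1) wid(1)[OF i] wid(1)[OF j] by simp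
  then show ?thesis using True by (simp add: Dc_def ev_zero I2_def)
next
  case False
  define D where "D = ev k (Dc i j)"
  define h where "h x y = u 0 0 x y - Gu i j x y" for x y
  have cD: "contC i j D" and ch: "contC i j h" and cb: "contC i j bb"
    unfolding D_def h_def using cont_eta[OF i j] bb_cell[OF i j] by (auto intro: contR)
  have b0: "0 \<le> bb x y" "2 * \<beta>\<^sup>2 \<le> bb x y" "bb x y \<le> Bm" if "x \<in> {X (i - 1)..X i}" "y \<in> {X (j - 1)..X j}" for x y
  proof -
    show "2 * \<beta>\<^sup>2 \<le> bb x y" "bb x y \<le> Bm" using bb(2,3) cell_subset[OF i that(1)] cell_subset[OF j that(2)] by auto
    moreover have "2 * \<beta>\<^sup>2 \<ge> 0" by simp
    ultimately show "0 \<le> bb x y" by linarith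
  qed
  have "0 = I2c i j (\<lambda>x y. bb x y * (h x y - D x y) * D x y)" using Dc[OF i j, of "Dc i j"] False by (simp add: D_def h_def)
  also have "\<dots> \<le> I2c i j (\<lambda>x y. 1 / 2 * (bb x y * (h x y)\<^sup>2) - 1 / 2 * (bb x y * (D x y)\<^sup>2))"
  proof (intro I2_mono contR cD ch cb)
    fix x y assume xy: "x \<in> {X (i - 1)..X i}" "y \<in> {X (j - 1)..X j}"
    have "0 \<le> bb x y * (h x y - D x y)\<^sup>2" using b0(1)[OF xy] by simp
    then show "bb x y * (h x y - D x y) * D x y \<le> 1 / 2 * (bb x y * (h x y)\<^sup>2) - 1 / 2 * (bb x y * (D x y)\<^sup>2)"
      by (simp add: power2_eq_square algebra_simps)
  qed
  also have "\<dots> = 1 / 2 * I2c i j (\<lambda>x y. bb x y * (h x y)\<^sup>2) - 1 / 2 * I2c i j (\<lambda>x y. bb x y * (D x y)\<^sup>2)"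
    by (subst I2_diff) (intro contR cD ch cb | simp only: I2_cmult)+
  finally have 1: "I2c i j (\<lambda>x y. bb x y * (D x y)\<^sup>2) \<le> I2c i j (\<lambda>x y. bb x y * (h x y)\<^sup>2)" by simp
  have "2 * \<beta>\<^sup>2 * I2c i j (\<lambda>x y. (D x y)\<^sup>2) = I2c i j (\<lambda>x y. 2 * \<beta>\<^sup>2 * (D x y)\<^sup>2)" by (rule I2_cmult[symmetric])
  also have "\<dots> \<le> I2c i j (\<lambda>x y. bb x y * (D x y)\<^sup>2)"
    by (intro I2_mono contR cD cb mult_right_mono b0) auto
  also note 1
  also have "I2c i j (\<lambda>x y. bb x y * (h x y)\<^sup>2) \<le> I2c i j (\<lambda>x y. Bm * (h x y)\<^sup>2)"
    by (intro I2_mono contR ch cb mult_right_mono b0) auto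
  also have "\<dots> = Bm * I2c i j (\<lambda>x y. (h x y)\<^sup>2)" by (rule I2_cmult)
  also have "\<dots> \<le> Bm * (4 * K\<^sup>2 * NN\<^sup>2 * (wid i * wid j))"
    using eta_u_square(2)[OF i j] False Bm(1) by (intro mult_left_mono) (auto simp: h_def)
  finally have "I2c i j (\<lambda>x y. (D x y)\<^sup>2) \<le> Bm * (4 * K\<^sup>2 * NN\<^sup>2 * (wid i * wid j)) / (2 * \<beta>\<^sup>2)"
    using beta by (simp add: pos_le_divide_eq mult_ac)
  also have "\<dots> = cdel * NN\<^sup>2 * (wid i * wid j)" by (simp add: cdel_def)
  finally show ?thesis by (simp add: D_def)
qed

text \<open>On coarse cells the cross term vanishes by the choice of \<open>Dc\<close>. On the
  others Young gives a quarter of the reaction energy away and pays with the interpolation error on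
  strips.\<close>

lemma mass_bound:
  assumes i: "i \<in> {1..N}" and j: "j \<in> {1..N}"
  shows "3 / 4 * I2c i j (\<lambda>x y. bb x y * (ev k (xu i j) x y)\<^sup>2) - Bm * (if refined i \<or> refined j then I2c i j (\<lambda>x y. (u 0 0 x y - Gu i j x y)\<^sup>2) else 0)
     \<le> I2c i j (\<lambda>x y. bb x y * eru Uc i j x y * ev k (xu i j) x y)"
proof -
  define D where "D = ev k (Dc i j)"
  define h where "h x y = u 0 0 x y - Gu i j x y" for x y
  define v where "v = ev k (xu i j)"
  have cD: "contC i j D" and ch: "contC i j h" and cb: "contC i j bb" and cv: "contC i j v"
    unfolding D_def h_def v_def using cont_eta[OF i j] bb_cell[OF i j] by (auto intro: contR)
  have b0: "0 \<le> bb x y" "bb x y \<le> Bm" if "x \<in> {X (i - 1)..X i}" "y \<in> {X (j - 1)..X j}" for x y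
  proof -
    have "2 * \<beta>\<^sup>2 \<le> bb x y" "2 * \<beta>\<^sup>2 \<ge> 0" using bb(2) cell_subset[OF i that(1)] cell_subset[OF j that(2)] by auto
    then show "0 \<le> bb x y" by linarith
    show "bb x y \<le> Bm" using bb(3) cell_subset[OF i that(1)] cell_subset[OF j that(2)] by auto
  qed
  have "I2c i j (\<lambda>x y. bb x y * eru Uc i j x y * v x y) = I2c i j (\<lambda>x y. bb x y * (h x y - D x y) * v x y + bb x y * (v x y)\<^sup>2)"
    unfolding splits(1)[OF i j] by (intro I2_cong) (simp add: h_def D_def v_def power2_eq_square algebra_simps)
  also have "\<dots> = I2c i j (\<lambda>x y. bb x y * (h x y - D x y) * v x y) + I2c i j (\<lambda>x y. bb x y * (v x y)\<^sup>2)"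
    by (intro I2_add contR cb ch cD cv)
  finally have split: "I2c i j (\<lambda>x y. bb x y * eru Uc i j x y * v x y) = \<dots>" .
  have v0: "0 \<le> I2c i j (\<lambda>x y. bb x y * (v x y)\<^sup>2)" by (intro I2_nonneg contR cb cv mult_nonneg_nonneg b0) auto
  have "- (1 / 4 * I2c i j (\<lambda>x y. bb x y * (v x y)\<^sup>2)) - Bm * (if refined i \<or> refined j then I2c i j (\<lambda>x y. (h x y)\<^sup>2) else 0)
     \<le> I2c i j (\<lambda>x y. bb x y * (h x y - D x y) * v x y)"
  proof (cases "refined i \<or> refined j")
    case False
    then have "I2c i j (\<lambda>x y. bb x y * (h x y - D x y) * v x y) = 0" using Dc[OF i j] by (simp add: h_def D_def v_def)
    then show ?thesis using v0 False by simp
  next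
    case True
    then have D0: "D x y = 0" for x y by (simp add: D_def Dc_def ev_zero)
    have "I2c i j (\<lambda>x y. (- 1 / 4) * (bb x y * (v x y)\<^sup>2) - Bm * (h x y)\<^sup>2) \<le> I2c i j (\<lambda>x y. bb x y * (h x y - D x y) * v x y)"
    proof (intro I2_mono contR cb ch cv cD)
      fix x y assume xy: "x \<in> {X (i - 1)..X i}" "y \<in> {X (j - 1)..X j}"
      have "0 \<le> bb x y * (v x y / 2 + h x y)\<^sup>2" using b0(1)[OF xy] by simp
      moreover have "bb x y * (h x y)\<^sup>2 \<le> Bm * (h x y)\<^sup>2" using b0(2)[OF xy] by (intro mult_right_mono) auto
      ultimately show "(- 1 / 4) * (bb x y * (v x y)\<^sup>2) - Bm * (h x y)\<^sup>2 \<le> bb x y * (h x y - D x y) * v x y"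
        unfolding D0 by (simp add: power2_eq_square algebra_simps)
    qed
    also have "I2c i j (\<lambda>x y. (- 1 / 4) * (bb x y * (v x y)\<^sup>2) - Bm * (h x y)\<^sup>2) = (- 1 / 4) * I2c i j (\<lambda>x y. bb x y * (v x y)\<^sup>2) - Bm * I2c i j (\<lambda>x y. (h x y)\<^sup>2)"
      by (subst I2_diff) (intro contR cv ch cb | simp only: I2_cmult)+
    finally show ?thesis using True by simp
  qed
  then show ?thesis unfolding v_def[symmetric] h_def[symmetric] using split by linarith
qed

text \<open>In the second summand \<open>N^2 * NN^2\<close> is \<open>N^(-2k)\<close>: the inverse
  inequality on coarse cells costs one power of \<open>N\<close> in the error. In \<open>CR\<close>
  the factors 2, 8 and 20 are twice the constants of a single direction.\<close>

definition "W = se * L2 + \<epsilon> * (real N)\<^sup>2 * NN\<^sup>2"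
definition "CR = 2 * KR + 8 * cinv k * cdel + Bm * (K\<^sup>2 * cM) + 20 * (cinv k)\<^sup>2 * cdel"

definition "XI = 1 / \<epsilon> * (\<Sum>j=1..N. \<Sum>i=1..N. I2c i j (\<lambda>x y. (ev k (xp i j) x y)\<^sup>2))
   + 1 / \<epsilon> * (\<Sum>j=1..N. \<Sum>i=1..N. I2c i j (\<lambda>x y. (ev k (xq i j) x y)\<^sup>2))
   + (se * Bdx (\<lambda>i j. ev k (xu i j)) + 1 / se * Jx (\<lambda>i j. ev k (xp i j)))
   + (se * Bdx (\<lambda>i j. ev k (transp (xu j i))) + 1 / se * Jx (\<lambda>i j. ev k (transp (xq j i))))"

definition "MX = (\<Sum>j=1..N. \<Sum>i=1..N. I2c i j (\<lambda>x y. bb x y * (ev k (xu i j) x y)\<^sup>2))"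

lemma Bd_J_sum:
  "(\<Sum>j=1..N. integral {X (j - 1)..X j} (\<lambda>y. se * ((ev k (a 1 j) (X 0) y)\<^sup>2 + (ev k (a N j) (X N) y)\<^sup>2)
       + 1 / se * (ev k (c (Suc m) j) (X m) y - ev k (c m j) (X m) y)\<^sup>2))
   = se * Bdx (\<lambda>i j. ev k (a i j)) + 1 / se * Jx (\<lambda>i j. ev k (c i j))"
proof -
  have "integral {X (j - 1)..X j} (\<lambda>y. se * ((ev k (a 1 j) (X 0) y)\<^sup>2 + (ev k (a N j) (X N) y)\<^sup>2)
       + 1 / se * (ev k (c (Suc m) j) (X m) y - ev k (c m j) (X m) y)\<^sup>2)
     = integral {X (j - 1)..X j} (\<lambda>y. se * ((ev k (a 1 j) (X 0) y)\<^sup>2 + (ev k (a N j) (X N) y)\<^sup>2))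
       + integral {X (j - 1)..X j} (\<lambda>y. 1 / se * (ev k (c (Suc m) j) (X m) y - ev k (c m j) (X m) y)\<^sup>2)" for j
    by (intro integral_add integrable_continuous_interval continuous_intros ev_continuous_y)
  then show ?thesis unfolding Bdx_def Jx_def by (simp only: integral_mult_right sum.distrib sum_distrib_left)
qed

text \<open>The error equation is tested with the discrete error. Rows and columns produce half of
  the energy and cost \<open>\<beta>^2\<close> times the square of the discrete
  \<open>u\<close>-error, at most half of the reaction energy since \<open>bb\<close> is at least
  \<open>2 * \<beta>^2\<close>. Of the three quarters left by \<open>mass_bound\<close> one quarter
  survives.\<close>

lemma discrete_error: "1 / 2 * XI + 1 / 4 * MX \<le> CR * W"
proof -
  define p2 where "p2 i j = I2c i j (\<lambda>x y. (ev k (xp i j) x y)\<^sup>2)" for i j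
  define q2 where "q2 i j = I2c i j (\<lambda>x y. (ev k (xq i j) x y)\<^sup>2)" for i j
  define u2 where "u2 i j = I2c i j (\<lambda>x y. (ev k (xu i j) x y)\<^sup>2)" for i j
  define d2 where "d2 i j = I2c i j (\<lambda>x y. (ev k (Dc i j) x y)\<^sup>2)" for i j
  define b2 where "b2 i j = I2c i j (\<lambda>x y. bb x y * (ev k (xu i j) x y)\<^sup>2)" for i j
  define mm where "mm i j = I2c i j (\<lambda>x y. bb x y * eru Uc i j x y * ev k (xu i j) x y)" for i j
  define h2 where "h2 i j = (if refined i \<or> refined j then I2c i j (\<lambda>x y. (u 0 0 x y - Gu i j x y)\<^sup>2) else 0)" for i j
  define TX where "TX i j = 1 / \<epsilon> * I2c i j (\<lambda>x y. erp Pc i j x y * ev k (xp i j) x y) + cellX k N m se (1 / se) X (eru Uc) (erp Pc) (xp i j) (xu i j) i j" for i j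
  define TY where "TY i j = 1 / \<epsilon> * I2c i j (\<lambda>x y. erq Qc i j x y * ev k (xq i j) x y) + cellX k N m se (1 / se) X (swapf (eru Uc)) (swapf (erq Qc)) (transp (xq i j)) (transp (xu i j)) j i" for i j
  define BX where "BX j = integral {X (j - 1)..X j} (\<lambda>y. se * ((ev k (xu 1 j) (X 0) y)\<^sup>2 + (ev k (xu N j) (X N) y)\<^sup>2)
       + 1 / se * (ev k (xp (Suc m) j) (X m) y - ev k (xp m j) (X m) y)\<^sup>2)" for j
  define BY where "BY i = integral {X (i - 1)..X i} (\<lambda>y. se * ((ev k (transp (xu i 1)) (X 0) y)\<^sup>2 + (ev k (transp (xu i N)) (X N) y)\<^sup>2)
       + 1 / se * (ev k (transp (xq i (Suc m))) (X m) y - ev k (transp (xq i m)) (X m) y)\<^sup>2)" for i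
  define c1 where "c1 = 10 * (cinv k)\<^sup>2 * \<epsilon> * (real N)\<^sup>2"
  define c2 where "c2 = 2 * cinv k * se * real N"
  have ci: "1 \<le> cinv k" by (rule cinv_ge)
  have c0: "0 \<le> c1" "0 \<le> c2" unfolding c1_def c2_def using ci eps se by auto
  have cd0: "0 \<le> cdel" unfolding cdel_def using Bm(1) by simp
  have d0: "0 \<le> d2 i j" for i j unfolding d2_def by (intro I2_nonneg contR) auto
  have dle: "d2 i j \<le> cdel * NN\<^sup>2 * (wid i * wid j)" if "i \<in> {1..N}" "j \<in> {1..N}" for i j
    unfolding d2_def by (rule Dc_small[OF that])
  have row: "1 / 2 * (1 / \<epsilon> * (\<Sum>i=1..N. p2 i j) + BX j) \<le> (\<Sum>i=1..N. TX i j) + \<beta>\<^sup>2 / 2 * (\<Sum>i=1..N. u2 i j)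
       + KR * se * L2 * wid j + c1 * (\<Sum>i=1..N. d2 i j) + c2 * d2 m j" if j: "j \<in> {1..N}" for j
  proof -
    have D0: "Dc i j = (\<lambda>_ _. 0)" if "i \<notin> {lo<..m}" for i
    proof -
      have "refined i" using that coarse_iff[of i] by blast
      then show ?thesis by (simp add: Dc_def)
    qed
    have "1 / 2 * (1 / \<epsilon> * (\<Sum>i=1..N. p2 i j) + BX j) \<le> (\<Sum>i=1..N. TX i j) + \<beta>\<^sup>2 / 2 * (\<Sum>i=1..N. u2 i j)
       + KR * se * L2 * wid j + c1 * (\<Sum>i\<in>{lo<..m}. d2 i j) + c2 * d2 m j"
      using row_integrated[OF bc(1,2) j, of "eru Uc" "\<lambda>i. Dc i j" "\<lambda>i. xu i j" "erp Pc" "\<lambda>i. xp i j", OF _ _ splits(1)[OF _ j] splits(2)[OF _ j] D0]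
      unfolding p2_def BX_def TX_def u2_def wid_def d2_def c1_def c2_def by simp
    moreover have "c1 * (\<Sum>i\<in>{lo<..m}. d2 i j) \<le> c1 * (\<Sum>i=1..N. d2 i j)"
      using c0 d0 index_order by (intro mult_left_mono sum_mono2) auto
    ultimately show ?thesis by linarith
  qed
  have col: "1 / 2 * (1 / \<epsilon> * (\<Sum>j=1..N. q2 i j) + BY i) \<le> (\<Sum>j=1..N. TY i j) + \<beta>\<^sup>2 / 2 * (\<Sum>j=1..N. u2 i j)
       + KR * se * L2 * wid i + c1 * (\<Sum>j=1..N. d2 i j) + c2 * d2 i m" if i: "i \<in> {1..N}" for i
  proof -
    have D0: "transp (Dc i j) = (\<lambda>_ _. 0)" if "j \<notin> {lo<..m}" for j
    proof -
      have "refined j" using that coarse_iff[of j] by blast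
      then show ?thesis by (simp add: Dc_def transp_def)
    qed
    \<comment> \<open>The splitting of the error rewritten for the exchanged problem.
      \<open>sw_Gu\<close> identifies the two interpolants of \<open>u\<close>, so the transposed
      \<open>Dc\<close> and \<open>xu\<close> serve here as well.\<close>
    have e1: "swapf (eru Uc) j i x y = total (fam_swap s) (fam_swap v) (fam_swap w) (fam_swap z) 0 0 x y - sw.Gu j i x y - ev k (transp (Dc i j)) x y + ev k (transp (xu i j)) x y"
      if "j \<in> {1..N}" for j x y
      unfolding swapf_def sw_u ev_transp using splits(1)[OF i that, of y x] sw_Gu[OF i that, of x y] by (simp add: fam_swap_def)
    have e2: "swapf (erq Qc) j i x y = \<epsilon> * total (fam_swap s) (fam_swap v) (fam_swap w) (fam_swap z) 1 0 x y - sw.Gp j i x y + ev k (transp (xq i j)) x y"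
      if "j \<in> {1..N}" for j x y
      unfolding swapf_def sw_u ev_transp using splits(3)[OF i that, of y x] by (simp add: fam_swap_def)
    have I2e: "I2c j i (\<lambda>x y. swapf (erq Qc) j i x y * ev k (transp (xq i j)) x y) = I2c i j (\<lambda>x y. erq Qc i j x y * ev k (xq i j) x y)" if j: "j \<in> {1..N}" for j
      unfolding swapf_def ev_transp
    proof (rule I2_swap)
      have "contC i j (u 0 1)" using family_contC[OF sm(7), of 0 1 i j] i j by simp
      then show "contC i j (\<lambda>x y. erq Qc i j x y * ev k (xq i j) x y)" unfolding erq_def by (intro contR)
    qed
    have ST: "(\<Sum>j=1..N. TY i j) = (\<Sum>j=1..N. 1 / \<epsilon> * I2c j i (\<lambda>x y. swapf (erq Qc) j i x y * ev k (transp (xq i j)) x y)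
        + cellX k N m se (1 / se) X (swapf (eru Uc)) (swapf (erq Qc)) (transp (xq i j)) (transp (xu i j)) j i)"
      unfolding TY_def by (intro sum.cong refl) (simp only: I2e)
    have "1 / 2 * (1 / \<epsilon> * (\<Sum>j=1..N. q2 i j) + BY i) \<le> (\<Sum>j=1..N. TY i j) + \<beta>\<^sup>2 / 2 * (\<Sum>j=1..N. u2 i j)
       + KR * se * L2 * wid i + c1 * (\<Sum>j\<in>{lo<..m}. d2 i j) + c2 * d2 i m"
      using sw.row_integrated[OF sw_bc i, of "swapf (eru Uc)" "\<lambda>j. transp (Dc i j)" "\<lambda>j. transp (xu i j)" "swapf (erq Qc)" "\<lambda>j. transp (xq i j)", OF _ _ e1 e2 D0]
      unfolding ST q2_def BY_def u2_def wid_def d2_def c1_def c2_def I2c_transp by simp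
    moreover have "c1 * (\<Sum>j\<in>{lo<..m}. d2 i j) \<le> c1 * (\<Sum>j=1..N. d2 i j)"
      using c0 d0 index_order by (intro mult_left_mono sum_mono2) auto
    ultimately show ?thesis by linarith
  qed
  let ?SS = "\<lambda>f. \<Sum>j=1..N. \<Sum>i=1..N. f i j"
  have rows: "1 / 2 * (1 / \<epsilon> * ?SS p2 + (\<Sum>j=1..N. BX j)) \<le> ?SS TX + \<beta>\<^sup>2 / 2 * ?SS u2 + KR * se * L2 + c1 * ?SS d2 + c2 * (\<Sum>j=1..N. d2 m j)"
  proof -
    have "(\<Sum>j=1..N. 1 / 2 * (1 / \<epsilon> * (\<Sum>i=1..N. p2 i j) + BX j)) \<le> (\<Sum>j=1..N. (\<Sum>i=1..N. TX i j) + \<beta>\<^sup>2 / 2 * (\<Sum>i=1..N. u2 i j)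
       + KR * se * L2 * wid j + c1 * (\<Sum>i=1..N. d2 i j) + c2 * d2 m j)" using row by (intro sum_mono) auto
    then show ?thesis unfolding sum.distrib sum_distrib_left[symmetric] wid(2) by simp
  qed
  have cols: "1 / 2 * (1 / \<epsilon> * ?SS q2 + (\<Sum>i=1..N. BY i)) \<le> ?SS TY + \<beta>\<^sup>2 / 2 * ?SS u2 + KR * se * L2 + c1 * ?SS d2 + c2 * (\<Sum>i=1..N. d2 i m)"
  proof -
    have "(\<Sum>i=1..N. 1 / 2 * (1 / \<epsilon> * (\<Sum>j=1..N. q2 i j) + BY i)) \<le> (\<Sum>i=1..N. (\<Sum>j=1..N. TY i j) + \<beta>\<^sup>2 / 2 * (\<Sum>j=1..N. u2 i j)
       + KR * se * L2 * wid i + c1 * (\<Sum>j=1..N. d2 i j) + c2 * d2 i m)" using col by (intro sum_mono) auto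
    then have "1 / 2 * (1 / \<epsilon> * (\<Sum>i=1..N. \<Sum>j=1..N. q2 i j) + (\<Sum>i=1..N. BY i)) \<le> (\<Sum>i=1..N. \<Sum>j=1..N. TY i j) + \<beta>\<^sup>2 / 2 * (\<Sum>i=1..N. \<Sum>j=1..N. u2 i j)
       + KR * se * L2 + c1 * (\<Sum>i=1..N. \<Sum>j=1..N. d2 i j) + c2 * (\<Sum>i=1..N. d2 i m)"
      unfolding sum.distrib sum_distrib_left[symmetric] wid(2) by simp
    then show ?thesis using sum.swap[of q2 "{1..N}" "{1..N}"] sum.swap[of TY "{1..N}" "{1..N}"] sum.swap[of u2 "{1..N}" "{1..N}"] sum.swap[of d2 "{1..N}" "{1..N}"] by simp
  qed
  have "TX i j + TY i j + mm i j = 0" if "i \<in> {1..N}" "j \<in> {1..N}" for i j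
    using scheme[OF that, of "xp i j" "xq i j" "xu i j"] by (simp add: TX_def TY_def mm_def)
  then have "(\<Sum>j=1..N. \<Sum>i=1..N. TX i j + TY i j + mm i j) = 0" by (intro sum.neutral ballI) auto
  then have tot: "?SS TX + ?SS TY + ?SS mm = 0" by (simp only: sum.distrib)
  have "(\<Sum>j=1..N. \<Sum>i=1..N. 3 / 4 * b2 i j - Bm * h2 i j) \<le> ?SS mm"
    using mass_bound by (intro sum_mono) (auto simp: b2_def h2_def mm_def)
  then have mass: "3 / 4 * ?SS b2 - Bm * ?SS h2 \<le> ?SS mm" by (simp only: sum_subtractf sum_distrib_left)
  have h: "Bm * ?SS h2 \<le> Bm * (K\<^sup>2 * cM * (se * L2))"
    using sum_eta_refined Bm(1) by (intro mult_left_mono) (auto simp: h2_def)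
  have ub: "\<beta>\<^sup>2 * ?SS u2 \<le> 1 / 2 * ?SS b2"
    unfolding sum_distrib_left
  proof (intro sum_mono)
    fix i j assume ij: "j \<in> {1..N}" "i \<in> {1..N}"
    have "2 * \<beta>\<^sup>2 * u2 i j = I2c i j (\<lambda>x y. 2 * \<beta>\<^sup>2 * (ev k (xu i j) x y)\<^sup>2)" unfolding u2_def by (rule I2_cmult[symmetric])
    also have "\<dots> \<le> b2 i j" unfolding b2_def
      by (intro I2_mono contR bb_cell ij mult_right_mono bb(2) cell_subset[OF ij(1)] cell_subset[OF ij(2)]) auto
    finally show "\<beta>\<^sup>2 * u2 i j \<le> 1 / 2 * b2 i j" by simp
  qed
  have dd: "?SS d2 \<le> cdel * NN\<^sup>2"
  proof -
    have "?SS d2 \<le> (\<Sum>j=1..N. \<Sum>i=1..N. cdel * NN\<^sup>2 * (wid i * wid j))" using dle by (intro sum_mono) auto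
    also have "\<dots> = cdel * NN\<^sup>2" unfolding sum_distrib_left[symmetric] sum_sum_prod wid(2)
      using sum_sum_prod[of wid wid] wid(2) by (simp add: sum_distrib_left[symmetric])
    finally show ?thesis .
  qed
  have mN: "m \<in> {1..N}" using index_order by auto
  have dm: "d2 m j \<le> cdel * NN\<^sup>2 * (2 / real N) * wid j" "d2 j m \<le> cdel * NN\<^sup>2 * (2 / real N) * wid j" if j: "j \<in> {1..N}" for j
  proof -
    have "cdel * NN\<^sup>2 * (wid m * wid j) \<le> cdel * NN\<^sup>2 * (2 / real N * wid j)"
      using wid(3)[OF mN] wid(1)[OF j] cd0 by (intro mult_left_mono mult_right_mono) auto
    then show "d2 m j \<le> cdel * NN\<^sup>2 * (2 / real N) * wid j" "d2 j m \<le> cdel * NN\<^sup>2 * (2 / real N) * wid j"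
      using dle[OF mN j] dle[OF j mN] by (simp_all add: mult_ac)
  qed
  have dms: "(\<Sum>j=1..N. d2 m j) \<le> cdel * NN\<^sup>2 * (2 / real N)" "(\<Sum>i=1..N. d2 i m) \<le> cdel * NN\<^sup>2 * (2 / real N)"
    using sum_mono[of "{1..N}" "\<lambda>j. d2 m j" "\<lambda>j. cdel * NN\<^sup>2 * (2 / real N) * wid j"] sum_mono[of "{1..N}" "\<lambda>j. d2 j m" "\<lambda>j. cdel * NN\<^sup>2 * (2 / real N) * wid j"] dm
    unfolding sum_distrib_left[symmetric] wid(2) by auto
  have r1: "c1 * ?SS d2 \<le> 10 * (cinv k)\<^sup>2 * cdel * (\<epsilon> * (real N)\<^sup>2 * NN\<^sup>2)"
    using mult_left_mono[OF dd c0(1)] by (simp add: c1_def mult_ac)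
  have r2: "c2 * (\<Sum>j=1..N. d2 m j) \<le> 4 * cinv k * cdel * (se * L2)" "c2 * (\<Sum>i=1..N. d2 i m) \<le> 4 * cinv k * cdel * (se * L2)"
  proof -
    \<comment> \<open>Only a single line of cells next to the penalised node is involved. Its width
      \<open>2 / N\<close> cancels the factor \<open>N\<close> in \<open>c2\<close>.\<close>
    have "c2 * (cdel * NN\<^sup>2 * (2 / real N)) = 4 * cinv k * cdel * (se * NN\<^sup>2)" using N by (simp add: c2_def)
    also have "\<dots> \<le> 4 * cinv k * cdel * (se * L2)" using ci cd0 se L2 by (intro mult_left_mono) auto
    finally have *: "c2 * (cdel * NN\<^sup>2 * (2 / real N)) \<le> 4 * cinv k * cdel * (se * L2)" .
    show "c2 * (\<Sum>j=1..N. d2 m j) \<le> 4 * cinv k * cdel * (se * L2)" "c2 * (\<Sum>i=1..N. d2 i m) \<le> 4 * cinv k * cdel * (se * L2)"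
      using mult_left_mono[OF dms(1) c0(2)] mult_left_mono[OF dms(2) c0(2)] * by linarith+
  qed
  have BXs: "(\<Sum>j=1..N. BX j) = se * Bdx (\<lambda>i j. ev k (xu i j)) + 1 / se * Jx (\<lambda>i j. ev k (xp i j))"
    unfolding BX_def by (rule Bd_J_sum)
  have BYs: "(\<Sum>i=1..N. BY i) = se * Bdx (\<lambda>i j. ev k (transp (xu j i))) + 1 / se * Jx (\<lambda>i j. ev k (transp (xq j i)))"
    unfolding BY_def by (rule Bd_J_sum[of "\<lambda>i j. transp (xu j i)" "\<lambda>i j. transp (xq j i)"])
  have XI: "XI = 1 / \<epsilon> * ?SS p2 + 1 / \<epsilon> * ?SS q2 + (\<Sum>j=1..N. BX j) + (\<Sum>i=1..N. BY i)"
    unfolding XI_def BXs BYs p2_def q2_def by simp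
  have MX: "MX = ?SS b2" unfolding MX_def b2_def by simp
  define A where "A = se * L2"
  define B where "B = \<epsilon> * (real N)\<^sup>2 * NN\<^sup>2"
  have AB: "0 \<le> A" "0 \<le> B" using se L2 eps by (auto simp: A_def B_def)
  have "1 / 2 * XI + 1 / 4 * MX \<le> 2 * (KR * A) + 8 * cinv k * cdel * A + Bm * (K\<^sup>2 * cM * A) + 20 * (cinv k)\<^sup>2 * cdel * B"
    using rows cols tot mass h ub r1 r2 unfolding XI MX A_def B_def by (simp add: algebra_simps)
  also have "\<dots> \<le> CR * (A + B)"
  proof -
    have kr: "0 \<le> KR" using K0 beta sigma unfolding KR_def cPsi_def by simp
    have cm: "0 \<le> cM" using beta sigma unfolding cM_def by simp
    have n: "0 \<le> KR * B" "0 \<le> cinv k * cdel * B" "0 \<le> Bm * (K\<^sup>2 * cM * B)" "0 \<le> (cinv k)\<^sup>2 * cdel * A"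
      using kr cm cd0 ci AB Bm(1) by auto
    have "CR * (A + B) = 2 * (KR * A) + 8 * cinv k * cdel * A + Bm * (K\<^sup>2 * cM * A) + 20 * (cinv k)\<^sup>2 * cdel * B
       + (2 * (KR * B) + 8 * (cinv k * cdel * B) + Bm * (K\<^sup>2 * cM * B) + 20 * ((cinv k)\<^sup>2 * cdel * A))"
      by (simp add: CR_def algebra_simps)
    then show ?thesis using n by linarith
  qed
  finally show ?thesis by (simp add: W_def A_def B_def)
qed

lemma I2_split:
  assumes "contR a b c d F" "contR a b c d G"
  shows "I2 a b c d (\<lambda>x y. (F x y + G x y)\<^sup>2) \<le> 2 * I2 a b c d (\<lambda>x y. (F x y)\<^sup>2) + 2 * I2 a b c d (\<lambda>x y. (G x y)\<^sup>2)"
proof -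
  have "I2 a b c d (\<lambda>x y. (F x y + G x y)\<^sup>2) \<le> I2 a b c d (\<lambda>x y. 2 * (F x y)\<^sup>2 + 2 * (G x y)\<^sup>2)"
  proof (intro I2_mono contR assms)
    show "(F x y + G x y)\<^sup>2 \<le> 2 * (F x y)\<^sup>2 + 2 * (G x y)\<^sup>2" for x y
      using sum_squares_bound[of "F x y" "G x y"] by (simp add: power2_sum)
  qed
  also have "\<dots> = 2 * I2 a b c d (\<lambda>x y. (F x y)\<^sup>2) + 2 * I2 a b c d (\<lambda>x y. (G x y)\<^sup>2)"
    by (subst I2_add) (intro contR assms | simp only: I2_cmult)+
  finally show ?thesis .
qed

definition "CC = 4 * K\<^sup>2 * cPsi + 4 * K\<^sup>2 + 8 * CR + 48 * Bm * K\<^sup>2 / \<beta> + 48 * Bm * K\<^sup>2 + 4 * Bm * cdel"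

lemma nonneg_parts:
  "0 \<le> (\<Sum>j=1..N. \<Sum>i=1..N. I2c i j (\<lambda>x y. (ev k (c i j) x y)\<^sup>2))" "0 \<le> Bdx (\<lambda>i j. ev k (c i j))" "0 \<le> Jx (\<lambda>i j. ev k (c i j))"
  unfolding Bdx_def Jx_def
  by (intro sum_nonneg I2_nonneg contR integral_nonneg integrable_continuous_interval continuous_intros ev_continuous_y add_nonneg_nonneg zero_le_power2; simp)+

lemma W_ge: "0 \<le> W" "se * L2 \<le> W" and CR_nonneg: "0 \<le> CR" "0 \<le> cPsi" "0 \<le> cdel"
proof -
  have "0 \<le> se * L2" "0 \<le> \<epsilon> * (real N)\<^sup>2 * NN\<^sup>2" using se L2 eps by auto
  then show "0 \<le> W" "se * L2 \<le> W" by (auto simp: W_def)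
  have kr: "0 \<le> KR" using K0 beta sigma unfolding KR_def cPsi_def by simp
  have cm: "0 \<le> cM" using beta sigma unfolding cM_def by simp
  show cd: "0 \<le> cdel" unfolding cdel_def using Bm(1) by simp
  show "0 \<le> cPsi" unfolding cPsi_def using beta sigma by simp
  show "0 \<le> CR" unfolding CR_def using kr cm cd Bm(1) cinv_ge[of k] by (intro add_nonneg_nonneg mult_nonneg_nonneg) auto
qed

lemma XI_MX: "XI \<le> 2 * CR * W" "MX \<le> 4 * CR * W"
proof -
  have "0 \<le> MX" unfolding MX_def
  proof (intro sum_nonneg I2_nonneg contR bb_cell mult_nonneg_nonneg zero_le_power2)
    fix i j x y assume "j \<in> {1..N}" "i \<in> {1..N}" "x \<in> {X (i - 1)..X i}" "y \<in> {X (j - 1)..X j}"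
    then have "2 * \<beta>\<^sup>2 \<le> bb x y" using bb(2) cell_subset by blast
    moreover have "0 \<le> 2 * \<beta>\<^sup>2" by simp
    ultimately show "0 \<le> bb x y" by linarith
  qed auto
  moreover have "0 \<le> XI" unfolding XI_def using nonneg_parts eps se by (intro add_nonneg_nonneg mult_nonneg_nonneg) auto
  ultimately show "XI \<le> 2 * CR * W" "MX \<le> 4 * CR * W" using discrete_error by linarith+
qed

text \<open>Triangle inequality between interpolation error and discrete error. The three groups are
  separated by how the norms treat them: the first has weights larger by \<open>1 / se\<close> in
  the balanced norm, the second has equal weights, and the third contains the unavoidable
  \<open>NN\<^sup>2\<close>.\<close>

lemma energy_estimate:
  "1 / \<epsilon> * (\<Sum>j=1..N. \<Sum>i=1..N. I2c i j (\<lambda>x y. (erp Pc i j x y)\<^sup>2)) + 1 / \<epsilon> * (\<Sum>j=1..N. \<Sum>i=1..N. I2c i j (\<lambda>x y. (erq Qc i j x y)\<^sup>2))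
     + se * (Bdx (eru Uc) + Bdx (swapf (eru Uc))) \<le> CC * W"
  "1 / se * (Jx (erp Pc) + Jx (swapf (erq Qc))) \<le> CC * W"
  "(\<Sum>j=1..N. \<Sum>i=1..N. I2c i j (\<lambda>x y. bb x y * (eru Uc i j x y)\<^sup>2)) \<le> CC * (W + NN\<^sup>2)"
proof -
  let ?SS = "\<lambda>f. \<Sum>j=1..N. \<Sum>i=1..N. f i j"
  have cu: "contC i j (u a b)" if "i \<in> {1..N}" "j \<in> {1..N}" "a \<le> 1" "b \<le> 1" for a b i j
    using family_contC[OF sm(7), of a b i j] that by simp
  define P where "P = 1 / \<epsilon> * ?SS (\<lambda>i j. I2c i j (\<lambda>x y. (ev k (xp i j) x y)\<^sup>2))"
  define Q where "Q = 1 / \<epsilon> * ?SS (\<lambda>i j. I2c i j (\<lambda>x y. (ev k (xq i j) x y)\<^sup>2))"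
  define BX where "BX = se * Bdx (\<lambda>i j. ev k (xu i j))"
  define BY where "BY = se * Bdx (\<lambda>i j. ev k (transp (xu j i)))"
  define JX where "JX = 1 / se * Jx (\<lambda>i j. ev k (xp i j))"
  define JY where "JY = 1 / se * Jx (\<lambda>i j. ev k (transp (xq j i)))"
  have nn: "0 \<le> P" "0 \<le> Q" "0 \<le> BX" "0 \<le> BY" "0 \<le> JX" "0 \<le> JY"
    unfolding P_def Q_def BX_def BY_def JX_def JY_def using nonneg_parts eps se by auto
  have XI: "XI = P + Q + (BX + JX) + (BY + JY)" by (simp add: XI_def P_def Q_def BX_def BY_def JX_def JY_def)
  have ep: "1 / \<epsilon> * ?SS (\<lambda>i j. I2c i j (\<lambda>x y. (erp Pc i j x y)\<^sup>2)) \<le> 2 * (K\<^sup>2 * cPsi * (se * L2)) + 2 * P"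
  proof -
    have "?SS (\<lambda>i j. I2c i j (\<lambda>x y. (erp Pc i j x y)\<^sup>2)) \<le> (\<Sum>j=1..N. \<Sum>i=1..N. 2 * I2c i j (\<lambda>x y. (\<epsilon> * u 1 0 x y - Gp i j x y)\<^sup>2) + 2 * I2c i j (\<lambda>x y. (ev k (xp i j) x y)\<^sup>2))"
    proof (intro sum_mono)
      fix i j assume ij: "j \<in> {1..N}" "i \<in> {1..N}"
      show "I2c i j (\<lambda>x y. (erp Pc i j x y)\<^sup>2) \<le> 2 * I2c i j (\<lambda>x y. (\<epsilon> * u 1 0 x y - Gp i j x y)\<^sup>2) + 2 * I2c i j (\<lambda>x y. (ev k (xp i j) x y)\<^sup>2)"
        unfolding splits(2)[OF ij(2,1)] by (intro I2_split contR cu contC_Gu ij) auto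
    qed
    also have "\<dots> = 2 * ?SS (\<lambda>i j. I2c i j (\<lambda>x y. (\<epsilon> * u 1 0 x y - Gp i j x y)\<^sup>2)) + 2 * ?SS (\<lambda>i j. I2c i j (\<lambda>x y. (ev k (xp i j) x y)\<^sup>2))"
      by (simp only: sum.distrib sum_distrib_left)
    also have "\<dots> \<le> 2 * (K\<^sup>2 * \<epsilon> * (cPsi * se * L2)) + 2 * ?SS (\<lambda>i j. I2c i j (\<lambda>x y. (ev k (xp i j) x y)\<^sup>2))"
      using eta_p_integrated[OF bc(1,2)] by simp
    finally have "1 / \<epsilon> * ?SS (\<lambda>i j. I2c i j (\<lambda>x y. (erp Pc i j x y)\<^sup>2)) \<le> 1 / \<epsilon> * (2 * (K\<^sup>2 * \<epsilon> * (cPsi * se * L2)) + 2 * ?SS (\<lambda>i j. I2c i j (\<lambda>x y. (ev k (xp i j) x y)\<^sup>2)))"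
      using eps by (intro mult_left_mono) auto
    also have "\<dots> = 2 * (K\<^sup>2 * cPsi * (se * L2)) + 2 * P" using eps by (simp add: P_def field_simps)
    finally show ?thesis .
  qed
  have eq: "1 / \<epsilon> * ?SS (\<lambda>i j. I2c i j (\<lambda>x y. (erq Qc i j x y)\<^sup>2)) \<le> 2 * (K\<^sup>2 * cPsi * (se * L2)) + 2 * Q"
  proof -
    have cq: "contC i j (\<lambda>x y. sw.Gp j i y x)" if ij: "j \<in> {1..N}" "i \<in> {1..N}" for i j
      unfolding Qpc[OF ij(2,1)] by (intro contR)
    have "?SS (\<lambda>i j. I2c i j (\<lambda>x y. (erq Qc i j x y)\<^sup>2)) \<le> (\<Sum>j=1..N. \<Sum>i=1..N. 2 * I2c i j (\<lambda>x y. (\<epsilon> * u 0 1 x y - sw.Gp j i y x)\<^sup>2) + 2 * I2c i j (\<lambda>x y. (ev k (xq i j) x y)\<^sup>2))"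
    proof (intro sum_mono)
      fix i j assume ij: "j \<in> {1..N}" "i \<in> {1..N}"
      show "I2c i j (\<lambda>x y. (erq Qc i j x y)\<^sup>2) \<le> 2 * I2c i j (\<lambda>x y. (\<epsilon> * u 0 1 x y - sw.Gp j i y x)\<^sup>2) + 2 * I2c i j (\<lambda>x y. (ev k (xq i j) x y)\<^sup>2)"
        unfolding splits(3)[OF ij(2,1)] by (intro I2_split contR cu cq ij) auto
    qed
    also have "\<dots> = 2 * ?SS (\<lambda>i j. I2c i j (\<lambda>x y. (\<epsilon> * u 0 1 x y - sw.Gp j i y x)\<^sup>2)) + 2 * ?SS (\<lambda>i j. I2c i j (\<lambda>x y. (ev k (xq i j) x y)\<^sup>2))"
      by (simp only: sum.distrib sum_distrib_left)
    also have "?SS (\<lambda>i j. I2c i j (\<lambda>x y. (\<epsilon> * u 0 1 x y - sw.Gp j i y x)\<^sup>2)) \<le> K\<^sup>2 * \<epsilon> * (cPsi * se * L2)"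
    proof -
      have "I2c j i (\<lambda>x y. (\<epsilon> * fam_swap u 1 0 x y - sw.Gp j i x y)\<^sup>2) = I2c i j (\<lambda>x y. (\<epsilon> * u 0 1 x y - sw.Gp j i y x)\<^sup>2)" if ij: "j \<in> {1..N}" "i \<in> {1..N}" for i j
      proof -
        have fs: "fam_swap u 1 0 x y = u 0 1 y x" for x y by (simp add: fam_swap_def)
        have "contC i j (\<lambda>x y. (\<epsilon> * u 0 1 x y - sw.Gp j i y x)\<^sup>2)" by (intro contR cu cq ij; simp)
        then show ?thesis unfolding fs by (rule I2_swap)
      qed
      then have "?SS (\<lambda>i j. I2c i j (\<lambda>x y. (\<epsilon> * u 0 1 x y - sw.Gp j i y x)\<^sup>2)) = (\<Sum>j=1..N. \<Sum>i=1..N. I2c j i (\<lambda>x y. (\<epsilon> * fam_swap u 1 0 x y - sw.Gp j i x y)\<^sup>2))"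
        by (intro sum.cong refl) auto
      also have "\<dots> = (\<Sum>i=1..N. \<Sum>j=1..N. I2c j i (\<lambda>x y. (\<epsilon> * fam_swap u 1 0 x y - sw.Gp j i x y)\<^sup>2))" by (rule sum.swap)
      also have "\<dots> \<le> K\<^sup>2 * \<epsilon> * (cPsi * se * L2)" using sw.eta_p_integrated[OF sw_bc] unfolding sw_u by simp
      finally show ?thesis .
    qed
    finally have "1 / \<epsilon> * ?SS (\<lambda>i j. I2c i j (\<lambda>x y. (erq Qc i j x y)\<^sup>2)) \<le> 1 / \<epsilon> * (2 * (K\<^sup>2 * \<epsilon> * (cPsi * se * L2)) + 2 * ?SS (\<lambda>i j. I2c i j (\<lambda>x y. (ev k (xq i j) x y)\<^sup>2)))"
      using eps by (intro mult_left_mono) auto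
    also have "\<dots> = 2 * (K\<^sup>2 * cPsi * (se * L2)) + 2 * Q" using eps by (simp add: Q_def field_simps)
    finally show ?thesis .
  qed
  have rN: "refined 1" "refined N" using index_order by (auto simp: refined_def)
  have sx: "Bdx (eru Uc) \<le> 2 * K\<^sup>2 * L2 + 2 * Bdx (\<lambda>i j. ev k (xu i j))" "Jx (erp Pc) \<le> 2 * K\<^sup>2 * \<epsilon> * L2 + 2 * Jx (\<lambda>i j. ev k (xp i j))"
  proof -
    have e: "eru Uc i j x y = u 0 0 x y - Gu i j x y + ev k (xu i j) x y" if "i \<in> {1, N}" "j \<in> {1..N}" for i j x y
      using splits(1)[of i j x y] that rN index_order by (auto simp: Dc_def ev_zero)
    have e': "erp Pc i j x y = \<epsilon> * u 1 0 x y - Gp i j x y + ev k (xp i j) x y" if "i \<in> {m, Suc m}" "j \<in> {1..N}" for i j x y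
      using splits(2)[of i j x y] that index_order by auto
    show "Bdx (eru Uc) \<le> 2 * K\<^sup>2 * L2 + 2 * Bdx (\<lambda>i j. ev k (xu i j))" "Jx (erp Pc) \<le> 2 * K\<^sup>2 * \<epsilon> * L2 + 2 * Jx (\<lambda>i j. ev k (xp i j))"
      by (rule boundary_split[OF bc(1,2) e e']; assumption)+
  qed
  have sy: "Bdx (swapf (eru Uc)) \<le> 2 * K\<^sup>2 * L2 + 2 * Bdx (\<lambda>i j. ev k (transp (xu j i)))" "Jx (swapf (erq Qc)) \<le> 2 * K\<^sup>2 * \<epsilon> * L2 + 2 * Jx (\<lambda>i j. ev k (transp (xq j i)))"
  proof -
    have e: "swapf (eru Uc) i j x y = total (fam_swap s) (fam_swap v) (fam_swap w) (fam_swap z) 0 0 x y - sw.Gu i j x y + ev k (transp (xu j i)) x y" if "i \<in> {1, N}" "j \<in> {1..N}" for i j x y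
    proof -
      have iN: "i \<in> {1..N}" using that index_order by auto
      have "Dc j i = (\<lambda>_ _. 0)" using that rN by (auto simp: Dc_def)
      then show ?thesis unfolding swapf_def sw_u ev_transp using splits(1)[OF that(2) iN, of y x] sw_Gu[OF that(2) iN, of x y] by (simp add: fam_swap_def ev_zero)
    qed
    have e': "swapf (erq Qc) i j x y = \<epsilon> * total (fam_swap s) (fam_swap v) (fam_swap w) (fam_swap z) 1 0 x y - sw.Gp i j x y + ev k (transp (xq j i)) x y" if "i \<in> {m, Suc m}" "j \<in> {1..N}" for i j x y
    proof -
      have iN: "i \<in> {1..N}" using that index_order by auto
      show ?thesis unfolding swapf_def sw_u ev_transp using splits(3)[OF that(2) iN, of y x] by (simp add: fam_swap_def)
    qed
    show "Bdx (swapf (eru Uc)) \<le> 2 * K\<^sup>2 * L2 + 2 * Bdx (\<lambda>i j. ev k (transp (xu j i)))" "Jx (swapf (erq Qc)) \<le> 2 * K\<^sup>2 * \<epsilon> * L2 + 2 * Jx (\<lambda>i j. ev k (transp (xq j i)))"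
      by (rule sw.boundary_split[OF sw_bc e e']; assumption)+
  qed
  define A where "A = se * L2"
  have A: "0 \<le> A" "A \<le> W" using W_ge se L2 by (auto simp: A_def)
  have bd: "se * (Bdx (eru Uc) + Bdx (swapf (eru Uc))) \<le> 4 * (K\<^sup>2 * A) + 2 * (BX + BY)"
  proof -
    have "se * (Bdx (eru Uc) + Bdx (swapf (eru Uc))) \<le> se * ((2 * K\<^sup>2 * L2 + 2 * Bdx (\<lambda>i j. ev k (xu i j))) + (2 * K\<^sup>2 * L2 + 2 * Bdx (\<lambda>i j. ev k (transp (xu j i)))))"
      using sx(1) sy(1) se by (intro mult_left_mono add_mono) auto
    also have "\<dots> = 4 * (K\<^sup>2 * A) + 2 * (BX + BY)" by (simp add: BX_def BY_def A_def algebra_simps)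
    finally show ?thesis .
  qed
  have jp: "1 / se * (Jx (erp Pc) + Jx (swapf (erq Qc))) \<le> 4 * (K\<^sup>2 * A) + 2 * (JX + JY)"
  proof -
    have "1 / se * (Jx (erp Pc) + Jx (swapf (erq Qc))) \<le> 1 / se * ((2 * K\<^sup>2 * (se * se) * L2 + 2 * Jx (\<lambda>i j. ev k (xp i j))) + (2 * K\<^sup>2 * (se * se) * L2 + 2 * Jx (\<lambda>i j. ev k (transp (xq j i)))))"
      unfolding se(4) using sx(2) sy(2) se(1) by (intro mult_left_mono add_mono) auto
    also have "\<dots> = 4 * (K\<^sup>2 * A) + 2 * (JX + JY)" using se(1) by (simp add: JX_def JY_def A_def field_simps)
    finally show ?thesis .
  qed
  have KA: "K\<^sup>2 * A \<le> K\<^sup>2 * W" "K\<^sup>2 * cPsi * A \<le> K\<^sup>2 * cPsi * W" using A CR_nonneg by (auto intro!: mult_left_mono)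
  have nW: "0 \<le> K\<^sup>2 * W" "0 \<le> K\<^sup>2 * cPsi * W" "0 \<le> CR * W" "0 \<le> Bm * K\<^sup>2 / \<beta> * W" "0 \<le> Bm * K\<^sup>2 * W" "0 \<le> Bm * cdel * W"
    using W_ge CR_nonneg Bm beta by auto
  have CCW: "CC * W = 4 * (K\<^sup>2 * cPsi * W) + 4 * (K\<^sup>2 * W) + 8 * (CR * W) + 48 * (Bm * K\<^sup>2 / \<beta> * W) + 48 * (Bm * K\<^sup>2 * W) + 4 * (Bm * cdel * W)"
    by (simp add: CC_def algebra_simps)
  have XIW: "XI \<le> 2 * (CR * W)" "MX \<le> 4 * (CR * W)" using XI_MX by auto
  show "1 / \<epsilon> * ?SS (\<lambda>i j. I2c i j (\<lambda>x y. (erp Pc i j x y)\<^sup>2)) + 1 / \<epsilon> * ?SS (\<lambda>i j. I2c i j (\<lambda>x y. (erq Qc i j x y)\<^sup>2))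
     + se * (Bdx (eru Uc) + Bdx (swapf (eru Uc))) \<le> CC * W"
    using ep eq bd KA nW XIW(1) nn unfolding CCW XI A_def[symmetric] by argo
  show "1 / se * (Jx (erp Pc) + Jx (swapf (erq Qc))) \<le> CC * W"
    using jp KA nW XIW(1) nn unfolding CCW XI by argo
  have mass: "I2c i j (\<lambda>x y. bb x y * (eru Uc i j x y)\<^sup>2) \<le> 4 * Bm * I2c i j (\<lambda>x y. (u 0 0 x y - Gu i j x y)\<^sup>2) + 4 * Bm * I2c i j (\<lambda>x y. (ev k (Dc i j) x y)\<^sup>2)
     + 2 * I2c i j (\<lambda>x y. bb x y * (ev k (xu i j) x y)\<^sup>2)" if ij: "j \<in> {1..N}" "i \<in> {1..N}" for i j
  proof -
    have c0: "contC i j (u 0 0)" using cu[OF ij(2,1), of 0 0] by simp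
    have "I2c i j (\<lambda>x y. bb x y * (eru Uc i j x y)\<^sup>2) \<le> I2c i j (\<lambda>x y. (4 * Bm * (u 0 0 x y - Gu i j x y)\<^sup>2 + 4 * Bm * (ev k (Dc i j) x y)\<^sup>2) + 2 * (bb x y * (ev k (xu i j) x y)\<^sup>2))"
    proof (intro I2_mono contR bb_cell c0 contC_Gu ij)
      show "contC i j (eru Uc i j)" using cu[OF ij(2,1), of 0 0] unfolding eru_def[abs_def] by (intro contR) simp
      fix x y assume xy: "x \<in> {X (i - 1)..X i}" "y \<in> {X (j - 1)..X j}"
      define h where "h = u 0 0 x y - Gu i j x y"
      define d where "d = ev k (Dc i j) x y"
      define v where "v = ev k (xu i j) x y"
      have b: "bb x y \<le> Bm" "2 * \<beta>\<^sup>2 \<le> bb x y" using bb(2,3) cell_subset[OF ij(2) xy(1)] cell_subset[OF ij(1) xy(2)] by auto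
      have "0 \<le> 2 * \<beta>\<^sup>2" by simp
      then have b0: "0 \<le> bb x y" using b(2) by linarith
      have "(h - d + v)\<^sup>2 \<le> 4 * (h\<^sup>2 + d\<^sup>2) + 2 * v\<^sup>2"
      proof -
        \<comment> \<open>This sum of squares is exactly the difference of the two sides. Splitting
          off \<open>v\<close> first keeps its factor at 2.\<close>
        have "0 \<le> (h - d - v)\<^sup>2 + 2 * (h + d)\<^sup>2" by simp
        then show ?thesis by (simp add: power2_eq_square algebra_simps)
      qed
      then have "bb x y * (h - d + v)\<^sup>2 \<le> bb x y * (4 * (h\<^sup>2 + d\<^sup>2) + 2 * v\<^sup>2)" using b0 by (intro mult_left_mono)
      also have "\<dots> = bb x y * (4 * (h\<^sup>2 + d\<^sup>2)) + 2 * (bb x y * v\<^sup>2)" by (simp add: algebra_simps)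
      also have "\<dots> \<le> Bm * (4 * (h\<^sup>2 + d\<^sup>2)) + 2 * (bb x y * v\<^sup>2)" using b by (intro add_right_mono mult_right_mono) auto
      also have "\<dots> = 4 * Bm * h\<^sup>2 + 4 * Bm * d\<^sup>2 + 2 * (bb x y * v\<^sup>2)" by (simp add: algebra_simps)
      finally show "bb x y * (eru Uc i j x y)\<^sup>2 \<le> (4 * Bm * (u 0 0 x y - Gu i j x y)\<^sup>2 + 4 * Bm * (ev k (Dc i j) x y)\<^sup>2) + 2 * (bb x y * (ev k (xu i j) x y)\<^sup>2)"
        unfolding splits(1)[OF ij(2,1)] h_def d_def v_def .
    qed
    also have "\<dots> = I2c i j (\<lambda>x y. 4 * Bm * (u 0 0 x y - Gu i j x y)\<^sup>2 + 4 * Bm * (ev k (Dc i j) x y)\<^sup>2) + I2c i j (\<lambda>x y. 2 * (bb x y * (ev k (xu i j) x y)\<^sup>2))"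
      by (intro I2_add contR bb_cell c0 contC_Gu ij)
    also have "I2c i j (\<lambda>x y. 4 * Bm * (u 0 0 x y - Gu i j x y)\<^sup>2 + 4 * Bm * (ev k (Dc i j) x y)\<^sup>2) = I2c i j (\<lambda>x y. 4 * Bm * (u 0 0 x y - Gu i j x y)\<^sup>2) + I2c i j (\<lambda>x y. 4 * Bm * (ev k (Dc i j) x y)\<^sup>2)"
      by (intro I2_add contR c0 contC_Gu ij)
    finally show ?thesis by (simp only: I2_cmult)
  qed
  have "?SS (\<lambda>i j. I2c i j (\<lambda>x y. bb x y * (eru Uc i j x y)\<^sup>2)) \<le> (\<Sum>j=1..N. \<Sum>i=1..N. 4 * Bm * I2c i j (\<lambda>x y. (u 0 0 x y - Gu i j x y)\<^sup>2) + 4 * Bm * (cdel * NN\<^sup>2 * (wid i * wid j))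
     + 2 * I2c i j (\<lambda>x y. bb x y * (ev k (xu i j) x y)\<^sup>2))"
  proof (intro sum_mono)
    fix i j assume ij: "j \<in> {1..N}" "i \<in> {1..N}"
    have "4 * Bm * I2c i j (\<lambda>x y. (ev k (Dc i j) x y)\<^sup>2) \<le> 4 * Bm * (cdel * NN\<^sup>2 * (wid i * wid j))"
      using Dc_small[OF ij(2,1)] Bm(1) by (intro mult_left_mono) auto
    then show "I2c i j (\<lambda>x y. bb x y * (eru Uc i j x y)\<^sup>2) \<le> 4 * Bm * I2c i j (\<lambda>x y. (u 0 0 x y - Gu i j x y)\<^sup>2) + 4 * Bm * (cdel * NN\<^sup>2 * (wid i * wid j))
       + 2 * I2c i j (\<lambda>x y. bb x y * (ev k (xu i j) x y)\<^sup>2)" using mass[OF ij] by linarith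
  qed
  also have "\<dots> = 4 * Bm * ?SS (\<lambda>i j. I2c i j (\<lambda>x y. (u 0 0 x y - Gu i j x y)\<^sup>2)) + 4 * Bm * (cdel * NN\<^sup>2 * ((\<Sum>i=1..N. wid i) * (\<Sum>j=1..N. wid j))) + 2 * MX"
    unfolding sum_sum_prod[symmetric] MX_def by (simp only: sum.distrib sum_distrib_left)
  also have "\<dots> \<le> 4 * Bm * (12 * K\<^sup>2 / \<beta> * (se * L2) + 12 * K\<^sup>2 * NN\<^sup>2) + 4 * Bm * (cdel * NN\<^sup>2 * (1 * 1)) + 2 * (4 * (CR * W))"
    unfolding wid(2) using sum_eta_all Bm(1) XIW(2) by (intro add_mono mult_left_mono order.refl) auto
  also have "\<dots> = 48 * (Bm * K\<^sup>2 / \<beta> * A) + 48 * (Bm * K\<^sup>2 * NN\<^sup>2) + 4 * (Bm * cdel * NN\<^sup>2) + 8 * (CR * W)"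
    by (simp add: A_def algebra_simps)
  also have "\<dots> \<le> CC * (W + NN\<^sup>2)"
  proof -
    have 1: "Bm * K\<^sup>2 / \<beta> * A \<le> Bm * K\<^sup>2 / \<beta> * W" using A Bm(1) beta by (intro mult_left_mono) auto
    have 2: "0 \<le> K\<^sup>2 * cPsi * NN\<^sup>2" "0 \<le> K\<^sup>2 * NN\<^sup>2" "0 \<le> CR * NN\<^sup>2" "0 \<le> Bm * K\<^sup>2 / \<beta> * NN\<^sup>2"
      using CR_nonneg Bm(1) beta by auto
    have "CC * NN\<^sup>2 = 4 * (K\<^sup>2 * cPsi * NN\<^sup>2) + 4 * (K\<^sup>2 * NN\<^sup>2) + 8 * (CR * NN\<^sup>2) + 48 * (Bm * K\<^sup>2 / \<beta> * NN\<^sup>2) + 48 * (Bm * K\<^sup>2 * NN\<^sup>2) + 4 * (Bm * cdel * NN\<^sup>2)"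
      by (simp add: CC_def algebra_simps)
    then show ?thesis using 1 2 nW unfolding distrib_left CCW by argo
  qed
  finally show "?SS (\<lambda>i j. I2c i j (\<lambda>x y. bb x y * (eru Uc i j x y)\<^sup>2)) \<le> CC * (W + NN\<^sup>2)" .
qed

end

subsection \<open>From the scheme to the error equation\<close>

text \<open>The passage from the scheme, stated with Lebesgue integrals over open sets and arbitrary
  values on mesh lines, to integrals of continuous functions over closed intervals. The next lemma
  does the same for cells.\<close>

lemma lebesgue_open_interval:
  assumes f: "continuous_on {a..b} f" and g: "\<And>x. x \<in> {a<..<b} \<Longrightarrow> g x = f x"
  shows "(LINT x:{a<..<b}|lebesgue. g x) = integral {a..b} (f :: real \<Rightarrow> real)"
proof -
  have "set_integrable lebesgue {a<..<b} f"
    by (rule set_integrable_subset[OF absolutely_integrable_continuous_real[OF f]]) auto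
  from set_lebesgue_integral_eq_integral(2)[OF this]
  have "(LINT x:{a<..<b}|lebesgue. f x) = integral {a..b} f" by (simp add: integral_open_interval_real)
  moreover have "(LINT x:{a<..<b}|lebesgue. g x) = (LINT x:{a<..<b}|lebesgue. f x)"
    using g by (intro set_lebesgue_integral_cong) auto
  ultimately show ?thesis by simp
qed

lemma lebesgue_open_rectangle:
  assumes F: "contR a b c d F" and g: "\<And>x y. x \<in> {a<..<b} \<Longrightarrow> y \<in> {c<..<d} \<Longrightarrow> g (x, y) = F x y"
  shows "set_integrable lebesgue ({a<..<b} \<times> {c<..<d}) g"
    and "(LINT z:{a<..<b} \<times> {c<..<d}|lebesgue. g z) = I2 a b c d F"
    and "(g has_integral I2 a b c d F) ({a<..<b} \<times> {c<..<d})"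
proof -
  let ?f = "\<lambda>z. F (fst z) (snd z)"
  have b: "box (a, c) (b, d) = {a<..<b} \<times> {c<..<d}" "cbox (a, c) (b, d) = {a..b} \<times> {c..d}"
    by (auto simp: box_def cbox_Pair_eq Basis_prod_def)
  have c: "continuous_on (cbox (a, c) (b, d)) ?f" using F by (simp add: contR_def b)
  have sub: "{a<..<b} \<times> {c<..<d} \<subseteq> cbox (a, c) (b, d)" unfolding b by auto
  have i: "set_integrable lebesgue ({a<..<b} \<times> {c<..<d}) ?f"
    by (rule set_integrable_subset[OF absolutely_integrable_continuous[OF c] _ sub]) (unfold b(1)[symmetric], simp)
  have eq: "set_integrable lebesgue ({a<..<b} \<times> {c<..<d}) g = set_integrable lebesgue ({a<..<b} \<times> {c<..<d}) ?f"
    using g by (intro set_integrable_cong) auto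
  then show ig: "set_integrable lebesgue ({a<..<b} \<times> {c<..<d}) g" using i by simp
  have "(LINT z:{a<..<b} \<times> {c<..<d}|lebesgue. g z) = (LINT z:{a<..<b} \<times> {c<..<d}|lebesgue. ?f z)"
    using g by (intro set_lebesgue_integral_cong) (unfold b(1)[symmetric], simp, unfold b(1), auto)
  also have "\<dots> = integral (box (a, c) (b, d)) ?f" using set_lebesgue_integral_eq_integral(2)[OF i] by (simp only: b)
  also have "\<dots> = integral {a..b} (\<lambda>x. integral {c..d} (F x))"
    unfolding integral_open_interval using integral_prod_continuous[OF c] by simp
  also have "\<dots> = I2 a b c d F" using I2_swap[OF F] by (simp add: I2_def)
  finally show L: "(LINT z:{a<..<b} \<times> {c<..<d}|lebesgue. g z) = I2 a b c d F" .
  show "(g has_integral I2 a b c d F) ({a<..<b} \<times> {c<..<d})" using has_integral_set_lebesgue[OF ig] L by simp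
qed

definition flip :: "fn2 \<Rightarrow> fn2" where
  "flip g = (\<lambda>(x, y). g (y, x))"

lemma flip_simps [simp]: "flip g (x, y) = g (y, x)"
  by (simp add: flip_def)

text \<open>All notions for horizontal edges are those for vertical edges applied to the flipped
  functions, so every statement about traces and fluxes is proved in one direction only.\<close>

lemma flip_translations:
  "tryp X v = trxp X (flip v)" "trym X v = trxm X (flip v)" "jumpy N X v = jumpx N X (flip v)"
  "fluxUy \<epsilon> N X U Q = fluxUx \<epsilon> N X (flip U) (flip Q)" "fluxQy \<epsilon> N X U Q = fluxPx \<epsilon> N X (flip U) (flip Q)"
  "dy g = flip (dx (flip g))"
  by (auto simp: fun_eq_iff tryp_def trxp_def trym_def trxm_def jumpy_def jumpx_def fluxUy_def fluxUx_def fluxQy_def fluxPx_def dx_def dy_def)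

definition pol :: "nat \<Rightarrow> (nat \<Rightarrow> nat \<Rightarrow> real) \<Rightarrow> fn2" where
  "pol k c = (\<lambda>(x, y). ev k c x y)"

lemma pol_simps [simp]: "pol k c (x, y) = ev k c x y"
  by (simp add: pol_def)

lemma flip_pol: "flip (pol k c) = pol k (transp c)"
  by (auto simp: fun_eq_iff ev_transp)

lemma dx_pol: "x \<in> {0..1} \<Longrightarrow> dx (pol k c) (x, y) = poly (pderiv (sec k c y)) x"
proof -
  assume x: "x \<in> {0..1}"
  have "((\<lambda>\<xi>. poly (sec k c y) \<xi>) has_real_derivative poly (pderiv (sec k c y)) x) (at x within {0..1})"
    by (rule DERIV_subset[OF poly_DERIV]) simp
  then have "((\<lambda>\<xi>. ev k c \<xi> y) has_vector_derivative poly (pderiv (sec k c y)) x) (at x within cbox 0 1)"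
    by (simp add: poly_sec has_real_derivative_iff_has_vector_derivative)
  then show ?thesis unfolding dx_def using x by (auto intro!: vector_derivative_within_cbox[of 0 1, simplified])
qed

text \<open>The scheme holds on each cell separately for all test functions, so global polynomials
  suffice for testing: a different one may be taken on each cell, and no cut-off is
  required.\<close>

lemma pol_fe_space: "pol k c \<in> fe_space k N X"
proof -
  have c: "contR 0 1 0 1 (\<lambda>x y. ev k c x y)" "contR 0 1 0 1 (\<lambda>x y. (ev k c x y)\<^sup>2)" by (intro contR)+
  have "in_L2 Omega (pol k c)"
    unfolding in_L2_def set_borel_measurable_def
  proof
    show "(\<lambda>x. indicat_real Omega x *\<^sub>R pol k c x) \<in> borel_measurable lebesgue"
      using lebesgue_open_rectangle(1)[OF c(1), of "pol k c"] unfolding set_integrable_def by (auto dest: borel_measurable_integrable)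
    show "set_integrable lebesgue Omega (\<lambda>z. (pol k c z)\<^sup>2)"
      using lebesgue_open_rectangle(1)[OF c(2), of "\<lambda>z. (pol k c z)\<^sup>2"] by simp
  qed
  then show ?thesis unfolding fe_space_def is_Qk_on_def by (auto simp: ev_def)
qed

context layered
begin

text \<open>\<open>pwc g F\<close>: on the open cell \<open>(i, j)\<close> the function \<open>g\<close> coincides with \<open>F i j\<close>, which is continuous on the closed cell;
  the values of \<open>g\<close> on the mesh lines are arbitrary.\<close>

definition pwc :: "fn2 \<Rightarrow> (nat \<Rightarrow> nat \<Rightarrow> real \<Rightarrow> real \<Rightarrow> real) \<Rightarrow> bool" where
  "pwc g F \<longleftrightarrow> (\<forall>i\<in>{1..N}. \<forall>j\<in>{1..N}. contC i j (F i j) \<and> (\<forall>x\<in>ival X i. \<forall>y\<in>ival X j. g (x, y) = F i j x y))"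

lemma pwcD:
  assumes "pwc g F" "i \<in> {1..N}" "j \<in> {1..N}"
  shows "contC i j (F i j)" "x \<in> ival X i \<Longrightarrow> y \<in> ival X j \<Longrightarrow> g (x, y) = F i j x y"
  using assms unfolding pwc_def by blast+

lemma pwc_flip: "pwc g F \<Longrightarrow> pwc (flip g) (swapf F)"
  unfolding pwc_def swapf_def by (auto intro: contR_swap)

lemma pwc_diff: "pwc f F \<Longrightarrow> pwc g G \<Longrightarrow> pwc (\<lambda>z. f z - g z) (\<lambda>i j x y. F i j x y - G i j x y)"
  unfolding pwc_def by (auto intro!: contR)

lemma pwc_pol: "pwc (pol k c) (\<lambda>i j. ev k c)"
  unfolding pwc_def by (auto intro: contR)

lemma inner_cell:
  assumes ij: "i \<in> {1..N}" "j \<in> {1..N}" and F: "contC i j F"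
    and g: "\<And>x y. x \<in> ival X i \<Longrightarrow> y \<in> ival X j \<Longrightarrow> g (x, y) * h (x, y) = F x y"
  shows "l2_inner (cell X i j) g h = I2c i j F"
  using lebesgue_open_rectangle(2)[OF F, of "\<lambda>z. g z * h z"] g unfolding l2_inner_def cell_def ival_def by blast

lemma inner_ival:
  assumes F: "continuous_on {X (j - 1)..X j} F" and g: "\<And>y. y \<in> ival X j \<Longrightarrow> g y * h y = F y"
  shows "l2_inner (ival X j) g h = integral {X (j - 1)..X j} F"
  using lebesgue_open_interval[OF F, of "\<lambda>z. g z * h z"] g unfolding l2_inner_def ival_def by blast

text \<open>Inside the row and close to the node, \<open>g\<close> agrees with a function continuous
  up to the node, so the one-sided limit exists and is the value of that function.\<close>

lemma traces:
  assumes F: "pwc g F" and j: "j \<in> {1..N}" and y: "y \<in> ival X j"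
  shows "i \<in> {1..N} \<Longrightarrow> trxm X g i y = F i j (X i) y" "i < N \<Longrightarrow> trxp X g i y = F (Suc i) j (X i) y"
proof -
  have y': "y \<in> {X (j - 1)..X j}" using y by (auto simp: ival_def)
  have c: "continuous_on {X (i - 1)..X i} (\<lambda>x. F i j x y)" if "i \<in> {1..N}" for i
    by (rule contR_x[OF pwcD(1)[OF F that j] y'])
  show "trxm X g i y = F i j (X i) y" if i: "i \<in> {1..N}"
    unfolding trxm_def
  proof (rule tendsto_Lim)
    have "((\<lambda>x. F i j x y) \<longlongrightarrow> F i j (X i) y) (at (X i) within {X (i - 1)..X i})"
      using c[OF i] X_less[OF i] by (auto simp: continuous_on_def)
    then have "((\<lambda>x. F i j x y) \<longlongrightarrow> F i j (X i) y) (at_left (X i))" by (simp only: at_within_Icc_at_left[OF X_less[OF i]])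
    moreover have "eventually (\<lambda>x. F i j x y = g (x, y)) (at_left (X i))"
      unfolding eventually_at_left_field using X_less[OF i] pwcD(2)[OF F i j _ y] by (auto simp: ival_def intro!: exI[of _ "X (i - 1)"])
    ultimately show "((\<lambda>x. g (x, y)) \<longlongrightarrow> F i j (X i) y) (at_left (X i))" by (rule Lim_transform_eventually)
  qed simp
  show "trxp X g i y = F (Suc i) j (X i) y" if i: "i < N"
    unfolding trxp_def
  proof (rule tendsto_Lim)
    have i': "Suc i \<in> {1..N}" using i by simp
    have lt: "X i < X (Suc i)" using X_less[OF i'] by simp
    have "((\<lambda>x. F (Suc i) j x y) \<longlongrightarrow> F (Suc i) j (X i) y) (at (X i) within {X i..X (Suc i)})"
      using c[OF i'] lt by (auto simp: continuous_on_def)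
    then have "((\<lambda>x. F (Suc i) j x y) \<longlongrightarrow> F (Suc i) j (X i) y) (at_right (X i))" by (simp only: at_within_Icc_at_right[OF lt])
    moreover have "eventually (\<lambda>x. F (Suc i) j x y = g (x, y)) (at_right (X i))"
      unfolding eventually_at_right_field using lt pwcD(2)[OF F i' j _ y] by (auto simp: ival_def intro!: exI[of _ "X (Suc i)"])
    ultimately show "((\<lambda>x. g (x, y)) \<longlongrightarrow> F (Suc i) j (X i) y) (at_right (X i))" by (rule Lim_transform_eventually)
  qed simp
qed

lemma fluxes:
  assumes U: "pwc U Au" and P: "pwc P Ap" and j: "j \<in> {1..N}" and y: "y \<in> ival X j" and i: "i \<le> N"
  shows "fluxUx \<epsilon> N X U P i y = uflux N m (1 / se) X (\<lambda>i x. Au i j x y) (\<lambda>i x. Ap i j x y) i"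
    and "fluxPx \<epsilon> N X U P i y = pflux N se X (\<lambda>i x. Au i j x y) (\<lambda>i x. Ap i j x y) i"
proof -
  note U' = traces[OF U j y] and P' = traces[OF P j y]
  have z: "i = 0 \<or> i = N \<or> (i \<in> {1..N} \<and> i < N)" using i by auto
  show "fluxUx \<epsilon> N X U P i y = uflux N m (1 / se) X (\<lambda>i x. Au i j x y) (\<lambda>i x. Ap i j x y) i"
    using z index_order U'[of i] P'[of i] unfolding fluxUx_def uflux_def lam_tr_def jumpx_def se_def[symmetric] m_def[symmetric] by auto
  show "fluxPx \<epsilon> N X U P i y = pflux N se X (\<lambda>i x. Au i j x y) (\<lambda>i x. Ap i j x y) i"
    using z index_order U'[of i] P'[of i] U'(2)[of 0] U'(1)[of N] P'(2)[of 0] P'(1)[of N] unfolding fluxPx_def pflux_def lam_bd_def se_def[symmetric] by auto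
qed

lemma cell_form:
  assumes U: "pwc U Au" and P: "pwc P Ap" and i: "i \<in> {1..N}" and j: "j \<in> {1..N}"
  shows "l2_inner (cell X i j) U (dx (pol k s')) - l2_inner (ival X j) (fluxUx \<epsilon> N X U P i) (trxm X (pol k s') i)
      + l2_inner (ival X j) (fluxUx \<epsilon> N X U P (i - 1)) (trxp X (pol k s') (i - 1))
      + (l2_inner (cell X i j) P (dx (pol k v')) - l2_inner (ival X j) (fluxPx \<epsilon> N X U P i) (trxm X (pol k v') i)
      + l2_inner (ival X j) (fluxPx \<epsilon> N X U P (i - 1)) (trxp X (pol k v') (i - 1)))
      = cellX k N m se (1 / se) X Au Ap s' v' i j"
proof -
  have i': "i - 1 < N" "i \<le> N" "i - 1 \<le> N" "Suc (i - 1) = i" using i by auto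
  have cu: "contC i j (\<lambda>x y. Au i j x y * poly (pderiv (sec k s' y)) x)" "contC i j (\<lambda>x y. Ap i j x y * poly (pderiv (sec k v' y)) x)"
    by (intro contR pwcD(1)[OF U i j] pwcD(1)[OF P i j])+
  have X01: "x \<in> {0..1}" if "x \<in> ival X i" for x using cell_subset[OF i, of x] that by (auto simp: ival_def)
  have 1: "l2_inner (cell X i j) U (dx (pol k s')) = I2c i j (\<lambda>x y. Au i j x y * poly (pderiv (sec k s' y)) x)"
    by (rule inner_cell[OF i j cu(1)]) (simp only: dx_pol X01 pwcD(2)[OF U i j])
  have 2: "l2_inner (cell X i j) P (dx (pol k v')) = I2c i j (\<lambda>x y. Ap i j x y * poly (pderiv (sec k v' y)) x)"
    by (rule inner_cell[OF i j cu(2)]) (simp only: dx_pol X01 pwcD(2)[OF P i j])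
  have fc: "continuous_on {X (j - 1)..X j} (\<lambda>y. uflux N m lt X (\<lambda>i x. Au i j x y) (\<lambda>i x. Ap i j x y) a)"
    "continuous_on {X (j - 1)..X j} (\<lambda>y. pflux N lam X (\<lambda>i x. Au i j x y) (\<lambda>i x. Ap i j x y) a)" if "a \<le> N" for a lt lam
    by (rule flux_continuous[where X = X and eu = "\<lambda>i. Au i j" and ep = "\<lambda>i. Ap i j"]; (rule index_order X_less that pwcD(1)[OF U _ j] pwcD(1)[OF P _ j]; assumption?))+
  have 3: "l2_inner (ival X j) (fluxUx \<epsilon> N X U P i) (trxm X (pol k s') i)
      = integral {X (j - 1)..X j} (\<lambda>y. uflux N m (1 / se) X (\<lambda>i x. Au i j x y) (\<lambda>i x. Ap i j x y) i * ev k s' (X i) y)"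
    by (intro inner_ival continuous_on_mult fc ev_continuous_y i') (simp only: fluxes(1)[OF U P j _ i'(2)] traces(1)[OF pwc_pol j _ i])
  have 4: "l2_inner (ival X j) (fluxPx \<epsilon> N X U P i) (trxm X (pol k v') i)
      = integral {X (j - 1)..X j} (\<lambda>y. pflux N se X (\<lambda>i x. Au i j x y) (\<lambda>i x. Ap i j x y) i * ev k v' (X i) y)"
    by (intro inner_ival continuous_on_mult fc ev_continuous_y i') (simp only: fluxes(2)[OF U P j _ i'(2)] traces(1)[OF pwc_pol j _ i])
  have 5: "l2_inner (ival X j) (fluxUx \<epsilon> N X U P (i - 1)) (trxp X (pol k s') (i - 1))
      = integral {X (j - 1)..X j} (\<lambda>y. uflux N m (1 / se) X (\<lambda>i x. Au i j x y) (\<lambda>i x. Ap i j x y) (i - 1) * ev k s' (X (i - 1)) y)"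
    by (intro inner_ival continuous_on_mult fc ev_continuous_y i') (simp only: fluxes(1)[OF U P j _ i'(3)] traces(2)[OF pwc_pol j _ i'(1)])
  have 6: "l2_inner (ival X j) (fluxPx \<epsilon> N X U P (i - 1)) (trxp X (pol k v') (i - 1))
      = integral {X (j - 1)..X j} (\<lambda>y. pflux N se X (\<lambda>i x. Au i j x y) (\<lambda>i x. Ap i j x y) (i - 1) * ev k v' (X (i - 1)) y)"
    by (intro inner_ival continuous_on_mult fc ev_continuous_y i') (simp only: fluxes(2)[OF U P j _ i'(3)] traces(2)[OF pwc_pol j _ i'(1)])
  show ?thesis unfolding 1 2 3 4 5 6 cellX_def I2_add[OF cu] by simp
qed

lemma flip_inner_cell:
  assumes U: "pwc U Au" and i: "i \<in> {1..N}" and j: "j \<in> {1..N}"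
  shows "l2_inner (cell X j i) (flip U) (dx (flip (pol k r'))) = l2_inner (cell X i j) U (dy (pol k r'))"
proof -
  have c: "contC i j (\<lambda>x y. Au i j x y * poly (pderiv (sec k (transp r') x)) y)"
    using contR_swap[of "X (j - 1)" "X j" "X (i - 1)" "X i" "\<lambda>y x. poly (pderiv (sec k (transp r') x)) y"] pwcD(1)[OF U i j]
    by (intro contR) (auto intro: contR)
  have X01: "x \<in> {0..1}" if "x \<in> ival X j" for x using cell_subset[OF j, of x] that by (auto simp: ival_def)
  have "l2_inner (cell X i j) U (dy (pol k r')) = I2c i j (\<lambda>x y. Au i j x y * poly (pderiv (sec k (transp r') x)) y)"
    by (rule inner_cell[OF i j c]) (simp only: flip_translations flip_simps flip_pol dx_pol X01 pwcD(2)[OF U i j])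
  moreover have "l2_inner (cell X j i) (flip U) (dx (flip (pol k r'))) = I2c j i (\<lambda>y x. Au i j x y * poly (pderiv (sec k (transp r') x)) y)"
    by (rule inner_cell[OF j i contR_swap[OF c]]) (simp only: flip_translations flip_simps flip_pol dx_pol X01 pwcD(2)[OF U i j])
  ultimately show ?thesis using I2_swap[OF c] by simp
qed

lemma cellX_diff:
  assumes U: "pwc U' Au" "pwc U2 Bu" and P: "pwc P' Ap" "pwc P2 Bp" and i: "i \<in> {1..N}" and j: "j \<in> {1..N}"
  shows "cellX k N m lam lt X (\<lambda>i j x y. Au i j x y - Bu i j x y) (\<lambda>i j x y. Ap i j x y - Bp i j x y) s' v' i j
     = cellX k N m lam lt X Au Ap s' v' i j - cellX k N m lam lt X Bu Bp s' v' i j"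
proof -
  have i': "i \<le> N" "i - 1 \<le> N" using i by auto
  have uf: "uflux N m lt X (\<lambda>i x. Au i j x y - Bu i j x y) (\<lambda>i x. Ap i j x y - Bp i j x y) a
      = uflux N m lt X (\<lambda>i x. Au i j x y) (\<lambda>i x. Ap i j x y) a - uflux N m lt X (\<lambda>i x. Bu i j x y) (\<lambda>i x. Bp i j x y) a" for a y
    by (simp add: uflux_def algebra_simps)
  have pf: "pflux N lam X (\<lambda>i x. Au i j x y - Bu i j x y) (\<lambda>i x. Ap i j x y - Bp i j x y) a
      = pflux N lam X (\<lambda>i x. Au i j x y) (\<lambda>i x. Ap i j x y) a - pflux N lam X (\<lambda>i x. Bu i j x y) (\<lambda>i x. Bp i j x y) a" for a y
    by (simp add: pflux_def algebra_simps)
  have fc: "continuous_on {X (j - 1)..X j} (\<lambda>y. uflux N m lt X (\<lambda>i x. Fu i j x y) (\<lambda>i x. Fp i j x y) a)"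
    "continuous_on {X (j - 1)..X j} (\<lambda>y. pflux N lam X (\<lambda>i x. Fu i j x y) (\<lambda>i x. Fp i j x y) a)" if "a \<le> N" "pwc g Fu" "pwc h Fp" for a g h Fu Fp
    by (rule flux_continuous[where X = X and eu = "\<lambda>i. Fu i j" and ep = "\<lambda>i. Fp i j"]; (rule index_order X_less that(1) pwcD(1)[OF that(2) _ j] pwcD(1)[OF that(3) _ j]; assumption?))+
  have int: "integral {X (j - 1)..X j} (\<lambda>y. (A y - B y) * C y) = integral {X (j - 1)..X j} (\<lambda>y. A y * C y) - integral {X (j - 1)..X j} (\<lambda>y. B y * C y)"
    if "continuous_on {X (j - 1)..X j} A" "continuous_on {X (j - 1)..X j} B" "continuous_on {X (j - 1)..X j} C" for A B C :: "real \<Rightarrow> real"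
    unfolding left_diff_distrib by (intro integral_diff integrable_continuous_interval continuous_on_mult that)
  have I: "I2c i j (\<lambda>x y. (Au i j x y - Bu i j x y) * poly (pderiv (sec k s' y)) x + (Ap i j x y - Bp i j x y) * poly (pderiv (sec k v' y)) x)
      = I2c i j (\<lambda>x y. Au i j x y * poly (pderiv (sec k s' y)) x + Ap i j x y * poly (pderiv (sec k v' y)) x)
        - I2c i j (\<lambda>x y. Bu i j x y * poly (pderiv (sec k s' y)) x + Bp i j x y * poly (pderiv (sec k v' y)) x)"
  proof -
    have "(\<lambda>x y. (Au i j x y - Bu i j x y) * poly (pderiv (sec k s' y)) x + (Ap i j x y - Bp i j x y) * poly (pderiv (sec k v' y)) x)
      = (\<lambda>x y. (Au i j x y * poly (pderiv (sec k s' y)) x + Ap i j x y * poly (pderiv (sec k v' y)) x) - (Bu i j x y * poly (pderiv (sec k s' y)) x + Bp i j x y * poly (pderiv (sec k v' y)) x))"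
      by (simp add: fun_eq_iff algebra_simps)
    then show ?thesis by (simp only:) (intro I2_diff contR pwcD(1)[OF U(1) i j] pwcD(1)[OF U(2) i j] pwcD(1)[OF P(1) i j] pwcD(1)[OF P(2) i j])
  qed
  show ?thesis unfolding cellX_def uf pf I
    int[OF fc(1)[OF i'(1) U(1) P(1)] fc(1)[OF i'(1) U(2) P(2)] ev_continuous_y] int[OF fc(1)[OF i'(2) U(1) P(1)] fc(1)[OF i'(2) U(2) P(2)] ev_continuous_y]
    int[OF fc(2)[OF i'(1) U(1) P(1)] fc(2)[OF i'(1) U(2) P(2)] ev_continuous_y] int[OF fc(2)[OF i'(2) U(1) P(1)] fc(2)[OF i'(2) U(2) P(2)] ev_continuous_y]
    by simp
qed

text \<open>Consistency of the fluxes: for the continuous solution the jump vanishes, the zero flux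
  of \<open>u\<close> agrees with the boundary condition, and the boundary penalty is multiplied by
  0. Integration by parts on the cell then cancels all edge terms.\<close>

lemma exact_cell:
  assumes F: "smooth_family (k + 2) F" and bc: "\<And>t. t \<in> {0..1} \<Longrightarrow> F 0 0 0 t = 0" "\<And>t. t \<in> {0..1} \<Longrightarrow> F 0 0 1 t = 0"
    and i: "i \<in> {1..N}" and j: "j \<in> {1..N}"
  shows "cellX k N m se lt X (\<lambda>i j. F 0 0) (\<lambda>i j x y. \<epsilon> * F 1 0 x y) s' v' i j
    = - I2c i j (\<lambda>x y. F 1 0 x y * ev k s' x y) - \<epsilon> * I2c i j (\<lambda>x y. F 2 0 x y * ev k v' x y)"
proof -
  have c: "contC i j (F a 0)" if "a \<le> 2" for a using family_contC[OF F _ _ i j, of a 0] that k by auto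
  have yX: "y \<in> {0..1}" if "y \<in> {X (j - 1)..X j}" for y using cell_subset[OF j that] .
  have uf: "uflux N m lt X (\<lambda>i x. F 0 0 x y) (\<lambda>i x. \<epsilon> * F 1 0 x y) a = F 0 0 (X a) y" if "y \<in> {X (j - 1)..X j}" for a y
    using bc yX[OF that] X_special by (auto simp: uflux_def)
  have pf: "pflux N se X (\<lambda>i x. F 0 0 x y) (\<lambda>i x. \<epsilon> * F 1 0 x y) a = \<epsilon> * F 1 0 (X a) y" if "y \<in> {X (j - 1)..X j}" for a y
    using bc yX[OF that] X_special by (auto simp: pflux_def)
  let ?I = "integral {X (j - 1)..X j}"
  have f: "?I (\<lambda>y. uflux N m lt X (\<lambda>i x. F 0 0 x y) (\<lambda>i x. \<epsilon> * F 1 0 x y) a * ev k s' (X a) y) = ?I (\<lambda>y. F 0 0 (X a) y * ev k s' (X a) y)"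
    "?I (\<lambda>y. pflux N se X (\<lambda>i x. F 0 0 x y) (\<lambda>i x. \<epsilon> * F 1 0 x y) a * ev k v' (X a) y) = ?I (\<lambda>y. \<epsilon> * F 1 0 (X a) y * ev k v' (X a) y)" for a
    by (intro integral_cong; simp only: uf pf)+
  have ce: "continuous_on {X (j - 1)..X j} (F a 0 (X b))" if "a \<le> 2" "b \<in> {i - 1, i}" for a b
    using contR_y[OF c[OF that(1)], of "X b"] X_less[OF i] that(2) by auto
  have parts: "integral {X (i - 1)..X i} (\<lambda>x. F a 0 x y * poly (pderiv p) x) = F a 0 (X i) y * poly p (X i) - F a 0 (X (i - 1)) y * poly p (X (i - 1))
      - integral {X (i - 1)..X i} (\<lambda>x. F (Suc a) 0 x y * poly p x)" if "y \<in> {X (j - 1)..X j}" "a \<le> 1" for a y p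
  proof (rule integral_by_parts_poly)
    show "X (i - 1) \<le> X i" using X_less[OF i] by simp
    show "continuous_on {X (i - 1)..X i} (\<lambda>x. F (Suc a) 0 x y)" using contR_x[OF c that(1)] that(2) by simp
    show "((\<lambda>x. F a 0 x y) has_real_derivative F (Suc a) 0 x y) (at x within {X (i - 1)..X i})" if "x \<in> {X (i - 1)..X i}" for x
      using DERIV_subset[OF smooth_familyD(2)[OF F, of a 0 x y] cell_subset'[OF i]] yX[OF \<open>y \<in> _\<close>] cell_subset[OF i that] \<open>a \<le> 1\<close> by simp
  qed
  have "I2c i j (\<lambda>x y. F 0 0 x y * poly (pderiv (sec k s' y)) x + \<epsilon> * F 1 0 x y * poly (pderiv (sec k v' y)) x)
     = ?I (\<lambda>y. (F 0 0 (X i) y * ev k s' (X i) y - F 0 0 (X (i - 1)) y * ev k s' (X (i - 1)) y - integral {X (i - 1)..X i} (\<lambda>x. F 1 0 x y * ev k s' x y))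
        + (\<epsilon> * F 1 0 (X i) y * ev k v' (X i) y - \<epsilon> * F 1 0 (X (i - 1)) y * ev k v' (X (i - 1)) y - \<epsilon> * integral {X (i - 1)..X i} (\<lambda>x. F 2 0 x y * ev k v' x y)))"
    unfolding I2_def
  proof (intro integral_cong)
    fix y assume y: "y \<in> {X (j - 1)..X j}"
    have ca: "continuous_on {X (i - 1)..X i} (\<lambda>x. F 0 0 x y * poly (pderiv (sec k s' y)) x)" "continuous_on {X (i - 1)..X i} (\<lambda>x. F 1 0 x y * poly (pderiv (sec k v' y)) x)"
      by (intro continuous_intros contR_x[OF c y]; simp)+
    have "integral {X (i - 1)..X i} (\<lambda>x. F 0 0 x y * poly (pderiv (sec k s' y)) x + \<epsilon> * F 1 0 x y * poly (pderiv (sec k v' y)) x)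
      = integral {X (i - 1)..X i} (\<lambda>x. F 0 0 x y * poly (pderiv (sec k s' y)) x) + integral {X (i - 1)..X i} (\<lambda>x. \<epsilon> * (F 1 0 x y * poly (pderiv (sec k v' y)) x))"
      unfolding mult.assoc by (intro integral_add integrable_continuous_interval ca continuous_on_mult_left)
    also have "\<dots> = integral {X (i - 1)..X i} (\<lambda>x. F 0 0 x y * poly (pderiv (sec k s' y)) x) + \<epsilon> * integral {X (i - 1)..X i} (\<lambda>x. F 1 0 x y * poly (pderiv (sec k v' y)) x)"
      by simp
    finally show "integral {X (i - 1)..X i} (\<lambda>x. F 0 0 x y * poly (pderiv (sec k s' y)) x + \<epsilon> * F 1 0 x y * poly (pderiv (sec k v' y)) x)
     = (F 0 0 (X i) y * ev k s' (X i) y - F 0 0 (X (i - 1)) y * ev k s' (X (i - 1)) y - integral {X (i - 1)..X i} (\<lambda>x. F 1 0 x y * ev k s' x y))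
        + (\<epsilon> * F 1 0 (X i) y * ev k v' (X i) y - \<epsilon> * F 1 0 (X (i - 1)) y * ev k v' (X (i - 1)) y - \<epsilon> * integral {X (i - 1)..X i} (\<lambda>x. F 2 0 x y * ev k v' x y))"
      unfolding parts[OF y le0] parts[OF y order.refl] poly_sec by (simp add: right_diff_distrib numeral_2_eq_2)
  qed
  also have "\<dots> = (?I (\<lambda>y. F 0 0 (X i) y * ev k s' (X i) y) - ?I (\<lambda>y. F 0 0 (X (i - 1)) y * ev k s' (X (i - 1)) y) - I2c i j (\<lambda>x y. F 1 0 x y * ev k s' x y))
        + (?I (\<lambda>y. \<epsilon> * F 1 0 (X i) y * ev k v' (X i) y) - ?I (\<lambda>y. \<epsilon> * F 1 0 (X (i - 1)) y * ev k v' (X (i - 1)) y) - \<epsilon> * I2c i j (\<lambda>x y. F 2 0 x y * ev k v' x y))"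
    unfolding I2_def
    by (intro integral_unique has_integral_add has_integral_diff has_integral_mult_right integrable_integral integrable_continuous_interval
        contR_inner contR c continuous_intros ce ev_continuous_y; simp)
  finally show ?thesis unfolding cellX_def f by simp
qed

lemma pwc_family:
  assumes "smooth_family (k + 2) F" "a \<le> k + 2" "b \<le> k + 2"
  shows "pwc (\<lambda>(x, y). F a b x y) (\<lambda>i j. F a b)"
  unfolding pwc_def using family_contC[OF assms] by auto

lemma pwc_cmult: "pwc g G \<Longrightarrow> pwc (\<lambda>z. r * g z) (\<lambda>i j x y. r * G i j x y)"
  unfolding pwc_def by (auto intro!: contR)

lemma pwc_eru: "pwc (\<lambda>z. (case z of (x, y) \<Rightarrow> u 0 0 x y) - U z) (eru Uc)"
  if "pwc U (\<lambda>i j. ev k (Uc i j))"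
  using pwc_diff[OF pwc_family[OF sm(7)] that, of 0 0] by (simp add: eru_def[abs_def])

lemma discrete_equation:
  assumes bb: "contR 0 1 0 1 (\<lambda>x y. b (x, y))"
    and sol: "ldg_solution k N X \<epsilon> b f U P Q"
    and pde: "\<And>x y. x \<in> {0<..<1} \<Longrightarrow> y \<in> {0<..<1} \<Longrightarrow> f (x, y) = - \<epsilon> * (u 2 0 x y + u 0 2 x y) + b (x, y) * u 0 0 x y"
    and U: "pwc U (\<lambda>i j. ev k (Uc i j))" and P: "pwc P (\<lambda>i j. ev k (Pc i j))" and Q: "pwc Q (\<lambda>i j. ev k (Qc i j))"
    and i: "i \<in> {1..N}" and j: "j \<in> {1..N}"
  shows "1 / \<epsilon> * I2c i j (\<lambda>x y. ev k (Pc i j) x y * ev k s' x y) + 1 / \<epsilon> * I2c i j (\<lambda>x y. ev k (Qc i j) x y * ev k r' x y)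
      + I2c i j (\<lambda>x y. b (x, y) * ev k (Uc i j) x y * ev k v' x y)
      + cellX k N m se (1 / se) X (\<lambda>i j. ev k (Uc i j)) (\<lambda>i j. ev k (Pc i j)) s' v' i j
      + cellX k N m se (1 / se) X (swapf (\<lambda>i j. ev k (Uc i j))) (swapf (\<lambda>i j. ev k (Qc i j))) (transp r') (transp v') j i
     = I2c i j (\<lambda>x y. (- \<epsilon> * (u 2 0 x y + u 0 2 x y) + b (x, y) * u 0 0 x y) * ev k v' x y)"
proof -
  have bij: "contC i j (\<lambda>x y. b (x, y))"
    using continuous_on_subset[OF bb[unfolded contR_def], of "{X (i - 1)..X i} \<times> {X (j - 1)..X j}"] cell_subset'[OF i] cell_subset'[OF j]
    unfolding contR_def by blast
  have cu: "contC i j (u c d)" if "c \<le> 2" "d \<le> 2" for c d using family_contC[OF sm(7) _ _ i j, of c d] that by simp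
  have "(1 / \<epsilon>) * l2_inner (cell X i j) P (pol k s') + l2_inner (cell X i j) U (dx (pol k s'))
         - l2_inner (ival X j) (fluxUx \<epsilon> N X U P i) (trxm X (pol k s') i)
         + l2_inner (ival X j) (fluxUx \<epsilon> N X U P (i - 1)) (trxp X (pol k s') (i - 1)) = 0 \<and>
       (1 / \<epsilon>) * l2_inner (cell X i j) Q (pol k r') + l2_inner (cell X i j) U (dy (pol k r'))
         - l2_inner (ival X i) (fluxUy \<epsilon> N X U Q j) (trym X (pol k r') j)
         + l2_inner (ival X i) (fluxUy \<epsilon> N X U Q (j - 1)) (tryp X (pol k r') (j - 1)) = 0 \<and>
       l2_inner (cell X i j) P (dx (pol k v'))
         - l2_inner (ival X j) (fluxPx \<epsilon> N X U P i) (trxm X (pol k v') i)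
         + l2_inner (ival X j) (fluxPx \<epsilon> N X U P (i - 1)) (trxp X (pol k v') (i - 1))
         + l2_inner (cell X i j) Q (dy (pol k v'))
         - l2_inner (ival X i) (fluxQy \<epsilon> N X U Q j) (trym X (pol k v') j)
         + l2_inner (ival X i) (fluxQy \<epsilon> N X U Q (j - 1)) (tryp X (pol k v') (j - 1))
         + l2_inner (cell X i j) (\<lambda>z. b z * U z) (pol k v')
         = l2_inner (cell X i j) f (pol k v')"
    using sol i j pol_fe_space unfolding ldg_solution_def by blast
  note eqs = this[unfolded flip_translations(1-5)]
  have x: "l2_inner (cell X i j) U (dx (pol k s')) - l2_inner (ival X j) (fluxUx \<epsilon> N X U P i) (trxm X (pol k s') i)
      + l2_inner (ival X j) (fluxUx \<epsilon> N X U P (i - 1)) (trxp X (pol k s') (i - 1))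
      + (l2_inner (cell X i j) P (dx (pol k v')) - l2_inner (ival X j) (fluxPx \<epsilon> N X U P i) (trxm X (pol k v') i)
      + l2_inner (ival X j) (fluxPx \<epsilon> N X U P (i - 1)) (trxp X (pol k v') (i - 1)))
      = cellX k N m se (1 / se) X (\<lambda>i j. ev k (Uc i j)) (\<lambda>i j. ev k (Pc i j)) s' v' i j" by (rule cell_form[OF U P i j])
  have y: "l2_inner (cell X i j) U (dy (pol k r')) - l2_inner (ival X i) (fluxUx \<epsilon> N X (flip U) (flip Q) j) (trxm X (flip (pol k r')) j)
      + l2_inner (ival X i) (fluxUx \<epsilon> N X (flip U) (flip Q) (j - 1)) (trxp X (flip (pol k r')) (j - 1))
      + (l2_inner (cell X i j) Q (dy (pol k v')) - l2_inner (ival X i) (fluxPx \<epsilon> N X (flip U) (flip Q) j) (trxm X (flip (pol k v')) j)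
      + l2_inner (ival X i) (fluxPx \<epsilon> N X (flip U) (flip Q) (j - 1)) (trxp X (flip (pol k v')) (j - 1)))
      = cellX k N m se (1 / se) X (swapf (\<lambda>i j. ev k (Uc i j))) (swapf (\<lambda>i j. ev k (Qc i j))) (transp r') (transp v') j i"
    using cell_form[OF pwc_flip[OF U] pwc_flip[OF Q] j i, of "transp r'" "transp v'"]
    unfolding flip_pol[symmetric] flip_inner_cell[OF U i j] flip_inner_cell[OF Q i j] .
  have 1: "l2_inner (cell X i j) P (pol k s') = I2c i j (\<lambda>x y. ev k (Pc i j) x y * ev k s' x y)"
    by (rule inner_cell[OF i j]) (auto intro: contR simp: pwcD(2)[OF P i j])
  have 2: "l2_inner (cell X i j) Q (pol k r') = I2c i j (\<lambda>x y. ev k (Qc i j) x y * ev k r' x y)"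
    by (rule inner_cell[OF i j]) (auto intro: contR simp: pwcD(2)[OF Q i j])
  have 3: "l2_inner (cell X i j) (\<lambda>z. b z * U z) (pol k v') = I2c i j (\<lambda>x y. b (x, y) * ev k (Uc i j) x y * ev k v' x y)"
  proof (rule inner_cell[OF i j])
    show "contC i j (\<lambda>x y. b (x, y) * ev k (Uc i j) x y * ev k v' x y)" by (intro contR bij)
  qed (simp add: pwcD(2)[OF U i j])
  have 4: "l2_inner (cell X i j) f (pol k v') = I2c i j (\<lambda>x y. (- \<epsilon> * (u 2 0 x y + u 0 2 x y) + b (x, y) * u 0 0 x y) * ev k v' x y)"
  proof (rule inner_cell[OF i j])
    show "contC i j (\<lambda>x y. (- \<epsilon> * (u 2 0 x y + u 0 2 x y) + b (x, y) * u 0 0 x y) * ev k v' x y)" by (intro contR bij cu) simp_all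
    fix x y assume xy: "x \<in> ival X i" "y \<in> ival X j"
    have "0 \<le> X (i - 1)" "X i \<le> 1" "0 \<le> X (j - 1)" "X j \<le> 1" using X_range[of "i - 1"] X_range[of i] X_range[of "j - 1"] X_range[of j] i j by auto
    then have "x \<in> {0<..<1}" "y \<in> {0<..<1}" using xy by (auto simp: ival_def)
    then show "f (x, y) * pol k v' (x, y) = (- \<epsilon> * (u 2 0 x y + u 0 2 x y) + b (x, y) * u 0 0 x y) * ev k v' x y" using pde[of x y] by simp
  qed
  show ?thesis using eqs x y unfolding 1 2 3 4 by argo
qed

lemma exact_equation:
  assumes bb: "contR 0 1 0 1 (\<lambda>x y. b (x, y))"
    and bc: "\<And>t. t \<in> {0..1} \<Longrightarrow> u 0 0 0 t = 0" "\<And>t. t \<in> {0..1} \<Longrightarrow> u 0 0 1 t = 0"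
      "\<And>t. t \<in> {0..1} \<Longrightarrow> u 0 0 t 0 = 0" "\<And>t. t \<in> {0..1} \<Longrightarrow> u 0 0 t 1 = 0"
    and i: "i \<in> {1..N}" and j: "j \<in> {1..N}"
  shows "1 / \<epsilon> * I2c i j (\<lambda>x y. \<epsilon> * u 1 0 x y * ev k s' x y) + 1 / \<epsilon> * I2c i j (\<lambda>x y. \<epsilon> * u 0 1 x y * ev k r' x y)
      + I2c i j (\<lambda>x y. b (x, y) * u 0 0 x y * ev k v' x y)
      + cellX k N m se (1 / se) X (\<lambda>i j. u 0 0) (\<lambda>i j x y. \<epsilon> * u 1 0 x y) s' v' i j
      + cellX k N m se (1 / se) X (swapf (\<lambda>i j. u 0 0)) (swapf (\<lambda>i j x y. \<epsilon> * u 0 1 x y)) (transp r') (transp v') j i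
     = I2c i j (\<lambda>x y. (- \<epsilon> * (u 2 0 x y + u 0 2 x y) + b (x, y) * u 0 0 x y) * ev k v' x y)"
proof -
  have bij: "contC i j (\<lambda>x y. b (x, y))"
    using continuous_on_subset[OF bb[unfolded contR_def], of "{X (i - 1)..X i} \<times> {X (j - 1)..X j}"] cell_subset'[OF i] cell_subset'[OF j]
    unfolding contR_def by blast
  have cu: "contC i j (u c d)" if "c \<le> 2" "d \<le> 2" for c d using family_contC[OF sm(7) _ _ i j, of c d] that by simp
  have sw: "swapf (\<lambda>i j. u 0 0) = (\<lambda>i j. fam_swap u 0 0)" "swapf (\<lambda>i j x y. \<epsilon> * u 0 1 x y) = (\<lambda>i j x y. \<epsilon> * fam_swap u 1 0 x y)"
    by (auto simp: swapf_def fam_swap_def)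
  have y: "cellX k N m se (1 / se) X (swapf (\<lambda>i j. u 0 0)) (swapf (\<lambda>i j x y. \<epsilon> * u 0 1 x y)) (transp r') (transp v') j i
      = - I2c i j (\<lambda>x y. u 0 1 x y * ev k r' x y) - \<epsilon> * I2c i j (\<lambda>x y. u 0 2 x y * ev k v' x y)"
  proof -
    have e: "I2c j i (\<lambda>x y. fam_swap u c 0 x y * ev k (transp q) x y) = I2c i j (\<lambda>x y. u 0 c x y * ev k q x y)" if "c \<le> 2" for c q
    proof -
      have "fam_swap u c 0 x y * ev k (transp q) x y = u 0 c y x * ev k q y x" for x y by (simp add: fam_swap_def ev_transp)
      moreover have "contC i j (\<lambda>x y. u 0 c x y * ev k q x y)" by (intro contR cu that) simp
      ultimately show ?thesis by (simp only: I2_swap)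
    qed
    have b0: "fam_swap u 0 0 0 t = 0" "fam_swap u 0 0 1 t = 0" if "t \<in> {0..1}" for t
      using bc(3,4) that by (auto simp: fam_swap_def)
    have "cellX k N m se (1 / se) X (\<lambda>i j. fam_swap u 0 0) (\<lambda>i j x y. \<epsilon> * fam_swap u 1 0 x y) (transp r') (transp v') j i
      = - I2c j i (\<lambda>x y. fam_swap u 1 0 x y * ev k (transp r') x y) - \<epsilon> * I2c j i (\<lambda>x y. fam_swap u 2 0 x y * ev k (transp v') x y)"
      by (rule exact_cell[OF smooth_family_swap[OF sm(7)] _ _ j i]) (use b0 in auto)
    then show ?thesis unfolding sw e[OF one_le_numeral] e[OF order.refl] .
  qed
  have p: "I2c i j (\<lambda>x y. \<epsilon> * F x y * G x y) = \<epsilon> * I2c i j (\<lambda>x y. F x y * G x y)" for F G :: "real \<Rightarrow> real \<Rightarrow> real"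
    unfolding mult.assoc by (rule I2_cmult)
  have "I2c i j (\<lambda>x y. (- \<epsilon> * (u 2 0 x y + u 0 2 x y) + b (x, y) * u 0 0 x y) * ev k v' x y)
     = I2c i j (\<lambda>x y. b (x, y) * u 0 0 x y * ev k v' x y - (\<epsilon> * (u 2 0 x y * ev k v' x y) + \<epsilon> * (u 0 2 x y * ev k v' x y)))"
    by (intro I2_cong) (simp add: algebra_simps)
  also have "\<dots> = I2c i j (\<lambda>x y. b (x, y) * u 0 0 x y * ev k v' x y) - I2c i j (\<lambda>x y. \<epsilon> * (u 2 0 x y * ev k v' x y) + \<epsilon> * (u 0 2 x y * ev k v' x y))"
    by (intro I2_diff contR bij cu) simp_all
  also have "I2c i j (\<lambda>x y. \<epsilon> * (u 2 0 x y * ev k v' x y) + \<epsilon> * (u 0 2 x y * ev k v' x y)) = I2c i j (\<lambda>x y. \<epsilon> * (u 2 0 x y * ev k v' x y)) + I2c i j (\<lambda>x y. \<epsilon> * (u 0 2 x y * ev k v' x y))"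
    by (intro I2_add contR cu) simp_all
  finally have r: "I2c i j (\<lambda>x y. (- \<epsilon> * (u 2 0 x y + u 0 2 x y) + b (x, y) * u 0 0 x y) * ev k v' x y)
     = I2c i j (\<lambda>x y. b (x, y) * u 0 0 x y * ev k v' x y) - (\<epsilon> * I2c i j (\<lambda>x y. u 2 0 x y * ev k v' x y) + \<epsilon> * I2c i j (\<lambda>x y. u 0 2 x y * ev k v' x y))"
    unfolding I2_cmult .
  have x: "cellX k N m se (1 / se) X (\<lambda>i j. u 0 0) (\<lambda>i j x y. \<epsilon> * u 1 0 x y) s' v' i j
      = - I2c i j (\<lambda>x y. u 1 0 x y * ev k s' x y) - \<epsilon> * I2c i j (\<lambda>x y. u 2 0 x y * ev k v' x y)"
    by (rule exact_cell[OF sm(7) _ _ i j]) (use bc in auto)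
  show ?thesis unfolding x y r p using eps by simp
qed

text \<open>Exact and discrete equation have the same right-hand side, so linearity of
  \<open>cellX\<close> leaves zero. This is the assumption \<open>scheme\<close> of
  \<open>ldg_error\<close>.\<close>

lemma error_equation:
  assumes bb: "contR 0 1 0 1 (\<lambda>x y. b (x, y))"
    and bc: "\<And>t. t \<in> {0..1} \<Longrightarrow> u 0 0 0 t = 0" "\<And>t. t \<in> {0..1} \<Longrightarrow> u 0 0 1 t = 0"
      "\<And>t. t \<in> {0..1} \<Longrightarrow> u 0 0 t 0 = 0" "\<And>t. t \<in> {0..1} \<Longrightarrow> u 0 0 t 1 = 0"
    and sol: "ldg_solution k N X \<epsilon> b f U P Q"
    and pde: "\<And>x y. x \<in> {0<..<1} \<Longrightarrow> y \<in> {0<..<1} \<Longrightarrow> f (x, y) = - \<epsilon> * (u 2 0 x y + u 0 2 x y) + b (x, y) * u 0 0 x y"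
    and U: "pwc U (\<lambda>i j. ev k (Uc i j))" and P: "pwc P (\<lambda>i j. ev k (Pc i j))" and Q: "pwc Q (\<lambda>i j. ev k (Qc i j))"
    and i: "i \<in> {1..N}" and j: "j \<in> {1..N}"
  shows "1 / \<epsilon> * I2c i j (\<lambda>x y. erp Pc i j x y * ev k s' x y) + 1 / \<epsilon> * I2c i j (\<lambda>x y. erq Qc i j x y * ev k r' x y)
      + I2c i j (\<lambda>x y. b (x, y) * eru Uc i j x y * ev k v' x y)
      + cellX k N m se (1 / se) X (eru Uc) (erp Pc) s' v' i j
      + cellX k N m se (1 / se) X (swapf (eru Uc)) (swapf (erq Qc)) (transp r') (transp v') j i = 0"
proof -
  have bij: "contC i j (\<lambda>x y. b (x, y))"
    using continuous_on_subset[OF bb[unfolded contR_def], of "{X (i - 1)..X i} \<times> {X (j - 1)..X j}"] cell_subset'[OF i] cell_subset'[OF j]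
    unfolding contR_def by blast
  have cu: "contC i j (u c d)" if "c \<le> 2" "d \<le> 2" for c d using family_contC[OF sm(7) _ _ i j, of c d] that by simp
  have pu: "pwc (\<lambda>(x, y). u 0 0 x y) (\<lambda>i j. u 0 0)" by (rule pwc_family[OF sm(7)]) simp_all
  have pp: "pwc (\<lambda>z. \<epsilon> * (case z of (x, y) \<Rightarrow> u 1 0 x y)) (\<lambda>i j x y. \<epsilon> * u 1 0 x y)" by (rule pwc_cmult[OF pwc_family[OF sm(7)]]) simp_all
  have pq: "pwc (\<lambda>z. \<epsilon> * (case z of (x, y) \<Rightarrow> u 0 1 x y)) (\<lambda>i j x y. \<epsilon> * u 0 1 x y)" by (rule pwc_cmult[OF pwc_family[OF sm(7)]]) simp_all
  have e: "eru Uc = (\<lambda>i j x y. u 0 0 x y - ev k (Uc i j) x y)" "erp Pc = (\<lambda>i j x y. \<epsilon> * u 1 0 x y - ev k (Pc i j) x y)"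
    "swapf (eru Uc) = (\<lambda>i j x y. swapf (\<lambda>i j. u 0 0) i j x y - swapf (\<lambda>i j. ev k (Uc i j)) i j x y)"
    "swapf (erq Qc) = (\<lambda>i j x y. swapf (\<lambda>i j x y. \<epsilon> * u 0 1 x y) i j x y - swapf (\<lambda>i j. ev k (Qc i j)) i j x y)"
    by (simp_all add: fun_eq_iff eru_def erp_def erq_def swapf_def)
  have 1: "I2c i j (\<lambda>x y. erp Pc i j x y * ev k s' x y) = I2c i j (\<lambda>x y. \<epsilon> * u 1 0 x y * ev k s' x y) - I2c i j (\<lambda>x y. ev k (Pc i j) x y * ev k s' x y)"
    unfolding erp_def left_diff_distrib by (intro I2_diff contR cu) simp_all
  have 2: "I2c i j (\<lambda>x y. erq Qc i j x y * ev k r' x y) = I2c i j (\<lambda>x y. \<epsilon> * u 0 1 x y * ev k r' x y) - I2c i j (\<lambda>x y. ev k (Qc i j) x y * ev k r' x y)"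
    unfolding erq_def left_diff_distrib by (intro I2_diff contR cu) simp_all
  have 3: "I2c i j (\<lambda>x y. b (x, y) * eru Uc i j x y * ev k v' x y) = I2c i j (\<lambda>x y. b (x, y) * u 0 0 x y * ev k v' x y) - I2c i j (\<lambda>x y. b (x, y) * ev k (Uc i j) x y * ev k v' x y)"
    unfolding eru_def left_diff_distrib right_diff_distrib by (intro I2_diff contR cu bij) simp_all
  have de: "1 / \<epsilon> * I2c i j (\<lambda>x y. ev k (Pc i j) x y * ev k s' x y) + 1 / \<epsilon> * I2c i j (\<lambda>x y. ev k (Qc i j) x y * ev k r' x y)
      + I2c i j (\<lambda>x y. b (x, y) * ev k (Uc i j) x y * ev k v' x y)
      + cellX k N m se (1 / se) X (\<lambda>i j. ev k (Uc i j)) (\<lambda>i j. ev k (Pc i j)) s' v' i j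
      + cellX k N m se (1 / se) X (swapf (\<lambda>i j. ev k (Uc i j))) (swapf (\<lambda>i j. ev k (Qc i j))) (transp r') (transp v') j i
     = I2c i j (\<lambda>x y. (- \<epsilon> * (u 2 0 x y + u 0 2 x y) + b (x, y) * u 0 0 x y) * ev k v' x y)"
    by (rule discrete_equation[OF bb sol _ U P Q i j]) (rule pde)
  have ee: "1 / \<epsilon> * I2c i j (\<lambda>x y. \<epsilon> * u 1 0 x y * ev k s' x y) + 1 / \<epsilon> * I2c i j (\<lambda>x y. \<epsilon> * u 0 1 x y * ev k r' x y)
      + I2c i j (\<lambda>x y. b (x, y) * u 0 0 x y * ev k v' x y)
      + cellX k N m se (1 / se) X (\<lambda>i j. u 0 0) (\<lambda>i j x y. \<epsilon> * u 1 0 x y) s' v' i j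
      + cellX k N m se (1 / se) X (swapf (\<lambda>i j. u 0 0)) (swapf (\<lambda>i j x y. \<epsilon> * u 0 1 x y)) (transp r') (transp v') j i
     = I2c i j (\<lambda>x y. (- \<epsilon> * (u 2 0 x y + u 0 2 x y) + b (x, y) * u 0 0 x y) * ev k v' x y)"
    by (rule exact_equation[OF bb _ _ _ _ i j]) (use bc in auto)
  show ?thesis
    unfolding 1 2 3 e(3,4) cellX_diff[OF pwc_flip[OF pu] pwc_flip[OF U] pwc_flip[OF pq] pwc_flip[OF Q] j i]
    unfolding e(1,2) cellX_diff[OF pu U pp P i j]
    using de ee unfolding right_diff_distrib by argo
qed

end

subsection \<open>The norms of the error\<close>

definition pdf :: "fn2 \<Rightarrow> family" where
  "pdf g = (\<lambda>i j x y. pd i j g (x, y))"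

lemma smooth_family_pdf: "derivs_bounded n g B \<Longrightarrow> smooth_family n (pdf g)"
proof -
  assume "derivs_bounded n g B"
  then have s: "\<forall>(i, j)\<in>{..n} \<times> {..n}. continuous_on cl_Omega (pd i j g) \<and>
     (\<forall>(x, y)\<in>cl_Omega.
       ((Suc i, j) \<in> {..n} \<times> {..n} \<longrightarrow> ((\<lambda>\<xi>. pd i j g (\<xi>, y)) has_real_derivative pd (Suc i) j g (x, y)) (at x within {0..1})) \<and>
       ((i, Suc j) \<in> {..n} \<times> {..n} \<longrightarrow> ((\<lambda>\<eta>. pd i j g (x, \<eta>)) has_real_derivative pd i (Suc j) g (x, y)) (at y within {0..1})))"
    unfolding derivs_bounded_def smooth_on_def by blast
  show ?thesis unfolding smooth_family_def pdf_def case_prod_eta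
  proof (intro allI impI conjI ballI)
    fix i j assume ij: "i \<le> n" "j \<le> n"
    then have a: "(i, j) \<in> {..n} \<times> {..n}" by simp
    show "continuous_on cl_Omega (pd i j g)" using s a by blast
    fix x y :: real assume "x \<in> {0..1}" "y \<in> {0..1}"
    then have xy: "(x, y) \<in> cl_Omega" by simp
    have d: "((Suc i, j) \<in> {..n} \<times> {..n} \<longrightarrow> ((\<lambda>\<xi>. pd i j g (\<xi>, y)) has_real_derivative pd (Suc i) j g (x, y)) (at x within {0..1}))"
       "((i, Suc j) \<in> {..n} \<times> {..n} \<longrightarrow> ((\<lambda>\<eta>. pd i j g (x, \<eta>)) has_real_derivative pd i (Suc j) g (x, y)) (at y within {0..1}))"
      using s a xy by blast+
    show "((\<lambda>x. pd i j g (x, y)) has_real_derivative pd (Suc i) j g (x, y)) (at x within {0..1})" if "i < n" using d(1) ij that by simp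
    show "((\<lambda>y. pd i j g (x, y)) has_real_derivative pd i (Suc j) g (x, y)) (at y within {0..1})" if "j < n" using d(2) ij that by simp
  qed
qed

lemma pdf_bound: "derivs_bounded n g B \<Longrightarrow> i \<le> n \<Longrightarrow> j \<le> n \<Longrightarrow> x \<in> {0..1} \<Longrightarrow> y \<in> {0..1} \<Longrightarrow> \<bar>pdf g i j x y\<bar> \<le> B i j x y"
  unfolding derivs_bounded_def pdf_def by blast

text \<open>Smoothness on the closed square is given for the parts of the decomposition and not for
  \<open>u\<close> itself. Uniqueness of the derivative within the unit interval transfers their
  derivatives to \<open>dx\<close> and \<open>dy\<close> of \<open>u\<close>.\<close>

lemma derivative_of_family:
  assumes G: "smooth_family n G" "i \<le> n" "j \<le> n" and eq: "\<And>x y. x \<in> {0..1} \<Longrightarrow> y \<in> {0..1} \<Longrightarrow> g (x, y) = G i j x y"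
    and xy: "x \<in> {0..1}" "y \<in> {0..1}"
  shows "i < n \<Longrightarrow> dx g (x, y) = G (Suc i) j x y" "j < n \<Longrightarrow> dy g (x, y) = G i (Suc j) x y"
proof -
  have vd: "vector_derivative h (at t within {0..1}) = d" if "(h' has_real_derivative d) (at t within {0..1})" "t \<in> {0..1}" "\<And>t. t \<in> {0..1} \<Longrightarrow> h t = h' t"
    for h h' :: "real \<Rightarrow> real" and t d
  proof -
    have "(h has_vector_derivative d) (at t within {0..1})"
      by (rule has_vector_derivative_transform[OF that(2,3) that(1)[unfolded has_real_derivative_iff_has_vector_derivative]])
    then show ?thesis
      using vector_derivative_within_cbox[of 0 1 t h d] that(2) by simp
  qed
  show "dx g (x, y) = G (Suc i) j x y" if "i < n"
    unfolding dx_def prod.case by (rule vd[OF smooth_familyD(2)[OF G that xy] xy(1) eq[OF _ xy(2)]])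
  show "dy g (x, y) = G i (Suc j) x y" if "j < n"
    unfolding dy_def prod.case by (rule vd[OF smooth_familyD(3)[OF G that xy] xy(2) eq[OF xy(1)]])
qed

context shishkin
begin

text \<open>Layers at opposite sides are merged, \<open>W 1\<close> with \<open>W 3\<close> and
  \<open>W 2\<close> with \<open>W 4\<close>, as are the four corner layers. The symmetric
  \<open>E\<close> is designed for these sums.\<close>

lemma decomp_of_solution:
  assumes sol: "solution_decomposition k \<beta> C1 \<epsilon> uu S W Z"
  defines "s \<equiv> pdf S" and "w \<equiv> fam_add (pdf (W 1)) (pdf (W 3))" and "v \<equiv> fam_add (pdf (W 2)) (pdf (W 4))"
    and "z \<equiv> fam_add (fam_add (pdf (Z 1)) (pdf (Z 2))) (fam_add (pdf (Z 3)) (pdf (Z 4)))"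
  shows "decomp s w v z" and "x \<in> {0..1} \<Longrightarrow> y \<in> {0..1} \<Longrightarrow> uu (x, y) = total s w v z 0 0 x y"
proof -
  note D = sol[unfolded solution_decomposition_def se_def[symmetric]]
  have pw: "\<epsilon> powr (- real i / 2) = 1 / se ^ i" for i
  proof -
    have "\<epsilon> powr (- real i / 2) = inverse ((\<epsilon> powr (1 / 2)) powr real i)" by (simp add: powr_powr powr_minus)
    moreover have "\<epsilon> powr (1 / 2) = se" unfolding se_def using eps(1) by (simp add: powr_half_sqrt)
    moreover have "se powr real i = se ^ i" by (rule powr_realpow[OF se(1)])
    ultimately show ?thesis by (simp only: inverse_eq_divide)
  qed
  have S: "derivs_bounded (k + 2) S (\<lambda>i j x y. C1)" using D by blast
  have W: "derivs_bounded (k + 2) (W 1) (\<lambda>i j x y. C1 * (1 / se ^ i) * exp (- \<beta> * x / se))"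
    "derivs_bounded (k + 2) (W 2) (\<lambda>i j x y. C1 * (1 / se ^ j) * exp (- \<beta> * y / se))"
    "derivs_bounded (k + 2) (W 3) (\<lambda>i j x y. C1 * (1 / se ^ i) * exp (- \<beta> * (1 - x) / se))"
    "derivs_bounded (k + 2) (W 4) (\<lambda>i j x y. C1 * (1 / se ^ j) * exp (- \<beta> * (1 - y) / se))"
    using D unfolding pw by blast+
  have Z: "derivs_bounded (k + 2) (Z 1) (\<lambda>i j x y. C1 * (1 / se ^ (i + j)) * exp (- \<beta> * (x + y) / se))"
    "derivs_bounded (k + 2) (Z 2) (\<lambda>i j x y. C1 * (1 / se ^ (i + j)) * exp (- \<beta> * (1 - x + y) / se))"
    "derivs_bounded (k + 2) (Z 3) (\<lambda>i j x y. C1 * (1 / se ^ (i + j)) * exp (- \<beta> * (2 - x - y) / se))"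
    "derivs_bounded (k + 2) (Z 4) (\<lambda>i j x y. C1 * (1 / se ^ (i + j)) * exp (- \<beta> * (x + 1 - y) / se))"
    using D unfolding pw by blast+
  have sf: "smooth_family (k + 2) s" "smooth_family (k + 2) w" "smooth_family (k + 2) v" "smooth_family (k + 2) z"
    unfolding s_def w_def v_def z_def by (intro smooth_family_add smooth_family_pdf[OF S] smooth_family_pdf[OF W(1)] smooth_family_pdf[OF W(2)]
      smooth_family_pdf[OF W(3)] smooth_family_pdf[OF W(4)] smooth_family_pdf[OF Z(1)] smooth_family_pdf[OF Z(2)] smooth_family_pdf[OF Z(3)] smooth_family_pdf[OF Z(4)])+
  have ex: "exp (- \<beta> * (a + c) / se) = exp (- \<beta> * a / se) * exp (- \<beta> * c / se)" for a c
    by (simp add: exp_add[symmetric] add_divide_distrib[symmetric] algebra_simps)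
  have "\<bar>s i j x y\<bar> \<le> C1 \<and> \<bar>w i j x y\<bar> \<le> C1 / se ^ i * E x \<and> \<bar>v i j x y\<bar> \<le> C1 / se ^ j * E y \<and> \<bar>z i j x y\<bar> \<le> C1 / se ^ (i + j) * E x * E y"
    if ij: "i \<le> k + 2" "j \<le> k + 2" and xy: "x \<in> {0..1}" "y \<in> {0..1}" for i j x y
  proof (intro conjI)
    show "\<bar>s i j x y\<bar> \<le> C1" unfolding s_def by (rule pdf_bound[OF S ij xy])
    show "\<bar>w i j x y\<bar> \<le> C1 / se ^ i * E x"
      using pdf_bound[OF W(1) ij xy] pdf_bound[OF W(3) ij xy] unfolding w_def fam_add_def E_def by (simp add: algebra_simps add_divide_distrib)
    show "\<bar>v i j x y\<bar> \<le> C1 / se ^ j * E y"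
      using pdf_bound[OF W(2) ij xy] pdf_bound[OF W(4) ij xy] unfolding v_def fam_add_def E_def by (simp add: algebra_simps add_divide_distrib)
    have 2: "2 - x - y = (1 - x) + (1 - y)" "x + 1 - y = x + (1 - y)" by simp_all
    have "\<bar>z i j x y\<bar> \<le> \<bar>pdf (Z 1) i j x y\<bar> + \<bar>pdf (Z 2) i j x y\<bar> + \<bar>pdf (Z 3) i j x y\<bar> + \<bar>pdf (Z 4) i j x y\<bar>"
    proof -
      have t: "\<bar>(a + c) + (d + e)\<bar> \<le> \<bar>a\<bar> + \<bar>c\<bar> + \<bar>d\<bar> + \<bar>e\<bar>" for a c d e :: real by linarith
      show ?thesis unfolding z_def fam_add_def by (rule t)
    qed
    also have "\<dots> \<le> C1 * (1 / se ^ (i + j)) * exp (- \<beta> * (x + y) / se) + C1 * (1 / se ^ (i + j)) * exp (- \<beta> * (1 - x + y) / se)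
       + C1 * (1 / se ^ (i + j)) * exp (- \<beta> * (2 - x - y) / se) + C1 * (1 / se ^ (i + j)) * exp (- \<beta> * (x + 1 - y) / se)"
      by (intro add_mono pdf_bound[OF Z(1) ij xy] pdf_bound[OF Z(2) ij xy] pdf_bound[OF Z(3) ij xy] pdf_bound[OF Z(4) ij xy])
    \<comment> \<open>Multiplying out \<open>E x * E y\<close> yields precisely the four corner
      exponentials.\<close>
    also have "\<dots> = C1 / se ^ (i + j) * E x * E y"
      unfolding 2 ex E_def by (simp only: ring_distribs mult_1_right divide_inverse mult_1_left ac_simps)
    finally show "\<bar>z i j x y\<bar> \<le> C1 / se ^ (i + j) * E x * E y" .
  qed
  then show "decomp s w v z" unfolding decomp_def using sf by blast
  have sum4: "(\<Sum>m=1..4. h m) = h 1 + h 2 + h 3 + (h 4 :: real)" for h :: "nat \<Rightarrow> real" by (simp add: numeral_eq_Suc)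
  assume "x \<in> {0..1}" "y \<in> {0..1}"
  then have "uu (x, y) = S (x, y) + (\<Sum>m=1..4. W m (x, y)) + (\<Sum>m=1..4. Z m (x, y))" using D by blast
  then show "uu (x, y) = total s w v z 0 0 x y"
    unfolding sum4 by (simp add: total_def fam_add_def s_def w_def v_def z_def pdf_def pd_def)
qed

end

context layered
begin

lemma solution_facts:
  assumes uu: "\<And>x y. x \<in> {0..1} \<Longrightarrow> y \<in> {0..1} \<Longrightarrow> uu (x, y) = u 0 0 x y" and bvp: "bvp_solution \<epsilon> b f uu"
  shows "\<And>x y. x \<in> {0..1} \<Longrightarrow> y \<in> {0..1} \<Longrightarrow> dx uu (x, y) = u 1 0 x y"
    and "\<And>x y. x \<in> {0..1} \<Longrightarrow> y \<in> {0..1} \<Longrightarrow> dy uu (x, y) = u 0 1 x y"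
    and "\<And>x y. x \<in> {0<..<1} \<Longrightarrow> y \<in> {0<..<1} \<Longrightarrow> f (x, y) = - \<epsilon> * (u 2 0 x y + u 0 2 x y) + b (x, y) * u 0 0 x y"
    and "\<And>t. t \<in> {0..1} \<Longrightarrow> u 0 0 0 t = 0" "\<And>t. t \<in> {0..1} \<Longrightarrow> u 0 0 1 t = 0"
    and "\<And>t. t \<in> {0..1} \<Longrightarrow> u 0 0 t 0 = 0" "\<And>t. t \<in> {0..1} \<Longrightarrow> u 0 0 t 1 = 0"
proof -
  show dx: "dx uu (x, y) = u 1 0 x y" if "x \<in> {0..1}" "y \<in> {0..1}" for x y
    using derivative_of_family(1)[OF sm(7) _ _ uu that] by simp
  show dy: "dy uu (x, y) = u 0 1 x y" if "x \<in> {0..1}" "y \<in> {0..1}" for x y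
    using derivative_of_family(2)[OF sm(7) _ _ uu that] by simp
  have dxx: "pd 2 0 uu (x, y) = u 2 0 x y" if "x \<in> {0..1}" "y \<in> {0..1}" for x y
    using derivative_of_family(1)[OF sm(7) _ _ dx that] by (simp add: pd_def numeral_2_eq_2)
  have dyy: "pd 0 2 uu (x, y) = u 0 2 x y" if "x \<in> {0..1}" "y \<in> {0..1}" for x y
    using derivative_of_family(2)[OF sm(7) _ _ dy that] by (simp add: pd_def numeral_2_eq_2)
  show "f (x, y) = - \<epsilon> * (u 2 0 x y + u 0 2 x y) + b (x, y) * u 0 0 x y" if "x \<in> {0<..<1}" "y \<in> {0<..<1}" for x y
  proof -
    have "(x, y) \<in> Omega" using that by simp
    then have "- \<epsilon> * (pd 2 0 uu (x, y) + pd 0 2 uu (x, y)) + b (x, y) * uu (x, y) = f (x, y)"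
      using bvp unfolding bvp_solution_def by blast
    then show ?thesis using that dxx[of x y] dyy[of x y] uu[of x y] by simp
  qed
  have z: "u 0 0 x y = 0" if "(x, y) \<in> cl_Omega - Omega" for x y
  proof -
    have "uu (x, y) = 0" using bvp that unfolding bvp_solution_def by blast
    then show ?thesis using that uu[of x y] by simp
  qed
  show "u 0 0 0 t = 0" "u 0 0 1 t = 0" "u 0 0 t 0 = 0" "u 0 0 t 1 = 0" if "t \<in> {0..1}" for t
    using z[of 0 t] z[of 1 t] z[of t 0] z[of t 1] that by auto
qed

section \<open>Norms of functions that are continuous on each cell\<close>

lemma cell_cover:
  assumes "x \<in> {0<..<1}" "x \<notin> X ` {0..N}"
  shows "\<exists>i\<in>{1..N}. x \<in> ival X i"
proof -
  define i where "i = (LEAST i. x < X i)"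
  have xN: "x < X N" using assms(1) X_special by simp
  have i: "x < X i" "i \<le> N" unfolding i_def using LeastI[of "\<lambda>i. x < X i", OF xN] Least_le[of "\<lambda>i. x < X i", OF xN] by auto
  have "i \<noteq> 0" using i(1) assms(1) X_special(1) by (cases "i = 0") auto
  then have "\<not> x < X (i - 1)" using not_less_Least[of "i - 1" "\<lambda>i. x < X i"] unfolding i_def by simp
  moreover have "x \<noteq> X (i - 1)" using assms(2) i(2) by auto
  ultimately show ?thesis using i \<open>i \<noteq> 0\<close> by (intro bexI[of _ i]) (auto simp: ival_def)
qed

lemma ival_disjoint:
  assumes "i \<in> {1..N}" "i' \<in> {1..N}" "i \<noteq> i'"
  shows "ival X i \<inter> ival X i' = {}"
proof -
  have *: "ival X i \<inter> ival X i' = {}" if "i < i'" "i' \<in> {1..N}" for i i'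
  proof -
    have "X i \<le> X (i' - 1)" using that by (intro X_mono) auto
    then show ?thesis by (auto simp: ival_def)
  qed
  show ?thesis
  proof (cases "i < i'")
    case True then show ?thesis using * assms by simp
  next
    case False then have "i' < i" using assms by simp
    then show ?thesis using *[of i' i] assms by blast
  qed
qed

text \<open>The open cells are disjoint and cover the square up to the mesh lines, which lie in
  finitely many hyperplanes and are negligible. The values there, over which the finite element
  space gives no control, do not matter.\<close>

lemma norm_pwc:
  assumes G: "pwc g G"
  shows "(l2_norm Omega g)\<^sup>2 = (\<Sum>j=1..N. \<Sum>i=1..N. I2c i j (\<lambda>x y. (G i j x y)\<^sup>2))"
proof -
  let ?I = "{1..N} \<times> {1..N}" and ?T = "\<lambda>(i, j). cell X i j"
  let ?v = "\<Sum>j=1..N. \<Sum>i=1..N. I2c i j (\<lambda>x y. (G i j x y)\<^sup>2)"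
  have "((\<lambda>z. g z * g z) has_integral (\<Sum>(i, j)\<in>?I. I2c i j (\<lambda>x y. (G i j x y)\<^sup>2))) (\<Union>p\<in>?I. ?T p)"
  proof (rule has_integral_UN)
    show "((\<lambda>z. g z * g z) has_integral (case p of (i, j) \<Rightarrow> I2c i j (\<lambda>x y. (G i j x y)\<^sup>2))) (?T p)" if p: "p \<in> ?I" for p
    proof -
      obtain i j where ij: "p = (i, j)" "i \<in> {1..N}" "j \<in> {1..N}" using p by auto
      have "((\<lambda>z. g z * g z) has_integral I2c i j (\<lambda>x y. (G i j x y)\<^sup>2)) (cell X i j)"
        unfolding cell_def ival_def
      proof (rule lebesgue_open_rectangle(3))
        show "contC i j (\<lambda>x y. (G i j x y)\<^sup>2)" by (intro contR pwcD(1)[OF G ij(2,3)])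
        show "g (x, y) * g (x, y) = (G i j x y)\<^sup>2" if "x \<in> {X (i - 1)<..<X i}" "y \<in> {X (j - 1)<..<X j}" for x y
          using pwcD(2)[OF G ij(2,3), of x y] that by (simp add: ival_def power2_eq_square)
      qed
      then show ?thesis using ij by simp
    qed
    show "pairwise (\<lambda>p p'. negligible (?T p \<inter> ?T p')) ?I"
    proof (rule pairwiseI)
      fix p p' assume p: "p \<in> ?I" "p' \<in> ?I" "p \<noteq> p'"
      obtain i j i' j' where e: "p = (i, j)" "p' = (i', j')" by fastforce
      have "?T p \<inter> ?T p' = {}"
        using p e ival_disjoint[of i i'] ival_disjoint[of j j'] by (cases "i = i'") (auto simp: cell_def)
      then show "negligible (?T p \<inter> ?T p')" by simp
    qed
  qed auto
  moreover have "(\<Sum>(i, j)\<in>?I. I2c i j (\<lambda>x y. (G i j x y)\<^sup>2)) = ?v" by (subst sum.swap) (simp add: sum.cartesian_product)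
  moreover have "((\<lambda>z. g z * g z) has_integral ?v) Omega \<longleftrightarrow> ((\<lambda>z. g z * g z) has_integral ?v) (\<Union>p\<in>?I. ?T p)"
  proof (rule has_integral_spike_set_eq)
    have sub: "ival X i \<subseteq> {0<..<1}" if "i \<in> {1..N}" for i
    proof -
      have "i - 1 \<le> N" "i \<le> N" using that by auto
      then have "0 \<le> X (i - 1)" "X i \<le> 1" using X_range by auto
      then show ?thesis unfolding ival_def by auto
    qed
    then have "(\<Union>p\<in>?I. ?T p) \<subseteq> Omega" unfolding cell_def by blast
    then have e: "{z \<in> (\<Union>p\<in>?I. ?T p) - Omega. g z * g z \<noteq> 0} = {}" by blast
    show "negligible {z \<in> (\<Union>p\<in>?I. ?T p) - Omega. g z * g z \<noteq> 0}" unfolding e by simp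
    have line: "negligible {z :: real \<times> real. (1, 0) \<bullet> z = t}" "negligible {z :: real \<times> real. (0, 1) \<bullet> z = t}" for t
      by (rule negligible_hyperplane; simp add: zero_prod_def)+
    have "negligible ((\<Union>t\<in>X ` {0..N}. {z :: real \<times> real. (1, 0) \<bullet> z = t}) \<union> (\<Union>t\<in>X ` {0..N}. {z :: real \<times> real. (0, 1) \<bullet> z = t}))"
      by (intro negligible_Un negligible_Union) (auto simp: line)
    moreover have "{z \<in> Omega - (\<Union>p\<in>?I. ?T p). g z * g z \<noteq> 0} \<subseteq> (\<Union>t\<in>X ` {0..N}. {z :: real \<times> real. (1, 0) \<bullet> z = t}) \<union> (\<Union>t\<in>X ` {0..N}. {z :: real \<times> real. (0, 1) \<bullet> z = t})"
    proof
      fix z assume z: "z \<in> {z \<in> Omega - (\<Union>p\<in>?I. ?T p). g z * g z \<noteq> 0}"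
      obtain x y where xy: "z = (x, y)" by fastforce
      have "x \<in> X ` {0..N} \<or> y \<in> X ` {0..N}"
      proof (rule ccontr)
        assume "\<not> ?thesis"
        then obtain i j where "i \<in> {1..N}" "x \<in> ival X i" "j \<in> {1..N}" "y \<in> ival X j" using cell_cover[of x] cell_cover[of y] z xy by auto
        then have "z \<in> (\<Union>p\<in>?I. ?T p)" unfolding xy cell_def by (intro UN_I[of "(i, j)"]) auto
        then show False using z by blast
      qed
      then show "z \<in> (\<Union>t\<in>X ` {0..N}. {z :: real \<times> real. (1, 0) \<bullet> z = t}) \<union> (\<Union>t\<in>X ` {0..N}. {z :: real \<times> real. (0, 1) \<bullet> z = t})"
        unfolding xy by auto
    qed
    ultimately show "negligible {z \<in> Omega - (\<Union>p\<in>?I. ?T p). g z * g z \<noteq> 0}" by (rule negligible_subset)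
  qed
  ultimately have h: "((\<lambda>z. g z * g z) has_integral ?v) Omega" by metis
  have "set_integrable lebesgue Omega (\<lambda>z. g z * g z)"
    by (rule nonnegative_absolutely_integrable_1) (use h in \<open>auto simp: integrable_on_def\<close>)
  from set_lebesgue_integral_eq_integral(2)[OF this] have "l2_inner Omega g g = ?v" unfolding l2_inner_def using integral_unique[OF h] by simp
  moreover have "0 \<le> ?v" using has_integral_nonneg[OF h] by simp
  ultimately show ?thesis unfolding l2_norm_def by simp
qed

lemma jumps_pwc:
  assumes G: "pwc g G"
  shows "(\<Sum>j=1..N. \<Sum>i\<in>{0, N}. l2_inner (ival X j) (\<lambda>_. r) (\<lambda>y. (jumpx N X g i y)\<^sup>2)) = r * Bdx G"
    and "(\<Sum>j=1..N. l2_inner (ival X j) (\<lambda>_. r) (\<lambda>y. (jumpx N X g (3 * N div 4) y)\<^sup>2)) = r * Jx G"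
proof -
  have c: "continuous_on {X (j - 1)..X j} (G i j (X i))" "continuous_on {X (j - 1)..X j} (G i j (X (i - 1)))" if "i \<in> {1..N}" "j \<in> {1..N}" for i j
    using contR_y[OF pwcD(1)[OF G that], of "X i"] contR_y[OF pwcD(1)[OF G that], of "X (i - 1)"] X_less[OF that(1)] by auto
  have N: "1 \<in> {1..N}" "N \<in> {1..N}" "m \<in> {1..N}" "Suc m \<in> {1..N}" using index_order by auto
  have "(\<Sum>i\<in>{0, N}. l2_inner (ival X j) (\<lambda>_. r) (\<lambda>y. (jumpx N X g i y)\<^sup>2))
    = r * integral {X (j - 1)..X j} (\<lambda>y. (G 1 j (X 0) y)\<^sup>2 + (G N j (X N) y)\<^sup>2)" if j: "j \<in> {1..N}" for j
  proof -
    have c0: "continuous_on {X (j - 1)..X j} (\<lambda>y. (G 1 j (X 0) y)\<^sup>2)" "continuous_on {X (j - 1)..X j} (\<lambda>y. (G N j (X N) y)\<^sup>2)"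
      using c(2)[OF N(1) j] c(1)[OF N(2) j] by (auto intro!: continuous_intros)
    have "l2_inner (ival X j) (\<lambda>_. r) (\<lambda>y. (jumpx N X g 0 y)\<^sup>2) = integral {X (j - 1)..X j} (\<lambda>y. r * (G 1 j (X 0) y)\<^sup>2)"
      using traces(2)[OF G j, of _ 0] index_order by (intro inner_ival continuous_on_mult_left c0) (auto simp: jumpx_def)
    moreover have "l2_inner (ival X j) (\<lambda>_. r) (\<lambda>y. (jumpx N X g N y)\<^sup>2) = integral {X (j - 1)..X j} (\<lambda>y. r * (G N j (X N) y)\<^sup>2)"
      using traces(1)[OF G j, of _ N] index_order by (intro inner_ival continuous_on_mult_left c0) (auto simp: jumpx_def)
    moreover have "integral {X (j - 1)..X j} (\<lambda>y. (G 1 j (X 0) y)\<^sup>2 + (G N j (X N) y)\<^sup>2)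
       = integral {X (j - 1)..X j} (\<lambda>y. (G 1 j (X 0) y)\<^sup>2) + integral {X (j - 1)..X j} (\<lambda>y. (G N j (X N) y)\<^sup>2)"
      by (intro integral_add integrable_continuous_interval c0)
    ultimately show ?thesis using index_order by (simp add: distrib_left)
  qed
  then show "(\<Sum>j=1..N. \<Sum>i\<in>{0, N}. l2_inner (ival X j) (\<lambda>_. r) (\<lambda>y. (jumpx N X g i y)\<^sup>2)) = r * Bdx G"
    unfolding Bdx_def sum_distrib_left by (intro sum.cong refl)
  have "l2_inner (ival X j) (\<lambda>_. r) (\<lambda>y. (jumpx N X g (3 * N div 4) y)\<^sup>2)
    = r * integral {X (j - 1)..X j} (\<lambda>y. (G (Suc m) j (X m) y - G m j (X m) y)\<^sup>2)" if j: "j \<in> {1..N}" for j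
  proof -
    have "l2_inner (ival X j) (\<lambda>_. r) (\<lambda>y. (jumpx N X g m y)\<^sup>2) = integral {X (j - 1)..X j} (\<lambda>y. r * (G (Suc m) j (X m) y - G m j (X m) y)\<^sup>2)"
    proof (rule inner_ival)
      show "continuous_on {X (j - 1)..X j} (\<lambda>y. r * (G (Suc m) j (X m) y - G m j (X m) y)\<^sup>2)"
        using c(2)[OF N(4) j] c(1)[OF N(3) j] by (auto intro!: continuous_intros)
      show "r * (jumpx N X g m y)\<^sup>2 = r * (G (Suc m) j (X m) y - G m j (X m) y)\<^sup>2" if "y \<in> ival X j" for y
        using traces(1)[OF G j that N(3)] traces(2)[OF G j that, of m] index_order by (simp add: jumpx_def)
    qed
    then show ?thesis by (simp add: m_def)
  qed
  then show "(\<Sum>j=1..N. l2_inner (ival X j) (\<lambda>_. r) (\<lambda>y. (jumpx N X g (3 * N div 4) y)\<^sup>2)) = r * Jx G"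
    unfolding Jx_def sum_distrib_left by (intro sum.cong refl)
qed

end

lemma fe_space_coefficients:
  assumes "v \<in> fe_space k N X"
  shows "\<exists>c. \<forall>i\<in>{1..N}. \<forall>j\<in>{1..N}. \<forall>x\<in>ival X i. \<forall>y\<in>ival X j. v (x, y) = ev k (c i j) x y"
proof -
  have "\<exists>c. \<forall>x\<in>ival X i. \<forall>y\<in>ival X j. v (x, y) = ev k c x y" if "i \<in> {1..N}" "j \<in> {1..N}" for i j
  proof -
    have "is_Qk_on k (cell X i j) v" using assms that unfolding fe_space_def by blast
    then obtain c where "\<forall>(x, y)\<in>cell X i j. v (x, y) = (\<Sum>a\<le>k. \<Sum>d\<le>k. c a d * x ^ a * y ^ d)" unfolding is_Qk_on_def by blast
    then show ?thesis unfolding ev_def cell_def by (intro exI[of _ c]) auto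
  qed
  then show ?thesis by metis
qed

text \<open>The estimates are proved for squares, while the rates are stated as sums; for
  nonnegative terms the sum of squares is at most the square of the sum.\<close>

lemma sqrt_sum_squares_le:
  assumes "0 \<le> a" "0 \<le> b" "0 \<le> c" "0 \<le> (r :: real)" "x \<le> r\<^sup>2 * (a\<^sup>2 + b\<^sup>2 + c\<^sup>2)"
  shows "sqrt x \<le> r * (a + b + c)"
proof (rule real_le_lsqrt)
  have "0 \<le> 2 * (a * b + a * c + b * c)" using assms by simp
  then have "a\<^sup>2 + b\<^sup>2 + c\<^sup>2 \<le> (a + b + c)\<^sup>2" by (simp add: power2_eq_square algebra_simps)
  then have "r\<^sup>2 * (a\<^sup>2 + b\<^sup>2 + c\<^sup>2) \<le> r\<^sup>2 * (a + b + c)\<^sup>2" by (intro mult_left_mono) auto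
  then show "x \<le> (r * (a + b + c))\<^sup>2" using assms(5) by (simp add: power_mult_distrib)
  show "0 \<le> r * (a + b + c)" using assms by simp
qed

context layered
begin

lemma pwc_fe:
  assumes "\<forall>i\<in>{1..N}. \<forall>j\<in>{1..N}. \<forall>x\<in>ival X i. \<forall>y\<in>ival X j. g (x, y) = ev k (c i j) x y"
  shows "pwc g (\<lambda>i j. ev k (c i j))"
  unfolding pwc_def using assms by (auto intro: contR)

lemma pwc_cong: "pwc g G \<Longrightarrow> (\<And>x y. x \<in> {0..1} \<Longrightarrow> y \<in> {0..1} \<Longrightarrow> h (x, y) = g (x, y)) \<Longrightarrow> pwc h G"
proof -
  assume G: "pwc g G" and h: "\<And>x y. x \<in> {0..1} \<Longrightarrow> y \<in> {0..1} \<Longrightarrow> h (x, y) = g (x, y)"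
  have "x \<in> {0..1}" if "x \<in> ival X i" "i \<in> {1..N}" for x i
    using cell_subset[OF that(2), of x] that(1) by (simp add: ival_def)
  then show ?thesis using G h unfolding pwc_def by metis
qed

text \<open>Outside its locale \<open>CC\<close> depends on \<open>k\<close>,
  \<open>\<beta>\<close>, \<open>\<sigma>\<close>, \<open>C1\<close> and \<open>Bm\<close> only, so
  \<open>M\<close> is free of \<open>\<epsilon>\<close> and \<open>N\<close>. The absolute value
  makes it nonnegative at once.\<close>

lemma error_norms:
  assumes uu: "\<And>x y. x \<in> {0..1} \<Longrightarrow> y \<in> {0..1} \<Longrightarrow> uu (x, y) = u 0 0 x y"
    and bvp: "bvp_solution \<epsilon> b f uu" and ldg: "ldg_solution k N X \<epsilon> b f U P Q"
    and b: "continuous_on cl_Omega b" "\<And>z. z \<in> cl_Omega \<Longrightarrow> 2 * \<beta>\<^sup>2 \<le> b z" "\<And>z. z \<in> cl_Omega \<Longrightarrow> b z \<le> Bm"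
  defines "M \<equiv> \<bar>ldg_error.CC k \<beta> \<sigma> C1 Bm\<bar>"
  shows "energy_norm N X \<epsilon> b (\<lambda>z. uu z - U z) (\<lambda>z. \<epsilon> * dx uu z - P z) (\<lambda>z. \<epsilon> * dy uu z - Q z)
      \<le> sqrt (6 * M + 1) * (\<epsilon> powr (1 / 4) * L ^ (k + 1) + sqrt \<epsilon> * (1 / real N) ^ k + NN)"
    and "balanced_norm N X \<epsilon> b (\<lambda>z. uu z - U z) (\<lambda>z. \<epsilon> * dx uu z - P z) (\<lambda>z. \<epsilon> * dy uu z - Q z)
      \<le> sqrt (6 * M + 1) * (sqrt \<epsilon> * L ^ (k + 1) + \<epsilon> powr (1 / 4) * (1 / real N) ^ k + L ^ (k + 1))"
proof -
  have fe: "U \<in> fe_space k N X" "P \<in> fe_space k N X" "Q \<in> fe_space k N X" using ldg unfolding ldg_solution_def by blast+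
  obtain Uc where c1: "\<forall>i\<in>{1..N}. \<forall>j\<in>{1..N}. \<forall>x\<in>ival X i. \<forall>y\<in>ival X j. U (x, y) = ev k (Uc i j) x y"
    using fe_space_coefficients[OF fe(1)] ..
  obtain Pc where c2: "\<forall>i\<in>{1..N}. \<forall>j\<in>{1..N}. \<forall>x\<in>ival X i. \<forall>y\<in>ival X j. P (x, y) = ev k (Pc i j) x y"
    using fe_space_coefficients[OF fe(2)] ..
  obtain Qc where c3: "\<forall>i\<in>{1..N}. \<forall>j\<in>{1..N}. \<forall>x\<in>ival X i. \<forall>y\<in>ival X j. Q (x, y) = ev k (Qc i j) x y"
    using fe_space_coefficients[OF fe(3)] ..
  note U = pwc_fe[OF c1] and P = pwc_fe[OF c2] and Q = pwc_fe[OF c3]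
  note sf = solution_facts[OF uu bvp]
  have bb: "contR 0 1 0 1 (\<lambda>x y. b (x, y))" using b(1) by (simp add: contR_def)
  interpret err: ldg_error k \<beta> \<sigma> \<epsilon> C1 N s w v z "\<lambda>x y. b (x, y)" Bm Uc Pc Qc
  proof unfold_locales
    fix i j s' r' v' assume ij: "i \<in> {1..N}" "j \<in> {1..N}"
    show "1 / \<epsilon> * I2c i j (\<lambda>x y. erp Pc i j x y * ev k s' x y) + 1 / \<epsilon> * I2c i j (\<lambda>x y. erq Qc i j x y * ev k r' x y)
      + I2c i j (\<lambda>x y. b (x, y) * eru Uc i j x y * ev k v' x y)
      + cellX k N m se (1 / se) X (eru Uc) (erp Pc) s' v' i j
      + cellX k N m se (1 / se) X (swapf (eru Uc)) (swapf (erq Qc)) (transp r') (transp v') j i = 0"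
      by (rule error_equation[OF bb _ _ _ _ ldg _ U P Q ij]) (use sf in auto)
  qed (use sf bb b in auto)
  define e\<^sub>u where "e\<^sub>u = (\<lambda>z. uu z - U z)"
  define e\<^sub>p where "e\<^sub>p = (\<lambda>z. \<epsilon> * dx uu z - P z)"
  define e\<^sub>q where "e\<^sub>q = (\<lambda>z. \<epsilon> * dy uu z - Q z)"
  have pu: "pwc e\<^sub>u (eru Uc)"
    by (rule pwc_cong[OF pwc_eru[OF U]]) (simp add: e\<^sub>u_def uu)
  have pp: "pwc e\<^sub>p (erp Pc)"
  proof (rule pwc_cong)
    show "pwc (\<lambda>z. \<epsilon> * (case z of (x, y) \<Rightarrow> u 1 0 x y) - P z) (erp Pc)"
      using pwc_diff[OF pwc_cmult[OF pwc_family[OF sm(7)]] P, of 1 0 \<epsilon>] by (simp add: erp_def[abs_def])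
  qed (simp only: e\<^sub>p_def sf(1) prod.case)
  have pq: "pwc e\<^sub>q (erq Qc)"
  proof (rule pwc_cong)
    show "pwc (\<lambda>z. \<epsilon> * (case z of (x, y) \<Rightarrow> u 0 1 x y) - Q z) (erq Qc)"
      using pwc_diff[OF pwc_cmult[OF pwc_family[OF sm(7)]] Q, of 0 1 \<epsilon>] by (simp add: erq_def[abs_def])
  qed (simp only: e\<^sub>q_def sf(2) prod.case)
  have pb: "pwc (\<lambda>z. sqrt (b z) * e\<^sub>u z) (\<lambda>i j x y. sqrt (b (x, y)) * eru Uc i j x y)"
    unfolding pwc_def
  proof (intro ballI conjI)
    fix i j assume ij: "i \<in> {1..N}" "j \<in> {1..N}"
    have "contC i j (\<lambda>x y. sqrt (b (x, y)))"
      using err.bb_cell[OF ij] unfolding contR_def by (intro continuous_on_real_sqrt)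
    then show "contC i j (\<lambda>x y. sqrt (b (x, y)) * eru Uc i j x y)" by (intro contR pwcD(1)[OF pu ij])
    show "sqrt (b (x, y)) * e\<^sub>u (x, y) = sqrt (b (x, y)) * eru Uc i j x y" if "x \<in> ival X i" "y \<in> ival X j" for x y
      using pwcD(2)[OF pu ij that] by simp
  qed
  have mass: "(l2_norm Omega (\<lambda>z. sqrt (b z) * e\<^sub>u z))\<^sup>2 = (\<Sum>j=1..N. \<Sum>i=1..N. I2c i j (\<lambda>x y. b (x, y) * (eru Uc i j x y)\<^sup>2))"
    unfolding norm_pwc[OF pb]
  proof (intro sum.cong refl I2_cong)
    fix i j x y assume ij: "j \<in> {1..N}" "i \<in> {1..N}" and xy: "x \<in> {X (i - 1)..X i}" "y \<in> {X (j - 1)..X j}"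
    have "2 * \<beta>\<^sup>2 \<le> b (x, y)" using b(2) cell_subset[OF ij(2) xy(1)] cell_subset[OF ij(1) xy(2)] by simp
    moreover have "0 \<le> 2 * \<beta>\<^sup>2" by simp
    ultimately have "0 \<le> b (x, y)" by linarith
    then show "(sqrt (b (x, y)) * eru Uc i j x y)\<^sup>2 = b (x, y) * (eru Uc i j x y)\<^sup>2" by (simp add: power_mult_distrib)
  qed
  define A where "A = 1 / \<epsilon> * (l2_norm Omega e\<^sub>p)\<^sup>2 + 1 / \<epsilon> * (l2_norm Omega e\<^sub>q)\<^sup>2 + se * (Bdx (eru Uc) + Bdx (swapf (eru Uc)))"
  define J where "J = 1 / se * (Jx (erp Pc) + Jx (swapf (erq Qc)))"
  define B where "B = (l2_norm Omega (\<lambda>z. sqrt (b z) * e\<^sub>u z))\<^sup>2"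
  have wn: "weighted_norm \<omega> \<mu> N X \<epsilon> b e\<^sub>u e\<^sub>p e\<^sub>q = sqrt (\<omega> * (l2_norm Omega e\<^sub>p)\<^sup>2 + \<omega> * (l2_norm Omega e\<^sub>q)\<^sup>2 + B
     + \<mu> * Bdx (eru Uc) + \<mu> * Bdx (swapf (eru Uc)) + 1 / se * Jx (erp Pc) + 1 / se * Jx (swapf (erq Qc)))" for \<omega> \<mu>
    unfolding weighted_norm_def flip_translations jumps_pwc[OF pu] jumps_pwc[OF pwc_flip[OF pu]] jumps_pwc[OF pp] jumps_pwc[OF pwc_flip[OF pq]] B_def lam_tr_def se_def ..
  let ?W = "err.W"
  let ?S = "?W + NN\<^sup>2"
  have W: "?W = se * L2 + \<epsilon> * (real N)\<^sup>2 * NN\<^sup>2" by (rule err.W_def)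
  have W0: "0 \<le> ?W" unfolding W using se L2 eps by simp
  have M: "0 \<le> M" "err.CC \<le> M" by (simp_all add: M_def)
  have CC: "err.CC * t \<le> M * t" if "0 \<le> t" for t using M that by (intro mult_right_mono)
  have est: "A \<le> M * ?W" "J \<le> M * ?W" "B \<le> M * ?S"
    using err.energy_estimate CC[OF W0] CC[of ?S] W0 unfolding A_def J_def B_def mass norm_pwc[OF pp] norm_pwc[OF pq] by auto
  have r: "(sqrt (6 * M + 1))\<^sup>2 = 6 * M + 1" using M by simp
  have p4: "(\<epsilon> powr (1 / 4))\<^sup>2 = se"
  proof -
    have "(\<epsilon> powr (1 / 4))\<^sup>2 = \<epsilon> powr (1 / 2)" by (simp add: power2_eq_square flip: powr_add)
    then show ?thesis using eps(1) by (simp add: se_def powr_half_sqrt)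
  qed
  \<comment> \<open>With this identity \<open>W + NN\<^sup>2\<close> is exactly the sum of the
    squares of the three terms in the energy rate.\<close>
  have Nk: "(1 / real N) ^ k = real N * NN" using N by (simp add: NN_def)
  have NN2: "NN\<^sup>2 \<le> L2" by (rule L2(4))
  have pos: "0 \<le> se" "0 \<le> L" "0 \<le> NN" "0 \<le> L2" using se L NN L2 by auto
  show "energy_norm N X \<epsilon> b (\<lambda>z. uu z - U z) (\<lambda>z. \<epsilon> * dx uu z - P z) (\<lambda>z. \<epsilon> * dy uu z - Q z)
      \<le> sqrt (6 * M + 1) * (\<epsilon> powr (1 / 4) * L ^ (k + 1) + sqrt \<epsilon> * (1 / real N) ^ k + NN)"
    unfolding energy_norm_def lam_bd_def e\<^sub>u_def[symmetric] e\<^sub>p_def[symmetric] e\<^sub>q_def[symmetric] wn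
  proof (rule sqrt_sum_squares_le)
    have sq: "(\<epsilon> powr (1 / 4) * L ^ (k + 1))\<^sup>2 + (sqrt \<epsilon> * (1 / real N) ^ k)\<^sup>2 + NN\<^sup>2 = ?S"
      unfolding power_mult_distrib p4 L2(3) Nk W using eps by simp
    have "1 / \<epsilon> * (l2_norm Omega e\<^sub>p)\<^sup>2 + 1 / \<epsilon> * (l2_norm Omega e\<^sub>q)\<^sup>2 + B
       + sqrt \<epsilon> * Bdx (eru Uc) + sqrt \<epsilon> * Bdx (swapf (eru Uc)) + 1 / se * Jx (erp Pc) + 1 / se * Jx (swapf (erq Qc)) = A + J + B"
      by (simp add: A_def J_def se_def distrib_left)
    also have "\<dots> \<le> M * ?W + M * ?W + M * ?S" using est by linarith
    also have "\<dots> \<le> (6 * M + 1) * ?S"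
    proof -
      have "0 \<le> M * ?W" "0 \<le> M * NN\<^sup>2" using M W0 by auto
      then show ?thesis using W0 by (simp add: algebra_simps)
    qed
    finally show "1 / \<epsilon> * (l2_norm Omega e\<^sub>p)\<^sup>2 + 1 / \<epsilon> * (l2_norm Omega e\<^sub>q)\<^sup>2 + B
       + sqrt \<epsilon> * Bdx (eru Uc) + sqrt \<epsilon> * Bdx (swapf (eru Uc)) + 1 / se * Jx (erp Pc) + 1 / se * Jx (swapf (erq Qc))
       \<le> (sqrt (6 * M + 1))\<^sup>2 * ((\<epsilon> powr (1 / 4) * L ^ (k + 1))\<^sup>2 + (sqrt \<epsilon> * (1 / real N) ^ k)\<^sup>2 + NN\<^sup>2)"
      unfolding sq r .
  qed (use pos M eps in auto)
  \<comment> \<open>The balanced weight of \<open>p\<close> and \<open>q\<close> is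
    \<open>1 / se\<close> times the energy weight. The same ratio holds between 1 and
    \<open>se\<close> for the boundary jumps, so the whole group \<open>A\<close> is simply divided
    by \<open>se\<close>.\<close>
  have w32: "\<epsilon> powr (- 3 / 2) = 1 / se * (1 / \<epsilon>)"
  proof -
    have "\<epsilon> powr (- 3 / 2) = \<epsilon> powr (- (1 / 2) - 1)" by simp
    also have "\<dots> = \<epsilon> powr (- (1 / 2)) / \<epsilon> powr 1" by (rule powr_diff)
    also have "\<epsilon> powr (- (1 / 2)) = 1 / se" using eps unfolding se_def by (simp add: powr_minus powr_half_sqrt inverse_eq_divide)
    finally show ?thesis using eps by simp
  qed
  show "balanced_norm N X \<epsilon> b (\<lambda>z. uu z - U z) (\<lambda>z. \<epsilon> * dx uu z - P z) (\<lambda>z. \<epsilon> * dy uu z - Q z)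
      \<le> sqrt (6 * M + 1) * (sqrt \<epsilon> * L ^ (k + 1) + \<epsilon> powr (1 / 4) * (1 / real N) ^ k + L ^ (k + 1))"
    unfolding balanced_norm_def e\<^sub>u_def[symmetric] e\<^sub>p_def[symmetric] e\<^sub>q_def[symmetric] wn
  proof (rule sqrt_sum_squares_le)
    let ?V = "L2 + se * (real N)\<^sup>2 * NN\<^sup>2"
    \<comment> \<open>\<open>W\<close> loses one factor \<open>se\<close> and still gives
      \<open>L2\<close> plus the square of \<open>\<epsilon>^(1/4) * N^(-k)\<close>, the balanced
      rate. This is where the factor \<open>se\<close> in every part of the discrete error is
      spent.\<close>
    have V: "1 / se * ?W = ?V"
    proof -
      have "?W = se * ?V" unfolding W by (simp add: distrib_left mult.assoc[symmetric] se(4))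
      then show ?thesis using se(1) by simp
    qed
    have V0: "0 \<le> ?V" using pos by simp
    have WV: "?W \<le> ?V"
    proof -
      have "se * ?V \<le> 1 * ?V" using se V0 by (intro mult_right_mono) auto
      moreover have "?W = se * ?V" using V se(1) by (simp add: field_simps)
      ultimately show ?thesis by simp
    qed
    have sq: "(sqrt \<epsilon> * L ^ (k + 1))\<^sup>2 + (\<epsilon> powr (1 / 4) * (1 / real N) ^ k)\<^sup>2 + (L ^ (k + 1))\<^sup>2 = \<epsilon> * L2 + se * (real N)\<^sup>2 * NN\<^sup>2 + L2"
      unfolding power_mult_distrib p4 L2(3) Nk using eps by simp
    have "\<epsilon> powr (- 3 / 2) * (l2_norm Omega e\<^sub>p)\<^sup>2 + \<epsilon> powr (- 3 / 2) * (l2_norm Omega e\<^sub>q)\<^sup>2 + B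
       + 1 * Bdx (eru Uc) + 1 * Bdx (swapf (eru Uc)) + 1 / se * Jx (erp Pc) + 1 / se * Jx (swapf (erq Qc)) = 1 / se * A + J + B"
      unfolding w32 A_def J_def using se(1) by (simp add: field_simps)
    also have "\<dots> \<le> M * ?V + M * ?V + M * (?V + L2)"
    proof -
      have "1 / se * A \<le> 1 / se * (M * ?W)" using est(1) se(1) by (intro mult_left_mono) auto
      also have "\<dots> = M * ?V" unfolding V[symmetric] by simp
      finally have "1 / se * A \<le> M * ?V" .
      moreover have "M * ?W \<le> M * ?V" using WV M by (intro mult_left_mono)
      moreover have "M * ?S \<le> M * (?V + L2)" using WV NN2 M by (intro mult_left_mono) auto
      ultimately show ?thesis using est by linarith
    qed
    also have "\<dots> \<le> (6 * M + 1) * (\<epsilon> * L2 + se * (real N)\<^sup>2 * NN\<^sup>2 + L2)"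
    proof -
      define a where "a = se * (real N)\<^sup>2 * NN\<^sup>2"
      have a: "0 \<le> a" "0 \<le> M * a" "0 \<le> M * L2" "0 \<le> M * (\<epsilon> * L2)" "0 \<le> \<epsilon> * L2" using pos M eps by (auto simp: a_def)
      show ?thesis unfolding a_def[symmetric] using a pos(4) by (simp add: algebra_simps)
    qed
    finally show "\<epsilon> powr (- 3 / 2) * (l2_norm Omega e\<^sub>p)\<^sup>2 + \<epsilon> powr (- 3 / 2) * (l2_norm Omega e\<^sub>q)\<^sup>2 + B
       + 1 * Bdx (eru Uc) + 1 * Bdx (swapf (eru Uc)) + 1 / se * Jx (erp Pc) + 1 / se * Jx (swapf (erq Qc))
       \<le> (sqrt (6 * M + 1))\<^sup>2 * ((sqrt \<epsilon> * L ^ (k + 1))\<^sup>2 + (\<epsilon> powr (1 / 4) * (1 / real N) ^ k)\<^sup>2 + (L ^ (k + 1))\<^sup>2)"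
      unfolding sq r .
  qed (use pos M eps in auto)
qed

end

theorem theorem2:
  fixes k :: nat
  assumes "k \<ge> 1"
  shows "\<exists>m::nat. \<forall>(\<beta>::real) (\<sigma>::real) (b::fn2) (f::fn2) (C\<^sub>0::real) (C\<^sub>1::real).
    \<beta> > 0 \<longrightarrow> \<sigma> \<ge> real k + 1 \<longrightarrow>
    Ck_on cl_Omega m b \<longrightarrow> Ck_on cl_Omega m f \<longrightarrow>
    (\<forall>z\<in>cl_Omega. b z \<ge> 2 * \<beta>\<^sup>2) \<longrightarrow>
    C\<^sub>0 > 0 \<longrightarrow> C\<^sub>1 > 0 \<longrightarrow>
    (\<exists>C>0. \<forall>(\<epsilon>::real) (N::nat) u S W Z U P Q.
      0 < \<epsilon> \<longrightarrow> \<epsilon> < 1 \<longrightarrow> N \<ge> 4 \<longrightarrow> 4 dvd N \<longrightarrow>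
      \<epsilon> \<le> C\<^sub>0 / real N \<longrightarrow> transition \<sigma> \<beta> \<epsilon> N \<le> 1 / 4 \<longrightarrow>
      bvp_solution \<epsilon> b f u \<longrightarrow>
      solution_decomposition k \<beta> C\<^sub>1 \<epsilon> u S W Z \<longrightarrow>
      ldg_solution k N (mesh (transition \<sigma> \<beta> \<epsilon> N) N) \<epsilon> b f U P Q \<longrightarrow>
      (let X = mesh (transition \<sigma> \<beta> \<epsilon> N) N;
           e\<^sub>u = (\<lambda>z. u z - U z);
           e\<^sub>p = (\<lambda>z. \<epsilon> * dx u z - P z);
           e\<^sub>q = (\<lambda>z. \<epsilon> * dy u z - Q z)
       in energy_norm N X \<epsilon> b e\<^sub>u e\<^sub>p e\<^sub>q
            \<le> C * (\<epsilon> powr (1 / 4) * (ln (real N) / real N) ^ (k + 1)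
                  + sqrt \<epsilon> * (1 / real N) ^ k + (1 / real N) ^ (k + 1)) \<and>
          balanced_norm N X \<epsilon> b e\<^sub>u e\<^sub>p e\<^sub>q
            \<le> C * (sqrt \<epsilon> * (ln (real N) / real N) ^ (k + 1)
                  + \<epsilon> powr (1 / 4) * (1 / real N) ^ k + (ln (real N) / real N) ^ (k + 1))))"
proof (rule exI[of _ 0], intro allI impI)
  fix \<beta> \<sigma> C\<^sub>0 C\<^sub>1 :: real and b f :: fn2
  assume \<beta>: "\<beta> > 0" and \<sigma>: "\<sigma> \<ge> real k + 1" and bs: "Ck_on cl_Omega 0 b"
    and bl: "\<forall>z\<in>cl_Omega. b z \<ge> 2 * \<beta>\<^sup>2" and C\<^sub>1: "C\<^sub>1 > 0"
  have bc: "continuous_on cl_Omega b" using bs unfolding Ck_on_def smooth_on_def by (auto simp: pd_def)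
  \<comment> \<open>Continuity on the compact square supplies the upper bound \<open>Bm\<close> of
    the reaction coefficient, through which the constant depends on \<open>b\<close>.\<close>
  have "bounded (b ` cl_Omega)"
    by (intro compact_imp_bounded compact_continuous_image[OF bc] compact_Times) auto
  then obtain Bm where Bm: "\<And>z. z \<in> cl_Omega \<Longrightarrow> \<bar>b z\<bar> \<le> Bm" unfolding bounded_real by blast
  define C where "C = sqrt (6 * \<bar>ldg_error.CC k \<beta> \<sigma> C\<^sub>1 Bm\<bar> + 1)"
  have C: "0 < C" unfolding C_def by (simp add: add_nonneg_pos)
  show "\<exists>C>0. \<forall>(\<epsilon>::real) (N::nat) u S W Z U P Q.
      0 < \<epsilon> \<longrightarrow> \<epsilon> < 1 \<longrightarrow> N \<ge> 4 \<longrightarrow> 4 dvd N \<longrightarrow>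
      \<epsilon> \<le> C\<^sub>0 / real N \<longrightarrow> transition \<sigma> \<beta> \<epsilon> N \<le> 1 / 4 \<longrightarrow>
      bvp_solution \<epsilon> b f u \<longrightarrow>
      solution_decomposition k \<beta> C\<^sub>1 \<epsilon> u S W Z \<longrightarrow>
      ldg_solution k N (mesh (transition \<sigma> \<beta> \<epsilon> N) N) \<epsilon> b f U P Q \<longrightarrow>
      (let X = mesh (transition \<sigma> \<beta> \<epsilon> N) N;
           e\<^sub>u = (\<lambda>z. u z - U z);
           e\<^sub>p = (\<lambda>z. \<epsilon> * dx u z - P z);
           e\<^sub>q = (\<lambda>z. \<epsilon> * dy u z - Q z)
       in energy_norm N X \<epsilon> b e\<^sub>u e\<^sub>p e\<^sub>q
            \<le> C * (\<epsilon> powr (1 / 4) * (ln (real N) / real N) ^ (k + 1)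
                  + sqrt \<epsilon> * (1 / real N) ^ k + (1 / real N) ^ (k + 1)) \<and>
          balanced_norm N X \<epsilon> b e\<^sub>u e\<^sub>p e\<^sub>q
            \<le> C * (sqrt \<epsilon> * (ln (real N) / real N) ^ (k + 1)
                  + \<epsilon> powr (1 / 4) * (1 / real N) ^ k + (ln (real N) / real N) ^ (k + 1)))"
  proof (intro exI[of _ C] conjI C allI impI)
    fix \<epsilon> :: real and N :: nat and u S W Z U P Q
    assume h: "0 < \<epsilon>" "\<epsilon> < 1" "N \<ge> 4" "4 dvd N" "transition \<sigma> \<beta> \<epsilon> N \<le> 1 / 4"
      and bvp: "bvp_solution \<epsilon> b f u" and sol: "solution_decomposition k \<beta> C\<^sub>1 \<epsilon> u S W Z"
      and ldg: "ldg_solution k N (mesh (transition \<sigma> \<beta> \<epsilon> N) N) \<epsilon> b f U P Q"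
    interpret sh: shishkin k \<beta> \<sigma> \<epsilon> C\<^sub>1 N
      by unfold_locales (use assms \<beta> \<sigma> C\<^sub>1 h in auto)
    interpret la: layered k \<beta> \<sigma> \<epsilon> C\<^sub>1 N "pdf S" "fam_add (pdf (W 1)) (pdf (W 3))" "fam_add (pdf (W 2)) (pdf (W 4))"
      "fam_add (fam_add (pdf (Z 1)) (pdf (Z 2))) (fam_add (pdf (Z 3)) (pdf (Z 4)))"
      by unfold_locales (rule sh.decomp_of_solution(1)[OF sol])
    have X: "mesh (transition \<sigma> \<beta> \<epsilon> N) N = sh.X" by (simp add: sh.X_def sh.\<tau>_def)
    have b: "\<And>z. z \<in> cl_Omega \<Longrightarrow> 2 * \<beta>\<^sup>2 \<le> b z" "\<And>z. z \<in> cl_Omega \<Longrightarrow> b z \<le> Bm"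
      using bl abs_le_D1[OF Bm] by blast+
    note E = la.error_norms[OF sh.decomp_of_solution(2)[OF sol] bvp ldg[unfolded X] bc b]
    show "let X = mesh (transition \<sigma> \<beta> \<epsilon> N) N;
           e\<^sub>u = (\<lambda>z. u z - U z);
           e\<^sub>p = (\<lambda>z. \<epsilon> * dx u z - P z);
           e\<^sub>q = (\<lambda>z. \<epsilon> * dy u z - Q z)
       in energy_norm N X \<epsilon> b e\<^sub>u e\<^sub>p e\<^sub>q
            \<le> C * (\<epsilon> powr (1 / 4) * (ln (real N) / real N) ^ (k + 1)
                  + sqrt \<epsilon> * (1 / real N) ^ k + (1 / real N) ^ (k + 1)) \<and>
          balanced_norm N X \<epsilon> b e\<^sub>u e\<^sub>p e\<^sub>q
            \<le> C * (sqrt \<epsilon> * (ln (real N) / real N) ^ (k + 1)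
                  + \<epsilon> powr (1 / 4) * (1 / real N) ^ k + (ln (real N) / real N) ^ (k + 1))"
      unfolding Let_def X C_def sh.L_def[symmetric] sh.NN_def[symmetric] using E by blast
  qed
qed

end
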